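(* Let $x$ take positive integer values, let $N=x$ (the optimal truncation index), and let $$R_N(x)=I_0(x)K_0(x)-\frac{1}{2x}\sum_{k=0}^{N-1}\frac{((2k)!)^3}{(k!)^4(8x)^{2k}} .$$ Then for every fixed positive integer $M$, $$R_N(x)=\frac{e^{-2x}}{4\sqrt{\pi}\,x^{3/2}}\left\{\sum_{j=0}^{M-1}B_j(2x)^{-j}+O\!\left(x^{-M+\frac12}\right)\right\}\qquad (N=x)$$ as $x\to+\infty$ through the positive integers, where $$B_j=\sum_{k=0}^{j}(-1)^k c_k D_{j-k,k},\qquad D_{k,j}=A_{k,j}+2^{k+1}\left(\tfrac12\right)_k G_{2k,j},$$ and the constants $c_k$, $A_{k,j}$, $G_{2k,j}$ are those defined in the context, with $\gamma_j=-j$.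
   Context: $I_0$ and $K_0$ are the standard modified Bessel functions, and $(a)_k=\Gamma(a+k)/\Gamma(a)$ is the Pochhammer symbol. **Coefficients $c_j$.** They are the coefficients of the inverse factorial expansion $$\frac{\Gamma(s+\frac12)^3}{\Gamma(s+1)}=\frac{2\sqrt{\pi}}{2^{2s}}\left\{\sum_{j=0}^{M-1}(-1)^jc_j\,\Gamma(2s-j)+\rho_M(s)\,\Gamma(2s-M)\right\},\qquad \rho_M(s)=O(1)\ \text{ as } |s|\to\infty \text{ in } |\arg s|<\pi,$$ for each positive integer $M$. Equivalently, $\frac1s\left(\Gamma(s+\frac12)/\Gamma(s)\right)^2\sim\sum_{j\ge0}c_j/(1-2s)_j$ as $s\to+\infty$. The first values are $c_0=1$, $c_1=\frac12$, $c_2=\frac58$, $c_3=\frac{21}{16}$, $c_4=\frac{507}{128}$, $c_5=\frac{4035}{256}$. **Coefficients $A_{k,j}$.** Let $T_\nu(z)=\frac{\Gamma(\nu)}{2\pi}\Gamma(1-\nu,z)$ be the terminant function, where $\Gamma(a,z)$ is the upper incomplete gamma function; for $\nu>0$, $z>0$ one has $T_\nu(z)=\frac{e^{-z}}{2\pi}\int_0^\infty e^{-zt}\frac{t^{\nu-1}}{1+t}\,dt$. For fixed $\gamma_j$, the coefficients $A_{k,j}$ are those of the asymptotic expansion $$T_{y+\gamma_j}(y)=\frac{e^{-2y}}{2\sqrt{2\pi y}}\left\{\sum_{k=0}^{K-1}A_{k,j}\,y^{-k}+O(y^{-K})\right\}\qquad (y\to+\infty)$$ for every positive integer $K$. They are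 polynomials in $\gamma_j$, the first being $A_{0,j}=1$ and $$A_{1,j}=\tfrac16(2-6\gamma_j+3\gamma_j^2),\qquad A_{2,j}=\tfrac1{288}(-11-120\gamma_j+300\gamma_j^2-192\gamma_j^3+36\gamma_j^4),$$ $$A_{3,j}=\tfrac{2}{51840}(-587+3510\gamma_j+9765\gamma_j^2-26280\gamma_j^3+18900\gamma_j^4-5400\gamma_j^5+540\gamma_j^6),$$ $$A_{4,j}=\tfrac{1}{2488320}(120341-44592\gamma_j-521736\gamma_j^2-722880\gamma_j^3+2336040\gamma_j^4-1826496\gamma_j^5+635040\gamma_j^6-103680\gamma_j^7+6480\gamma_j^8).$$ **Coefficients $G_{k,j}$.** They are defined by the expansion near $w=0$ $$\frac{\tau^{\gamma_j-1}}{1-\tau}\frac{d\tau}{dw}=-\frac1w+\sum_{k=0}^\infty G_{k,j}w^k,\qquad \tfrac12w^2=\tau-\log\tau-1,$$ with the branch of $w(\tau)$ chosen so that $w\sim\tau-1$ as $\tau\to1$. Writing $G_{2k,j}=6^{-2k}\hat G_{2k,j}$, the first values are $$\hat G_{0,j}=\tfrac23-\gamma_j,\qquad \hat G_{2,j}=\tfrac1{15}(46-225\gamma_j+270\gamma_j^2-90\gamma_j^3),$$ $$\hat G_{4,j}=\tfrac1{70}(230-3969\gamma_j+11340\gamma_j^2-11760\gamma_j^3+5040\gamma_j^4-756\gamma_j^5),$$ $$\hat G_{6,j}=\tfrac1{350}(-3626-17781\gamma_j+183330\gamma_j^2-397530\gamma_j^3+370440\gamma_j^4-170100\gamma_j^5+37800\gamma_j^6-3240\gamma_j^7),$$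 $$\hat G_{8,j}=\tfrac1{231000}(-4032746+43924815\gamma_j+88280280\gamma_j^2-743046480\gamma_j^3+1353607200\gamma_j^4-1160830440\gamma_j^5+541870560\gamma_j^6-141134400\gamma_j^7+19245600\gamma_j^8-1069200\gamma_j^9).$$ In the claim all of these coefficients are evaluated at $\gamma_j=-j$. *)

theory Defs
  imports "HOL-Analysis.Analysis" "HOL-Library.Landau_Symbols"
begin

definition bessel_I0 :: "real \<Rightarrow> real" where
  "bessel_I0 x = (\<Sum>k. (x / 2) ^ (2 * k) / (fact k)\<^sup>2)"

text \<open>Schlaefli's integral for \<open>K\<^sub>0\<close>; meaningful for \<open>x > 0\<close>.\<close>

definition bessel_K0 :: "real \<Rightarrow> real" where
  "bessel_K0 x = integral {0..} (\<lambda>t. exp (- x * cosh t))"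

definition remainder_IK :: "nat \<Rightarrow> real \<Rightarrow> real" where
  "remainder_IK N x = bessel_I0 x * bessel_K0 x -
     1 / (2 * x) * (\<Sum>k<N. (fact (2 * k)) ^ 3 / ((fact k) ^ 4 * (8 * x) ^ (2 * k)))"

text \<open>
  The three families of coefficients are the unique real sequences with the given (asymptotic or
  convergent) expansions, and are therefore introduced by definite descriptions.

  For \<open>c\<close>: by the duplication formula,
  \<open>\<Gamma>(s + 1/2)\<^sup>3 / \<Gamma>(s + 1) = 2 \<surd>\<pi> 2\<^bsup>-2s\<^esup> \<Gamma>(2s) \<cdot> (1/s) (\<Gamma>(s + 1/2) / \<Gamma>(s))\<^sup>2\<close>, and
  \<open>(-1)\<^bsup>j\<^esup> \<Gamma>(2s - j) = \<Gamma>(2s) / (1 - 2s)\<^sub>j\<close>; so the expansion below is the inverse factorial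
  expansion of \<open>\<Gamma>(s + 1/2)\<^sup>3 / \<Gamma>(s + 1)\<close> in the functions \<open>(-1)\<^bsup>j\<^esup> \<Gamma>(2s - j)\<close>, as \<open>s \<rightarrow> +\<infinity>\<close>.
\<close>

definition inverse_factorial_coeffs :: "(nat \<Rightarrow> real) \<Rightarrow> bool" where
  "inverse_factorial_coeffs c \<longleftrightarrow>
     (\<forall>M\<ge>1. (\<lambda>s::real. 1 / s * (Gamma (s + 1/2) / Gamma s)\<^sup>2
                        - (\<Sum>j<M. c j / pochhammer (1 - 2 * s) j))
             \<in> O[at_top](\<lambda>s. 1 / pochhammer (1 - 2 * s) M))"

definition c_coeff :: "nat \<Rightarrow> real" where
  "c_coeff = (THE c. inverse_factorial_coeffs c)"

definition upper_Gamma :: "real \<Rightarrow> real \<Rightarrow> real" where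
  "upper_Gamma a z = integral {z..} (\<lambda>t. t powr (a - 1) * exp (- t))"

definition terminant :: "real \<Rightarrow> real \<Rightarrow> real" where
  "terminant \<nu> z = Gamma \<nu> / (2 * pi) * upper_Gamma (1 - \<nu>) z"

definition terminant_coeffs :: "real \<Rightarrow> (nat \<Rightarrow> real) \<Rightarrow> bool" where
  "terminant_coeffs \<gamma> a \<longleftrightarrow>
     (\<forall>K\<ge>1. \<exists>E \<in> O[at_top](\<lambda>y. 1 / y ^ K). \<forall>\<^sub>F y in at_top.
        terminant (y + \<gamma>) y
          = exp (- 2 * y) / (2 * sqrt (2 * pi * y)) * ((\<Sum>k<K. a k / y ^ k) + E y))"

definition A_coeff :: "real \<Rightarrow> nat \<Rightarrow> real" where
  "A_coeff \<gamma> = (THE a. terminant_coeffs \<gamma> a)"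

text \<open>
  The branch \<open>w(\<tau>)\<close> of \<open>w\<^sup>2 / 2 = \<tau> - log \<tau> - 1\<close> with \<open>w \<sim> \<tau> - 1\<close> as \<open>\<tau> \<rightarrow> 1\<close>, for real \<open>\<tau> > 0\<close>;
  it is an increasing bijection from \<open>{0<..}\<close> onto the real line, with inverse \<open>\<tau>(w)\<close>.
\<close>

definition w_branch :: "real \<Rightarrow> real" where
  "w_branch \<tau> = sgn (\<tau> - 1) * sqrt (2 * (\<tau> - ln \<tau> - 1))"

definition tau_of :: "real \<Rightarrow> real" where
  "tau_of = the_inv_into {0<..} w_branch"

definition branch_coeffs :: "real \<Rightarrow> (nat \<Rightarrow> real) \<Rightarrow> bool" where
  "branch_coeffs \<gamma> g \<longleftrightarrow>
     (\<exists>r>0. \<forall>w. 0 < \<bar>w\<bar> \<and> \<bar>w\<bar> < r \<longrightarrow>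
        (\<lambda>k. g k * w ^ k) sums
          (tau_of w powr (\<gamma> - 1) / (1 - tau_of w) * deriv tau_of w + 1 / w))"

definition G_coeff :: "real \<Rightarrow> nat \<Rightarrow> real" where
  "G_coeff \<gamma> = (THE g. branch_coeffs \<gamma> g)"

text \<open>In \<open>D_coeff k j\<close> the parameter is \<open>\<gamma>\<^sub>j = -j\<close>.\<close>

definition D_coeff :: "nat \<Rightarrow> nat \<Rightarrow> real" where
  "D_coeff k j = A_coeff (- real j) k
                 + 2 ^ (k + 1) * pochhammer (1/2) k * G_coeff (- real j) (2 * k)"

definition B_coeff :: "nat \<Rightarrow> real" where
  "B_coeff j = (\<Sum>k\<le>j. (- 1) ^ k * c_coeff k * D_coeff (j - k) k)"

end

theory Submission
  imports Defs "HOL-Probability.Probability" "HOL-Complex_Analysis.Complex_Analysis" "HOL-Real_Asymp.Real_Asymp"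
begin

text \<open>
  Let \<open>\<mu>(y) = 1 / AGM(1, y)\<close>, which is \<open>agm_inv\<close> below. Writing \<open>I\<^sub>0 K\<^sub>0\<close> as a Laplace transform of a complete
  elliptic integral and applying Landen's transformation gives the principal value representation
  \<open>I\<^sub>0(x) K\<^sub>0(x) = 2/\<pi> \<integral>\<^sub>1\<^sup>\<infinity> \<mu>(y) PV\<integral>\<^sub>0\<^sup>\<infinity> e\<^bsup>-2xyv\<^esup> / (1 - v\<^sup>2) dv dy\<close>. Expanding
  \<open>1 / (1 - v\<^sup>2) = 1 + v\<^sup>2 + \<dots> + v\<^bsup>2N\<^esup> / (1 - v\<^sup>2)\<close> and using the moments of \<open>\<mu>\<close>, which are squared
  Gamma quotients, the first \<open>N\<close> terms become the subtracted partial sum, so that \<open>R\<^sub>N\<close> is the same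
  double integral with an extra factor \<open>v\<^bsup>2N\<^esup>\<close>.

  The same Gamma quotients identify the Taylor coefficients of \<open>\<mu>\<close> at \<open>y = 1\<close> as \<open>(-1)\<^sup>j c\<^sub>j / j!\<close>. With
  \<open>N = x\<close> and \<open>Y = 2x\<close> the \<open>j\<close>-th Taylor term contributes
  \<open>j! Y\<^bsup>-j-1\<^esup> PV\<integral>\<^sub>0\<^sup>\<infinity> e\<^bsup>-Yv\<^esup> v\<^bsup>Y-1-j\<^esup> / (1 - v\<^sup>2) dv\<close>. Now split
  \<open>2 / (1 - v\<^sup>2) = 1 / (1 + v) + 1 / (1 - v)\<close>: the first part is a terminant and yields the \<open>A\<^sub>k\<^sub>,\<^sub>j\<close>; in
  the second the substitution \<open>v = \<tau>(w)\<close> produces a Gaussian integral of the branch expansion, whose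
  odd pole \<open>-1/w\<close> has principal value \<open>0\<close>, and yields the \<open>G\<^sub>2\<^sub>k\<^sub>,\<^sub>j\<close>.
\<close>

text \<open>With N = x and Y = 2x, the factor e^(-Yv) v^Y peaks at v = 1, exactly on the pole of 1 /
  (1 - v^2), so saddle point and principal value cannot be treated separately. The obstacle is that
  a principal value does not admit Fubini. Folding the half-line at v = 1 by v -> 1/v removes it:
  the folded integrand is nonnegative as long as N \<le> x y, which N = x and y \<ge> 1 guarantee.
  Almost everything can therefore be done with nonnegative extended integrals, where exchanging the
  order costs no integrability proof; finiteness is checked only where something is subtracted.
  Positivity is used again at the end: a pointwise bound on the Taylor remainder of \<mu> integrates
  to a bound by moments of the same weight. That bound must hold on all of [1, \<infinity>), far
  beyond the convergence of the Taylor series at 1, and this is why it contains both powers M and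
  2M. As the coefficients are definite descriptions, each of the three expansions also needs
  uniqueness. The error obtained is O(x^(-M)), which lies within the claimed O(x^(-M+1/2)).\<close>

section \<open>Substitution and antiderivatives for nonnegative integrals\<close>

text \<open>The change of variables theorem for absolutely integrable functions says that one side
  is integrable iff the other is. For nonnegative functions, non-integrability means the value
  \<infinity>, so the extended integrals agree in either case and no integrability has to be
  assumed.\<close>

lemma nn_integral_substitution_inj:
  fixes f g g' :: "real \<Rightarrow> real"
  assumes S: "S \<in> sets borel" and gS: "g ` S \<in> sets borel"
    and der: "\<And>x. x \<in> S \<Longrightarrow> (g has_field_derivative g' x) (at x)"
    and inj: "inj_on g S"
    and cont: "continuous_on S g'"
    and f: "f \<in> borel_measurable borel"
    and nn: "\<And>u. u \<in> g ` S \<Longrightarrow> f u \<ge> 0"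
  shows "(\<integral>\<^sup>+x\<in>S. ennreal (\<bar>g' x\<bar> * f (g x)) \<partial>lborel) = (\<integral>\<^sup>+u\<in>g ` S. ennreal (f u) \<partial>lborel)"
proof -
  have contg: "continuous_on S g"
    using der by (meson DERIV_isCont continuous_at_imp_continuous_on)
  define F where "F = (\<lambda>x. indicator S x * (\<bar>g' x\<bar> * f (g x)))"
  define H where "H = (\<lambda>u. indicator (g ` S) u * f u)"
  have [measurable]: "(\<lambda>x. indicator S x *\<^sub>R g x) \<in> borel_measurable borel"
    "(\<lambda>x. indicator S x *\<^sub>R g' x) \<in> borel_measurable borel"
    using S contg cont by (intro borel_measurable_continuous_on_indicator; simp)+
  note [measurable] = f S gS
  \<comment> \<open>Nothing is known about \<open>g\<close> and \<open>g'\<close> outside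
    \<open>S\<close>. Cutting them off inside \<open>f\<close> as well leaves \<open>F\<close>
    unchanged and makes measurability provable.\<close>
  have F_alt: "F = (\<lambda>x. indicator S x * (\<bar>indicator S x *\<^sub>R g' x\<bar> * f (indicator S x *\<^sub>R g x)))"
    by (auto simp: F_def indicator_def fun_eq_iff)
  have Fm: "F \<in> borel_measurable borel" unfolding F_alt by measurable
  have Hm: "H \<in> borel_measurable borel" unfolding H_def by measurable
  have F0: "F x \<ge> 0" for x using nn by (auto simp: F_def indicator_def)
  have H0: "H x \<ge> 0" for x using nn by (auto simp: H_def indicator_def)
  have SL: "S \<in> sets lebesgue" using S by simp
  have cv: "((\<lambda>x. \<bar>g' x\<bar> * f(g x)) absolutely_integrable_on S \<and>
           integral S (\<lambda>x. \<bar>g' x\<bar> * f (g x)) = b)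
     \<longleftrightarrow> (f absolutely_integrable_on (g ` S) \<and> integral (g ` S) f = b)" for b
    using has_absolute_integral_change_of_variables_1'[OF SL _ inj, of g' f b] der
      has_field_derivative_at_within by blast
  have L: "(\<lambda>x. \<bar>g' x\<bar> * f(g x)) absolutely_integrable_on S \<longleftrightarrow> integrable lborel F"
    unfolding set_integrable_def F_def
    using Fm by (simp add: integrable_completion F_def)
  have R: "f absolutely_integrable_on (g ` S) \<longleftrightarrow> integrable lborel H"
    unfolding set_integrable_def H_def
    using Hm by (simp add: integrable_completion H_def)
  have iff: "integrable lborel F \<longleftrightarrow> integrable lborel H"
    using cv L R by blast
  have eqF: "(\<integral>\<^sup>+x\<in>S. ennreal (\<bar>g' x\<bar> * f (g x)) \<partial>lborel) = (\<integral>\<^sup>+x. ennreal (F x) \<partial>lborel)"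
    by (intro nn_integral_cong) (auto simp: F_def indicator_def)
  have eqH: "(\<integral>\<^sup>+u\<in>g ` S. ennreal (f u) \<partial>lborel) = (\<integral>\<^sup>+x. ennreal (H x) \<partial>lborel)"
    by (intro nn_integral_cong) (auto simp: H_def indicator_def)
  show ?thesis
  proof (cases "integrable lborel F")
    case True
    have iF: "integral S (\<lambda>x. \<bar>g' x\<bar> * f (g x)) = integral\<^sup>L lborel F"
    proof -
      have "integral S (\<lambda>x. \<bar>g' x\<bar> * f (g x)) = set_lebesgue_integral lebesgue S (\<lambda>x. \<bar>g' x\<bar> * f (g x))"
        using True L by (simp add: set_lebesgue_integral_eq_integral)
      also have "\<dots> = integral\<^sup>L lborel F"
        unfolding set_lebesgue_integral_def using Fm by (simp add: integral_completion F_def)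
      finally show ?thesis .
    qed
    have iH: "integral (g ` S) f = integral\<^sup>L lborel H"
    proof -
      have "integral (g ` S) f = set_lebesgue_integral lebesgue (g ` S) f"
        using True iff R by (simp add: set_lebesgue_integral_eq_integral)
      also have "\<dots> = integral\<^sup>L lborel H"
        unfolding set_lebesgue_integral_def using Hm by (simp add: integral_completion H_def)
      finally show ?thesis .
    qed
    have "integral\<^sup>L lborel F = integral\<^sup>L lborel H"
      using cv[of "integral\<^sup>L lborel F"] L True iF iH by auto
    then show ?thesis unfolding eqF eqH
      using True iff F0 H0 by (simp add: nn_integral_eq_integral)
  next
    \<comment> \<open>Integrability fails on both sides simultaneously, and a nonnegative measurable
      function that is not integrable has integral \<infinity>.\<close>
    case False
    then have "(\<integral>\<^sup>+x. ennreal (F x) \<partial>lborel) = \<infinity>" "(\<integral>\<^sup>+x. ennreal (H x) \<partial>lborel) = \<infinity>"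
      using iff F0 H0 Fm Hm by (simp_all add: integrable_iff_bounded, simp_all flip: top.not_eq_extremum)
    then show ?thesis using eqF eqH by simp
  qed
qed

text \<open>Derivatives are required only inside the interval because the substitutions through
  \<open>arccos\<close> need not be differentiable at its ends.\<close>

lemma image_Ioo_strict_mono:
  fixes g g' :: "real \<Rightarrow> real"
  assumes "a < b" and cont: "continuous_on {a..b} g"
    and der: "\<And>x. a < x \<Longrightarrow> x < b \<Longrightarrow> (g has_field_derivative g' x) (at x)"
    and pos: "\<And>x. a < x \<Longrightarrow> x < b \<Longrightarrow> g' x > 0"
  shows "g ` {a<..<b} = {g a<..<g b}" "inj_on g {a<..<b}"
proof -
  have mono: "g x < g y" if "a \<le> x" "x < y" "y \<le> b" for x y
  proof (rule DERIV_pos_imp_increasing_open[OF \<open>x < y\<close>])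
    show "continuous_on {x..y} g" using cont that by (auto intro: continuous_on_subset)
  qed (use der pos that in \<open>meson order_le_less_trans order_less_le_trans\<close>)
  show "inj_on g {a<..<b}"
    by (intro inj_onI) (metis greaterThanLessThan_iff less_imp_le linorder_neqE_linordered_idom mono order_less_irrefl)
  show "g ` {a<..<b} = {g a<..<g b}"
  proof safe
    fix z assume "z \<in> {g a<..<g b}"
    then obtain x where "a \<le> x" "x \<le> b" "g x = z"
      using IVT'[of g a z b] cont \<open>a < b\<close> by auto
    with \<open>z \<in> _\<close> have "x \<in> {a<..<b}" by (auto simp: less_le)
    then show "z \<in> g ` {a<..<b}" using \<open>g x = z\<close> by blast
  qed (auto intro: mono)
qed

text \<open>One-sided limits replace the values at the endpoints, which admits improper ends such as
  arctan (k tan \<theta>) at pi/2. The inequality is recorded because \<open>ennreal\<close> sends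
  negative numbers to 0, so that the equation alone would not determine B - A.\<close>

lemma nn_integral_FTC_Ioo:
  fixes f F :: "real \<Rightarrow> real"
  assumes "a < b"
    and F: "\<And>x. a < x \<Longrightarrow> x < b \<Longrightarrow> (F has_field_derivative f x) (at x)"
    and f: "\<And>x. a < x \<Longrightarrow> x < b \<Longrightarrow> isCont f x"
    and nn: "\<And>x. a < x \<Longrightarrow> x < b \<Longrightarrow> 0 \<le> f x"
    and A: "(F \<longlongrightarrow> A) (at_right a)" and B: "(F \<longlongrightarrow> B) (at_left b)"
  shows "(\<integral>\<^sup>+x\<in>{a<..<b}. ennreal (f x) \<partial>lborel) = ennreal (B - A)" and "B - A \<ge> 0"
proof -
  have *: "set_integrable lborel (einterval (ereal a) (ereal b)) f"
    "(LBINT x=ereal a..ereal b. f x) = B - A"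
    using interval_integral_FTC_nonneg[of "ereal a" "ereal b" F f A B] assms
    by (auto simp: ereal_tendsto_simps)
  have "(\<integral>\<^sup>+x\<in>{a<..<b}. ennreal (f x) \<partial>lborel) = (\<integral>\<^sup>+x. ennreal (indicator {a<..<b} x *\<^sub>R f x) \<partial>lborel)"
    by (intro nn_integral_cong) (auto simp: indicator_def)
  also have "\<dots> = ennreal (integral\<^sup>L lborel (\<lambda>x. indicator {a<..<b} x *\<^sub>R f x))"
    using *(1) nn by (intro nn_integral_eq_integral) (auto simp: set_integrable_def einterval_eq indicator_def)
  also have eq: "integral\<^sup>L lborel (\<lambda>x. indicator {a<..<b} x *\<^sub>R f x) = B - A"
    using *(2) \<open>a < b\<close> by (simp add: interval_lebesgue_integral_def set_lebesgue_integral_def einterval_eq)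
  finally show "(\<integral>\<^sup>+x\<in>{a<..<b}. ennreal (f x) \<partial>lborel) = ennreal (B - A)" .
  have "integral\<^sup>L lborel (\<lambda>x. indicator {a<..<b} x *\<^sub>R f x) \<ge> 0"
    using nn by (intro integral_nonneg_AE AE_I2) (auto simp: indicator_def)
  then show "B - A \<ge> 0" unfolding eq .
qed

lemma nn_integral_cong_except:
  fixes a :: real
  assumes "\<And>x. x \<noteq> a \<Longrightarrow> f x = g x"
  shows "(\<integral>\<^sup>+x. f x \<partial>lborel) = (\<integral>\<^sup>+x. g x \<partial>lborel)"
  by (rule nn_integral_cong_AE, rule AE_mp[OF AE_lborel_singleton[of a]], rule AE_I2) (use assms in blast)

lemma nn_integral_has_integral_on:
  fixes f :: "real \<Rightarrow> real"
  assumes "f \<in> borel_measurable borel" "S \<in> sets borel" "\<And>x. x \<in> S \<Longrightarrow> f x \<ge> 0" "(f has_integral I) S"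
  shows "(\<integral>\<^sup>+x\<in>S. ennreal (f x) \<partial>lborel) = ennreal I"
proof -
  have "(\<lambda>x. if x \<in> S then f x else 0) = (\<lambda>x. indicator S x * f x)"
    by (auto simp: indicator_def)
  then have "((\<lambda>x. indicator S x * f x) has_integral I) UNIV"
    using assms(4) by (simp add: has_integral_restrict_UNIV[symmetric, of f])
  then have "(\<integral>\<^sup>+x. ennreal (indicator S x * f x) \<partial>lborel) = ennreal I"
    using assms(1-3) by (intro nn_integral_has_integral_lborel) (auto simp: indicator_def)
  also have "(\<integral>\<^sup>+x. ennreal (indicator S x * f x) \<partial>lborel) = (\<integral>\<^sup>+x\<in>S. ennreal (f x) \<partial>lborel)"
    by (intro nn_integral_cong) (auto simp: indicator_def)
  finally show ?thesis .
qed

text \<open>Wallis's integral. The function cos^(2n+1) sin vanishes at both ends, and integrating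
  its derivative gives (2n+2) W(n+1) = (2n+1) W(n).\<close>

lemma has_integral_cos_even_power:
  "((\<lambda>\<phi>. cos \<phi> ^ (2 * n)) has_integral (pi * fact (2 * n) / (4 ^ n * (fact n)\<^sup>2))) {0..pi}"
proof (induction n)
  case 0
  then show ?case using has_integral_const_real[of "1::real" 0 pi] by simp
next
  case (Suc n)
  have "((\<lambda>\<phi>. (2 * n + 2) * cos \<phi> ^ (2 * n + 2) - (2 * n + 1) * cos \<phi> ^ (2 * n)) has_integral
      (cos pi ^ (2 * n + 1) * sin pi - cos 0 ^ (2 * n + 1) * sin 0)) {0..pi}"
  proof (rule fundamental_theorem_of_calculus)
    fix x :: real
    have "real (2 * n + 1) * cos x ^ (2 * n) * - sin x * sin x + cos x ^ (2 * n + 1) * cos x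
      = real (2 * n + 1) * cos x ^ (2 * n) * ((cos x)\<^sup>2 - 1) + cos x ^ (2 * n) * (cos x)\<^sup>2"
      unfolding sin_squared_eq[of x, symmetric, THEN arg_cong[where f=uminus], unfolded minus_diff_eq] by (simp add: power2_eq_square algebra_simps)
    also have "\<dots> = (2 * n + 2) * cos x ^ (2 * n + 2) - (2 * n + 1) * cos x ^ (2 * n)"
      by (simp add: power2_eq_square algebra_simps)
    finally have s: "real (2 * n + 1) * cos x ^ (2 * n) * - sin x * sin x + cos x ^ (2 * n + 1) * cos x
      = (2 * n + 2) * cos x ^ (2 * n + 2) - (2 * n + 1) * cos x ^ (2 * n)" .
    have "((\<lambda>\<phi>. cos \<phi> ^ (2 * n + 1) * sin \<phi>) has_real_derivative
       (real (2 * n + 1) * cos x ^ (2 * n) * - sin x * sin x + cos x ^ (2 * n + 1) * cos x)) (at x within {0..pi})"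
      by (rule derivative_eq_intros refl)+ (simp add: algebra_simps)
    then show "((\<lambda>\<phi>. cos \<phi> ^ (2 * n + 1) * sin \<phi>) has_vector_derivative
         (2 * n + 2) * cos x ^ (2 * n + 2) - (2 * n + 1) * cos x ^ (2 * n)) (at x within {0..pi})"
      unfolding has_real_derivative_iff_has_vector_derivative[symmetric] s .
  qed auto
  from has_integral_add[OF this has_integral_mult_right[OF Suc, of "2 * n + 1"]]
  have "((\<lambda>\<phi>. (2 * n + 2) * cos \<phi> ^ (2 * n + 2)) has_integral
     (2 * n + 1) * (pi * fact (2 * n) / (4 ^ n * (fact n)\<^sup>2))) {0..pi}"
    by simp
  from has_integral_mult_right[OF this, of "1 / (2 * n + 2)"]
  have *: "((\<lambda>\<phi>. cos \<phi> ^ (2 * n + 2)) has_integral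
     (1 / (2 * n + 2) * ((2 * n + 1) * (pi * fact (2 * n) / (4 ^ n * (fact n)\<^sup>2))))) {0..pi}"
    by (simp add: mult.assoc[symmetric] del: mult_Suc_right)
  have "1 / real (2 * n + 2) * ((2 * n + 1) * (pi * fact (2 * n) / (4 ^ n * (fact n)\<^sup>2)))
     = pi * fact (2 * Suc n) / (4 ^ Suc n * (fact (Suc n))\<^sup>2)"
    by (simp add: divide_simps power2_eq_square) (simp add: algebra_simps)
  with * show ?case by simp
qed

lemma nn_integral_reflect_pi:
  fixes f :: "real \<Rightarrow> real"
  assumes "f \<in> borel_measurable borel" "\<And>u. f u \<ge> 0" "a \<le> b"
  shows "(\<integral>\<^sup>+x\<in>{pi-b<..<pi-a}. ennreal (f (pi - x)) \<partial>lborel) = (\<integral>\<^sup>+u\<in>{a<..<b}. ennreal (f u) \<partial>lborel)"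
proof -
  have im: "(\<lambda>x. pi - x) ` {pi-b<..<pi-a} = {a<..<b}"
  proof (intro set_eqI iffI)
    fix x assume "x \<in> {a<..<b}"
    then show "x \<in> (\<lambda>x. pi - x) ` {pi-b<..<pi-a}" by (intro image_eqI[of _ _ "pi - x"]) auto
  qed auto
  have "(\<integral>\<^sup>+x\<in>{pi-b<..<pi-a}. ennreal (\<bar>-1\<bar> * f (pi - x)) \<partial>lborel) = (\<integral>\<^sup>+u\<in>(\<lambda>x. pi - x) ` {pi-b<..<pi-a}. ennreal (f u) \<partial>lborel)"
  proof (rule nn_integral_substitution_inj)
    show "((\<lambda>x. pi - x) has_field_derivative -1) (at x)" for x :: real
      by (auto intro!: derivative_eq_intros)
    show "(\<lambda>x. pi - x) ` {pi - b<..<pi - a} \<in> sets borel" unfolding im by simp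
  qed (use assms in \<open>auto intro!: inj_onI\<close>)
  then show ?thesis using im by simp
qed

section \<open>The product of the Bessel functions as a Laplace transform\<close>

lemma bessel_I0_sums: "(\<lambda>k. (x / 2) ^ (2 * k) / (fact k)\<^sup>2) sums bessel_I0 x"
proof -
  have s: "summable (\<lambda>k. ((x/2)\<^sup>2) ^ k / fact k)"
    using summable_exp[of "(x/2)\<^sup>2"] by (simp only: divide_inverse mult.commute)
  have "norm ((x / 2) ^ (2 * k) / (fact k)\<^sup>2) \<le> ((x/2)\<^sup>2) ^ k / fact k" for k
  proof -
    have "fact k * 1 \<le> fact k * (fact k :: real)"
      by (intro mult_left_mono) auto
    then have "((x/2)\<^sup>2) ^ k / (fact k)\<^sup>2 \<le> ((x/2)\<^sup>2) ^ k / fact k"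
      by (intro divide_left_mono) (auto simp: power2_eq_square[of "fact k"])
    then show ?thesis
      by (simp only: real_norm_def power_mult) simp
  qed
  then have "summable (\<lambda>k. (x / 2) ^ (2 * k) / (fact k)\<^sup>2)"
    by (intro summable_comparison_test[OF _ s]) auto
  then show ?thesis unfolding bessel_I0_def by (rule summable_sums)
qed

lemma bessel_I0_nonneg: "bessel_I0 x \<ge> 0"
  by (rule sums_le[OF _ sums_zero bessel_I0_sums[of x]]) (simp add: power_mult)

text \<open>Averaging the integrand with its reflection \<phi> -> pi - \<phi> replaces exp by cosh.
  All terms of the series are then nonnegative, so it may be integrated term by term, and Wallis's
  integral produces the squared factorials.\<close>

lemma bessel_I0_nn_integral:
  "ennreal (bessel_I0 x) = (\<integral>\<^sup>+\<phi>\<in>{0<..<pi}. ennreal (exp (x * cos \<phi>) / pi) \<partial>lborel)"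
proof -
  have wallis: "(\<integral>\<^sup>+\<phi>\<in>{0<..<pi}. ennreal (cos \<phi> ^ (2*k)) \<partial>lborel) = ennreal (pi * fact (2 * k) / (4 ^ k * (fact k)\<^sup>2))" for k
    using has_integral_cos_even_power[of k]
    by (intro nn_integral_has_integral_on) (auto simp: power_mult has_integral_Icc_iff_Ioo)
  have refl: "(\<integral>\<^sup>+\<phi>\<in>{0<..<pi}. ennreal (exp (- x * cos \<phi>) / pi) \<partial>lborel) = (\<integral>\<^sup>+\<phi>\<in>{0<..<pi}. ennreal (exp (x * cos \<phi>) / pi) \<partial>lborel)"
    using nn_integral_reflect_pi[of "\<lambda>\<phi>. exp (x * cos \<phi>) / pi" 0 pi] by simp
  have cosh_series: "(\<lambda>k. (x * cos \<phi>) ^ (2*k) / fact (2*k)) sums cosh (x * cos \<phi>)" for \<phi>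
  proof -
    have "(\<lambda>n. if even n then (x * cos \<phi>) ^ n /\<^sub>R fact n else 0) sums cosh (x * cos \<phi>)"
      by (rule cosh_converges)
    then have "(\<lambda>k. (\<lambda>n. if even n then (x * cos \<phi>) ^ n /\<^sub>R fact n else 0) (2 * k)) sums cosh (x * cos \<phi>)"
      by (subst sums_mono_reindex[where g="\<lambda>k. 2 * k"]) (auto simp: strict_mono_def elim!: evenE)
    then show ?thesis by (simp add: divide_inverse mult.commute)
  qed
  have "2 * (\<integral>\<^sup>+\<phi>\<in>{0<..<pi}. ennreal (exp (x * cos \<phi>) / pi) \<partial>lborel)
     = (\<integral>\<^sup>+\<phi>\<in>{0<..<pi}. ennreal (exp (x * cos \<phi>) / pi) \<partial>lborel) + (\<integral>\<^sup>+\<phi>\<in>{0<..<pi}. ennreal (exp (- x * cos \<phi>) / pi) \<partial>lborel)"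
    unfolding refl by (simp add: mult_2)
  also have "\<dots> = (\<integral>\<^sup>+\<phi>. (ennreal (exp (x * cos \<phi>) / pi) * indicator {0<..<pi} \<phi> + ennreal (exp (- x * cos \<phi>) / pi) * indicator {0<..<pi} \<phi>) \<partial>lborel)"
    by (rule nn_integral_add[symmetric]) auto
  also have "\<dots> = (\<integral>\<^sup>+\<phi>. (\<Sum>k. ennreal (2 / pi * (x ^ (2*k) / fact (2*k)) * cos \<phi> ^ (2*k)) * indicator {0<..<pi} \<phi>) \<partial>lborel)"
  proof (rule nn_integral_cong)
    fix \<phi> :: real
    have "(\<lambda>k. 2 / pi * (x ^ (2*k) / fact (2*k)) * cos \<phi> ^ (2*k)) sums (2 / pi * cosh (x * cos \<phi>))"
      using sums_mult[OF cosh_series[of \<phi>], of "2/pi"] by (simp add: power_mult_distrib mult.assoc)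
    moreover have "0 \<le> 2 / pi * (x ^ (2*k) / fact (2*k)) * cos \<phi> ^ (2*k)" for k
      by (simp add: power_mult)
    ultimately have "(\<Sum>k. ennreal (2 / pi * (x ^ (2*k) / fact (2*k)) * cos \<phi> ^ (2*k))) = ennreal (2 / pi * cosh (x * cos \<phi>))"
      by (intro suminf_ennreal_eq)
    moreover have "2 / pi * cosh (x * cos \<phi>) = exp (x * cos \<phi>) / pi + exp (- x * cos \<phi>) / pi"
      by (simp add: cosh_def field_simps)
    ultimately show "ennreal (exp (x * cos \<phi>) / pi) * indicator {0<..<pi} \<phi> + ennreal (exp (- x * cos \<phi>) / pi) * indicator {0<..<pi} \<phi> =
       (\<Sum>k. ennreal (2 / pi * (x ^ (2*k) / fact (2*k)) * cos \<phi> ^ (2*k)) * indicator {0<..<pi} \<phi>)"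
      by (auto simp: indicator_def ennreal_plus simp del: ennreal_plus[symmetric])
  qed
  also have "\<dots> = (\<Sum>k. \<integral>\<^sup>+\<phi>. (ennreal (2 / pi * (x ^ (2*k) / fact (2*k)) * cos \<phi> ^ (2*k)) * indicator {0<..<pi} \<phi>) \<partial>lborel)"
    by (intro nn_integral_suminf) auto
  also have "\<dots> = (\<Sum>k. ennreal (2 * ((x / 2) ^ (2 * k) / (fact k)\<^sup>2)))"
  proof (intro suminf_cong)
    fix k
    have "(\<integral>\<^sup>+\<phi>. (ennreal (2 / pi * (x ^ (2*k) / fact (2*k)) * cos \<phi> ^ (2*k)) * indicator {0<..<pi} \<phi>) \<partial>lborel)
       = (\<integral>\<^sup>+\<phi>. ennreal (2 / pi * (x ^ (2*k) / fact (2*k))) * (ennreal (cos \<phi> ^ (2*k)) * indicator {0<..<pi} \<phi>) \<partial>lborel)"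
      by (intro nn_integral_cong, subst ennreal_mult) (auto simp: power_mult mult.assoc)
    also have "\<dots> = ennreal (2 / pi * (x ^ (2*k) / fact (2*k))) * ennreal (pi * fact (2 * k) / (4 ^ k * (fact k)\<^sup>2))"
      by (subst nn_integral_cmult) (auto simp: wallis)
    also have "\<dots> = ennreal (2 / pi * (x ^ (2*k) / fact (2*k)) * (pi * fact (2 * k) / (4 ^ k * (fact k)\<^sup>2)))"
      by (subst ennreal_mult) (auto simp: power_mult)
    also have "2 / pi * (x ^ (2*k) / fact (2*k)) * (pi * fact (2 * k) / (4 ^ k * (fact k)\<^sup>2)) = 2 * ((x / 2) ^ (2 * k) / (fact k)\<^sup>2)"
      by (simp add: power_divide power_mult)
    finally show "(\<integral>\<^sup>+\<phi>. (ennreal (2 / pi * (x ^ (2*k) / fact (2*k)) * cos \<phi> ^ (2*k)) * indicator {0<..<pi} \<phi>) \<partial>lborel)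
       = ennreal (2 * ((x / 2) ^ (2 * k) / (fact k)\<^sup>2))" .
  qed
  also have "\<dots> = ennreal (2 * bessel_I0 x)"
    using sums_mult[OF bessel_I0_sums[of x], of 2]
    by (intro suminf_ennreal_eq) (auto simp: power_mult)
  also have "\<dots> = 2 * ennreal (bessel_I0 x)" by (simp add: ennreal_mult')
  finally show ?thesis
    by (simp add: ennreal_mult_cancel_left)
qed

lemma borel_measurable_cosh [measurable]: "cosh \<in> borel_measurable (borel :: real measure)"
  by (intro borel_measurable_continuous_onI continuous_intros)

lemma exp_half_le_cosh: "exp t / 2 \<le> cosh (t::real)"
  by (simp add: cosh_def)

lemma cosh_ge_half: "t / 2 \<le> cosh (t::real)"
  using exp_ge_add_one_self[of t] exp_half_le_cosh[of t] by linarith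

lemma bessel_K0_nn_integral:
  assumes "x > 0"
  shows "ennreal (bessel_K0 x) = (\<integral>\<^sup>+t\<in>{0<..}. ennreal (exp (- x * cosh t)) \<partial>lborel)"
    and "bessel_K0 x \<ge> 0"
proof -
  have i: "(\<lambda>t. exp (- x * cosh t)) integrable_on {0..}"
  proof (rule measurable_bounded_by_integrable_imp_integrable_real)
    show "(\<lambda>t. exp (- (x/2) * t)) integrable_on {0..}"
      using integrable_on_exp_minus_to_infinity[of "x/2" 0] assms by simp
    fix t :: real
    show "\<bar>exp (- x * cosh t)\<bar> \<le> exp (- (x/2) * t)"
      using cosh_ge_half[of t] assms by (simp add: field_simps)
  qed (auto intro!: measurable_restrict_space1 measurable_completion)
  then have h: "((\<lambda>t. exp (- x * cosh t)) has_integral bessel_K0 x) {0..}"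
    unfolding bessel_K0_def by (rule integrable_integral)
  show "bessel_K0 x \<ge> 0" by (rule has_integral_nonneg[OF h]) auto
  have "ennreal (bessel_K0 x) = (\<integral>\<^sup>+t\<in>{0..}. ennreal (exp (- x * cosh t)) \<partial>lborel)"
    by (rule nn_integral_has_integral_on[symmetric]) (use h in auto)
  also have "\<dots> = (\<integral>\<^sup>+t\<in>{0<..}. ennreal (exp (- x * cosh t)) \<partial>lborel)"
  proof (rule nn_integral_cong_except[of 0])
    fix t :: real assume "t \<noteq> 0"
    then show "ennreal (exp (- x * cosh t)) * indicator {0..} t = ennreal (exp (- x * cosh t)) * indicator {0<..} t"
      by (cases "t > 0") (simp_all add: indicator_def)
  qed
  finally show "ennreal (bessel_K0 x) = (\<integral>\<^sup>+t\<in>{0<..}. ennreal (exp (- x * cosh t)) \<partial>lborel)" .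
qed

lemma bessel_product_nn_integral:
  assumes "x > 0"
  shows "ennreal (bessel_I0 x * bessel_K0 x) =
    (\<integral>\<^sup>+\<phi>\<in>{0<..<pi}. (\<integral>\<^sup>+t\<in>{0<..}. ennreal (exp (- x * (cosh t - cos \<phi>)) / pi) \<partial>lborel) \<partial>lborel)"
proof -
  have "ennreal (bessel_I0 x * bessel_K0 x) =
     (\<integral>\<^sup>+\<phi>. (ennreal (exp (x * cos \<phi>) / pi) * indicator {0<..<pi} \<phi>) * ennreal (bessel_K0 x) \<partial>lborel)"
    using bessel_K0_nn_integral(2)[OF assms]
    by (subst nn_integral_multc) (auto simp: ennreal_mult bessel_I0_nonneg bessel_I0_nn_integral)
  also have "\<dots> = (\<integral>\<^sup>+\<phi>\<in>{0<..<pi}. (\<integral>\<^sup>+t\<in>{0<..}. ennreal (exp (- x * (cosh t - cos \<phi>)) / pi) \<partial>lborel) \<partial>lborel)"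
  proof (rule nn_integral_cong)
    fix \<phi> :: real
    have "ennreal (exp (x * cos \<phi>) / pi) * ennreal (bessel_K0 x) =
      (\<integral>\<^sup>+t. ennreal (exp (x * cos \<phi>) / pi) * (ennreal (exp (- x * cosh t)) * indicator {0<..} t) \<partial>lborel)"
      unfolding bessel_K0_nn_integral(1)[OF assms] by (rule nn_integral_cmult[symmetric]) auto
    also have "\<dots> = (\<integral>\<^sup>+t\<in>{0<..}. ennreal (exp (- x * (cosh t - cos \<phi>)) / pi) \<partial>lborel)"
    proof (rule nn_integral_cong)
      fix t
      have "exp (x * cos \<phi>) / pi * exp (- x * cosh t) = exp (- x * (cosh t - cos \<phi>)) / pi"
        by (simp add: field_simps flip: exp_add)
      then show "ennreal (exp (x * cos \<phi>) / pi) * (ennreal (exp (- x * cosh t)) * indicator {0<..} t) = ennreal (exp (- x * (cosh t - cos \<phi>)) / pi) * indicator {0<..} t"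
        by (simp add: ennreal_mult[symmetric] mult.assoc[symmetric] del: times_divide_eq_left)
    qed
    finally have e: "(\<integral>\<^sup>+t\<in>{0<..}. ennreal (exp (- x * (cosh t - cos \<phi>)) / pi) \<partial>lborel) = ennreal (exp (x * cos \<phi>) / pi) * ennreal (bessel_K0 x)" ..
    show "(ennreal (exp (x * cos \<phi>) / pi) * indicator {0<..<pi} \<phi>) * ennreal (bessel_K0 x) = (\<integral>\<^sup>+t\<in>{0<..}. ennreal (exp (- x * (cosh t - cos \<phi>)) / pi) \<partial>lborel) * indicator {0<..<pi} \<phi>"
      unfolding e by (simp only: mult_ac)
  qed
  finally show ?thesis .
qed

text \<open>The new variable u is half of cosh t - cos \<phi>, which turns the product into a
  Laplace transform with parameter 2x. The square root is sinh t, coming from the Jacobian.\<close>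

lemma cosh_substitution:
  assumes \<phi>: "0 < \<phi>" "\<phi> < pi"
  shows "(\<integral>\<^sup>+t\<in>{0<..}. ennreal (exp (- x * (cosh t - cos \<phi>)) / pi) \<partial>lborel)
    = (\<integral>\<^sup>+u\<in>{(1 - cos \<phi>) / 2<..}. ennreal (exp (- 2 * x * u) * (2 / pi / sqrt ((2 * u + cos \<phi>)\<^sup>2 - 1))) \<partial>lborel)"
proof -
  let ?g = "\<lambda>t::real. (cosh t - cos \<phi>) / 2"
  let ?f = "\<lambda>u::real. exp (- 2 * x * u) * (2 / pi / sqrt ((2 * u + cos \<phi>)\<^sup>2 - 1))"
  have "?g t \<in> {(1 - cos \<phi>) / 2<..}" if "t > 0" for t
    using cosh_real_strict_mono[of 0 t] that by simp
  moreover have "u \<in> ?g ` {0<..}" if u: "u \<in> {(1 - cos \<phi>) / 2<..}" for u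
  proof
    have "2 * u + cos \<phi> > 1" using u by (simp add: field_simps)
    then show "u = ?g (arcosh (2 * u + cos \<phi>))" "arcosh (2 * u + cos \<phi>) \<in> {0<..}"
      by (auto simp: cosh_arcosh_real)
  qed
  ultimately have im: "?g ` {0<..} = {(1 - cos \<phi>) / 2<..}" by blast
  have "(\<integral>\<^sup>+t\<in>{0<..}. ennreal (\<bar>sinh t / 2\<bar> * ?f (?g t)) \<partial>lborel) = (\<integral>\<^sup>+u\<in>?g ` {0<..}. ennreal (?f u) \<partial>lborel)"
  proof (rule nn_integral_substitution_inj[where f="?f" and g="?g" and g'="\<lambda>t. sinh t / 2"])
    show "?g ` {0<..} \<in> sets borel" unfolding im by simp
    show "(?g has_field_derivative sinh t / 2) (at t)" for t
      by (auto intro!: derivative_eq_intros)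
    show "inj_on ?g {0<..}"
      by (intro inj_onI) auto
    show "continuous_on {0<..} (\<lambda>t::real. sinh t / 2)" by (intro continuous_intros) auto
    show "?f u \<ge> 0" if "u \<in> ?g ` {0<..}" for u
    proof -
      have "2 * u + cos \<phi> > 1" using that unfolding im by (simp add: field_simps)
      then have "(2 * u + cos \<phi>)\<^sup>2 \<ge> 1" by (intro one_le_power) simp
      then show ?thesis by (intro mult_nonneg_nonneg divide_nonneg_nonneg) auto
    qed
  qed auto
  moreover have "\<bar>sinh t / 2\<bar> * ?f (?g t) = exp (- x * (cosh t - cos \<phi>)) / pi" if "t > 0" for t
  proof -
    have s: "sinh t > 0" using that by simp
    have "(cosh t)\<^sup>2 - 1 = (sinh t)\<^sup>2" using cosh_square_eq[of t] by simp
    moreover have "2 * ?g t + cos \<phi> = cosh t" by (simp add: field_simps)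
    ultimately have "sqrt ((2 * ?g t + cos \<phi>)\<^sup>2 - 1) = sinh t" using s by (simp only: real_sqrt_abs abs_of_pos)
    then show ?thesis using s by (simp add: field_simps)
  qed
  then have "(\<integral>\<^sup>+t\<in>{0<..}. ennreal (exp (- x * (cosh t - cos \<phi>)) / pi) \<partial>lborel) = (\<integral>\<^sup>+t\<in>{0<..}. ennreal (\<bar>sinh t / 2\<bar> * ?f (?g t)) \<partial>lborel)"
    by (intro nn_integral_cong) (auto simp: indicator_def)
  ultimately show ?thesis unfolding im by simp
qed

lemma bessel_product_laplace1:
  assumes "x > 0"
  shows "ennreal (bessel_I0 x * bessel_K0 x) =
    (\<integral>\<^sup>+u\<in>{0<..}. ennreal (exp (- 2 * x * u)) *
       (\<integral>\<^sup>+\<phi>\<in>{\<phi>\<in>{0<..<pi}. (1 - cos \<phi>) / 2 < u}. ennreal (2 / pi / sqrt ((2 * u + cos \<phi>)\<^sup>2 - 1)) \<partial>lborel) \<partial>lborel)"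
proof -
  have "ennreal (bessel_I0 x * bessel_K0 x) =
    (\<integral>\<^sup>+\<phi>\<in>{0<..<pi}. (\<integral>\<^sup>+t\<in>{0<..}. ennreal (exp (- x * (cosh t - cos \<phi>)) / pi) \<partial>lborel) \<partial>lborel)"
    by (rule bessel_product_nn_integral[OF assms])
  also have "\<dots> = (\<integral>\<^sup>+\<phi>. (\<integral>\<^sup>+u. ennreal (exp (- 2 * x * u)) * (indicator {0<..} u * (ennreal (2 / pi / sqrt ((2 * u + cos \<phi>)\<^sup>2 - 1)) * indicator {\<phi>\<in>{0<..<pi}. (1 - cos \<phi>) / 2 < u} \<phi>)) \<partial>lborel) \<partial>lborel)"
  proof (rule nn_integral_cong)
    fix \<phi> :: real
    show "(\<integral>\<^sup>+t\<in>{0<..}. ennreal (exp (- x * (cosh t - cos \<phi>)) / pi) \<partial>lborel) * indicator {0<..<pi} \<phi>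
      = (\<integral>\<^sup>+u. ennreal (exp (- 2 * x * u)) * (indicator {0<..} u * (ennreal (2 / pi / sqrt ((2 * u + cos \<phi>)\<^sup>2 - 1)) * indicator {\<phi>\<in>{0<..<pi}. (1 - cos \<phi>) / 2 < u} \<phi>)) \<partial>lborel)"
    proof (cases "\<phi> \<in> {0<..<pi}")
      case True
      have "ennreal (exp (- 2 * x * u) * (2 / pi / sqrt ((2 * u + cos \<phi>)\<^sup>2 - 1))) * indicator {(1 - cos \<phi>) / 2<..} u
        = ennreal (exp (- 2 * x * u)) * (indicator {0<..} u * (ennreal (2 / pi / sqrt ((2 * u + cos \<phi>)\<^sup>2 - 1)) * indicator {\<phi>\<in>{0<..<pi}. (1 - cos \<phi>) / 2 < u} \<phi>))" for u
      proof (cases "u > (1 - cos \<phi>) / 2")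
        case u: True
        moreover have "(1 - cos \<phi>) / 2 \<ge> 0" by simp
        ultimately have "u > 0" by linarith
        moreover have "ennreal (exp (- 2 * x * u) * (2 / pi / sqrt ((2 * u + cos \<phi>)\<^sup>2 - 1))) = ennreal (exp (- 2 * x * u)) * ennreal (2 / pi / sqrt ((2 * u + cos \<phi>)\<^sup>2 - 1))"
          by (rule ennreal_mult') simp
        ultimately show ?thesis using u True by (simp del: times_divide_eq_left times_divide_eq_right)
      qed (simp add: True)
      then show ?thesis using True cosh_substitution[of \<phi> x] by simp
    qed (auto simp: indicator_def)
  qed
  also have "\<dots> = (\<integral>\<^sup>+u. (\<integral>\<^sup>+\<phi>. ennreal (exp (- 2 * x * u)) * (indicator {0<..} u * (ennreal (2 / pi / sqrt ((2 * u + cos \<phi>)\<^sup>2 - 1)) * indicator {\<phi>\<in>{0<..<pi}. (1 - cos \<phi>) / 2 < u} \<phi>)) \<partial>lborel) \<partial>lborel)"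
    unfolding indicator_def by (rule lborel_pair.Fubini') measurable
  also have "\<dots> = (\<integral>\<^sup>+u\<in>{0<..}. ennreal (exp (- 2 * x * u)) *
       (\<integral>\<^sup>+\<phi>\<in>{\<phi>\<in>{0<..<pi}. (1 - cos \<phi>) / 2 < u}. ennreal (2 / pi / sqrt ((2 * u + cos \<phi>)\<^sup>2 - 1)) \<partial>lborel) \<partial>lborel)"
    by (intro nn_integral_cong) (auto simp: nn_integral_cmult mult_ac)
  finally show ?thesis .
qed

text \<open>With \<open>q = sin\<^sup>2 (\<phi>/2)\<close>, the substitution \<open>u sin\<^sup>2 (\<beta>/2) = q (1 + u - q)\<close> works because
  \<open>(1 - q) (u - q) = u - q (1 + u - q)\<close>.\<close>

lemma elliptic_substitution_aux:
  fixes u a :: real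
  assumes "u > 0" "0 < a" "a \<le> pi" and ua: "u \<ge> 1 \<and> a = pi \<or> u < 1 \<and> (1 - cos a) / 2 = u"
  shows "(\<integral>\<^sup>+\<phi>\<in>{0<..<a}. ennreal (2 / pi / sqrt ((2 * u + cos \<phi>)\<^sup>2 - 1)) \<partial>lborel)
       = (\<integral>\<^sup>+\<beta>\<in>{0<..<pi}. ennreal (1 / pi / sqrt (1 + u\<^sup>2 + 2 * u * cos \<beta>)) \<partial>lborel)"
proof -
  define q where "q = (\<lambda>\<phi>::real. (1 - cos \<phi>) / 2)"
  \<comment> \<open>\<open>C\<close> is cos \<beta> for the \<beta> of the substitution, since sin^2
    (\<beta>/2) = (1 - cos \<beta>) / 2.\<close>
  define C where "C = (\<lambda>\<phi>. 1 - 2 * (q \<phi> * (1 + u - q \<phi>)) / u)"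
  define g where "g = (\<lambda>\<phi>. arccos (C \<phi>))"
  define g' where "g' = (\<lambda>\<phi>. (1 + u - 2 * q \<phi>) / sqrt ((1 + u - q \<phi>) * (u - q \<phi>)))"
  have q0: "q 0 = 0" by (simp add: q_def)
  have qa: "q a = min 1 u" using ua by (auto simp: q_def)
  have qmono: "q x < q y" if "0 \<le> x" "x < y" "y \<le> pi" for x y
    using that cos_monotone_0_pi[of x y] by (simp add: q_def)
  have qb: "0 < q \<phi> \<and> q \<phi> < 1 \<and> q \<phi> < u" if "0 < \<phi>" "\<phi> < a" for \<phi>
    using qmono[of 0 \<phi>] qmono[of \<phi> a] that q0 qa assms(3) by auto
  have qb': "0 \<le> q \<phi> \<and> q \<phi> \<le> 1 \<and> q \<phi> \<le> u" if "0 \<le> \<phi>" "\<phi> \<le> a" for \<phi>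
    using qb[of \<phi>] that q0 qa \<open>u > 0\<close> by (cases "\<phi> = 0 \<or> \<phi> = a") auto
  have Cb: "-1 \<le> C \<phi> \<and> C \<phi> \<le> 1" if "0 \<le> \<phi>" "\<phi> \<le> a" for \<phi>
  proof -
    have "0 \<le> (1 - q \<phi>) * (u - q \<phi>)" "0 \<le> q \<phi> * (1 + u - q \<phi>)"
      using qb'[OF that] by (auto intro!: mult_nonneg_nonneg)
    then show ?thesis using \<open>u > 0\<close> by (auto simp: C_def field_simps)
  qed
  have Cb': "-1 < C \<phi> \<and> C \<phi> < 1" if "0 < \<phi>" "\<phi> < a" for \<phi>
  proof -
    have "0 < (1 - q \<phi>) * (u - q \<phi>)" "0 < q \<phi> * (1 + u - q \<phi>)"
      using qb[OF that] by (auto intro!: mult_pos_pos)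
    then show ?thesis using \<open>u > 0\<close> by (auto simp: C_def field_simps)
  qed
  have g'pos: "g' \<phi> > 0" if "0 < \<phi>" "\<phi> < a" for \<phi>
    using qb[OF that] by (auto simp: g'_def intro!: divide_pos_pos mult_pos_pos)
  have der: "(g has_field_derivative g' \<phi>) (at \<phi>)" if \<phi>: "0 < \<phi>" "\<phi> < a" for \<phi>
  proof -
    have sq: "sin \<phi> = 2 * sqrt (q \<phi> * (1 - q \<phi>))"
    proof -
      have "q \<phi> * (1 - q \<phi>) = (sin \<phi> / 2)\<^sup>2"
        by (simp add: q_def power_divide sin_squared_eq) (simp add: power2_eq_square field_simps)
      moreover have "sin \<phi> > 0" using \<phi> assms(3) by (intro sin_gt_zero) auto
      ultimately show ?thesis by (simp add: real_sqrt_mult_self real_sqrt_abs)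
    qed
    define Q where "Q = q \<phi>"
    have Q: "0 < Q" "Q < 1" "Q < u" using qb[OF \<phi>] by (auto simp: Q_def)
    have dq: "(q has_field_derivative sin \<phi> / 2) (at \<phi>)"
      unfolding q_def by (auto intro!: derivative_eq_intros)
    have dC: "(C has_field_derivative (- (1 + u - 2 * Q) * sin \<phi> / u)) (at \<phi>)"
      unfolding C_def using \<open>u > 0\<close>
      by (auto intro!: derivative_eq_intros dq simp: Q_def field_simps)
    have "1 - (C \<phi>)\<^sup>2 = (2 / u)\<^sup>2 * ((Q * (1 - Q)) * ((1 + u - Q) * (u - Q)))"
      using \<open>u > 0\<close> unfolding C_def Q_def[symmetric] by (simp add: power2_eq_square field_simps)
    then have s: "sqrt (1 - (C \<phi>)\<^sup>2) = 2 / u * (sqrt (Q * (1 - Q)) * sqrt ((1 + u - Q) * (u - Q)))"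
      using \<open>u > 0\<close> by (simp add: real_sqrt_mult)
    have "(g has_field_derivative (- (1 + u - 2 * Q) * sin \<phi> / u) * inverse (- sqrt (1 - (C \<phi>)\<^sup>2))) (at \<phi>)"
      unfolding g_def using Cb'[OF \<phi>]
      by (auto intro!: derivative_eq_intros dC)
    moreover have "(- (1 + u - 2 * Q) * sin \<phi> / u) * inverse (- sqrt (1 - (C \<phi>)\<^sup>2)) = g' \<phi>"
    proof -
      define A B where "A = sqrt (Q * (1 - Q))" and "B = sqrt ((1 + u - Q) * (u - Q))"
      have "A > 0" "B > 0" using Q by (auto simp: A_def B_def intro!: mult_pos_pos)
      then have "(- (1 + u - 2 * Q) * (2 * A) / u) * inverse (- (2 / u * (A * B))) = (1 + u - 2 * Q) / B"
        using \<open>u > 0\<close> by (simp add: field_simps)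
      then show ?thesis unfolding s sq g'_def Q_def[symmetric] A_def B_def .
    qed
    ultimately show ?thesis by simp
  qed
  have contC: "continuous_on {0..a} C"
    unfolding C_def q_def using \<open>u > 0\<close> by (intro continuous_intros) auto
  have cont: "continuous_on {0..a} g"
    unfolding g_def by (intro continuous_on_arccos contC) (use Cb in auto)
  have g0: "g 0 = 0" by (simp add: g_def C_def q0)
  have ga: "g a = pi"
  proof -
    \<comment> \<open>At the upper end q = min 1 u, so one of the factors 1 - q and u - q
      vanishes.\<close>
    have "C a = -1" using \<open>u > 0\<close> by (auto simp: C_def qa min_def field_simps)
    then show ?thesis by (simp add: g_def)
  qed
  have im: "g ` {0<..<a} = {0<..<pi}" and inj: "inj_on g {0<..<a}"
    using image_Ioo_strict_mono[OF \<open>0 < a\<close> cont der g'pos] g0 ga by auto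
  let ?f = "\<lambda>\<beta>. 1 / pi / sqrt (1 + u\<^sup>2 + 2 * u * cos \<beta>)"
  have "(\<integral>\<^sup>+\<phi>\<in>{0<..<a}. ennreal (\<bar>g' \<phi>\<bar> * ?f (g \<phi>)) \<partial>lborel) = (\<integral>\<^sup>+\<beta>\<in>g ` {0<..<a}. ennreal (?f \<beta>) \<partial>lborel)"
  proof (rule nn_integral_substitution_inj[where f="?f" and g=g and g'=g', OF _ _ _ inj])
    show "g ` {0<..<a} \<in> sets borel" unfolding im by simp
    have "continuous_on {0<..<a} q" unfolding q_def by (intro continuous_intros) auto
    then show "continuous_on {0<..<a} g'"
      unfolding g'_def
    proof (intro continuous_intros ballI)
      fix \<phi> assume "\<phi> \<in> {0<..<a}"
      then have "(1 + u - q \<phi>) * (u - q \<phi>) > 0" using qb[of \<phi>] by (intro mult_pos_pos) auto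
      then show "sqrt ((1 + u - q \<phi>) * (u - q \<phi>)) \<noteq> 0"
        by (metis order_less_irrefl real_sqrt_eq_0_iff)
    qed
    show "?f \<beta> \<ge> 0" for \<beta>
    proof -
      have "0 \<le> 1 + cos \<beta>" using cos_ge_minus_one[of \<beta>] by linarith
      then have "0 \<le> (1 - u)\<^sup>2 + 2 * u * (1 + cos \<beta>)" using \<open>u > 0\<close> by simp
      then have "0 \<le> 1 + u\<^sup>2 + 2 * u * cos \<beta>" by (simp add: power2_eq_square algebra_simps)
      then show ?thesis by simp
    qed
  qed (use der in auto)
  moreover have "\<bar>g' \<phi>\<bar> * ?f (g \<phi>) = 2 / pi / sqrt ((2 * u + cos \<phi>)\<^sup>2 - 1)" if \<phi>: "0 < \<phi>" "\<phi> < a" for \<phi>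
  proof -
    define Q where "Q = q \<phi>"
    have Q: "0 < Q" "Q < 1" "Q < u" using qb[OF \<phi>] by (auto simp: Q_def)
    have c: "cos \<phi> = 1 - 2 * Q" by (simp add: Q_def q_def field_simps)
    \<comment> \<open>The point of the substitution: the radicand on the right becomes the perfect
      square of 1 + u - 2q, which is the numerator of \<open>g'\<close> and cancels.\<close>
    have "cos (g \<phi>) = C \<phi>" unfolding g_def using Cb'[OF \<phi>] by (intro cos_arccos) auto
    then have "1 + u\<^sup>2 + 2 * u * cos (g \<phi>) = (1 + u - 2 * Q)\<^sup>2"
      using \<open>u > 0\<close> by (simp add: C_def Q_def[symmetric] power2_eq_square field_simps)
    then have 1: "sqrt (1 + u\<^sup>2 + 2 * u * cos (g \<phi>)) = 1 + u - 2 * Q" using Q by simp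
    have "(2 * u + cos \<phi>)\<^sup>2 - 1 = 2\<^sup>2 * ((1 + u - Q) * (u - Q))"
      unfolding c by (simp add: power2_eq_square algebra_simps)
    then have 2: "sqrt ((2 * u + cos \<phi>)\<^sup>2 - 1) = 2 * sqrt ((1 + u - Q) * (u - Q))"
      by (simp only: real_sqrt_mult real_sqrt_power) simp
    have "(1 + u - Q) * (u - Q) > 0" using Q by (intro mult_pos_pos) auto
    moreover define B W where "B = sqrt ((1 + u - Q) * (u - Q))" and "W = 1 + u - 2 * Q"
    ultimately have "B > 0" "W > 0" using Q by auto
    then have "\<bar>W / B\<bar> * (1 / pi / W) = 2 / pi / (2 * B)" by simp
    then show ?thesis unfolding 1 2 by (simp only: g'_def Q_def[symmetric] B_def W_def)
  qed
  then have "(\<integral>\<^sup>+\<phi>\<in>{0<..<a}. ennreal (\<bar>g' \<phi>\<bar> * ?f (g \<phi>)) \<partial>lborel) = (\<integral>\<^sup>+\<phi>\<in>{0<..<a}. ennreal (2 / pi / sqrt ((2 * u + cos \<phi>)\<^sup>2 - 1)) \<partial>lborel)"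
    by (intro nn_integral_cong) (auto simp: indicator_def)
  ultimately show ?thesis unfolding im by simp
qed

lemma elliptic_substitution:
  fixes u :: real
  assumes "u > 0"
  shows "(\<integral>\<^sup>+\<phi>\<in>{\<phi>\<in>{0<..<pi}. (1 - cos \<phi>) / 2 < u}. ennreal (2 / pi / sqrt ((2 * u + cos \<phi>)\<^sup>2 - 1)) \<partial>lborel)
       = (\<integral>\<^sup>+\<beta>\<in>{0<..<pi}. ennreal (1 / pi / sqrt (1 + u\<^sup>2 + 2 * u * cos \<beta>)) \<partial>lborel)"
proof -
  define a where "a = (if u \<ge> 1 then pi else arccos (1 - 2 * u))"
  have "0 < a \<and> a \<le> pi \<and> (u \<ge> 1 \<and> a = pi \<or> u < 1 \<and> (1 - cos a) / 2 = u) \<and> {\<phi>\<in>{0<..<pi}. (1 - cos \<phi>) / 2 < u} = {0<..<a}"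
  proof (cases "u \<ge> 1")
    case True
    have "(1 - cos \<phi>) / 2 < u" if "0 < \<phi>" "\<phi> < pi" for \<phi>
      using cos_monotone_0_pi[of \<phi> pi] that True by simp
    then show ?thesis using True by (auto simp: a_def)
  next
    case False
    have a: "a = arccos (1 - 2 * u)" and ca: "cos a = 1 - 2 * u" using False \<open>u > 0\<close> by (auto simp: a_def)
    have b: "0 < a" "a \<le> pi"
      using False \<open>u > 0\<close> arccos_lt_bounded[of "1 - 2 * u"] by (auto simp: a)
    have "(1 - cos \<phi>) / 2 < u \<longleftrightarrow> \<phi> < a" if "0 < \<phi>" "\<phi> < pi" for \<phi>
      using cos_mono_less_eq[of a \<phi>] that ca b by auto
    then show ?thesis using False b ca by auto
  qed
  then show ?thesis using elliptic_substitution_aux[OF assms, of a] by auto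
qed

text \<open>Landen's transformation, \<open>sin (\<beta> - \<psi>) = u sin \<psi>\<close>.\<close>

lemma landen_substitution:
  fixes u :: real
  assumes u: "0 < u" "u < 1"
  shows "(\<integral>\<^sup>+\<beta>\<in>{0<..<pi}. ennreal (1 / sqrt (1 + u\<^sup>2 + 2 * u * cos \<beta>)) \<partial>lborel)
      = (\<integral>\<^sup>+\<psi>\<in>{0<..<pi}. ennreal (1 / sqrt (1 - u\<^sup>2 * (sin \<psi>)\<^sup>2)) \<partial>lborel)"
proof -
  define g where "g = (\<lambda>\<psi>. \<psi> + arcsin (u * sin \<psi>))"
  define S where "S = (\<lambda>\<psi>. sqrt (1 - u\<^sup>2 * (sin \<psi>)\<^sup>2))"
  define g' where "g' = (\<lambda>\<psi>. 1 + u * cos \<psi> / S \<psi>)"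
  have us: "\<bar>u * sin \<psi>\<bar> < 1" for \<psi>
  proof -
    have "u * \<bar>sin \<psi>\<bar> \<le> u * 1" using u by (intro mult_left_mono) auto
    then have "u * \<bar>sin \<psi>\<bar> < 1" using u by linarith
    then show ?thesis using u by (simp add: abs_mult)
  qed
  have us': "u\<^sup>2 * (sin \<psi>)\<^sup>2 < 1" for \<psi>
    using us[of \<psi>] by (simp add: abs_square_less_1 flip: power_mult_distrib)
  have Spos: "S \<psi> > 0" for \<psi> using us'[of \<psi>] by (simp add: S_def)
  \<comment> \<open>The difference of the squares of \<open>S \<psi>\<close> and u cos \<psi> is 1 -
    u^2 > 0.\<close>
  have Sc: "S \<psi> + u * cos \<psi> > 0" for \<psi>
  proof -
    have "\<bar>u * cos \<psi>\<bar> < S \<psi>" unfolding S_def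
    proof (rule real_less_rsqrt)
      have "u\<^sup>2 < 1" using u by (simp add: power_less_one_iff)
      then show "\<bar>u * cos \<psi>\<bar>\<^sup>2 < 1 - u\<^sup>2 * (sin \<psi>)\<^sup>2"
        by (simp add: cos_squared_eq power_mult_distrib algebra_simps)
    qed
    then show ?thesis by linarith
  qed
  have g'_eq: "g' \<psi> = (S \<psi> + u * cos \<psi>) / S \<psi>" for \<psi> using Spos[of \<psi>] by (simp add: g'_def field_simps)
  have g'pos: "g' \<psi> > 0" for \<psi> using Sc Spos by (simp add: g'_eq)
  have der: "(g has_field_derivative g' \<psi>) (at \<psi>)" for \<psi>
    unfolding g_def g'_def S_def using us[of \<psi>]
    by (auto intro!: derivative_eq_intros simp: field_simps abs_less_iff)
  have cont: "continuous_on {0..pi} g"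
    using der by (meson DERIV_isCont continuous_at_imp_continuous_on)
  have im: "g ` {0<..<pi} = {0<..<pi}" and inj: "inj_on g {0<..<pi}"
    using image_Ioo_strict_mono[OF pi_gt_zero cont der g'pos] by (auto simp: g_def)
  let ?f = "\<lambda>\<beta>. 1 / sqrt (1 + u\<^sup>2 + 2 * u * cos \<beta>)"
  \<comment> \<open>The radicand again becomes a square, namely that of the numerator of
    \<open>g'\<close>.\<close>
  have eq: "1 + u\<^sup>2 + 2 * u * cos (g \<psi>) = (S \<psi> + u * cos \<psi>)\<^sup>2" for \<psi>
  proof -
    have "sin (arcsin (u * sin \<psi>)) = u * sin \<psi>" using us[of \<psi>] by (intro sin_arcsin) auto
    moreover have "cos (arcsin (u * sin \<psi>)) = S \<psi>" using us[of \<psi>] by (simp add: cos_arcsin S_def power_mult_distrib abs_less_iff)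
    ultimately have c: "cos (g \<psi>) = cos \<psi> * S \<psi> - u * (sin \<psi>)\<^sup>2"
      by (simp add: g_def cos_add power2_eq_square)
    have "(S \<psi>)\<^sup>2 = 1 - u\<^sup>2 * (sin \<psi>)\<^sup>2" using us'[of \<psi>] by (simp add: S_def)
    then show ?thesis unfolding c by (simp add: power2_sum power_mult_distrib cos_squared_eq) (simp add: power2_eq_square algebra_simps)
  qed
  have "(\<integral>\<^sup>+\<psi>\<in>{0<..<pi}. ennreal (\<bar>g' \<psi>\<bar> * ?f (g \<psi>)) \<partial>lborel) = (\<integral>\<^sup>+\<beta>\<in>g ` {0<..<pi}. ennreal (?f \<beta>) \<partial>lborel)"
  proof (rule nn_integral_substitution_inj[where f="?f" and g=g and g'=g', OF _ _ _ inj])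
    show "g ` {0<..<pi} \<in> sets borel" unfolding im by simp
    show "continuous_on {0<..<pi} g'"
      unfolding g'_def S_def using us' by (intro continuous_intros) (auto simp: less_le)
    show "?f \<beta> \<ge> 0" if "\<beta> \<in> g ` {0<..<pi}" for \<beta> using that eq by auto
  qed (use der in auto)
  moreover have "\<bar>g' \<psi>\<bar> * ?f (g \<psi>) = 1 / sqrt (1 - u\<^sup>2 * (sin \<psi>)\<^sup>2)" for \<psi>
  proof -
    have "\<bar>g' \<psi>\<bar> * ?f (g \<psi>) = 1 / S \<psi>"
      unfolding eq using Sc[of \<psi>] Spos[of \<psi>] by (simp add: g'_eq)
    then show ?thesis by (simp add: S_def)
  qed
  ultimately show ?thesis unfolding im by simp
qed

section \<open>Complete elliptic integrals as double integrals\<close>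

text \<open>The antiderivative is arctan (k tan \<theta>) / (A k) with k = sqrt (B / A), and A k =
  sqrt (A B). Its limit at pi/2 is reached because tan tends to infinity there.\<close>

lemma nn_integral_inverse_trig_quadratic:
  fixes A B :: real
  assumes "A > 0" "B > 0"
  shows "(\<integral>\<^sup>+\<theta>\<in>{0<..<pi/2}. ennreal (1 / (A * (cos \<theta>)\<^sup>2 + B * (sin \<theta>)\<^sup>2)) \<partial>lborel) = ennreal (pi / 2 / sqrt (A * B))"
proof -
  define k where "k = sqrt (B / A)"
  have k: "k > 0" "k\<^sup>2 = B / A" using assms by (auto simp: k_def)
  have cpos: "cos \<theta> > 0" if "0 < \<theta>" "\<theta> < pi / 2" for \<theta>
    using that by (intro cos_gt_zero) auto
  have pos: "A * (cos \<theta>)\<^sup>2 + B * (sin \<theta>)\<^sup>2 > 0" if "0 < \<theta>" "\<theta> < pi / 2" for \<theta>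
    using cpos[OF that] assms by (intro add_pos_nonneg) auto
  have "(\<integral>\<^sup>+\<theta>\<in>{0<..<pi/2}. ennreal (1 / (A * (cos \<theta>)\<^sup>2 + B * (sin \<theta>)\<^sup>2)) \<partial>lborel)
    = ennreal (1 / (A * k) * (pi / 2) - 1 / (A * k) * arctan (k * tan 0))"
  proof (rule nn_integral_FTC_Ioo)
    fix \<theta> :: real assume \<theta>: "0 < \<theta>" "\<theta> < pi / 2"
    note c = cpos[OF \<theta>]
    have "((\<lambda>\<theta>. 1 / (A * k) * arctan (k * tan \<theta>)) has_field_derivative
        1 / (A * k) * (k * inverse ((cos \<theta>)\<^sup>2) * inverse (1 + (k * tan \<theta>)\<^sup>2))) (at \<theta>)"
      using c by (auto intro!: derivative_eq_intros simp: divide_inverse)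
    also have "1 / (A * k) * (k * inverse ((cos \<theta>)\<^sup>2) * inverse (1 + (k * tan \<theta>)\<^sup>2))
        = 1 / (A * ((cos \<theta>)\<^sup>2 * (1 + (k * tan \<theta>)\<^sup>2)))"
      using k by (simp add: field_simps)
    also have "A * ((cos \<theta>)\<^sup>2 * (1 + (k * tan \<theta>)\<^sup>2)) = A * (cos \<theta>)\<^sup>2 + B * (sin \<theta>)\<^sup>2"
      using c assms unfolding power_mult_distrib k(2) tan_def by (simp add: field_simps)
    finally show "((\<lambda>\<theta>. 1 / (A * k) * arctan (k * tan \<theta>)) has_field_derivative
        1 / (A * (cos \<theta>)\<^sup>2 + B * (sin \<theta>)\<^sup>2)) (at \<theta>)" .
    show "isCont (\<lambda>\<theta>. 1 / (A * (cos \<theta>)\<^sup>2 + B * (sin \<theta>)\<^sup>2)) \<theta>"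
      using pos[OF \<theta>] by (intro continuous_intros) auto
    show "0 \<le> 1 / (A * (cos \<theta>)\<^sup>2 + B * (sin \<theta>)\<^sup>2)" using pos[OF \<theta>] by simp
  next
    have "isCont (\<lambda>\<theta>. 1 / (A * k) * arctan (k * tan \<theta>)) 0" by (intro continuous_intros) auto
    then show "((\<lambda>\<theta>. 1 / (A * k) * arctan (k * tan \<theta>)) \<longlongrightarrow> 1 / (A * k) * arctan (k * tan 0)) (at_right 0)"
      by (simp add: isCont_def filterlim_at_split)
    have "filterlim (\<lambda>\<theta>. k * tan \<theta>) at_top (at_left (pi / 2))"
      by (rule filterlim_tendsto_pos_mult_at_top[OF tendsto_const k(1) filterlim_tan_at_left])
    then have "((\<lambda>\<theta>. arctan (k * tan \<theta>)) \<longlongrightarrow> pi / 2) (at_left (pi / 2))"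
      by (rule filterlim_compose[OF tendsto_arctan_at_top])
    then show "((\<lambda>\<theta>. 1 / (A * k) * arctan (k * tan \<theta>)) \<longlongrightarrow> 1 / (A * k) * (pi / 2)) (at_left (pi / 2))"
      by (intro tendsto_intros)
  qed auto
  also have "A * k = sqrt (A * B)"
    using assms real_sqrt_mult[of "A\<^sup>2" "B / A"] by (simp add: k_def power2_eq_square)
  finally show ?thesis by (simp add: mult.commute)
qed

lemma nn_integral_sin_substitution:
  fixes f :: "real \<Rightarrow> real"
  assumes [measurable]: "f \<in> borel_measurable borel" and nn: "\<And>t. 0 < t \<Longrightarrow> t < 1 \<Longrightarrow> f t \<ge> 0"
  shows "(\<integral>\<^sup>+t\<in>{0<..<1}. ennreal (f t / sqrt (1 - t\<^sup>2)) \<partial>lborel) = (\<integral>\<^sup>+\<psi>\<in>{0<..<pi/2}. ennreal (f (sin \<psi>)) \<partial>lborel)"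
proof -
  have cpos: "cos \<psi> > 0" if "0 < \<psi>" "\<psi> < pi / 2" for \<psi>
    using that by (intro cos_gt_zero) auto
  have im: "sin ` {0<..<pi/2} = {0<..<1::real}" and inj: "inj_on sin {0<..<pi/2::real}"
    using image_Ioo_strict_mono[of 0 "pi/2" sin cos, OF _ continuous_on_sin[OF continuous_on_id] DERIV_sin] cpos by auto
  have "(\<integral>\<^sup>+\<psi>\<in>{0<..<pi/2}. ennreal (\<bar>cos \<psi>\<bar> * (f (sin \<psi>) / sqrt (1 - (sin \<psi>)\<^sup>2))) \<partial>lborel)
     = (\<integral>\<^sup>+t\<in>sin ` {0<..<pi/2}. ennreal (f t / sqrt (1 - t\<^sup>2)) \<partial>lborel)"
  proof (rule nn_integral_substitution_inj[where f="\<lambda>t. f t / sqrt (1 - t\<^sup>2)" and g=sin and g'=cos, OF _ _ _ inj])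
    show "f u / sqrt (1 - u\<^sup>2) \<ge> 0" if "u \<in> sin ` {0<..<pi/2}" for u
      using that nn[of u] unfolding im by (intro divide_nonneg_nonneg) (auto simp: abs_square_le_1)
    show "sin ` {0<..<pi/2::real} \<in> sets borel" unfolding im by simp
  qed (auto intro!: continuous_intros)
  moreover have "\<bar>cos \<psi>\<bar> * (f (sin \<psi>) / sqrt (1 - (sin \<psi>)\<^sup>2)) = f (sin \<psi>)" if "0 < \<psi>" "\<psi> < pi / 2" for \<psi>
    using cpos[OF that] by (simp add: cos_squared_eq[symmetric])
  then have "(\<integral>\<^sup>+\<psi>\<in>{0<..<pi/2}. ennreal (\<bar>cos \<psi>\<bar> * (f (sin \<psi>) / sqrt (1 - (sin \<psi>)\<^sup>2))) \<partial>lborel) = (\<integral>\<^sup>+\<psi>\<in>{0<..<pi/2}. ennreal (f (sin \<psi>)) \<partial>lborel)"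
    by (intro nn_integral_cong) (auto simp: indicator_def)
  ultimately show ?thesis unfolding im by simp
qed

text \<open>Integrating over \<theta> first leaves (pi/2) / sqrt ((a - b t^2) (1 - t^2)), an
  elliptic integral in Legendre's form that t = sin \<psi> makes trigonometric. The order with t
  inside is the one that the principal value kernel produces.\<close>

lemma elliptic_double_integral:
  fixes a b :: real
  assumes "a > 0" "b \<le> a" "b > 0"
  shows "(\<integral>\<^sup>+\<theta>\<in>{0<..<pi/2}. (\<integral>\<^sup>+t\<in>{0<..<1}. ennreal (1 / ((a - b * t\<^sup>2) * (cos \<theta>)\<^sup>2 + (1 - t\<^sup>2) * (sin \<theta>)\<^sup>2)) \<partial>lborel) \<partial>lborel)
   = ennreal (pi / 2) * (\<integral>\<^sup>+\<psi>\<in>{0<..<pi/2}. ennreal (1 / sqrt (a - b * (sin \<psi>)\<^sup>2)) \<partial>lborel)"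
proof -
  have ab: "a - b * t\<^sup>2 > 0" "1 - t\<^sup>2 > 0" if "0 < t" "t < 1" for t
  proof -
    have t: "t\<^sup>2 < 1" using that by (simp add: power_less_one_iff)
    then have "b * t\<^sup>2 < b * 1" using assms by (intro mult_strict_left_mono) auto
    then show "a - b * t\<^sup>2 > 0" "1 - t\<^sup>2 > 0" using assms t by linarith+
  qed
  have "(\<integral>\<^sup>+\<theta>\<in>{0<..<pi/2}. (\<integral>\<^sup>+t\<in>{0<..<1}. ennreal (1 / ((a - b * t\<^sup>2) * (cos \<theta>)\<^sup>2 + (1 - t\<^sup>2) * (sin \<theta>)\<^sup>2)) \<partial>lborel) \<partial>lborel)
    = (\<integral>\<^sup>+\<theta>. (\<integral>\<^sup>+t. ennreal (1 / ((a - b * t\<^sup>2) * (cos \<theta>)\<^sup>2 + (1 - t\<^sup>2) * (sin \<theta>)\<^sup>2)) * indicator {0<..<1} t * indicator {0<..<pi/2} \<theta> \<partial>lborel) \<partial>lborel)"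
    by (intro nn_integral_cong nn_integral_multc[symmetric]) measurable
  also have "\<dots> = (\<integral>\<^sup>+t. (\<integral>\<^sup>+\<theta>. ennreal (1 / ((a - b * t\<^sup>2) * (cos \<theta>)\<^sup>2 + (1 - t\<^sup>2) * (sin \<theta>)\<^sup>2)) * indicator {0<..<1} t * indicator {0<..<pi/2} \<theta> \<partial>lborel) \<partial>lborel)"
    by (rule lborel_pair.Fubini') measurable
  also have "\<dots> = (\<integral>\<^sup>+t. (\<integral>\<^sup>+\<theta>\<in>{0<..<pi/2}. ennreal (1 / ((a - b * t\<^sup>2) * (cos \<theta>)\<^sup>2 + (1 - t\<^sup>2) * (sin \<theta>)\<^sup>2)) \<partial>lborel) * indicator {0<..<1} t \<partial>lborel)"
    by (intro nn_integral_cong, subst nn_integral_multc[symmetric]) (measurable, auto simp: mult_ac)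
  also have "\<dots> = (\<integral>\<^sup>+t\<in>{0<..<1}. ennreal (pi / 2 * (1 / sqrt (a - b * t\<^sup>2)) / sqrt (1 - t\<^sup>2)) \<partial>lborel)"
  proof (rule nn_integral_cong)
    fix t :: real
    show "(\<integral>\<^sup>+\<theta>\<in>{0<..<pi/2}. ennreal (1 / ((a - b * t\<^sup>2) * (cos \<theta>)\<^sup>2 + (1 - t\<^sup>2) * (sin \<theta>)\<^sup>2)) \<partial>lborel) * indicator {0<..<1} t
      = ennreal (pi / 2 * (1 / sqrt (a - b * t\<^sup>2)) / sqrt (1 - t\<^sup>2)) * indicator {0<..<1} t"
    proof (cases "t \<in> {0<..<1}")
      case True
      then show ?thesis using ab[of t] by (simp only: nn_integral_inverse_trig_quadratic greaterThanLessThan_iff real_sqrt_mult) simp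
    qed simp
  qed
  also have "\<dots> = (\<integral>\<^sup>+\<psi>\<in>{0<..<pi/2}. ennreal (pi / 2 * (1 / sqrt (a - b * (sin \<psi>)\<^sup>2))) \<partial>lborel)"
    using ab by (intro nn_integral_sin_substitution[where f="\<lambda>t. pi / 2 * (1 / sqrt (a - b * t\<^sup>2))"]) (auto simp: less_imp_le)
  also have "\<dots> = (\<integral>\<^sup>+\<psi>. ennreal (pi / 2) * (ennreal (1 / sqrt (a - b * (sin \<psi>)\<^sup>2)) * indicator {0<..<pi/2} \<psi>) \<partial>lborel)"
    by (intro nn_integral_cong) (simp add: ennreal_mult'[symmetric] mult.assoc[symmetric] del: times_divide_eq_right times_divide_eq_left)
  also have "\<dots> = ennreal (pi / 2) * (\<integral>\<^sup>+\<psi>\<in>{0<..<pi/2}. ennreal (1 / sqrt (a - b * (sin \<psi>)\<^sup>2)) \<partial>lborel)"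
    by (rule nn_integral_cmult) measurable
  finally show ?thesis .
qed

section \<open>The principal value representation\<close>

lemma has_field_derivative_artanh_comp:
  fixes z :: "real \<Rightarrow> real"
  assumes "(z has_field_derivative d) (at v)" "\<bar>z v\<bar> < 1" "e = d / (1 - (z v)\<^sup>2)"
  shows "((\<lambda>v. artanh (z v)) has_field_derivative e) (at v)"
  unfolding assms(3) using DERIV_chain2[OF artanh_real_has_field_derivative assms(1)] assms(2) by simp

lemma nn_integral_artanh:
  assumes "0 < p" "0 < q" "p < q"
  shows "(\<integral>\<^sup>+t\<in>{0<..<1}. ennreal (1 / (q\<^sup>2 - p\<^sup>2 * t\<^sup>2)) \<partial>lborel) = ennreal (artanh (p / q) / (p * q))"
proof -
  have lt: "\<bar>p * t / q\<bar> < 1" if "0 \<le> t" "t \<le> 1" for t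
  proof -
    have "p * t \<le> p * 1" using that assms by (intro mult_left_mono) auto
    then have "p * t < q" using assms by linarith
    then show ?thesis using that assms by (simp add: abs_mult)
  qed
  have pos: "q\<^sup>2 - p\<^sup>2 * t\<^sup>2 > 0" if "0 \<le> t" "t \<le> 1" for t
  proof -
    have "p * t < q" using lt[OF that] that assms by (simp add: abs_mult)
    then have "(p * t)\<^sup>2 < q\<^sup>2" using that assms by (intro power_strict_mono) auto
    then show ?thesis by (simp add: power_mult_distrib)
  qed
  have D: "((\<lambda>t. artanh (p * t / q) / (p * q)) has_field_derivative 1 / (q\<^sup>2 - p\<^sup>2 * t\<^sup>2)) (at t)" if "0 \<le> t" "t \<le> 1" for t
  proof -
    have "((\<lambda>t. artanh (p * t / q)) has_field_derivative p * q / (q\<^sup>2 - p\<^sup>2 * t\<^sup>2)) (at t)"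
      by (rule has_field_derivative_artanh_comp[where d="p / q"])
        (use assms lt[OF that] pos[OF that] in \<open>auto intro!: derivative_eq_intros simp: power_divide power_mult_distrib field_simps power2_eq_square\<close>)
    from DERIV_cdivide[OF this, of "p * q"] show ?thesis using assms by simp
  qed
  have "(\<integral>\<^sup>+t\<in>{0<..<1}. ennreal (1 / (q\<^sup>2 - p\<^sup>2 * t\<^sup>2)) \<partial>lborel) = ennreal (artanh (p * 1 / q) / (p * q) - artanh (p * 0 / q) / (p * q))"
  proof (rule nn_integral_FTC_Ioo)
    show "((\<lambda>t. artanh (p * t / q) / (p * q)) \<longlongrightarrow> artanh (p * 0 / q) / (p * q)) (at_right 0)"
      using DERIV_isCont[OF D[of 0]] by (simp add: isCont_def filterlim_at_split)
    show "((\<lambda>t. artanh (p * t / q) / (p * q)) \<longlongrightarrow> artanh (p * 1 / q) / (p * q)) (at_left 1)"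
      using DERIV_isCont[OF D[of 1]] by (simp add: isCont_def filterlim_at_split)
    show "isCont (\<lambda>t. 1 / (q\<^sup>2 - p\<^sup>2 * t\<^sup>2)) t" if "0 < t" "t < 1" for t
      using pos[of t] that by (intro continuous_intros) auto
  qed (use D pos in \<open>auto simp: less_imp_le\<close>)
  then show ?thesis by simp
qed

text \<open>The instance used later has a = u^2 cos^2 \<theta> and b = sin^2 \<theta>.
  \<open>zA\<close> and \<open>zB\<close> are the arguments of the artanh antiderivatives of 1 / ((1
  - v^2) sqrt (a + b v^2)) and of v / ((1 - v^2) sqrt (a v^2 + b)). Up to sign the second integrand
  is the image of the first under v -> 1/v.\<close>

locale pv_kernel =
  fixes a b r :: real
  assumes ab: "a > 0" "b > 0" and r: "r = sqrt (a + b)"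
begin

definition "zA v = v * r / sqrt (a + b * v\<^sup>2)"
definition "zB v = sqrt (a * v\<^sup>2 + b) / r"

lemma r_pos: "r > 0" and r_square: "r\<^sup>2 = a + b" using ab by (auto simp: r)
lemma radicand_A_pos: "a + b * v\<^sup>2 > 0" using ab by (intro add_pos_nonneg) auto
lemma radicand_B_pos: "a * v\<^sup>2 + b > 0" using ab by (intro add_nonneg_pos) auto

lemma one_minus_zA_square: "1 - (zA v)\<^sup>2 = a * (1 - v\<^sup>2) / (a + b * v\<^sup>2)"
  using radicand_A_pos[of v] by (simp add: zA_def power_divide power_mult_distrib r_square field_simps)

lemma one_minus_zB_square: "1 - (zB v)\<^sup>2 = a * (1 - v\<^sup>2) / r\<^sup>2"
  using radicand_B_pos[of v] ab by (simp add: zB_def power_divide r_square field_simps)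

lemma one_minus_square_pos: "0 \<le> v \<Longrightarrow> v < 1 \<Longrightarrow> 1 - v\<^sup>2 > (0::real)" by (simp add: power_less_one_iff)

lemma zA_less: "0 \<le> v \<Longrightarrow> v < 1 \<Longrightarrow> \<bar>zA v\<bar> < 1"
proof -
  assume "0 \<le> v" "v < 1"
  then have "1 - (zA v)\<^sup>2 > 0" unfolding one_minus_zA_square using ab radicand_A_pos one_minus_square_pos by (intro divide_pos_pos mult_pos_pos) auto
  then show ?thesis by (simp add: abs_square_less_1)
qed

lemma zB_less: "0 \<le> v \<Longrightarrow> v < 1 \<Longrightarrow> \<bar>zB v\<bar> < 1"
proof -
  assume "0 \<le> v" "v < 1"
  then have "1 - (zB v)\<^sup>2 > 0" unfolding one_minus_zB_square using ab r_pos one_minus_square_pos by (intro divide_pos_pos mult_pos_pos) auto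
  then show ?thesis by (simp add: abs_square_less_1)
qed

lemma artanh_zA_deriv:
  assumes "0 \<le> v" "v < 1"
  shows "((\<lambda>v. artanh (zA v) / r) has_field_derivative 1 / ((1 - v\<^sup>2) * sqrt (a + b * v\<^sup>2))) (at v)"
proof -
  define s where "s = sqrt (a + b * v\<^sup>2)"
  have s: "s > 0" "s\<^sup>2 = a + b * v\<^sup>2" using radicand_A_pos[of v] by (auto simp: s_def)
  have ds: "((\<lambda>v. sqrt (a + b * v\<^sup>2)) has_field_derivative b * v / s) (at v)"
    using radicand_A_pos[of v] s(1) by (auto intro!: derivative_eq_intros simp: s_def[symmetric] divide_simps)
  have "(zA has_field_derivative (r * s - v * r * (b * v / s)) / (s * s)) (at v)"
    unfolding zA_def using s(1)
    using DERIV_divide[OF DERIV_cmult_right[OF DERIV_ident, of r] ds] by (simp flip: s_def)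
  also have "(r * s - v * r * (b * v / s)) / (s * s) = r * (s\<^sup>2 - b * v\<^sup>2) / s ^ 3"
    using s(1) by (simp add: field_simps power2_eq_square power3_eq_cube)
  also have "s\<^sup>2 - b * v\<^sup>2 = a" by (simp add: s)
  finally have "(zA has_field_derivative r * a / s ^ 3) (at v)" .
  then have "((\<lambda>v. artanh (zA v)) has_field_derivative r / ((1 - v\<^sup>2) * s)) (at v)"
  proof (rule has_field_derivative_artanh_comp)
    show "r / ((1 - v\<^sup>2) * s) = r * a / s ^ 3 / (1 - (zA v)\<^sup>2)"
      unfolding one_minus_zA_square s(2)[symmetric] using s(1) one_minus_square_pos[OF assms] ab by (simp add: field_simps power2_eq_square power3_eq_cube)
  qed (use zA_less assms in auto)
  from DERIV_cdivide[OF this, of r] show ?thesis using r_pos by (simp add: s_def)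
qed

lemma artanh_zB_deriv:
  assumes "0 \<le> v" "v < 1"
  shows "((\<lambda>v. artanh (zB v) / r) has_field_derivative v / ((1 - v\<^sup>2) * sqrt (a * v\<^sup>2 + b))) (at v)"
proof -
  define s where "s = sqrt (a * v\<^sup>2 + b)"
  have s: "s > 0" using radicand_B_pos[of v] by (auto simp: s_def)
  have ds: "((\<lambda>v. sqrt (a * v\<^sup>2 + b)) has_field_derivative a * v / s) (at v)"
    using radicand_B_pos[of v] s(1) by (auto intro!: derivative_eq_intros simp: s_def[symmetric] divide_simps)
  have "(zB has_field_derivative (a * v / s) / r) (at v)"
    unfolding zB_def by (rule DERIV_cdivide[OF ds])
  then have "((\<lambda>v. artanh (zB v)) has_field_derivative r * (v / ((1 - v\<^sup>2) * s))) (at v)"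
  proof (rule has_field_derivative_artanh_comp)
    show "r * (v / ((1 - v\<^sup>2) * s)) = (a * v / s) / r / (1 - (zB v)\<^sup>2)"
      unfolding one_minus_zB_square using s(1) one_minus_square_pos[OF assms] ab r_pos by (simp add: field_simps power2_eq_square)
  qed (use zB_less assms in auto)
  from DERIV_cdivide[OF this, of r] show ?thesis using r_pos by (simp add: s_def)
qed

text \<open>Both antiderivatives blow up at \<open>v = 1\<close>; here their difference is written in a form that shows that
  its limit there is \<open>0\<close>.\<close>

lemma artanh_diff:
  assumes "0 \<le> v" "v < 1"
  shows "artanh (zA v) - artanh (zB v) = ln (((1 + zA v) / (1 + zB v))\<^sup>2 * ((a + b * v\<^sup>2) / r\<^sup>2)) / 2"
proof -
  have A: "1 + zA v > 0" "1 - zA v > 0" using zA_less[OF assms] by auto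
  have B: "1 + zB v > 0" "1 - zB v > 0" using zB_less[OF assms] by auto
  have "(1 - (zB v)\<^sup>2) / (1 - (zA v)\<^sup>2) = (a + b * v\<^sup>2) / r\<^sup>2"
    unfolding one_minus_zA_square one_minus_zB_square using ab one_minus_square_pos[OF assms] r_pos radicand_A_pos[of v] by (simp add: field_simps)
  moreover have "(1 - (zB v)\<^sup>2) / (1 - (zA v)\<^sup>2) = ((1 - zB v) * (1 + zB v)) / ((1 - zA v) * (1 + zA v))"
    by (simp add: power2_eq_square algebra_simps)
  moreover have "(pA / pB)\<^sup>2 * ((mB * pB) / (mA * pA)) = (pA / mA) / (pB / mB)" if "pA > 0" "mA > 0" "pB > 0" "mB > 0" for pA mA pB mB :: real
    using that by (simp add: field_simps power2_eq_square)
  ultimately have "((1 + zA v) / (1 + zB v))\<^sup>2 * ((a + b * v\<^sup>2) / r\<^sup>2) = ((1 + zA v) / (1 - zA v)) / ((1 + zB v) / (1 - zB v))"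
    using A B by metis
  moreover have "ln (((1 + zA v) / (1 - zA v)) / ((1 + zB v) / (1 - zB v))) = ln ((1 + zA v) / (1 - zA v)) - ln ((1 + zB v) / (1 - zB v))"
    using A B by (intro ln_divide_pos divide_pos_pos) auto
  ultimately show ?thesis by (simp only: artanh_def diff_divide_distrib)
qed

lemma artanh_diff_tendsto: "((\<lambda>v. artanh (zA v) / r - artanh (zB v) / r) \<longlongrightarrow> 0) (at_left 1)"
proof -
  have "((\<lambda>v. ln (((1 + zA v) / (1 + zB v))\<^sup>2 * ((a + b * v\<^sup>2) / r\<^sup>2)) / 2 / r) \<longlongrightarrow> ln (((1 + zA 1) / (1 + zB 1))\<^sup>2 * ((a + b * 1\<^sup>2) / r\<^sup>2)) / 2 / r) (at_left 1)"
    unfolding zA_def zB_def using ab r_pos by (intro tendsto_intros) (auto simp: r add_eq_0_iff)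
  also have "ln (((1 + zA 1) / (1 + zB 1))\<^sup>2 * ((a + b * 1\<^sup>2) / r\<^sup>2)) / 2 / r = 0"
  proof -
    have "zA 1 = 1" "zB 1 = 1" "a + b \<noteq> 0" using ab r_pos by (auto simp: zA_def zB_def simp flip: r)
    then show ?thesis by (simp add: r_square)
  qed
  finally show ?thesis
  proof (rule Lim_transform_eventually)
    have "eventually (\<lambda>v::real. v \<in> {0<..<1}) (at_left 1)" by (rule eventually_at_left_real) simp
    then show "\<forall>\<^sub>F v in at_left 1. ln (((1 + zA v) / (1 + zB v))\<^sup>2 * ((a + b * v\<^sup>2) / r\<^sup>2)) / 2 / r = artanh (zA v) / r - artanh (zB v) / r"
    proof eventually_elim
      case (elim v)
      then have "artanh (zA v) - artanh (zB v) = ln (((1 + zA v) / (1 + zB v))\<^sup>2 * ((a + b * v\<^sup>2) / r\<^sup>2)) / 2"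
        by (intro artanh_diff) auto
      then show ?case by (simp only: diff_divide_distrib[symmetric])
    qed
  qed
qed

lemma nn_integral_A:
  assumes "0 < e" "e < 1"
  shows "(\<integral>\<^sup>+v\<in>{0<..<e}. ennreal (1 / ((1 - v\<^sup>2) * sqrt (a + b * v\<^sup>2))) \<partial>lborel) = ennreal (artanh (zA e) / r)"
    "artanh (zA e) / r \<ge> 0"
proof -
  have 1: "((\<lambda>v. artanh (zA v) / r) \<longlongrightarrow> artanh (zA e) / r) (at_left e)"
    "((\<lambda>v. artanh (zA v) / r) \<longlongrightarrow> artanh (zA 0) / r) (at_right 0)"
    using DERIV_isCont[OF artanh_zA_deriv[of e]] DERIV_isCont[OF artanh_zA_deriv[of 0]] assms by (auto simp: isCont_def filterlim_at_split)
  have *: "isCont (\<lambda>v. 1 / ((1 - v\<^sup>2) * sqrt (a + b * v\<^sup>2))) v" "0 \<le> 1 / ((1 - v\<^sup>2) * sqrt (a + b * v\<^sup>2))" if "0 < v" "v < e" for v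
    using one_minus_square_pos[of v] radicand_A_pos[of v] that assms by (auto intro!: continuous_intros divide_nonneg_pos)
  note nn_integral_FTC_Ioo[OF assms(1) artanh_zA_deriv *  1(2,1)]
  from this[OF _ _ _ _] show "(\<integral>\<^sup>+v\<in>{0<..<e}. ennreal (1 / ((1 - v\<^sup>2) * sqrt (a + b * v\<^sup>2))) \<partial>lborel) = ennreal (artanh (zA e) / r)"
    "artanh (zA e) / r \<ge> 0" using assms by (auto simp: zA_def)
qed

text \<open>Each term alone diverges at v = 1. Their difference is nonnegative and has an
  antiderivative that tends to 0 there, so its integral is read off at the lower end e.\<close>

lemma nn_integral_A_minus_B:
  assumes "0 < e" "e < 1"
  shows "(\<integral>\<^sup>+v\<in>{e<..<1}. ennreal (1 / ((1 - v\<^sup>2) * sqrt (a + b * v\<^sup>2)) - v / ((1 - v\<^sup>2) * sqrt (a * v\<^sup>2 + b))) \<partial>lborel) = ennreal (artanh (zB e) / r - artanh (zA e) / r)"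
    "artanh (zB e) / r - artanh (zA e) / r \<ge> 0"
proof -
  have D: "((\<lambda>v. artanh (zA v) / r - artanh (zB v) / r) has_field_derivative (1 / ((1 - v\<^sup>2) * sqrt (a + b * v\<^sup>2)) - v / ((1 - v\<^sup>2) * sqrt (a * v\<^sup>2 + b)))) (at v)"
    if "e \<le> v" "v < 1" for v
    using that assms by (intro DERIV_diff artanh_zA_deriv artanh_zB_deriv) auto
  have 1: "((\<lambda>v. artanh (zA v) / r - artanh (zB v) / r) \<longlongrightarrow> artanh (zA e) / r - artanh (zB e) / r) (at_right e)"
    using DERIV_isCont[OF D[of e]] assms by (auto simp: isCont_def filterlim_at_split)
  have c: "isCont (\<lambda>v. 1 / ((1 - v\<^sup>2) * sqrt (a + b * v\<^sup>2)) - v / ((1 - v\<^sup>2) * sqrt (a * v\<^sup>2 + b))) v" if "e < v" "v < 1" for v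
    using one_minus_square_pos[of v] radicand_A_pos[of v] radicand_B_pos[of v] that assms by (intro continuous_intros) auto
  have n: "0 \<le> 1 / ((1 - v\<^sup>2) * sqrt (a + b * v\<^sup>2)) - v / ((1 - v\<^sup>2) * sqrt (a * v\<^sup>2 + b))" if v: "e < v" "v < 1" for v
  proof -
    have v0: "0 < v" using v assms by linarith
    \<comment> \<open>The right side minus the left side is b (1 - v^4).\<close>
    have "v\<^sup>2 * (a + b * v\<^sup>2) \<le> a * v\<^sup>2 + b"
    proof -
      have "v ^ 4 \<le> 1" using v v0 by (simp add: power_le_one)
      then have "b * v ^ 4 \<le> b * 1" using ab by (intro mult_left_mono) auto
      then show ?thesis by (simp add: algebra_simps power2_eq_square power4_eq_xxxx)
    qed
    then have "sqrt (v\<^sup>2 * (a + b * v\<^sup>2)) \<le> sqrt (a * v\<^sup>2 + b)" by simp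
    then have le: "v * sqrt (a + b * v\<^sup>2) \<le> sqrt (a * v\<^sup>2 + b)" using v0 by (simp add: real_sqrt_mult)
    have "v / sqrt (a * v\<^sup>2 + b) \<le> 1 / sqrt (a + b * v\<^sup>2)"
      using le radicand_A_pos[of v] radicand_B_pos[of v] by (simp add: divide_simps mult_ac)
    then have "(v / sqrt (a * v\<^sup>2 + b)) / (1 - v\<^sup>2) \<le> (1 / sqrt (a + b * v\<^sup>2)) / (1 - v\<^sup>2)"
      using one_minus_square_pos[of v] v v0 by (intro divide_right_mono) auto
    then show ?thesis by (simp add: mult.commute)
  qed
  note nn_integral_FTC_Ioo[OF assms(2) D c n 1 artanh_diff_tendsto]
  from this[OF _ _ _ _ ] show "(\<integral>\<^sup>+v\<in>{e<..<1}. ennreal (1 / ((1 - v\<^sup>2) * sqrt (a + b * v\<^sup>2)) - v / ((1 - v\<^sup>2) * sqrt (a * v\<^sup>2 + b))) \<partial>lborel) = ennreal (artanh (zB e) / r - artanh (zA e) / r)"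
    "artanh (zB e) / r - artanh (zA e) / r \<ge> 0" by auto
qed

end

text \<open>\<open>agm_inv y\<close> is the reciprocal of the arithmetic-geometric mean of \<open>1\<close> and \<open>y\<close>.\<close>

definition agm_inv :: "real \<Rightarrow> real" where
  "agm_inv y = enn2real (\<integral>\<^sup>+\<theta>\<in>{0<..<pi/2}. ennreal (2 / pi / sqrt (y\<^sup>2 * (cos \<theta>)\<^sup>2 + (sin \<theta>)\<^sup>2)) \<partial>lborel)"

lemma agm_radicand_ge_1:
  assumes "y \<ge> (1::real)"
  shows "y\<^sup>2 * (cos \<theta>)\<^sup>2 + (sin \<theta>)\<^sup>2 \<ge> 1"
proof -
  have "1 * (cos \<theta>)\<^sup>2 \<le> y\<^sup>2 * (cos \<theta>)\<^sup>2" using assms by (intro mult_right_mono) auto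
  then show ?thesis using sin_cos_squared_add[of \<theta>] by linarith
qed

text \<open>The integral must be finite before the \<open>enn2real\<close> in the definition can be
  undone; for y \<ge> 1 the integrand is at most 2/pi.\<close>

lemma agm_inv_nn_integral:
  assumes "y \<ge> 1"
  shows "ennreal (agm_inv y) = (\<integral>\<^sup>+\<theta>\<in>{0<..<pi/2}. ennreal (2 / pi / sqrt (y\<^sup>2 * (cos \<theta>)\<^sup>2 + (sin \<theta>)\<^sup>2)) \<partial>lborel)"
proof -
  have "(\<integral>\<^sup>+\<theta>\<in>{0<..<pi/2}. ennreal (2 / pi / sqrt (y\<^sup>2 * (cos \<theta>)\<^sup>2 + (sin \<theta>)\<^sup>2)) \<partial>lborel)
     \<le> (\<integral>\<^sup>+\<theta>\<in>{0<..<pi/2}. ennreal (2 / pi) \<partial>lborel)"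
  proof (intro nn_integral_mono mult_right_mono ennreal_leI)
    fix \<theta>
    have "sqrt (y\<^sup>2 * (cos \<theta>)\<^sup>2 + (sin \<theta>)\<^sup>2) \<ge> 1" using agm_radicand_ge_1[OF assms] by simp
    then show "2 / pi / sqrt (y\<^sup>2 * (cos \<theta>)\<^sup>2 + (sin \<theta>)\<^sup>2) \<le> 2 / pi"
      by (subst divide_le_eq) (auto simp: field_simps)
  qed auto
  also have "\<dots> = 1" by (simp add: nn_integral_cmult_indicator ennreal_mult[symmetric])
  finally have le: "(\<integral>\<^sup>+\<theta>\<in>{0<..<pi/2}. ennreal (2 / pi / sqrt (y\<^sup>2 * (cos \<theta>)\<^sup>2 + (sin \<theta>)\<^sup>2)) \<partial>lborel) \<le> 1" .
  then have "(\<integral>\<^sup>+\<theta>\<in>{0<..<pi/2}. ennreal (2 / pi / sqrt (y\<^sup>2 * (cos \<theta>)\<^sup>2 + (sin \<theta>)\<^sup>2)) \<partial>lborel) < \<top>"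
    using ennreal_one_less_top le_less_trans by blast
  then show "ennreal (agm_inv y) = (\<integral>\<^sup>+\<theta>\<in>{0<..<pi/2}. ennreal (2 / pi / sqrt (y\<^sup>2 * (cos \<theta>)\<^sup>2 + (sin \<theta>)\<^sup>2)) \<partial>lborel)"
    unfolding agm_inv_def by simp
qed

lemma agm_inv_nonneg: "agm_inv y \<ge> 0"
  by (simp add: agm_inv_def)

lemma agm_inv_measurable [measurable]: "agm_inv \<in> borel_measurable borel"
  unfolding agm_inv_def by measurable

text \<open>Adding to \<open>e\<^bsup>-2Xv\<^esup> v\<^bsup>2N\<^esup> / (1 - v\<^sup>2)\<close> its pullback under \<open>v \<mapsto> 1/v\<close> removes the pole at \<open>1\<close>, so the
  principal value over the half-line becomes an ordinary integral over \<open>(0, 1)\<close>; its integrand is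
  nonnegative when \<open>N \<le> X\<close>.\<close>

definition pv_integrand :: "nat \<Rightarrow> real \<Rightarrow> real \<Rightarrow> real" where
  "pv_integrand N X v = (exp (- 2 * X * v) * v ^ (2 * N) - exp (- 2 * X / v) / v ^ (2 * N)) / (1 - v\<^sup>2)"

lemma pv_integrand_measurable [measurable (raw)]:
  assumes [measurable]: "f \<in> borel_measurable M" "g \<in> borel_measurable M"
  shows "(\<lambda>z. pv_integrand N (f z) (g z)) \<in> borel_measurable M"
  unfolding pv_integrand_def by measurable

text \<open>Writing v = e^(-t) turns the claim into p t \<le> Y sinh t, which follows from t \<le>
  sinh t. This is the source of all positivity of folded integrands.\<close>

lemma reflected_exp_powr_le:
  fixes v Y p :: real
  assumes "0 < v" "v \<le> 1" "p \<le> Y" "0 \<le> Y"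
  shows "exp (- Y / v) * v powr (- p) \<le> exp (- Y * v) * v powr p"
proof -
  define t where "t = - ln v"
  have t: "t \<ge> 0" "v = exp (- t)" using assms by (auto simp: t_def)
  have "2 * t \<le> exp t - exp (- t)"
    using real_le_x_sinh[OF t(1)] by (simp add: exp_minus)
  then have "Y * (2 * t) \<le> Y * (exp t - exp (- t))" using assms by (intro mult_left_mono) auto
  moreover have "p * (2 * t) \<le> Y * (2 * t)" using assms t by (intro mult_right_mono) auto
  ultimately have "- Y * exp t + p * t \<le> - Y * exp (- t) - p * t" by (simp add: algebra_simps)
  then have "exp (- Y * exp t + p * t) \<le> exp (- Y * exp (- t) - p * t)" by simp
  then show ?thesis
    unfolding t(2) by (simp add: powr_def exp_add exp_diff exp_minus divide_inverse mult_ac flip: exp_minus)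
qed

lemma pv_integrand_nonneg:
  assumes "real N \<le> X" "0 < v" "v < 1"
  shows "pv_integrand N X v \<ge> 0"
proof -
  have "exp (- (2 * X) / v) * v powr (- (2 * real N)) \<le> exp (- (2 * X) * v) * v powr (2 * real N)"
    by (rule reflected_exp_powr_le) (use assms in auto)
  moreover have "v powr (2 * real N) = v ^ (2 * N)" using assms by (simp flip: powr_realpow)
  ultimately have "exp (- 2 * X / v) / v ^ (2 * N) \<le> exp (- 2 * X * v) * v ^ (2 * N)"
    using assms by (simp add: powr_minus divide_inverse)
  moreover have "1 - v\<^sup>2 > 0" using assms by (simp add: power_less_one_iff)
  ultimately show ?thesis by (simp add: pv_integrand_def)
qed

section \<open>The folded principal value in the Laplace variable\<close>

text \<open>Applied with w = v and with w = 1/v, the scaling u = y w brings the two different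
  exponentials of the folded integrand to the common factor e^(-2xu).\<close>

lemma scaled_laplace:
  fixes w c s :: real
  assumes "w > 0" "c > 0" "s > 0"
  shows "(\<integral>\<^sup>+y\<in>{1<..}. ennreal (exp (- 2 * x * y * w) / sqrt (y\<^sup>2 * c\<^sup>2 + s\<^sup>2)) \<partial>lborel)
     = (\<integral>\<^sup>+u\<in>{w<..}. ennreal (exp (- 2 * x * u) / sqrt (u\<^sup>2 * c\<^sup>2 + w\<^sup>2 * s\<^sup>2)) \<partial>lborel)"
proof -
  have im: "(\<lambda>y. y * w) ` {1<..} = {w<..}"
  proof (intro set_eqI iffI)
    fix u assume "u \<in> {w<..}"
    then show "u \<in> (\<lambda>y. y * w) ` {1<..}" using assms by (intro image_eqI[of _ _ "u / w"]) auto
  qed (use assms in auto)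
  let ?f = "\<lambda>u. exp (- 2 * x * u) / sqrt (u\<^sup>2 * c\<^sup>2 + w\<^sup>2 * s\<^sup>2)"
  have "(\<integral>\<^sup>+y\<in>{1<..}. ennreal (\<bar>w\<bar> * ?f (y * w)) \<partial>lborel) = (\<integral>\<^sup>+u\<in>(\<lambda>y. y * w) ` {1<..}. ennreal (?f u) \<partial>lborel)"
  proof (rule nn_integral_substitution_inj[where f="?f" and g="\<lambda>y. y * w" and g'="\<lambda>_. w"])
    show "(\<lambda>y. y * w) ` {1<..} \<in> sets borel" unfolding im by simp
  qed (use assms in \<open>auto intro!: derivative_eq_intros inj_onI\<close>)
  moreover have "\<bar>w\<bar> * ?f (y * w) = exp (- 2 * x * y * w) / sqrt (y\<^sup>2 * c\<^sup>2 + s\<^sup>2)" for y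
  proof -
    have "(y * w)\<^sup>2 * c\<^sup>2 + w\<^sup>2 * s\<^sup>2 = w\<^sup>2 * (y\<^sup>2 * c\<^sup>2 + s\<^sup>2)" by (simp add: power_mult_distrib algebra_simps)
    then have "sqrt ((y * w)\<^sup>2 * c\<^sup>2 + w\<^sup>2 * s\<^sup>2) = w * sqrt (y\<^sup>2 * c\<^sup>2 + s\<^sup>2)" using assms by (simp add: real_sqrt_mult)
    then show ?thesis using assms by (simp add: mult_ac)
  qed
  ultimately show ?thesis unfolding im by simp
qed

text \<open>The two terms come from the two exponentials by \<open>u = y v\<close> and \<open>u = y / v\<close>.\<close>

definition pv_kern :: "real \<Rightarrow> real \<Rightarrow> real \<Rightarrow> real" where
  "pv_kern v \<theta> u = indicator {v<..} u / sqrt (u\<^sup>2 * (cos \<theta>)\<^sup>2 + v\<^sup>2 * (sin \<theta>)\<^sup>2)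
      - indicator {1/v<..} u / sqrt (u\<^sup>2 * (cos \<theta>)\<^sup>2 + (1/v)\<^sup>2 * (sin \<theta>)\<^sup>2)"

lemma pv_kern_measurable [measurable (raw)]:
  assumes [measurable]: "f \<in> borel_measurable M" "g \<in> borel_measurable M" "h \<in> borel_measurable M"
  shows "(\<lambda>z. pv_kern (f z) (g z) (h z)) \<in> borel_measurable M"
  unfolding pv_kern_def indicator_def greaterThan_iff by measurable

lemma pv_kern_laplace:
  assumes "x > 0" "0 < v" "v < 1" "0 < \<theta>" "\<theta> < pi / 2"
  shows "(\<integral>\<^sup>+y\<in>{1<..}. ennreal ((exp (- 2 * x * y * v) - exp (- 2 * x * y / v)) / sqrt (y\<^sup>2 * (cos \<theta>)\<^sup>2 + (sin \<theta>)\<^sup>2)) \<partial>lborel)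
      = (\<integral>\<^sup>+u\<in>{0<..}. ennreal (exp (- 2 * x * u) * pv_kern v \<theta> u) \<partial>lborel)"
proof -
  define c s where "c = cos \<theta>" and "s = sin \<theta>"
  have cs: "c > 0" "s > 0" using assms by (auto simp: c_def s_def intro!: cos_gt_zero sin_gt_zero2)
  have v1: "v < 1 / v"
  proof -
    have "v * v < 1 * 1" using assms by (intro mult_strict_mono) auto
    then show ?thesis using assms by (simp add: field_simps)
  qed
  define h where "h = (\<lambda>w u. exp (- 2 * x * u) * (indicator {w<..} u / sqrt (u\<^sup>2 * c\<^sup>2 + w\<^sup>2 * s\<^sup>2)))"
  define h' where "h' = (\<lambda>w y. exp (- 2 * x * y * w) / sqrt (y\<^sup>2 * c\<^sup>2 + s\<^sup>2))"
  have [measurable]: "h w \<in> borel_measurable borel" "h' w \<in> borel_measurable borel" for w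
    unfolding h_def h'_def by measurable
  have hh: "(\<integral>\<^sup>+y\<in>{1<..}. ennreal (h' w y) \<partial>lborel) = (\<integral>\<^sup>+u. ennreal (h w u) \<partial>lborel)" if "w > 0" for w
    unfolding h'_def scaled_laplace[OF that cs, of x]
    by (intro nn_integral_cong) (auto simp: h_def indicator_def)
  \<comment> \<open>Subtraction of extended numbers is truncated, so splitting the integral of a
    difference needs the subtracted integral to be finite.\<close>
  have fin: "(\<integral>\<^sup>+y\<in>{1<..}. ennreal (h' w y) \<partial>lborel) < \<top>" if "w > 0" for w
  proof -
    have "(\<integral>\<^sup>+y\<in>{1<..}. ennreal (h' w y) \<partial>lborel) \<le> (\<integral>\<^sup>+y\<in>{1..}. ennreal (exp (- (2 * x * w) * y)) \<partial>lborel)"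
    proof (rule nn_integral_mono)
      fix y :: real
      show "ennreal (h' w y) * indicator {1<..} y \<le> ennreal (exp (- (2 * x * w) * y)) * indicator {1..} y"
      proof (cases "y > 1")
        case True
        have "sqrt (y\<^sup>2 * c\<^sup>2 + s\<^sup>2) \<ge> 1" using agm_radicand_ge_1[of y \<theta>] True by (simp add: c_def s_def)
        then have "h' w y \<le> exp (- (2 * x * w) * y)"
          unfolding h'_def by (subst divide_le_eq) (auto simp: mult_ac)
        then show ?thesis using True by (simp add: ennreal_leI)
      qed simp
    qed
    also have "\<dots> = ennreal (exp (- (2 * x * w) * 1) / (2 * x * w))"
      using assms that has_integral_exp_minus_to_infinity[of "2 * x * w" 1]
      by (intro nn_integral_has_integral_on) auto
    also have "\<dots> < \<top>" by simp
    finally show ?thesis .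
  qed
  have "(\<integral>\<^sup>+y\<in>{1<..}. ennreal ((exp (- 2 * x * y * v) - exp (- 2 * x * y / v)) / sqrt (y\<^sup>2 * c\<^sup>2 + s\<^sup>2)) \<partial>lborel)
     = (\<integral>\<^sup>+y. ennreal (h' v y) * indicator {1<..} y - ennreal (h' (1/v) y) * indicator {1<..} y \<partial>lborel)"
    using cs by (intro nn_integral_cong) (auto simp: h'_def indicator_def ennreal_minus diff_divide_distrib)
  also have "\<dots> = (\<integral>\<^sup>+y\<in>{1<..}. ennreal (h' v y) \<partial>lborel) - (\<integral>\<^sup>+y\<in>{1<..}. ennreal (h' (1/v) y) \<partial>lborel)"
  proof (rule nn_integral_diff)
    have "h' (1/v) y \<le> h' v y" if "y > 1" for y
    proof -
      have "2 * x * y * v \<le> 2 * x * y * (1 / v)" using v1 assms that by (intro mult_left_mono) auto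
      then show ?thesis unfolding h'_def by (intro divide_right_mono) auto
    qed
    then show "AE y in lborel. ennreal (h' (1/v) y) * indicator {1<..} y \<le> ennreal (h' v y) * indicator {1<..} y"
      by (intro AE_I2) (auto simp: indicator_def ennreal_leI)
  qed (use fin[of "1/v"] assms in auto)
  also have "\<dots> = (\<integral>\<^sup>+u. ennreal (h v u) \<partial>lborel) - (\<integral>\<^sup>+u. ennreal (h (1/v) u) \<partial>lborel)"
    using hh assms by simp
  also have "\<dots> = (\<integral>\<^sup>+u. ennreal (h v u) - ennreal (h (1/v) u) \<partial>lborel)"
  proof (rule nn_integral_diff[symmetric])
    have "h (1/v) u \<le> h v u" for u
    proof (cases "u > 1 / v")
      case True
      have "v\<^sup>2 * s\<^sup>2 \<le> (1/v)\<^sup>2 * s\<^sup>2" using v1 assms by (intro mult_right_mono power_mono) auto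
      then have "sqrt (u\<^sup>2 * c\<^sup>2 + v\<^sup>2 * s\<^sup>2) \<le> sqrt (u\<^sup>2 * c\<^sup>2 + (1/v)\<^sup>2 * s\<^sup>2)" by (intro real_sqrt_le_mono add_left_mono)
      moreover have "sqrt (u\<^sup>2 * c\<^sup>2 + v\<^sup>2 * s\<^sup>2) > 0" using cs assms by (intro iffD2[OF real_sqrt_gt_0_iff] add_nonneg_pos mult_pos_pos) auto
      ultimately have "1 / sqrt (u\<^sup>2 * c\<^sup>2 + (1/v)\<^sup>2 * s\<^sup>2) \<le> 1 / sqrt (u\<^sup>2 * c\<^sup>2 + v\<^sup>2 * s\<^sup>2)"
        by (intro divide_left_mono) auto
      then have "exp (- 2 * x * u) * (1 / sqrt (u\<^sup>2 * c\<^sup>2 + (1/v)\<^sup>2 * s\<^sup>2)) \<le> exp (- 2 * x * u) * (1 / sqrt (u\<^sup>2 * c\<^sup>2 + v\<^sup>2 * s\<^sup>2))"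
        by (intro mult_left_mono) auto
      moreover have "u > v" using True v1 by linarith
      ultimately show ?thesis using True by (simp add: h_def)
    next
      case False
      then show ?thesis by (auto simp: h_def indicator_def)
    qed
    then show "AE u in lborel. ennreal (h (1/v) u) \<le> ennreal (h v u)" by (intro AE_I2) (auto intro!: ennreal_leI)
  qed (use hh[of "1/v"] fin[of "1/v"] assms in auto)
  also have "\<dots> = (\<integral>\<^sup>+u\<in>{0<..}. ennreal (exp (- 2 * x * u) * pv_kern v \<theta> u) \<partial>lborel)"
  proof (rule nn_integral_cong)
    fix u
    have "h (1/v) u \<ge> 0" by (auto simp: h_def)
    then have "ennreal (h v u) - ennreal (h (1/v) u) = ennreal (h v u - h (1/v) u)" by (rule ennreal_minus)
    also have "h v u - h (1/v) u = exp (- 2 * x * u) * pv_kern v \<theta> u"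
      by (simp add: h_def pv_kern_def c_def s_def right_diff_distrib)
    finally have "ennreal (h v u) - ennreal (h (1/v) u) = ennreal (exp (- 2 * x * u) * pv_kern v \<theta> u)" .
    moreover have "pv_kern v \<theta> u = 0" if "u \<le> 0"
    proof -
      have "\<not> v < u" "\<not> 1 / v < u" using that assms v1 by linarith+
      then show ?thesis by (simp add: pv_kern_def)
    qed
    ultimately show "ennreal (h v u) - ennreal (h (1/v) u) = ennreal (exp (- 2 * x * u) * pv_kern v \<theta> u) * indicator {0<..} u"
      by (cases "u > 0") auto
  qed
  finally show ?thesis by (simp only: c_def s_def)
qed

text \<open>The indicators in \<open>pv_kern\<close> decide the range. For u < 1 only the first term
  survives, on v < u; for u > 1 the first term lives on the whole interval and the second on v >
  1/u. At these cut points the antiderivatives collapse, since \<open>zA\<close> takes the value r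
  at u and \<open>zB\<close> the value 1/r at 1/u. The resulting artanh is written as an integral
  over t so that \<open>elliptic_double_integral\<close> applies.\<close>

lemma pv_kern_integral:
  assumes u: "u > 0" "u \<noteq> 1" and \<theta>: "0 < \<theta>" "\<theta> < pi / 2"
  shows "(\<integral>\<^sup>+v\<in>{0<..<1}. ennreal (pv_kern v \<theta> u / (1 - v\<^sup>2)) \<partial>lborel)
     = (\<integral>\<^sup>+t\<in>{0<..<1}. ennreal (1 / ((max 1 (u\<^sup>2) - min 1 (u\<^sup>2) * t\<^sup>2) * (cos \<theta>)\<^sup>2 + (1 - t\<^sup>2) * (sin \<theta>)\<^sup>2)) \<partial>lborel)"
proof -
  define c s where "c = cos \<theta>" and "s = sin \<theta>"
  have cs: "c > 0" "s > 0" "s\<^sup>2 = 1 - c\<^sup>2" using \<theta> by (auto simp: c_def s_def sin_squared_eq intro!: cos_gt_zero sin_gt_zero2)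
  define r where "r = sqrt (u\<^sup>2 * c\<^sup>2 + s\<^sup>2)"
  interpret K: pv_kernel "u\<^sup>2 * c\<^sup>2" "s\<^sup>2" r
    by unfold_locales (use u cs(1,2) in \<open>auto simp: r_def\<close>)
  have r2: "r\<^sup>2 = 1 - (1 - u\<^sup>2) * c\<^sup>2" using K.r_square cs by (simp add: algebra_simps)
  show ?thesis
  proof (cases "u < 1")
    case True
    have u2: "u\<^sup>2 < 1" using True u by (simp add: power_less_one_iff)
    have "0 < (1 - u\<^sup>2) * c\<^sup>2" using u2 cs by simp
    then have "r\<^sup>2 < 1" using r2 by linarith
    then have r1: "r < 1" using K.r_pos by (simp add: power_less_one_iff)
    have "sqrt (u\<^sup>2 * c\<^sup>2 + s\<^sup>2 * u\<^sup>2) = u"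
    proof -
      have "u\<^sup>2 * c\<^sup>2 + s\<^sup>2 * u\<^sup>2 = u\<^sup>2" unfolding cs(3) by (simp add: algebra_simps)
      then show ?thesis using u by simp
    qed
    then have zA: "K.zA u = r" using u by (simp add: K.zA_def)
    have "(\<integral>\<^sup>+v\<in>{0<..<1}. ennreal (pv_kern v \<theta> u / (1 - v\<^sup>2)) \<partial>lborel)
      = (\<integral>\<^sup>+v\<in>{0<..<u}. ennreal (1 / ((1 - v\<^sup>2) * sqrt (u\<^sup>2 * c\<^sup>2 + s\<^sup>2 * v\<^sup>2))) \<partial>lborel)"
    proof (rule nn_integral_cong)
      fix v :: real
      have "\<not> 1 / v < u" if "0 < v" "v < 1"
      proof -
        have "1 < 1 / v" using that by simp
        then show ?thesis using True by linarith
      qed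
      then show "ennreal (pv_kern v \<theta> u / (1 - v\<^sup>2)) * indicator {0<..<1} v = ennreal (1 / ((1 - v\<^sup>2) * sqrt (u\<^sup>2 * c\<^sup>2 + s\<^sup>2 * v\<^sup>2))) * indicator {0<..<u} v"
        using True by (auto simp: indicator_def pv_kern_def c_def s_def mult_ac)
    qed
    also have "\<dots> = ennreal (artanh r / r)"
      using K.nn_integral_A(1)[of u] u True zA by simp
    also have "\<dots> = (\<integral>\<^sup>+t\<in>{0<..<1}. ennreal (1 / (1\<^sup>2 - r\<^sup>2 * t\<^sup>2)) \<partial>lborel)"
      using nn_integral_artanh[of r 1] K.r_pos r1 by simp
    also have "\<dots> = (\<integral>\<^sup>+t\<in>{0<..<1}. ennreal (1 / ((max 1 (u\<^sup>2) - min 1 (u\<^sup>2) * t\<^sup>2) * c\<^sup>2 + (1 - t\<^sup>2) * s\<^sup>2)) \<partial>lborel)"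
    proof -
      have "1\<^sup>2 - r\<^sup>2 * t\<^sup>2 = (max 1 (u\<^sup>2) - min 1 (u\<^sup>2) * t\<^sup>2) * c\<^sup>2 + (1 - t\<^sup>2) * s\<^sup>2" for t
        unfolding r2 cs(3) using u2 by (simp add: max_def min_def algebra_simps)
      then show ?thesis by simp
    qed
    finally show ?thesis by (simp only: c_def s_def)
  next
    case False
    then have u1: "u > 1" using u by simp
    have u2: "u\<^sup>2 > 1" using u1 by simp
    have "0 < (u\<^sup>2 - 1) * c\<^sup>2" using u2 cs by simp
    then have "r\<^sup>2 > 1" using r2 by (simp add: algebra_simps)
    then have r1: "r > 1" using K.r_pos by (metis less_le_not_le linorder_not_less power_le_one)
    have e: "0 < 1 / u" "1 / u < 1" using u1 by auto
    have zB: "K.zB (1 / u) = 1 / r"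
    proof -
      have "u\<^sup>2 * c\<^sup>2 * (1 / u)\<^sup>2 + s\<^sup>2 = 1" unfolding cs(3) using u by (simp add: power_divide)
      then show ?thesis by (simp add: K.zB_def)
    qed
    \<comment> \<open>The range is split at v = 1/u, where the second term switches on. Beyond that
      point only the difference of the two terms is integrable up to 1.\<close>
    have "(\<integral>\<^sup>+v\<in>{0<..<1}. ennreal (pv_kern v \<theta> u / (1 - v\<^sup>2)) \<partial>lborel)
      = (\<integral>\<^sup>+v. ennreal (1 / ((1 - v\<^sup>2) * sqrt (u\<^sup>2 * c\<^sup>2 + s\<^sup>2 * v\<^sup>2))) * indicator {0<..<1/u} v
          + ennreal (1 / ((1 - v\<^sup>2) * sqrt (u\<^sup>2 * c\<^sup>2 + s\<^sup>2 * v\<^sup>2)) - v / ((1 - v\<^sup>2) * sqrt (u\<^sup>2 * c\<^sup>2 * v\<^sup>2 + s\<^sup>2))) * indicator {1/u<..<1} v \<partial>lborel)"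
    proof (rule nn_integral_cong_except[of "1/u"])
      fix v :: real assume v: "v \<noteq> 1 / u"
      have k1: "pv_kern v \<theta> u / (1 - v\<^sup>2) = 1 / ((1 - v\<^sup>2) * sqrt (u\<^sup>2 * c\<^sup>2 + s\<^sup>2 * v\<^sup>2))" if "0 < v" "v < 1 / u"
      proof -
        have "v < u" using that e u1 by linarith
        moreover have "u < 1 / v" using that u by (simp add: field_simps)
        ultimately show ?thesis by (simp add: pv_kern_def c_def s_def mult_ac)
      qed
      have k2: "pv_kern v \<theta> u / (1 - v\<^sup>2) = 1 / ((1 - v\<^sup>2) * sqrt (u\<^sup>2 * c\<^sup>2 + s\<^sup>2 * v\<^sup>2)) - v / ((1 - v\<^sup>2) * sqrt (u\<^sup>2 * c\<^sup>2 * v\<^sup>2 + s\<^sup>2))" if "1 / u < v" "v < 1"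
      proof -
        have v0: "v > 0" using that e by linarith
        have "v < u" using that u1 by linarith
        moreover have "1 / v < u" using that u v0 by (simp add: field_simps)
        moreover have "u\<^sup>2 * c\<^sup>2 + (1/v)\<^sup>2 * s\<^sup>2 = (u\<^sup>2 * c\<^sup>2 * v\<^sup>2 + s\<^sup>2) / v\<^sup>2" using v0 by (simp add: field_simps)
        then have "sqrt (u\<^sup>2 * c\<^sup>2 + (1/v)\<^sup>2 * s\<^sup>2) = sqrt (u\<^sup>2 * c\<^sup>2 * v\<^sup>2 + s\<^sup>2) / v" using v0 by (simp add: real_sqrt_divide)
        ultimately show ?thesis by (simp add: pv_kern_def c_def[symmetric] s_def[symmetric] diff_divide_distrib mult_ac)
      qed
      show "ennreal (pv_kern v \<theta> u / (1 - v\<^sup>2)) * indicator {0<..<1} v = ennreal (1 / ((1 - v\<^sup>2) * sqrt (u\<^sup>2 * c\<^sup>2 + s\<^sup>2 * v\<^sup>2))) * indicator {0<..<1/u} v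
          + ennreal (1 / ((1 - v\<^sup>2) * sqrt (u\<^sup>2 * c\<^sup>2 + s\<^sup>2 * v\<^sup>2)) - v / ((1 - v\<^sup>2) * sqrt (u\<^sup>2 * c\<^sup>2 * v\<^sup>2 + s\<^sup>2))) * indicator {1/u<..<1} v"
        (is "?L = ?A + ?B")
      proof -
        consider "v \<le> 0" | "0 < v" "v < 1 / u" | "1 / u < v" "v < 1" | "1 \<le> v" using v by linarith
        then show ?thesis
        proof cases
          case 1
          then have "v \<notin> {0<..<1}" "v \<notin> {0<..<1/u}" "v \<notin> {1/u<..<1}" using e unfolding greaterThanLessThan_iff by arith+
          then show ?thesis by (simp only: indicator_def simp_thms of_bool_eq mult_zero_right mult_1_right add_0 add_0_right)
        next
          case 2
          then have "v \<in> {0<..<1}" "v \<in> {0<..<1/u}" "v \<notin> {1/u<..<1}" using e unfolding greaterThanLessThan_iff by arith+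
          then show ?thesis using k1[OF 2] by (simp only: indicator_def simp_thms of_bool_eq mult_zero_right mult_1_right add_0 add_0_right)
        next
          case 3
          then have "v \<in> {0<..<1}" "v \<notin> {0<..<1/u}" "v \<in> {1/u<..<1}" using e unfolding greaterThanLessThan_iff by arith+
          then show ?thesis using k2[OF 3] by (simp only: indicator_def simp_thms of_bool_eq mult_zero_right mult_1_right add_0 add_0_right)
        next
          case 4
          then have "v \<notin> {0<..<1}" "v \<notin> {0<..<1/u}" "v \<notin> {1/u<..<1}" using e unfolding greaterThanLessThan_iff by arith+
          then show ?thesis by (simp only: indicator_def simp_thms of_bool_eq mult_zero_right mult_1_right add_0 add_0_right)
        qed
      qed
    qed
    also have "\<dots> = ennreal (artanh (K.zA (1/u)) / r) + ennreal (artanh (K.zB (1/u)) / r - artanh (K.zA (1/u)) / r)"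
      by (subst nn_integral_add) (auto simp: K.nn_integral_A(1)[OF e] K.nn_integral_A_minus_B(1)[OF e])
    also have "\<dots> = ennreal (artanh (1 / r) / r)"
      using K.nn_integral_A(2)[OF e] K.nn_integral_A_minus_B(2)[OF e] unfolding zB by (subst ennreal_plus[symmetric]) auto
    also have "\<dots> = (\<integral>\<^sup>+t\<in>{0<..<1}. ennreal (1 / (r\<^sup>2 - 1\<^sup>2 * t\<^sup>2)) \<partial>lborel)"
      using nn_integral_artanh[of 1 r] r1 by simp
    also have "\<dots> = (\<integral>\<^sup>+t\<in>{0<..<1}. ennreal (1 / ((max 1 (u\<^sup>2) - min 1 (u\<^sup>2) * t\<^sup>2) * c\<^sup>2 + (1 - t\<^sup>2) * s\<^sup>2)) \<partial>lborel)"
    proof -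
      have "r\<^sup>2 - 1\<^sup>2 * t\<^sup>2 = (max 1 (u\<^sup>2) - min 1 (u\<^sup>2) * t\<^sup>2) * c\<^sup>2 + (1 - t\<^sup>2) * s\<^sup>2" for t
        unfolding r2 cs(3) using u2 by (simp add: max_def min_def algebra_simps)
      then show ?thesis by simp
    qed
    finally show ?thesis by (simp only: c_def s_def)
  qed
qed

text \<open>In terms of the complete elliptic integral \<open>K\<close> of modulus \<open>k\<close>, this is \<open>K(u)\<close> for \<open>u < 1\<close> and
  \<open>K(1/u) / u\<close> for \<open>u > 1\<close>.\<close>

definition elliptic_J :: "real \<Rightarrow> ennreal" where
  "elliptic_J u = (\<integral>\<^sup>+\<psi>\<in>{0<..<pi/2}. ennreal (1 / sqrt (max 1 (u\<^sup>2) - min 1 (u\<^sup>2) * (sin \<psi>)\<^sup>2)) \<partial>lborel)"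

lemma nn_integral_half_pi:
  fixes f :: "real \<Rightarrow> real"
  assumes [measurable]: "f \<in> borel_measurable borel" and "\<And>u. f u \<ge> 0" "\<And>u. f (pi - u) = f u"
  shows "(\<integral>\<^sup>+\<psi>\<in>{0<..<pi}. ennreal (f \<psi>) \<partial>lborel) = 2 * (\<integral>\<^sup>+\<psi>\<in>{0<..<pi/2}. ennreal (f \<psi>) \<partial>lborel)"
proof -
  have "(\<integral>\<^sup>+\<psi>\<in>{0<..<pi}. ennreal (f \<psi>) \<partial>lborel) = (\<integral>\<^sup>+\<psi>. ennreal (f \<psi>) * indicator {0<..<pi/2} \<psi> + ennreal (f \<psi>) * indicator {pi/2<..<pi} \<psi> \<partial>lborel)"
  proof (rule nn_integral_cong_except[of "pi/2"])
    fix \<psi> :: real assume n: "\<psi> \<noteq> pi / 2"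
    consider "\<psi> \<in> {0<..<pi/2}" | "\<psi> \<in> {pi/2<..<pi}" | "\<psi> \<notin> {0<..<pi}" using n by fastforce
    then show "ennreal (f \<psi>) * indicator {0<..<pi} \<psi> = ennreal (f \<psi>) * indicator {0<..<pi/2} \<psi> + ennreal (f \<psi>) * indicator {pi/2<..<pi} \<psi>"
      by cases (auto simp: indicator_def)
  qed
  also have "\<dots> = (\<integral>\<^sup>+\<psi>\<in>{0<..<pi/2}. ennreal (f \<psi>) \<partial>lborel) + (\<integral>\<^sup>+\<psi>\<in>{pi/2<..<pi}. ennreal (f \<psi>) \<partial>lborel)"
    by (rule nn_integral_add) auto
  also have "(\<integral>\<^sup>+\<psi>\<in>{pi/2<..<pi}. ennreal (f \<psi>) \<partial>lborel) = (\<integral>\<^sup>+\<psi>\<in>{0<..<pi/2}. ennreal (f \<psi>) \<partial>lborel)"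
    using nn_integral_reflect_pi[of f 0 "pi/2"] assms by simp
  finally show ?thesis by (simp add: mult_2)
qed

lemma nn_set_integral_cmult:
  fixes c :: real
  assumes "0 \<le> c" "f \<in> borel_measurable borel" "S \<in> sets borel"
  shows "(\<integral>\<^sup>+x\<in>S. ennreal (c * f x) \<partial>lborel) = ennreal c * (\<integral>\<^sup>+x\<in>S. ennreal (f x) \<partial>lborel)"
proof -
  have "(\<integral>\<^sup>+x\<in>S. ennreal (c * f x) \<partial>lborel) = (\<integral>\<^sup>+x. ennreal c * (ennreal (f x) * indicator S x) \<partial>lborel)"
    using assms by (intro nn_integral_cong) (simp add: ennreal_mult' mult.assoc)
  also have "\<dots> = ennreal c * (\<integral>\<^sup>+x\<in>S. ennreal (f x) \<partial>lborel)"
    using assms by (intro nn_integral_cmult) auto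
  finally show ?thesis .
qed

text \<open>\<open>landen_substitution\<close> needs a modulus below 1. For u > 1 both sides are 1/u
  times their values at 1/u, which reduces to that case. The value u = 1, where the integrals
  diverge, is a null set for the later integration over u.\<close>

lemma elliptic_J_landen:
  assumes "u > 0" "u \<noteq> 1"
  shows "(\<integral>\<^sup>+\<beta>\<in>{0<..<pi}. ennreal (1 / pi / sqrt (1 + u\<^sup>2 + 2 * u * cos \<beta>)) \<partial>lborel) = ennreal (2 / pi) * elliptic_J u"
proof -
  have main: "(\<integral>\<^sup>+\<beta>\<in>{0<..<pi}. ennreal (1 / sqrt (1 + w\<^sup>2 + 2 * w * cos \<beta>)) \<partial>lborel)
     = 2 * (\<integral>\<^sup>+\<psi>\<in>{0<..<pi/2}. ennreal (1 / sqrt (1 - w\<^sup>2 * (sin \<psi>)\<^sup>2)) \<partial>lborel)" if w: "0 < w" "w < 1" for w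
  proof -
    have "1 - w\<^sup>2 * (sin \<psi>)\<^sup>2 \<ge> 0" for \<psi>
    proof -
      have "w\<^sup>2 * (sin \<psi>)\<^sup>2 \<le> 1 * 1" using w by (intro mult_mono) (auto simp: power_le_one abs_square_le_1)
      then show ?thesis by simp
    qed
    then show ?thesis unfolding landen_substitution[OF w] by (intro nn_integral_half_pi) auto
  qed
  have two: "ennreal (c * 2) = ennreal c * 2" if "c \<ge> 0" for c using that by (simp add: ennreal_mult)
  show ?thesis
  proof (cases "u < 1")
    case True
    then have "u\<^sup>2 < 1" using assms by (simp add: power_less_one_iff)
    then have J: "elliptic_J u = (\<integral>\<^sup>+\<psi>\<in>{0<..<pi/2}. ennreal (1 / sqrt (1 - u\<^sup>2 * (sin \<psi>)\<^sup>2)) \<partial>lborel)"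
      by (simp add: elliptic_J_def max_def min_def)
    have "(\<integral>\<^sup>+\<beta>\<in>{0<..<pi}. ennreal (1 / pi / sqrt (1 + u\<^sup>2 + 2 * u * cos \<beta>)) \<partial>lborel)
      = (\<integral>\<^sup>+\<beta>\<in>{0<..<pi}. ennreal (1 / pi * (1 / sqrt (1 + u\<^sup>2 + 2 * u * cos \<beta>))) \<partial>lborel)" by simp
    also have "\<dots> = ennreal (1 / pi) * (2 * elliptic_J u)"
      unfolding J main[OF assms(1) True, symmetric] by (rule nn_set_integral_cmult) auto
    finally show ?thesis using two[of "1 / pi"] by (simp add: mult.assoc)
  next
    case False
    define w where "w = 1 / u"
    have w: "0 < w" "w < 1" "u = 1 / w" using False assms by (auto simp: w_def)
    have "u\<^sup>2 > 1" using False assms by simp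
    then have "elliptic_J u = (\<integral>\<^sup>+\<psi>\<in>{0<..<pi/2}. ennreal (1 / sqrt (u\<^sup>2 - (sin \<psi>)\<^sup>2)) \<partial>lborel)"
      by (simp add: elliptic_J_def max_def min_def)
    also have "\<dots> = (\<integral>\<^sup>+\<psi>\<in>{0<..<pi/2}. ennreal (w * (1 / sqrt (1 - w\<^sup>2 * (sin \<psi>)\<^sup>2))) \<partial>lborel)"
    proof -
      have "u\<^sup>2 - (sin \<psi>)\<^sup>2 = (1 - w\<^sup>2 * (sin \<psi>)\<^sup>2) / w\<^sup>2" for \<psi>
        unfolding w(3) using w(1) by (simp add: power_divide field_simps)
      then have "1 / sqrt (u\<^sup>2 - (sin \<psi>)\<^sup>2) = w * (1 / sqrt (1 - w\<^sup>2 * (sin \<psi>)\<^sup>2))" for \<psi>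
        using w(1) by (simp add: real_sqrt_divide)
      then show ?thesis by simp
    qed
    also have "\<dots> = ennreal w * (\<integral>\<^sup>+\<psi>\<in>{0<..<pi/2}. ennreal (1 / sqrt (1 - w\<^sup>2 * (sin \<psi>)\<^sup>2)) \<partial>lborel)"
      using w by (intro nn_set_integral_cmult) auto
    finally have J: "elliptic_J u = ennreal w * (\<integral>\<^sup>+\<psi>\<in>{0<..<pi/2}. ennreal (1 / sqrt (1 - w\<^sup>2 * (sin \<psi>)\<^sup>2)) \<partial>lborel)" .
    have "(\<integral>\<^sup>+\<beta>\<in>{0<..<pi}. ennreal (1 / pi / sqrt (1 + u\<^sup>2 + 2 * u * cos \<beta>)) \<partial>lborel)
      = (\<integral>\<^sup>+\<beta>\<in>{0<..<pi}. ennreal (1 / pi * w * (1 / sqrt (1 + w\<^sup>2 + 2 * w * cos \<beta>))) \<partial>lborel)"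
    proof -
      have "1 + u\<^sup>2 + 2 * u * cos \<beta> = (1 + w\<^sup>2 + 2 * w * cos \<beta>) / w\<^sup>2" for \<beta>
        unfolding w(3) using w(1) by (simp add: power2_eq_square field_simps)
      then have "1 / pi / sqrt (1 + u\<^sup>2 + 2 * u * cos \<beta>) = 1 / pi * w * (1 / sqrt (1 + w\<^sup>2 + 2 * w * cos \<beta>))" for \<beta>
        using w(1) by (simp add: real_sqrt_divide)
      then show ?thesis by simp
    qed
    also have "\<dots> = ennreal (1 / pi * w) * (2 * (\<integral>\<^sup>+\<psi>\<in>{0<..<pi/2}. ennreal (1 / sqrt (1 - w\<^sup>2 * (sin \<psi>)\<^sup>2)) \<partial>lborel))"
      unfolding main[OF w(1,2), symmetric] using w by (intro nn_set_integral_cmult) auto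
    also have "ennreal (1 / pi * w) = ennreal (1 / pi) * ennreal w" by (rule ennreal_mult') simp
    finally show ?thesis unfolding J using two[of "1 / pi"] by (simp add: mult_ac)
  qed
qed

lemma bessel_product_laplace:
  assumes "x > 0"
  shows "ennreal (bessel_I0 x * bessel_K0 x) =
    (\<integral>\<^sup>+u\<in>{0<..}. ennreal (exp (- 2 * x * u)) * (ennreal (2 / pi) * elliptic_J u) \<partial>lborel)"
  unfolding bessel_product_laplace1[OF assms]
proof (rule nn_integral_cong_except[of 1])
  fix u :: real assume "u \<noteq> 1"
  then show "ennreal (exp (- 2 * x * u)) * (\<integral>\<^sup>+\<phi>\<in>{\<phi>\<in>{0<..<pi}. (1 - cos \<phi>) / 2 < u}. ennreal (2 / pi / sqrt ((2 * u + cos \<phi>)\<^sup>2 - 1)) \<partial>lborel) * indicator {0<..} u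
    = ennreal (exp (- 2 * x * u)) * (ennreal (2 / pi) * elliptic_J u) * indicator {0<..} u"
    using elliptic_substitution[of u] elliptic_J_landen[of u] by (cases "u > 0") simp_all
qed

text \<open>With \<open>agm_inv\<close> written as an integral over \<theta>, this is Tonelli in
  three variables. The y-integral is moved inside, where for fixed v and \<theta> it becomes an
  integral over u; then v is integrated out, then \<theta>. The factor 2/pi of
  \<open>agm_inv\<close> cancels against the pi/2 of
  \<open>elliptic_double_integral\<close>.\<close>

lemma pv_double_integral:
  assumes "x > 0"
  shows "(\<integral>\<^sup>+y\<in>{1<..}. ennreal (agm_inv y) * (\<integral>\<^sup>+v\<in>{0<..<1}. ennreal (pv_integrand 0 (x * y) v) \<partial>lborel) \<partial>lborel)
    = (\<integral>\<^sup>+u\<in>{0<..}. ennreal (exp (- 2 * x * u)) * elliptic_J u \<partial>lborel)"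
proof -
  define R where "R = (\<lambda>y \<theta>::real. sqrt (y\<^sup>2 * (cos \<theta>)\<^sup>2 + (sin \<theta>)\<^sup>2))"
  have [measurable (raw)]: "(\<lambda>z. R (f z) (g z)) \<in> borel_measurable M" if [measurable]: "f \<in> borel_measurable M" "g \<in> borel_measurable M" for f g M
    unfolding R_def by measurable
  define T where "T = (\<lambda>y v \<theta>. indicator {1<..} y * indicator {0<..<1} v * indicator {0<..<pi/2} \<theta> * ennreal (2 / pi / R y \<theta> * pv_integrand 0 (x * y) v))"
  define U where "U = (\<lambda>u v \<theta>. indicator {0<..} u * indicator {0<..<1} v * indicator {0<..<pi/2} \<theta> * ennreal (2 / pi * exp (- 2 * x * u) * (pv_kern v \<theta> u / (1 - v\<^sup>2))))"
  have [measurable (raw)]: "(\<lambda>z. T (f z) (g z) (h z)) \<in> borel_measurable M" "(\<lambda>z. U (f z) (g z) (h z)) \<in> borel_measurable M"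
    if [measurable]: "f \<in> borel_measurable M" "g \<in> borel_measurable M" "h \<in> borel_measurable M" for f g h M
    unfolding T_def U_def indicator_def greaterThan_iff greaterThanLessThan_iff by measurable
  have R0: "R y \<theta> \<ge> 0" for y \<theta> by (simp add: R_def)
  have "(\<integral>\<^sup>+y\<in>{1<..}. ennreal (agm_inv y) * (\<integral>\<^sup>+v\<in>{0<..<1}. ennreal (pv_integrand 0 (x * y) v) \<partial>lborel) \<partial>lborel)
    = (\<integral>\<^sup>+y. (\<integral>\<^sup>+v. (\<integral>\<^sup>+\<theta>. T y v \<theta> \<partial>lborel) \<partial>lborel) \<partial>lborel)"
  proof (rule nn_integral_cong)
    fix y :: real
    show "ennreal (agm_inv y) * (\<integral>\<^sup>+v\<in>{0<..<1}. ennreal (pv_integrand 0 (x * y) v) \<partial>lborel) * indicator {1<..} y = (\<integral>\<^sup>+v. (\<integral>\<^sup>+\<theta>. T y v \<theta> \<partial>lborel) \<partial>lborel)"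
    proof (cases "y > 1")
      case True
      have "(\<integral>\<^sup>+\<theta>. T y v \<theta> \<partial>lborel) = ennreal (agm_inv y) * (ennreal (pv_integrand 0 (x * y) v) * indicator {0<..<1} v)" for v
      proof -
        have "(\<integral>\<^sup>+\<theta>. T y v \<theta> \<partial>lborel) = (\<integral>\<^sup>+\<theta>. (ennreal (2 / pi / R y \<theta>) * indicator {0<..<pi/2} \<theta>) * (ennreal (pv_integrand 0 (x * y) v) * indicator {0<..<1} v) \<partial>lborel)"
        proof (rule nn_integral_cong)
          fix \<theta>
          have "ennreal (2 / pi / R y \<theta> * pv_integrand 0 (x * y) v) = ennreal (2 / pi / R y \<theta>) * ennreal (pv_integrand 0 (x * y) v)"
            using R0 by (intro ennreal_mult') auto
          then show "T y v \<theta> = (ennreal (2 / pi / R y \<theta>) * indicator {0<..<pi/2} \<theta>) * (ennreal (pv_integrand 0 (x * y) v) * indicator {0<..<1} v)"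
            using True by (simp add: T_def mult_ac del: times_divide_eq_left times_divide_eq_right)
        qed
        also have "\<dots> = (\<integral>\<^sup>+\<theta>. (ennreal (2 / pi / R y \<theta>) * indicator {0<..<pi/2} \<theta>) \<partial>lborel) * (ennreal (pv_integrand 0 (x * y) v) * indicator {0<..<1} v)"
          by (rule nn_integral_multc) measurable
        also have "(\<integral>\<^sup>+\<theta>. (ennreal (2 / pi / R y \<theta>) * indicator {0<..<pi/2} \<theta>) \<partial>lborel) = ennreal (agm_inv y)"
          using agm_inv_nn_integral[of y] True by (simp add: R_def)
        finally show ?thesis .
      qed
      then have "(\<integral>\<^sup>+v. (\<integral>\<^sup>+\<theta>. T y v \<theta> \<partial>lborel) \<partial>lborel) = (\<integral>\<^sup>+v. ennreal (agm_inv y) * (ennreal (pv_integrand 0 (x * y) v) * indicator {0<..<1} v) \<partial>lborel)" by simp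
      also have "\<dots> = ennreal (agm_inv y) * (\<integral>\<^sup>+v\<in>{0<..<1}. ennreal (pv_integrand 0 (x * y) v) \<partial>lborel)"
        by (rule nn_integral_cmult) measurable
      finally show ?thesis using True by simp
    qed (simp add: T_def)
  qed
  also have "\<dots> = (\<integral>\<^sup>+v. (\<integral>\<^sup>+y. (\<integral>\<^sup>+\<theta>. T y v \<theta> \<partial>lborel) \<partial>lborel) \<partial>lborel)"
    by (rule lborel_pair.Fubini') measurable
  also have "\<dots> = (\<integral>\<^sup>+v. (\<integral>\<^sup>+\<theta>. (\<integral>\<^sup>+y. T y v \<theta> \<partial>lborel) \<partial>lborel) \<partial>lborel)"
    by (rule nn_integral_cong, rule lborel_pair.Fubini') measurable
  also have "\<dots> = (\<integral>\<^sup>+v. (\<integral>\<^sup>+\<theta>. (\<integral>\<^sup>+u. U u v \<theta> \<partial>lborel) \<partial>lborel) \<partial>lborel)"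
  proof (rule nn_integral_cong, rule nn_integral_cong)
    fix v \<theta> :: real
    show "(\<integral>\<^sup>+y. T y v \<theta> \<partial>lborel) = (\<integral>\<^sup>+u. U u v \<theta> \<partial>lborel)"
    proof (cases "v \<in> {0<..<1} \<and> \<theta> \<in> {0<..<pi/2}")
      case True
      then have v: "0 < v" "v < 1" and \<theta>: "0 < \<theta>" "\<theta> < pi / 2" by auto
      have k: "2 / pi / (1 - v\<^sup>2) \<ge> 0" using v by (simp add: power_le_one)
      have "(\<integral>\<^sup>+y. T y v \<theta> \<partial>lborel) = (\<integral>\<^sup>+y\<in>{1<..}. ennreal (2 / pi / (1 - v\<^sup>2) * ((exp (- 2 * x * y * v) - exp (- 2 * x * y / v)) / sqrt (y\<^sup>2 * (cos \<theta>)\<^sup>2 + (sin \<theta>)\<^sup>2))) \<partial>lborel)"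
        using True by (intro nn_integral_cong) (simp add: T_def pv_integrand_def R_def mult_ac)
      also have "\<dots> = ennreal (2 / pi / (1 - v\<^sup>2)) * (\<integral>\<^sup>+u\<in>{0<..}. ennreal (exp (- 2 * x * u) * pv_kern v \<theta> u) \<partial>lborel)"
        unfolding pv_kern_laplace[OF assms v \<theta>, symmetric] by (rule nn_set_integral_cmult[OF k]) measurable
      also have "\<dots> = (\<integral>\<^sup>+u\<in>{0<..}. ennreal (2 / pi / (1 - v\<^sup>2) * (exp (- 2 * x * u) * pv_kern v \<theta> u)) \<partial>lborel)"
        by (rule nn_set_integral_cmult[OF k, symmetric]) measurable
      also have "\<dots> = (\<integral>\<^sup>+u. U u v \<theta> \<partial>lborel)"
        using True by (intro nn_integral_cong) (simp add: U_def mult_ac)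
      finally show ?thesis .
    qed (auto simp: T_def U_def)
  qed
  also have "\<dots> = (\<integral>\<^sup>+v. (\<integral>\<^sup>+u. (\<integral>\<^sup>+\<theta>. U u v \<theta> \<partial>lborel) \<partial>lborel) \<partial>lborel)"
    by (rule nn_integral_cong, rule lborel_pair.Fubini') measurable
  also have "\<dots> = (\<integral>\<^sup>+u. (\<integral>\<^sup>+v. (\<integral>\<^sup>+\<theta>. U u v \<theta> \<partial>lborel) \<partial>lborel) \<partial>lborel)"
    by (rule lborel_pair.Fubini') measurable
  also have "\<dots> = (\<integral>\<^sup>+u. (\<integral>\<^sup>+\<theta>. (\<integral>\<^sup>+v. U u v \<theta> \<partial>lborel) \<partial>lborel) \<partial>lborel)"
    by (rule nn_integral_cong, rule lborel_pair.Fubini') measurable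
  also have "\<dots> = (\<integral>\<^sup>+u\<in>{0<..}. ennreal (exp (- 2 * x * u)) * elliptic_J u \<partial>lborel)"
  \<comment> \<open>The kernel integral was computed for u \<noteq> 1 only, which suffices almost
    everywhere.\<close>
  proof (rule nn_integral_cong_except[of 1])
    fix u :: real assume u1: "u \<noteq> 1"
    show "(\<integral>\<^sup>+\<theta>. (\<integral>\<^sup>+v. U u v \<theta> \<partial>lborel) \<partial>lborel) = ennreal (exp (- 2 * x * u)) * elliptic_J u * indicator {0<..} u"
    proof (cases "u > 0")
      case True
      define Q where "Q = (\<lambda>t \<theta>::real. (max 1 (u\<^sup>2) - min 1 (u\<^sup>2) * t\<^sup>2) * (cos \<theta>)\<^sup>2 + (1 - t\<^sup>2) * (sin \<theta>)\<^sup>2)"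
      have inner: "(\<integral>\<^sup>+v. U u v \<theta> \<partial>lborel) = ennreal (2 / pi * exp (- 2 * x * u)) * ((\<integral>\<^sup>+t\<in>{0<..<1}. ennreal (1 / Q t \<theta>) \<partial>lborel) * indicator {0<..<pi/2} \<theta>)" for \<theta>
      proof (cases "\<theta> \<in> {0<..<pi/2}")
        case t: True
        have "(\<integral>\<^sup>+v. U u v \<theta> \<partial>lborel) = (\<integral>\<^sup>+v\<in>{0<..<1}. ennreal (2 / pi * exp (- 2 * x * u) * (pv_kern v \<theta> u / (1 - v\<^sup>2))) \<partial>lborel)"
          using t True by (intro nn_integral_cong) (simp add: U_def mult_ac)
        also have "\<dots> = ennreal (2 / pi * exp (- 2 * x * u)) * (\<integral>\<^sup>+v\<in>{0<..<1}. ennreal (pv_kern v \<theta> u / (1 - v\<^sup>2)) \<partial>lborel)"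
          by (rule nn_set_integral_cmult) auto
        also have "(\<integral>\<^sup>+v\<in>{0<..<1}. ennreal (pv_kern v \<theta> u / (1 - v\<^sup>2)) \<partial>lborel) = (\<integral>\<^sup>+t\<in>{0<..<1}. ennreal (1 / Q t \<theta>) \<partial>lborel)"
          using pv_kern_integral[OF True u1, of \<theta>] t unfolding Q_def by simp
        finally show ?thesis using t by simp
      qed (simp add: U_def)
      have "(\<integral>\<^sup>+\<theta>. (\<integral>\<^sup>+v. U u v \<theta> \<partial>lborel) \<partial>lborel) = ennreal (2 / pi * exp (- 2 * x * u)) * (\<integral>\<^sup>+\<theta>\<in>{0<..<pi/2}. (\<integral>\<^sup>+t\<in>{0<..<1}. ennreal (1 / Q t \<theta>) \<partial>lborel) \<partial>lborel)"
        unfolding inner Q_def by (rule nn_integral_cmult) measurable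
      also have "(\<integral>\<^sup>+\<theta>\<in>{0<..<pi/2}. (\<integral>\<^sup>+t\<in>{0<..<1}. ennreal (1 / Q t \<theta>) \<partial>lborel) \<partial>lborel) = ennreal (pi / 2) * elliptic_J u"
        unfolding Q_def elliptic_J_def by (rule elliptic_double_integral) (use True in \<open>auto simp: min_def max_def\<close>)
      also have "ennreal (2 / pi * exp (- 2 * x * u)) * (ennreal (pi / 2) * elliptic_J u) = ennreal (2 / pi * exp (- 2 * x * u) * (pi / 2)) * elliptic_J u"
        by (simp only: mult.assoc[symmetric], subst ennreal_mult) auto
      finally show ?thesis using True by simp
    qed (simp add: U_def)
  qed
  finally show ?thesis .
qed

lemma bessel_product_pv:
  assumes "x > 0"
  shows "ennreal (bessel_I0 x * bessel_K0 x) = ennreal (2 / pi) *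
    (\<integral>\<^sup>+y\<in>{1<..}. ennreal (agm_inv y) * (\<integral>\<^sup>+v\<in>{0<..<1}. ennreal (pv_integrand 0 (x * y) v) \<partial>lborel) \<partial>lborel)"
proof -
  have [measurable]: "elliptic_J \<in> borel_measurable borel" unfolding elliptic_J_def by measurable
  show ?thesis unfolding bessel_product_laplace[OF assms] pv_double_integral[OF assms]
    by (subst nn_integral_cmult[symmetric]) (auto simp: mult_ac)
qed

section \<open>The remainder as a double integral\<close>

lemma nn_integral_power_exp:
  fixes a b :: real
  assumes "a > 0"
  shows "(\<integral>\<^sup>+y\<in>{b<..}. ennreal ((y - b) ^ k * exp (- a * y)) \<partial>lborel) = ennreal (fact k * exp (- a * b) / a ^ Suc k)"
proof -
  let ?g = "\<lambda>y. a * (y - b)" and ?f = "\<lambda>z::real. z ^ k * exp (- z)"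
  have im: "?g ` {b<..} = {0<..}"
  proof (intro set_eqI iffI)
    fix u :: real assume "u \<in> {0<..}"
    then show "u \<in> ?g ` {b<..}" using assms by (intro image_eqI[of _ _ "u / a + b"]) auto
  qed (use assms in auto)
  have "(\<integral>\<^sup>+y\<in>{b<..}. ennreal (\<bar>a\<bar> * ?f (?g y)) \<partial>lborel) = (\<integral>\<^sup>+z\<in>?g ` {b<..}. ennreal (?f z) \<partial>lborel)"
  proof (rule nn_integral_substitution_inj[where f="?f" and g="?g" and g'="\<lambda>_. a"])
    show "?g ` {b<..} \<in> sets borel" unfolding im by simp
    show "?f u \<ge> 0" if "u \<in> ?g ` {b<..}" for u using that unfolding im by simp
    show "(?g has_field_derivative a) (at y)" for y by (auto intro!: derivative_eq_intros)
  qed (use assms in \<open>auto intro!: inj_onI\<close>)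
  also have "\<dots> = (\<integral>\<^sup>+z\<in>{0..}. ennreal (?f z) \<partial>lborel)"
    unfolding im
  proof (rule nn_integral_cong_except[of 0])
    fix z :: real assume "z \<noteq> 0"
    then show "ennreal (?f z) * indicator {0<..} z = ennreal (?f z) * indicator {0..} z"
      by (cases "z > 0") (simp_all add: indicator_def)
  qed
  also have "\<dots> = ennreal (fact k)"
    using nn_intergal_power_times_exp_Ici[of k] by (simp flip: ennreal_of_nat_eq_real_of_nat)
  finally have 1: "(\<integral>\<^sup>+y\<in>{b<..}. ennreal (\<bar>a\<bar> * ?f (?g y)) \<partial>lborel) = ennreal (fact k)" .
  have "(y - b) ^ k * exp (- a * y) = exp (- a * b) / a ^ Suc k * (\<bar>a\<bar> * ?f (?g y))" for y
  proof -
    have e: "exp (- (a * (y - b))) = exp (- a * y) * exp (a * b)" by (simp add: algebra_simps flip: exp_add)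
    show ?thesis unfolding power_mult_distrib e using assms by (simp add: exp_minus field_simps)
  qed
  then have "(\<integral>\<^sup>+y\<in>{b<..}. ennreal ((y - b) ^ k * exp (- a * y)) \<partial>lborel)
     = (\<integral>\<^sup>+y\<in>{b<..}. ennreal (exp (- a * b) / a ^ Suc k * (\<bar>a\<bar> * ?f (?g y))) \<partial>lborel)" by simp
  also have "\<dots> = ennreal (exp (- a * b) / a ^ Suc k) * ennreal (fact k)"
    unfolding 1[symmetric] using assms by (intro nn_set_integral_cmult) auto
  also have "\<dots> = ennreal (exp (- a * b) / a ^ Suc k * fact k)"
    using assms by (intro ennreal_mult'[symmetric]) auto
  finally show ?thesis by (simp add: mult.commute)
qed

lemma nn_integral_fold_at_1:
  fixes f :: "real \<Rightarrow> real"
  assumes [measurable]: "f \<in> borel_measurable borel" and nn: "\<And>v. v > 0 \<Longrightarrow> f v \<ge> 0"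
  shows "(\<integral>\<^sup>+v\<in>{0<..}. ennreal (f v) \<partial>lborel) = (\<integral>\<^sup>+v\<in>{0<..<1}. ennreal (f v + f (1 / v) / v\<^sup>2) \<partial>lborel)"
proof -
  have im: "(\<lambda>v. 1 / v) ` {0<..<1} = {1::real<..}"
  proof (intro set_eqI iffI)
    fix u :: real assume "u \<in> {1<..}"
    then show "u \<in> (\<lambda>v. 1 / v) ` {0<..<1}" by (intro image_eqI[of _ _ "1 / u"]) auto
  qed auto
  have "(\<integral>\<^sup>+v\<in>{0<..<1}. ennreal (\<bar>- (1 / v\<^sup>2)\<bar> * f (1 / v)) \<partial>lborel) = (\<integral>\<^sup>+z\<in>(\<lambda>v. 1 / v) ` {0<..<1}. ennreal (f z) \<partial>lborel)"
  proof (rule nn_integral_substitution_inj[where f=f and g="\<lambda>v. 1 / v" and g'="\<lambda>v. - (1 / v\<^sup>2)"])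
    show "(\<lambda>v::real. 1 / v) ` {0<..<1} \<in> sets borel" unfolding im by simp
    show "f u \<ge> 0" if "u \<in> (\<lambda>v. 1 / v) ` {0<..<1}" for u using that nn[of u] unfolding im by simp
    show "((\<lambda>v. 1 / v) has_field_derivative - (1 / y\<^sup>2)) (at y)" if "y \<in> {0<..<1}" for y :: real
      using that by (auto intro!: derivative_eq_intros simp: power2_eq_square)
    show "continuous_on {0<..<1::real} (\<lambda>v. - (1 / v\<^sup>2))" by (intro continuous_intros) auto
  qed (auto intro!: inj_onI)
  then have 1: "(\<integral>\<^sup>+z\<in>{1<..}. ennreal (f z) \<partial>lborel) = (\<integral>\<^sup>+v\<in>{0<..<1}. ennreal (f (1 / v) / v\<^sup>2) \<partial>lborel)"
    unfolding im by simp
  have "(\<integral>\<^sup>+v\<in>{0<..}. ennreal (f v) \<partial>lborel) = (\<integral>\<^sup>+v. ennreal (f v) * indicator {0<..<1} v + ennreal (f v) * indicator {1<..} v \<partial>lborel)"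
  proof (rule nn_integral_cong_except[of 1])
    fix v :: real assume "v \<noteq> 1"
    then consider "v \<in> {0<..<1}" | "v \<in> {1<..}" | "v \<notin> {0<..}" by fastforce
    then show "ennreal (f v) * indicator {0<..} v = ennreal (f v) * indicator {0<..<1} v + ennreal (f v) * indicator {1<..} v"
      by cases (auto simp: indicator_def)
  qed
  also have "\<dots> = (\<integral>\<^sup>+v\<in>{0<..<1}. ennreal (f v) \<partial>lborel) + (\<integral>\<^sup>+v\<in>{0<..<1}. ennreal (f (1 / v) / v\<^sup>2) \<partial>lborel)"
    unfolding 1[symmetric] by (rule nn_integral_add) auto
  also have "\<dots> = (\<integral>\<^sup>+v. ennreal (f v) * indicator {0<..<1} v + ennreal (f (1 / v) / v\<^sup>2) * indicator {0<..<1} v \<partial>lborel)"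
    by (rule nn_integral_add[symmetric]) auto
  also have "\<dots> = (\<integral>\<^sup>+v\<in>{0<..<1}. ennreal (f v + f (1 / v) / v\<^sup>2) \<partial>lborel)"
    using nn by (intro nn_integral_cong) (auto simp: indicator_def ennreal_plus)
  finally show ?thesis .
qed

text \<open>One step of the geometric series of 1 / (1 - v^2), taken in v for the first exponential
  and in 1/v for the reflected one. The part split off is v^(2N) e^(-2Xv) folded at 1, so it
  integrates to a Gamma integral over the half-line.\<close>

lemma pv_integrand_Suc:
  assumes "0 < v" "v < 1"
  shows "pv_integrand N X v = pv_integrand (Suc N) X v + (v ^ (2 * N) * exp (- (2 * X) * v) + (1 / v) ^ (2 * N) * exp (- (2 * X) * (1 / v)) / v\<^sup>2)"
proof -
  have v2: "1 - v\<^sup>2 > 0" using assms by (simp add: power_less_one_iff)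
  define A B V where "A = exp (- 2 * X * v)" and "B = exp (- 2 * X / v)" and "V = v ^ (2 * N)"
  have V: "V > 0" using assms by (simp add: V_def)
  have "(A * V - B / V) / (1 - v\<^sup>2) = (A * (v\<^sup>2 * V) - B / (v\<^sup>2 * V)) / (1 - v\<^sup>2) + (V * A + 1 / V * B / v\<^sup>2)"
    using v2 V assms by (simp add: divide_simps) (simp add: algebra_simps)
  then show ?thesis unfolding pv_integrand_def A_def B_def V_def
    by (simp add: power_add power2_eq_square power_one_over)
qed

text \<open>Assuming the bound for N + 1 makes the new folded integrand nonnegative, so that the
  extended integral of the sum splits.\<close>

lemma pv_integral_step:
  assumes "real (Suc N) \<le> X"
  shows "(\<integral>\<^sup>+v\<in>{0<..<1}. ennreal (pv_integrand N X v) \<partial>lborel) = (\<integral>\<^sup>+v\<in>{0<..<1}. ennreal (pv_integrand (Suc N) X v) \<partial>lborel) + ennreal (fact (2 * N) / (2 * X) ^ Suc (2 * N))"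
proof -
  define f where "f = (\<lambda>v::real. v ^ (2 * N) * exp (- (2 * X) * v))"
  have [measurable]: "f \<in> borel_measurable borel" unfolding f_def by measurable
  have f0: "f v \<ge> 0" for v by (simp add: f_def power_mult)
  have "(\<integral>\<^sup>+v\<in>{0<..<1}. ennreal (pv_integrand N X v) \<partial>lborel) = (\<integral>\<^sup>+v. ennreal (pv_integrand (Suc N) X v) * indicator {0<..<1} v + ennreal (f v + f (1 / v) / v\<^sup>2) * indicator {0<..<1} v \<partial>lborel)"
  proof (rule nn_integral_cong)
    fix v :: real
    show "ennreal (pv_integrand N X v) * indicator {0<..<1} v = ennreal (pv_integrand (Suc N) X v) * indicator {0<..<1} v + ennreal (f v + f (1 / v) / v\<^sup>2) * indicator {0<..<1} v"
    proof (cases "v \<in> {0<..<1}")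
      case True
      then have v: "0 < v" "v < 1" by auto
      have "f v + f (1 / v) / v\<^sup>2 \<ge> 0" using f0 by simp
      with pv_integrand_nonneg[OF assms v] True show ?thesis
        unfolding pv_integrand_Suc[OF v, of N X] f_def[symmetric, THEN fun_cong] by (simp add: ennreal_plus)
    qed simp
  qed
  also have "\<dots> = (\<integral>\<^sup>+v\<in>{0<..<1}. ennreal (pv_integrand (Suc N) X v) \<partial>lborel) + (\<integral>\<^sup>+v\<in>{0<..}. ennreal (f v) \<partial>lborel)"
    unfolding nn_integral_fold_at_1[of f, OF _ f0, simplified] by (rule nn_integral_add) auto
  also have "(\<integral>\<^sup>+v\<in>{0<..}. ennreal (f v) \<partial>lborel) = ennreal (fact (2 * N) / (2 * X) ^ Suc (2 * N))"
    using nn_integral_power_exp[of "2 * X" 0 "2 * N"] assms by (simp add: f_def)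
  finally show ?thesis .
qed

lemma pv_integral_sum:
  assumes "real N \<le> X"
  shows "(\<integral>\<^sup>+v\<in>{0<..<1}. ennreal (pv_integrand 0 X v) \<partial>lborel) = (\<integral>\<^sup>+v\<in>{0<..<1}. ennreal (pv_integrand N X v) \<partial>lborel) + (\<Sum>k<N. ennreal (fact (2 * k) / (2 * X) ^ Suc (2 * k)))"
  using assms
proof (induction N)
  case (Suc N)
  then show ?case using pv_integral_step[of N X] by (simp add: add_ac)
qed simp

section \<open>Moments of the reciprocal arithmetic-geometric mean\<close>

lemma nn_integral_Beta:
  assumes "a > 0" "b > 0"
  shows "(\<integral>\<^sup>+p\<in>{0<..<1}. ennreal (p powr (a - 1) * (1 - p) powr (b - 1)) \<partial>lborel) = ennreal (Beta a b)"
  using has_integral_Beta_real[OF assms] by (intro nn_integral_has_integral_on) (auto simp: has_integral_Icc_iff_Ioo)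

text \<open>The substitution p = cos^2 \<theta> + z sin^2 \<theta> runs from 1 down to z, and 1 - p
  and p - z become (1 - z) sin^2 \<theta> and (1 - z) cos^2 \<theta>. All trigonometric factors
  except the square root of p cancel against the Jacobian.\<close>

lemma agm_inv_inner:
  assumes z: "0 < z" "z < 1"
  shows "(\<integral>\<^sup>+p\<in>{z<..<1}. ennreal (1 / sqrt (p * (1 - p) * (p - z))) \<partial>lborel) = ennreal (pi / sqrt z * agm_inv (1 / sqrt z))"
proof -
  define g where "g = (\<lambda>\<theta>. (cos \<theta>)\<^sup>2 + z * (sin \<theta>)\<^sup>2)"
  define g' where "g' = (\<lambda>\<theta>. - (2 * (1 - z) * (cos \<theta> * sin \<theta>)))"
  have cs: "cos \<theta> > 0" "sin \<theta> > 0" if "0 < \<theta>" "\<theta> < pi / 2" for \<theta>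
    using that by (auto intro!: cos_gt_zero sin_gt_zero2)
  have der: "(g has_field_derivative g' \<theta>) (at \<theta>)" for \<theta>
    unfolding g_def g'_def by (auto intro!: derivative_eq_intros simp: algebra_simps)
  \<comment> \<open>The map \<open>g\<close> is decreasing, so the lemma on increasing maps is
    applied to its negative.\<close>
  have "continuous_on {0..pi/2} (\<lambda>\<theta>. - g \<theta>)"
    unfolding g_def by (intro continuous_intros)
  from image_Ioo_strict_mono[of 0 "pi/2", OF _ this DERIV_minus[OF der]]
  have im': "(\<lambda>\<theta>. - g \<theta>) ` {0<..<pi/2} = {- 1<..< - z}" and inj': "inj_on (\<lambda>\<theta>. - g \<theta>) {0<..<pi/2}"
    using cs z by (auto simp: g'_def g_def)
  have im: "g ` {0<..<pi/2} = {z<..<1}"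
  proof -
    have "g ` {0<..<pi/2} = uminus ` ((\<lambda>\<theta>. - g \<theta>) ` {0<..<pi/2})" by (simp add: image_image)
    then show ?thesis unfolding im' by simp
  qed
  have inj: "inj_on g {0<..<pi/2}" using inj' by (auto simp: inj_on_def)
  let ?f = "\<lambda>p. 1 / sqrt (p * (1 - p) * (p - z))"
  have "(\<integral>\<^sup>+\<theta>\<in>{0<..<pi/2}. ennreal (\<bar>g' \<theta>\<bar> * ?f (g \<theta>)) \<partial>lborel) = (\<integral>\<^sup>+p\<in>g ` {0<..<pi/2}. ennreal (?f p) \<partial>lborel)"
  proof (rule nn_integral_substitution_inj[where f="?f" and g=g and g'=g', OF _ _ _ inj])
    show "g ` {0<..<pi/2} \<in> sets borel" unfolding im by simp
    show "continuous_on {0<..<pi/2} g'" unfolding g'_def by (intro continuous_intros)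
    show "0 \<le> ?f u" if "u \<in> g ` {0<..<pi/2}" for u
      using that z unfolding im by auto
  qed (use der in auto)
  moreover have "\<bar>g' \<theta>\<bar> * ?f (g \<theta>) = pi / sqrt z * (2 / pi / sqrt ((1 / sqrt z)\<^sup>2 * (cos \<theta>)\<^sup>2 + (sin \<theta>)\<^sup>2))" if \<theta>: "0 < \<theta>" "\<theta> < pi / 2" for \<theta>
  proof -
    have s2: "(sin \<theta>)\<^sup>2 = 1 - (cos \<theta>)\<^sup>2" by (rule sin_squared_eq)
    have "1 - g \<theta> = (1 - z) * (sin \<theta>)\<^sup>2" "g \<theta> - z = (1 - z) * (cos \<theta>)\<^sup>2"
      unfolding g_def s2 by (auto simp: algebra_simps)
    then have "g \<theta> * (1 - g \<theta>) * (g \<theta> - z) = g \<theta> * ((1 - z) * (cos \<theta> * sin \<theta>))\<^sup>2"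
      by (simp add: power_mult_distrib power2_eq_square)
    moreover have w: "(1 - z) * (cos \<theta> * sin \<theta>) > 0" using cs[OF \<theta>] z by simp
    ultimately have 1: "sqrt (g \<theta> * (1 - g \<theta>) * (g \<theta> - z)) = sqrt (g \<theta>) * ((1 - z) * (cos \<theta> * sin \<theta>))"
      by (simp only: real_sqrt_mult[of "g \<theta>"] real_sqrt_abs abs_of_pos)
    have "(1 / sqrt z)\<^sup>2 * (cos \<theta>)\<^sup>2 + (sin \<theta>)\<^sup>2 = g \<theta> / z"
      using z by (simp add: g_def power_divide field_simps)
    then have 2: "sqrt ((1 / sqrt z)\<^sup>2 * (cos \<theta>)\<^sup>2 + (sin \<theta>)\<^sup>2) = sqrt (g \<theta>) / sqrt z"
      by (simp add: real_sqrt_divide)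
    have gp: "sqrt (g \<theta>) > 0" using cs[OF \<theta>] z by (auto simp: g_def intro!: add_pos_nonneg)
    have "\<bar>g' \<theta>\<bar> = 2 * ((1 - z) * (cos \<theta> * sin \<theta>))" using abs_of_pos[OF w] unfolding g'_def abs_minus_cancel mult.assoc by (simp only: abs_mult abs_numeral)
    then show ?thesis unfolding 1 2 using gp w z cs[OF \<theta>] by simp
  qed
  then have "(\<integral>\<^sup>+\<theta>\<in>{0<..<pi/2}. ennreal (\<bar>g' \<theta>\<bar> * ?f (g \<theta>)) \<partial>lborel) = (\<integral>\<^sup>+\<theta>\<in>{0<..<pi/2}. ennreal (pi / sqrt z * (2 / pi / sqrt ((1 / sqrt z)\<^sup>2 * (cos \<theta>)\<^sup>2 + (sin \<theta>)\<^sup>2))) \<partial>lborel)"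
    by (intro nn_integral_cong) (auto simp: indicator_def)
  also have "\<dots> = ennreal (pi / sqrt z) * (\<integral>\<^sup>+\<theta>\<in>{0<..<pi/2}. ennreal (2 / pi / sqrt ((1 / sqrt z)\<^sup>2 * (cos \<theta>)\<^sup>2 + (sin \<theta>)\<^sup>2)) \<partial>lborel)"
    using z by (intro nn_set_integral_cmult) auto
  also have "\<dots> = ennreal (pi / sqrt z) * ennreal (agm_inv (1 / sqrt z))"
    using z by (subst agm_inv_nn_integral[symmetric]) auto
  also have "\<dots> = ennreal (pi / sqrt z * agm_inv (1 / sqrt z))"
    using z by (intro ennreal_mult'[symmetric]) auto
  ultimately show ?thesis unfolding im by simp
qed

text \<open>A multiplicative convolution: the square of the Beta integral with parameters s + 1/2
  and 1/2 is a double integral over p and q. With z = p q, the p-integral is that of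
  \<open>agm_inv_inner\<close>, and z = 1/y^2 gives the moment. This is why the moments are squares
  of Gamma quotients.\<close>

lemma agm_inv_moment:
  fixes s :: real
  assumes "s \<ge> 0"
  shows "(\<integral>\<^sup>+y\<in>{1<..}. ennreal (agm_inv y * y powr (- 2 * s - 1)) \<partial>lborel) = ennreal ((Gamma (s + 1/2) / Gamma (s + 1))\<^sup>2 / 2)"
proof -
  define h where "h = (\<lambda>p::real. p powr (s - 1/2) / sqrt (1 - p))"
  have [measurable]: "h \<in> borel_measurable borel" unfolding h_def by measurable
  define \<beta> where "\<beta> = Beta (s + 1/2) (1/2)"
  have B: "\<beta> = Gamma (s + 1/2) * sqrt pi / Gamma (s + 1)" by (simp add: \<beta>_def Beta_def Gamma_one_half_real add.commute)
  have h0: "0 \<le> h p" if "0 < p" "p < 1" for p using that by (simp add: h_def)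
  have b0: "\<beta> \<ge> 0" unfolding B using assms by (intro divide_nonneg_nonneg mult_nonneg_nonneg) (auto intro!: less_imp_le Gamma_real_pos)
  have bi: "(\<integral>\<^sup>+p\<in>{0<..<1}. ennreal (h p) \<partial>lborel) = ennreal \<beta>"
  proof -
    have "(\<integral>\<^sup>+p\<in>{0<..<1}. ennreal (h p) \<partial>lborel) = (\<integral>\<^sup>+p\<in>{0<..<1}. ennreal (p powr ((s + 1/2) - 1) * (1 - p) powr (1/2 - 1)) \<partial>lborel)"
    proof (rule nn_integral_cong)
      fix p :: real
      have "h p = p powr ((s + 1/2) - 1) * (1 - p) powr (1/2 - 1)" if "0 < p" "p < 1"
      proof -
        have "(1 - p) powr (1/2 - 1) = 1 / sqrt (1 - p)"
          using that by (simp add: powr_minus_divide powr_half_sqrt flip: powr_minus)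
        then show ?thesis by (simp add: h_def)
      qed
      then show "ennreal (h p) * indicator {0<..<1} p = ennreal (p powr ((s + 1/2) - 1) * (1 - p) powr (1/2 - 1)) * indicator {0<..<1} p"
        by (cases "p \<in> {0<..<1}") auto
    qed
    also have "\<dots> = ennreal \<beta>" unfolding \<beta>_def using assms by (intro nn_integral_Beta) auto
    finally show ?thesis .
  qed
  \<comment> \<open>The product h(p) h(z/p) / p on 0 < z < p < 1, where 1/p is the Jacobian of q =
    z/p.\<close>
  define T where "T = (\<lambda>p z::real. indicator {0<..<1} p * indicator {0<..<p} z * ennreal (z powr (s - 1/2) * (1 / sqrt (p * (1 - p) * (p - z)))))"
  have [measurable]: "case_prod T \<in> borel_measurable (borel \<Otimes>\<^sub>M borel)"
    unfolding T_def indicator_def greaterThanLessThan_iff by measurable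
  have "ennreal (\<beta>\<^sup>2) = (\<integral>\<^sup>+p\<in>{0<..<1}. ennreal (h p) \<partial>lborel) * ennreal \<beta>"
    unfolding bi using b0 by (simp add: power2_eq_square ennreal_mult)
  also have "\<dots> = (\<integral>\<^sup>+p. ennreal (h p) * indicator {0<..<1} p * ennreal \<beta> \<partial>lborel)"
    by (rule nn_integral_multc[symmetric]) measurable
  also have "\<dots> = (\<integral>\<^sup>+p. (\<integral>\<^sup>+z. T p z \<partial>lborel) \<partial>lborel)"
  proof (rule nn_integral_cong)
    fix p :: real
    show "ennreal (h p) * indicator {0<..<1} p * ennreal \<beta> = (\<integral>\<^sup>+z. T p z \<partial>lborel)"
    proof (cases "p \<in> {0<..<1}")
      case True
      then have p: "0 < p" "p < 1" by auto
      have im: "(\<lambda>z. z / p) ` {0<..<p} = {0<..<1}"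
      proof (intro set_eqI iffI)
        fix u :: real assume "u \<in> {0<..<1}"
        then show "u \<in> (\<lambda>z. z / p) ` {0<..<p}" using p by (intro image_eqI[of _ _ "u * p"]) auto
      qed (use p in auto)
      have "(\<integral>\<^sup>+z\<in>{0<..<p}. ennreal (\<bar>1 / p\<bar> * h (z / p)) \<partial>lborel) = (\<integral>\<^sup>+q\<in>(\<lambda>z. z / p) ` {0<..<p}. ennreal (h q) \<partial>lborel)"
      proof (rule nn_integral_substitution_inj[where f=h and g="\<lambda>z. z / p" and g'="\<lambda>_. 1 / p"])
        show "(\<lambda>z. z / p) ` {0<..<p} \<in> sets borel" unfolding im by simp
        show "h u \<ge> 0" if "u \<in> (\<lambda>z. z / p) ` {0<..<p}" for u using that h0 unfolding im by simp
        show "((\<lambda>z. z / p) has_field_derivative 1 / p) (at z)" for z using p by (auto intro!: derivative_eq_intros)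
      qed (use p in \<open>auto intro!: inj_onI\<close>)
      then have "ennreal \<beta> = (\<integral>\<^sup>+z\<in>{0<..<p}. ennreal (\<bar>1 / p\<bar> * h (z / p)) \<partial>lborel)" unfolding im bi ..
      then have "ennreal (h p) * ennreal \<beta> = (\<integral>\<^sup>+z\<in>{0<..<p}. ennreal (h p * (\<bar>1 / p\<bar> * h (z / p))) \<partial>lborel)"
        by (simp only:) (rule nn_set_integral_cmult[symmetric], use h0[OF p] in auto)
      also have "\<dots> = (\<integral>\<^sup>+z. T p z \<partial>lborel)"
      proof (rule nn_integral_cong)
        fix z :: real
        have "h p * (\<bar>1 / p\<bar> * h (z / p)) = z powr (s - 1/2) * (1 / sqrt (p * (1 - p) * (p - z)))" if z: "0 < z" "z < p"
        proof -
          have 1: "sqrt (1 - z / p) = sqrt (p - z) / sqrt p"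
            using p z by (simp add: real_sqrt_divide[symmetric] diff_divide_distrib)
          have 2: "p powr (s - 1/2) * (z / p) powr (s - 1/2) = z powr (s - 1/2)"
            using p z by (simp add: powr_divide)
          have "h p * (\<bar>1 / p\<bar> * h (z / p)) = (p powr (s - 1/2) * (z / p) powr (s - 1/2)) * (1 / (sqrt (1 - p) * p * (sqrt (p - z) / sqrt p)))"
            using p by (simp add: h_def 1)
          also have "sqrt (1 - p) * p * (sqrt (p - z) / sqrt p) = sqrt (p * (1 - p) * (p - z))"
          proof -
            have "sqrt (1 - p) * p * (sqrt (p - z) / sqrt p) = sqrt (1 - p) * (p / sqrt p) * sqrt (p - z)" by simp
            also have "p / sqrt p = sqrt p" using p by (simp add: real_div_sqrt)
            finally show ?thesis by (simp only: real_sqrt_mult mult_ac)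
          qed
          finally show ?thesis unfolding 2 .
        qed
        then show "ennreal (h p * (\<bar>1 / p\<bar> * h (z / p))) * indicator {0<..<p} z = T p z"
          using True by (cases "z \<in> {0<..<p}") (auto simp: T_def)
      qed
      finally show ?thesis using True by simp
    qed (simp add: T_def)
  qed
  also have "\<dots> = (\<integral>\<^sup>+z. (\<integral>\<^sup>+p. T p z \<partial>lborel) \<partial>lborel)"
    by (rule lborel_pair.Fubini') measurable
  also have "\<dots> = (\<integral>\<^sup>+z\<in>{0<..<1}. ennreal (z powr (s - 1/2) * (pi / sqrt z * agm_inv (1 / sqrt z))) \<partial>lborel)"
  proof (rule nn_integral_cong)
    fix z :: real
    show "(\<integral>\<^sup>+p. T p z \<partial>lborel) = ennreal (z powr (s - 1/2) * (pi / sqrt z * agm_inv (1 / sqrt z))) * indicator {0<..<1} z"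
    proof (cases "z \<in> {0<..<1}")
      case True
      then have z: "0 < z" "z < 1" by auto
      have "(\<integral>\<^sup>+p. T p z \<partial>lborel) = (\<integral>\<^sup>+p\<in>{z<..<1}. ennreal (z powr (s - 1/2) * (1 / sqrt (p * (1 - p) * (p - z)))) \<partial>lborel)"
        using z by (intro nn_integral_cong) (auto simp: T_def indicator_def)
      also have "\<dots> = ennreal (z powr (s - 1/2)) * ennreal (pi / sqrt z * agm_inv (1 / sqrt z))"
        unfolding agm_inv_inner[OF z, symmetric] by (rule nn_set_integral_cmult) auto
      also have "\<dots> = ennreal (z powr (s - 1/2) * (pi / sqrt z * agm_inv (1 / sqrt z)))"
        by (rule ennreal_mult'[symmetric]) simp
      finally show ?thesis using True by simp
    next
      case False
      then have "T p z = 0" for p by (auto simp: T_def indicator_def)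
      then show ?thesis using False by simp
    qed
  qed
  also have "\<dots> = (\<integral>\<^sup>+y\<in>{1<..}. ennreal (2 * pi * (agm_inv y * y powr (- 2 * s - 1))) \<partial>lborel)"
  proof -
    let ?f = "\<lambda>z. z powr (s - 1/2) * (pi / sqrt z * agm_inv (1 / sqrt z))"
    have im: "(\<lambda>y. 1 / y\<^sup>2) ` {1<..} = {0<..<1::real}"
    proof (intro set_eqI iffI)
      fix u :: real assume "u \<in> {0<..<1}"
      then show "u \<in> (\<lambda>y. 1 / y\<^sup>2) ` {1<..}" by (intro image_eqI[of _ _ "1 / sqrt u"]) (auto simp: power_divide)
    qed auto
    have "(\<integral>\<^sup>+y\<in>{1<..}. ennreal (\<bar>- (2 / y ^ 3)\<bar> * ?f (1 / y\<^sup>2)) \<partial>lborel) = (\<integral>\<^sup>+z\<in>(\<lambda>y. 1 / y\<^sup>2) ` {1<..}. ennreal (?f z) \<partial>lborel)"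
    proof (rule nn_integral_substitution_inj[where f="?f" and g="\<lambda>y. 1 / y\<^sup>2" and g'="\<lambda>y. - (2 / y ^ 3)"])
      show "(\<lambda>y::real. 1 / y\<^sup>2) ` {1<..} \<in> sets borel" unfolding im by simp
      show "?f u \<ge> 0" if "u \<in> (\<lambda>y. 1 / y\<^sup>2) ` {1<..}" for u
        using that unfolding im by (intro mult_nonneg_nonneg divide_nonneg_nonneg agm_inv_nonneg) auto
      show "((\<lambda>y. 1 / y\<^sup>2) has_field_derivative - (2 / y ^ 3)) (at y)" if "y \<in> {1<..}" for y :: real
        using that by (auto intro!: derivative_eq_intros simp: field_simps power2_eq_square power3_eq_cube)
      show "continuous_on {1::real<..} (\<lambda>y. - (2 / y ^ 3))" by (intro continuous_intros) auto
    qed (auto intro!: inj_onI)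
    moreover have "\<bar>- (2 / y ^ 3)\<bar> * ?f (1 / y\<^sup>2) = 2 * pi * (agm_inv y * y powr (- 2 * s - 1))" if "y > 1" for y
    proof -
      have 1: "sqrt (1 / y\<^sup>2) = 1 / y" using that by (simp add: real_sqrt_divide)
      have "1 / y\<^sup>2 = y powr (- 2)" using that by (simp add: powr_minus_divide powr_numeral)
      then have 2: "(1 / y\<^sup>2) powr (s - 1/2) = y powr (- 2 * s + 1)" by (simp add: powr_powr algebra_simps)
      have 3: "1 / y ^ 3 = y powr (- 3)" using that by (simp add: powr_minus_divide powr_numeral)
      have "\<bar>- (2 / y ^ 3)\<bar> * ?f (1 / y\<^sup>2) = 2 * pi * (agm_inv y * (y powr (- 2 * s + 1) * (1 / y ^ 3) * y))"
        unfolding 1 2 using that by simp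
      also have "y powr (- 2 * s + 1) * (1 / y ^ 3) * y = y powr (- 2 * s + 1) * y powr (- 3) * y powr 1"
        unfolding 3 using that by simp
      also have "\<dots> = y powr (- 2 * s + 1 + - 3 + 1)" by (simp only: powr_add)
      also have "- 2 * s + 1 + - 3 + 1 = - 2 * s - 1" by simp
      finally show ?thesis .
    qed
    then have "(\<integral>\<^sup>+y\<in>{1<..}. ennreal (\<bar>- (2 / y ^ 3)\<bar> * ?f (1 / y\<^sup>2)) \<partial>lborel) = (\<integral>\<^sup>+y\<in>{1<..}. ennreal (2 * pi * (agm_inv y * y powr (- 2 * s - 1))) \<partial>lborel)"
      by (intro nn_integral_cong) (auto simp: indicator_def)
    ultimately show ?thesis unfolding im by simp
  qed
  also have "\<dots> = ennreal (2 * pi) * (\<integral>\<^sup>+y\<in>{1<..}. ennreal (agm_inv y * y powr (- 2 * s - 1)) \<partial>lborel)"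
    by (rule nn_set_integral_cmult) auto
  finally have e: "ennreal (2 * pi) * (\<integral>\<^sup>+y\<in>{1<..}. ennreal (agm_inv y * y powr (- 2 * s - 1)) \<partial>lborel) = ennreal (\<beta>\<^sup>2)" ..
  have "(\<integral>\<^sup>+y\<in>{1<..}. ennreal (agm_inv y * y powr (- 2 * s - 1)) \<partial>lborel) = ennreal (1 / (2 * pi)) * (ennreal (2 * pi) * (\<integral>\<^sup>+y\<in>{1<..}. ennreal (agm_inv y * y powr (- 2 * s - 1)) \<partial>lborel))"
    by (simp add: mult.assoc[symmetric] ennreal_mult'[symmetric])
  also have "\<dots> = ennreal (1 / (2 * pi) * \<beta>\<^sup>2)" unfolding e by (rule ennreal_mult'[symmetric]) simp
  also have "1 / (2 * pi) * \<beta>\<^sup>2 = (Gamma (s + 1/2) / Gamma (s + 1))\<^sup>2 / 2"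
    unfolding B by (simp add: power_divide power_mult_distrib)
  finally show ?thesis .
qed

text \<open>For y \<ge> 1 the hypothesis N \<le> x gives N \<le> x y, so the geometric expansion is
  available at every y. Integrating its k-th term uses the moment at s = k and reproduces the k-th
  term of the subtracted sum.\<close>

lemma remainder_IK_nn_integral:
  assumes "x > 0" "real N \<le> x"
  shows "(\<integral>\<^sup>+y\<in>{1<..}. ennreal (agm_inv y) * (\<integral>\<^sup>+v\<in>{0<..<1}. ennreal (pv_integrand N (x * y) v) \<partial>lborel) \<partial>lborel) = ennreal (pi / 2 * remainder_IK N x)"
    and "remainder_IK N x \<ge> 0"
proof -
  define V where "V = (\<lambda>n. (\<integral>\<^sup>+y\<in>{1<..}. ennreal (agm_inv y) * (\<integral>\<^sup>+v\<in>{0<..<1}. ennreal (pv_integrand n (x * y) v) \<partial>lborel) \<partial>lborel))"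
  define t where "t = (\<lambda>k::nat. fact (2 * k) / (2 * x) ^ Suc (2 * k) * ((Gamma (k + 1/2) / Gamma (real k + 1))\<^sup>2 / 2))"
  have t0: "t k \<ge> 0" for k using assms by (simp add: t_def)
  have "V 0 = (\<integral>\<^sup>+y. (ennreal (agm_inv y) * (\<integral>\<^sup>+v\<in>{0<..<1}. ennreal (pv_integrand N (x * y) v) \<partial>lborel)) * indicator {1<..} y
       + (\<Sum>k<N. ennreal (fact (2 * k) / (2 * x) ^ Suc (2 * k) * (agm_inv y * y powr (- 2 * real k - 1))) * indicator {1<..} y) \<partial>lborel)"
    unfolding V_def
  proof (rule nn_integral_cong)
    fix y :: real
    show "ennreal (agm_inv y) * (\<integral>\<^sup>+v\<in>{0<..<1}. ennreal (pv_integrand 0 (x * y) v) \<partial>lborel) * indicator {1<..} y =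
       (ennreal (agm_inv y) * (\<integral>\<^sup>+v\<in>{0<..<1}. ennreal (pv_integrand N (x * y) v) \<partial>lborel)) * indicator {1<..} y
       + (\<Sum>k<N. ennreal (fact (2 * k) / (2 * x) ^ Suc (2 * k) * (agm_inv y * y powr (- 2 * real k - 1))) * indicator {1<..} y)"
    proof (cases "y > 1")
      case True
      have "x * 1 \<le> x * y" using True assms by (intro mult_left_mono) auto
      then have xy: "real N \<le> x * y" using assms(2) by linarith
      have "ennreal (agm_inv y) * ennreal (fact (2 * k) / (2 * (x * y)) ^ Suc (2 * k)) = ennreal (fact (2 * k) / (2 * x) ^ Suc (2 * k) * (agm_inv y * y powr (- 2 * real k - 1)))" for k
      proof -
        have "y powr (- 2 * real k - 1) = 1 / y ^ Suc (2 * k)"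
        proof -
          have "- 2 * real k - 1 = - real (Suc (2 * k))" by simp
          then have "y powr (- 2 * real k - 1) = y powr (- real (Suc (2 * k)))" by (simp only:)
          also have "\<dots> = 1 / y ^ Suc (2 * k)" using True by (simp only: powr_minus_divide powr_realpow)
          finally show ?thesis .
        qed
        then have "agm_inv y * (fact (2 * k) / (2 * (x * y)) ^ Suc (2 * k)) = fact (2 * k) / (2 * x) ^ Suc (2 * k) * (agm_inv y * y powr (- 2 * real k - 1))"
          by (simp add: power_mult_distrib mult_ac)
        then show ?thesis by (simp add: ennreal_mult'[symmetric] agm_inv_nonneg del: power_Suc)
      qed
      then show ?thesis using True unfolding pv_integral_sum[OF xy] by (simp add: distrib_left sum_distrib_left)
    qed simp
  qed
  also have "\<dots> = V N + (\<integral>\<^sup>+y. (\<Sum>k<N. ennreal (fact (2 * k) / (2 * x) ^ Suc (2 * k) * (agm_inv y * y powr (- 2 * real k - 1))) * indicator {1<..} y) \<partial>lborel)"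
    unfolding V_def by (rule nn_integral_add) measurable
  also have "(\<integral>\<^sup>+y. (\<Sum>k<N. ennreal (fact (2 * k) / (2 * x) ^ Suc (2 * k) * (agm_inv y * y powr (- 2 * real k - 1))) * indicator {1<..} y) \<partial>lborel) = (\<Sum>k<N. ennreal (t k))"
  proof (subst nn_integral_sum)
    show "(\<Sum>k<N. \<integral>\<^sup>+y\<in>{1<..}. ennreal (fact (2 * k) / (2 * x) ^ Suc (2 * k) * (agm_inv y * y powr (- 2 * real k - 1))) \<partial>lborel) = (\<Sum>k<N. ennreal (t k))"
    proof (rule sum.cong)
      fix k
      have "(\<integral>\<^sup>+y\<in>{1<..}. ennreal (fact (2 * k) / (2 * x) ^ Suc (2 * k) * (agm_inv y * y powr (- 2 * real k - 1))) \<partial>lborel)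
        = ennreal (fact (2 * k) / (2 * x) ^ Suc (2 * k)) * ennreal ((Gamma (k + 1/2) / Gamma (real k + 1))\<^sup>2 / 2)"
        unfolding agm_inv_moment[of "real k", simplified, symmetric] using assms by (subst nn_set_integral_cmult) auto
      then show "(\<integral>\<^sup>+y\<in>{1<..}. ennreal (fact (2 * k) / (2 * x) ^ Suc (2 * k) * (agm_inv y * y powr (- 2 * real k - 1))) \<partial>lborel) = ennreal (t k)"
        using assms by (simp add: t_def ennreal_mult'[symmetric] del: power_Suc)
    qed simp
  qed measurable
  also have "(\<Sum>k<N. ennreal (t k)) = ennreal (\<Sum>k<N. t k)" using t0 by (simp add: sum_ennreal)
  finally have V0: "V 0 = V N + ennreal (\<Sum>k<N. t k)" .
  have "ennreal (bessel_I0 x * bessel_K0 x) = ennreal (2 / pi) * V 0"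
    unfolding V_def by (rule bessel_product_pv[OF assms(1)])
  then have "ennreal (pi / 2) * ennreal (bessel_I0 x * bessel_K0 x) = V 0"
    by (simp add: mult.assoc[symmetric] ennreal_mult'[symmetric])
  then have V0': "V 0 = ennreal (pi / 2 * (bessel_I0 x * bessel_K0 x))" using ennreal_mult'[of "pi / 2" "bessel_I0 x * bessel_K0 x"] by simp
  \<comment> \<open>This rests on Gamma (k + 1/2) = sqrt pi (2k)! / (4^k k!); the remaining powers
    combine through 8^(2k) = (2^(2k))^3.\<close>
  have tk: "t k = pi / 2 * (1 / (2 * x) * ((fact (2 * k)) ^ 3 / ((fact k) ^ 4 * (8 * x) ^ (2 * k))))" for k
  proof -
    have "Gamma (real k + 1/2) = Gamma (1/2) * pochhammer (1/2) k"
    proof -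
      have "(1/2::real) \<notin> \<int>\<^sub>\<le>\<^sub>0" using nonpos_Ints_nonpos[of "1/2::real"] by auto
      from pochhammer_Gamma[OF this, of k] show ?thesis by (simp add: Gamma_one_half_real add.commute)
    qed
    moreover have "pochhammer (1/2) k = (fact (2 * k) :: real) / (2 ^ (2 * k) * fact k)"
      using fact_double[of k, where 'a=real] by (simp add: field_simps)
    ultimately have G: "Gamma (real k + 1/2) = sqrt pi * (fact (2 * k) / (2 ^ (2 * k) * fact k))" by (simp add: Gamma_one_half_real)
    have F: "Gamma (real k + 1) = fact k" using Gamma_fact[of k, where 'a=real] by (simp add: add.commute)
    define D where "D = (2::real) ^ (2 * k)"
    have "(8::real) ^ (2 * k) = (2 ^ 3) ^ (2 * k)" by simp
    also have "\<dots> = D ^ 3" unfolding D_def by (simp only: power_mult[symmetric] mult.commute)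
    finally have p: "(8 * x) ^ (2 * k) = D ^ 3 * x ^ (2 * k)" "(2 * x) ^ (2 * k) = D * x ^ (2 * k)"
      by (simp_all add: power_mult_distrib D_def)
    have "D > 0" by (simp add: D_def)
    define f1 f2 X where "f1 = (fact k :: real)" and "f2 = (fact (2 * k) :: real)" and "X = x ^ (2 * k)"
    have "f1 > 0" "f2 > 0" "X > 0" using assms by (auto simp: f1_def f2_def X_def)
    then have "f2 / (2 * x * (D * X)) * ((sqrt pi * (f2 / (D * f1)) / f1)\<^sup>2 / 2) = pi / 2 * (1 / (2 * x) * (f2 ^ 3 / (f1 ^ 4 * (D ^ 3 * X))))"
      using assms \<open>D > 0\<close>
      by (simp add: power_divide power_mult_distrib field_simps power2_eq_square power3_eq_cube power4_eq_xxxx)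
    then show ?thesis unfolding t_def G F power_Suc p f1_def f2_def X_def D_def .
  qed
  have sumt: "(\<Sum>k<N. t k) = pi / 2 * (1 / (2 * x) * (\<Sum>k<N. (fact (2 * k)) ^ 3 / ((fact k) ^ 4 * (8 * x) ^ (2 * k))))"
    unfolding tk by (simp add: sum_distrib_left)
  have s0: "(\<Sum>k<N. t k) \<ge> 0" by (intro sum_nonneg t0)
  have nn: "0 \<le> pi / 2 * (bessel_I0 x * bessel_K0 x)" using bessel_I0_nonneg bessel_K0_nn_integral(2)[OF assms(1)] by simp
  \<comment> \<open>\<open>V N\<close> is dominated by \<open>V 0\<close>, which is finite because
    the Bessel product is a real number. Only then can the sum be subtracted.\<close>
  have VN: "V N = ennreal (enn2real (V N))"
  proof -
    have "V N \<le> V 0" unfolding V0 by simp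
    then have "V N < \<top>" unfolding V0' using ennreal_less_top le_less_trans by blast
    then show ?thesis by simp
  qed
  have "ennreal (pi / 2 * (bessel_I0 x * bessel_K0 x)) = ennreal (enn2real (V N) + (\<Sum>k<N. t k))"
    using V0 V0' VN s0 by (metis enn2real_nonneg ennreal_plus)
  then have "pi / 2 * (bessel_I0 x * bessel_K0 x) = enn2real (V N) + (\<Sum>k<N. t k)"
    using nn s0 by (subst (asm) ennreal_inj) auto
  then have r: "enn2real (V N) = pi / 2 * remainder_IK N x"
    unfolding sumt remainder_IK_def by (simp add: algebra_simps)
  with VN have "V N = ennreal (pi / 2 * remainder_IK N x)" by (simp only:)
  then show "(\<integral>\<^sup>+y\<in>{1<..}. ennreal (agm_inv y) * (\<integral>\<^sup>+v\<in>{0<..<1}. ennreal (pv_integrand N (x * y) v) \<partial>lborel) \<partial>lborel) = ennreal (pi / 2 * remainder_IK N x)"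
    by (simp only: V_def)
  have "pi / 2 * remainder_IK N x \<ge> 0" unfolding r[symmetric] by simp
  then show "remainder_IK N x \<ge> 0" using pi_gt_zero by (auto simp: zero_le_mult_iff)
qed

section \<open>The coefficients \<open>c\<^sub>j\<close>\<close>

text \<open>Once the earlier coefficients vanish, the expansion truncated after index n says that
  d(n) \<phi>(n) is O(\<phi>(n+1)), hence o(\<phi>(n)).\<close>

lemma asymptotic_coeffs_zero:
  fixes \<phi> :: "nat \<Rightarrow> real \<Rightarrow> real" and d :: "nat \<Rightarrow> real"
  assumes F: "F \<noteq> bot"
    and small: "\<And>n. \<phi> (Suc n) \<in> o[F](\<phi> n)"
    and nz: "\<And>n. eventually (\<lambda>x. \<phi> n x \<noteq> 0) F"
    and expn: "\<And>M. M \<ge> 1 \<Longrightarrow> (\<lambda>x. \<Sum>j<M. d j * \<phi> j x) \<in> O[F](\<phi> M)"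
  shows "d n = 0"
proof (induction n rule: less_induct)
  case (less n)
  have "(\<lambda>x. \<Sum>j<Suc n. d j * \<phi> j x) = (\<lambda>x. d n * \<phi> n x)"
    using less by (simp add: fun_eq_iff)
  with expn[of "Suc n"] have "(\<lambda>x. d n * \<phi> n x) \<in> O[F](\<phi> (Suc n))" by simp
  then have *: "(\<lambda>x. d n * \<phi> n x) \<in> o[F](\<phi> n)"
    using small by (rule landau_o.big_small_trans)
  show ?case
  proof (rule ccontr)
    assume "d n \<noteq> 0"
    then have "\<phi> n \<in> o[F](\<phi> n)" using * by simp
    then have "eventually (\<lambda>x. \<phi> n x = 0) F" by (simp add: landau_o.small_refl_iff)
    with nz[of n] have "eventually (\<lambda>x. False) F" by eventually_elim simp
    then show False using F by simp
  qed
qed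

text \<open>Resolves all three definite descriptions, with inverse factorials and inverse powers at
  infinity and with powers at 0 as the scale.\<close>

lemma asymptotic_coeffs_unique:
  fixes \<phi> :: "nat \<Rightarrow> real \<Rightarrow> real" and a b :: "nat \<Rightarrow> real"
  assumes F: "F \<noteq> bot"
    and small: "\<And>n. \<phi> (Suc n) \<in> o[F](\<phi> n)"
    and nz: "\<And>n. eventually (\<lambda>x. \<phi> n x \<noteq> 0) F"
    and a: "\<And>M. M \<ge> 1 \<Longrightarrow> (\<lambda>x. f x - (\<Sum>j<M. a j * \<phi> j x)) \<in> O[F](\<phi> M)"
    and b: "\<And>M. M \<ge> 1 \<Longrightarrow> (\<lambda>x. f x - (\<Sum>j<M. b j * \<phi> j x)) \<in> O[F](\<phi> M)"
  shows "a = b"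
proof
  fix n
  have "(\<lambda>j. b j - a j) n = 0"
  proof (rule asymptotic_coeffs_zero[where \<phi>=\<phi> and F=F and d="\<lambda>j. b j - a j", OF F small nz])
    fix M :: nat assume "M \<ge> 1"
    have "(\<lambda>x. (f x - (\<Sum>j<M. a j * \<phi> j x)) - (f x - (\<Sum>j<M. b j * \<phi> j x))) \<in> O[F](\<phi> M)"
      using a[OF \<open>M \<ge> 1\<close>] b[OF \<open>M \<ge> 1\<close>] by (rule sum_in_bigo(2))
    then show "(\<lambda>x. \<Sum>j<M. (b j - a j) * \<phi> j x) \<in> O[F](\<phi> M)"
      by (simp add: sum_subtractf left_diff_distrib)
  qed
  then show "a n = b n" by simp
qed

section \<open>Taylor expansion of the reciprocal arithmetic-geometric mean at 1\<close>

text \<open>The bound is global in h \<ge> 0, although the binomial series converges only for small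
  h: in Lagrange's form of the remainder, the derivative is largest in absolute value at 0.\<close>

lemma inverse_sqrt_remainder:
  fixes h :: real
  assumes "h \<ge> 0"
  shows "\<bar>1 / sqrt (1 + h) - (\<Sum>i<M. (- 1) ^ i * pochhammer (1/2) i / fact i * h ^ i)\<bar> \<le> pochhammer (1/2) M / fact M * h ^ M"
proof (cases "h = 0 \<or> M = 0")
  case True
  then show ?thesis
  proof
    assume "h = 0" then show ?thesis by (cases M) (auto simp: power_0_left lessThan_Suc_eq_insert_0 sum.reindex)
  next
    assume "M = 0" then show ?thesis using assms by (simp add: divide_le_eq)
  qed
next
  case False
  define D where "D = (\<lambda>m t. (- 1) ^ m * pochhammer (1/2) m * (1 + t) powr (- 1/2 - real m))"
  have "\<exists>t. 0 < t \<and> t < h \<and> D 0 h = (\<Sum>m<M. D m 0 / fact m * h ^ m) + D M t / fact M * h ^ M"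
  proof (rule Maclaurin)
    show "\<forall>m t. m < M \<and> 0 \<le> t \<and> t \<le> h \<longrightarrow> (D m has_real_derivative D (Suc m) t) (at t)"
    proof (intro allI impI)
      fix m t assume "m < M \<and> 0 \<le> t \<and> t \<le> h"
      then have "((\<lambda>t. (1 + t) powr (- 1/2 - real m)) has_real_derivative (- 1/2 - real m) * (1 + t) powr (- 1/2 - real m - 1)) (at t)"
        by (auto intro!: derivative_eq_intros)
      note DERIV_cmult[OF this, of "(- 1) ^ m * pochhammer (1/2) m"]
      moreover have "- 1/2 - real (Suc m) = - 1/2 - real m - 1" by simp
      then have "(- 1) ^ m * pochhammer (1/2) m * ((- 1/2 - real m) * (1 + t) powr (- 1/2 - real m - 1)) = D (Suc m) t"
        unfolding D_def pochhammer_Suc power_Suc by (simp add: algebra_simps)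
      ultimately show "(D m has_real_derivative D (Suc m) t) (at t)"
        by (simp only: D_def)
    qed
  qed (use False assms in auto)
  then obtain t where t: "0 < t" "D 0 h = (\<Sum>m<M. D m 0 / fact m * h ^ m) + D M t / fact M * h ^ M" by blast
  have "D 0 h = 1 / sqrt (1 + h)"
  proof -
    have "(1 + h) powr (- (1/2)) = 1 / sqrt (1 + h)"
      using assms by (simp add: powr_minus_divide powr_half_sqrt)
    then show ?thesis by (simp add: D_def)
  qed
  moreover have "(\<Sum>m<M. D m 0 / fact m * h ^ m) = (\<Sum>i<M. (- 1) ^ i * pochhammer (1/2) i / fact i * h ^ i)"
    by (simp add: D_def)
  moreover have "\<bar>D M t / fact M * h ^ M\<bar> \<le> pochhammer (1/2) M / fact M * h ^ M"
  proof -
    have "(1 + t) powr (- 1/2 - real M) \<le> (1 + t) powr 0" using t by (intro powr_mono) auto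
    then have "\<bar>D M t\<bar> \<le> pochhammer (1/2) M * 1"
      unfolding D_def abs_mult using t by (intro mult_mono) (auto simp: power_abs pochhammer_nonneg)
    then show ?thesis using assms by (simp add: abs_mult divide_right_mono mult_right_mono)
  qed
  ultimately show ?thesis using t(2) by linarith
qed

lemma agm_inv_integral:
  assumes "y \<ge> 1"
  shows "((\<lambda>\<theta>. 2 / pi * (1 / sqrt (1 + (y\<^sup>2 - 1) * (cos \<theta>)\<^sup>2))) has_integral agm_inv y) {0..pi/2}"
proof -
  have r: "1 + (y\<^sup>2 - 1) * (cos \<theta>)\<^sup>2 = y\<^sup>2 * (cos \<theta>)\<^sup>2 + (sin \<theta>)\<^sup>2" for \<theta>
    using sin_squared_eq[of \<theta>] by (simp add: algebra_simps)
  have pos: "1 + (y\<^sup>2 - 1) * (cos \<theta>)\<^sup>2 \<ge> 1" for \<theta> unfolding r by (rule agm_radicand_ge_1[OF assms])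
  have "continuous_on {0..pi/2} (\<lambda>\<theta>. 2 / pi * (1 / sqrt (1 + (y\<^sup>2 - 1) * (cos \<theta>)\<^sup>2)))"
  proof (intro continuous_intros ballI)
    fix \<theta> show "sqrt (1 + (y\<^sup>2 - 1) * (cos \<theta>)\<^sup>2) \<noteq> 0" using pos[of \<theta>] by (metis real_sqrt_eq_0_iff not_one_le_zero)
  qed
  then have "(\<lambda>\<theta>. 2 / pi * (1 / sqrt (1 + (y\<^sup>2 - 1) * (cos \<theta>)\<^sup>2))) integrable_on {0..pi/2}"
    by (rule integrable_continuous_real)
  then obtain I where I: "((\<lambda>\<theta>. 2 / pi * (1 / sqrt (1 + (y\<^sup>2 - 1) * (cos \<theta>)\<^sup>2))) has_integral I) {0..pi/2}"
    by blast
  have nn: "0 \<le> 2 / pi * (1 / sqrt (1 + (y\<^sup>2 - 1) * (cos \<theta>)\<^sup>2))" for \<theta>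
    using pos[of \<theta>] by (intro mult_nonneg_nonneg) auto
  have "(\<integral>\<^sup>+\<theta>\<in>{0<..<pi/2}. ennreal (2 / pi * (1 / sqrt (1 + (y\<^sup>2 - 1) * (cos \<theta>)\<^sup>2))) \<partial>lborel) = ennreal I"
    by (rule nn_integral_has_integral_on) (use I nn in \<open>auto simp: has_integral_Icc_iff_Ioo\<close>)
  moreover have "I \<ge> 0" by (rule has_integral_nonneg[OF I]) (use nn in auto)
  ultimately have "agm_inv y = I" unfolding agm_inv_def by (simp add: r)
  then show ?thesis using I by simp
qed

text \<open>The radicand is 1 + (y^2 - 1) cos^2 \<theta>, so the bound of
  \<open>inverse_sqrt_remainder\<close> with h = (y^2 - 1) cos^2 \<theta> is integrated over
  \<theta>. It inherits validity for every y \<ge> 1.\<close>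

lemma agm_inv_expansion_square:
  obtains e :: "nat \<Rightarrow> real" where "\<And>M. \<exists>C\<ge>0. \<forall>y\<ge>1. \<bar>agm_inv y - (\<Sum>i<M. e i * (y\<^sup>2 - 1) ^ i)\<bar> \<le> C * (y\<^sup>2 - 1) ^ M"
proof -
  define c where "c = (\<lambda>i. integral {0..pi/2} (\<lambda>\<theta>. (cos \<theta>) ^ (2 * i)))"
  define b where "b = (\<lambda>i. 2 / pi * ((- 1) ^ i * pochhammer (1/2) i / fact i) :: real)"
  have ci: "((\<lambda>\<theta>. (cos \<theta>) ^ (2 * i)) has_integral c i) {0..pi/2}" for i
    unfolding c_def by (intro integrable_integral integrable_continuous_real continuous_intros)
  show ?thesis
  proof (rule that[of "\<lambda>i. b i * c i"], intro exI conjI allI impI)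
    fix M :: nat and y :: real assume y: "y \<ge> 1"
    define k where "k = y\<^sup>2 - 1"
    have k: "k \<ge> 0" using y by (simp add: k_def)
    let ?C = "pochhammer (1/2) M / fact M :: real"
    have S: "((\<lambda>\<theta>. \<Sum>i<M. (b i * k ^ i) * (cos \<theta>) ^ (2 * i)) has_integral (\<Sum>i<M. (b i * k ^ i) * c i)) {0..pi/2}"
      by (intro has_integral_sum has_integral_mult_right ci) auto
    have I: "((\<lambda>\<theta>. 2 / pi * (1 / sqrt (1 + k * (cos \<theta>)\<^sup>2)) - (\<Sum>i<M. (b i * k ^ i) * (cos \<theta>) ^ (2 * i))) has_integral (agm_inv y - (\<Sum>i<M. (b i * k ^ i) * c i))) {0..pi/2}"
      using has_integral_diff[OF agm_inv_integral[OF y] S] by (simp add: k_def)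
    have "norm (agm_inv y - (\<Sum>i<M. (b i * k ^ i) * c i)) \<le> (2 / pi * (?C * k ^ M)) * measure lborel (cbox 0 (pi/2))"
    proof (rule has_integral_bound[where f="\<lambda>\<theta>. 2 / pi * (1 / sqrt (1 + k * (cos \<theta>)\<^sup>2)) - (\<Sum>i<M. (b i * k ^ i) * (cos \<theta>) ^ (2 * i))"])
      show "0 \<le> 2 / pi * (?C * k ^ M)" using k by (simp add: pochhammer_nonneg)
      fix \<theta> :: real
      define h where "h = k * (cos \<theta>)\<^sup>2"
      have h: "0 \<le> h" "h \<le> k" using k mult_left_mono[of "(cos \<theta>)\<^sup>2" 1 k] by (auto simp: h_def abs_square_le_1)
      have "2 / pi * (1 / sqrt (1 + k * (cos \<theta>)\<^sup>2)) - (\<Sum>i<M. (b i * k ^ i) * (cos \<theta>) ^ (2 * i)) = 2 / pi * (1 / sqrt (1 + h) - (\<Sum>i<M. (- 1) ^ i * pochhammer (1/2) i / fact i * h ^ i))"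
      proof -
        have "(b i * k ^ i) * (cos \<theta>) ^ (2 * i) = 2 / pi * ((- 1) ^ i * pochhammer (1/2) i / fact i * h ^ i)" for i
          unfolding h_def power_mult_distrib power_mult[of "cos \<theta>" 2 i] b_def by (simp only: mult_ac)
        then show ?thesis by (simp add: h_def right_diff_distrib sum_distrib_left)
      qed
      also have "norm \<dots> \<le> 2 / pi * (?C * h ^ M)"
        unfolding real_norm_def abs_mult using inverse_sqrt_remainder[OF h(1), of M] by (intro mult_mono) auto
      also have "\<dots> \<le> 2 / pi * (?C * k ^ M)"
        using h by (intro mult_left_mono power_mono) (auto simp: pochhammer_nonneg)
      finally show "norm (2 / pi * (1 / sqrt (1 + k * (cos \<theta>)\<^sup>2)) - (\<Sum>i<M. (b i * k ^ i) * (cos \<theta>) ^ (2 * i))) \<le> 2 / pi * (?C * k ^ M)" .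
    qed (use I in auto)
    then show "\<bar>agm_inv y - (\<Sum>i<M. b i * c i * (y\<^sup>2 - 1) ^ i)\<bar> \<le> ?C * (y\<^sup>2 - 1) ^ M"
      by (simp add: k_def mult_ac)
  qed (simp add: pochhammer_nonneg)
qed

text \<open>With t = y - 1 one has y^2 - 1 = t (t + 2). Re-expanding in t leaves monomials of degree
  at least M and below 2M, and the old error (t (t + 2))^M behaves like t^M near 0 and like t^(2M)
  at infinity. The sum of the two powers covers all of these.\<close>

lemma agm_inv_expansion:
  obtains \<rho> :: "nat \<Rightarrow> real" where "\<And>M. \<exists>C\<ge>0. \<forall>y\<ge>1. \<bar>agm_inv y - (\<Sum>j<M. \<rho> j * (y - 1) ^ j)\<bar> \<le> C * ((y - 1) ^ M + (y - 1) ^ (2 * M))"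
proof -
  obtain e :: "nat \<Rightarrow> real" where e: "\<And>M. \<exists>C\<ge>0. \<forall>y\<ge>1. \<bar>agm_inv y - (\<Sum>i<M. e i * (y\<^sup>2 - 1) ^ i)\<bar> \<le> C * (y\<^sup>2 - 1) ^ M"
    using agm_inv_expansion_square by blast
  \<comment> \<open>The coefficient of t^(i+l) in e(i) (t (t + 2))^i.\<close>
  define a where "a = (\<lambda>i l. e i * real (i choose l) * 2 ^ (i - l))"
  define \<rho> where "\<rho> = (\<lambda>j. \<Sum>i\<le>j. a i (j - i))"
  have pw: "t ^ (M + d) \<le> t ^ M + t ^ (2 * M)" if "t \<ge> 0" "d \<le> M" for t :: real and M d
  proof (cases "t \<le> 1")
    case True
    then have "t ^ (M + d) \<le> t ^ M" using that by (intro power_decreasing) auto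
    then show ?thesis using that zero_le_power[of t "2 * M"] by linarith
  next
    case False
    then have "t ^ (M + d) \<le> t ^ (2 * M)" using that by (intro power_increasing) auto
    then show ?thesis using that zero_le_power[of t M] by linarith
  qed
  show ?thesis
  proof (rule that[of \<rho>])
    fix M :: nat
    obtain C where C: "C \<ge> 0" "\<And>y. y \<ge> 1 \<Longrightarrow> \<bar>agm_inv y - (\<Sum>i<M. e i * (y\<^sup>2 - 1) ^ i)\<bar> \<le> C * (y\<^sup>2 - 1) ^ M"
      using e[of M] by blast
    define P where "P = {(i, l). i < M \<and> l \<le> i}"
    have P_Sig: "P = Sigma {..<M} (\<lambda>i. {..i})" by (auto simp: P_def)
    have finP: "finite P" unfolding P_Sig by auto
    define C2 where "C2 = (\<Sum>(i, l)\<in>P. \<bar>a i l\<bar>)"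
    have C2: "C2 \<ge> 0" unfolding C2_def by (auto intro!: sum_nonneg)
    have bound: "\<bar>agm_inv y - (\<Sum>j<M. \<rho> j * (y - 1) ^ j)\<bar> \<le> (C * 3 ^ M + C2) * ((y - 1) ^ M + (y - 1) ^ (2 * M))" if y: "y \<ge> 1" for y
    proof -
      define t where "t = y - 1"
      have t: "t \<ge> 0" using y by (simp add: t_def)
      have yt: "y\<^sup>2 - 1 = t * (t + 2)" by (simp add: t_def power2_eq_square algebra_simps)
      have "(\<Sum>i<M. e i * (y\<^sup>2 - 1) ^ i) = (\<Sum>i<M. \<Sum>l\<le>i. a i l * t ^ (i + l))"
      proof (rule sum.cong)
        fix i
        have "(y\<^sup>2 - 1) ^ i = t ^ i * (\<Sum>l\<le>i. real (i choose l) * t ^ l * 2 ^ (i - l))"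
          unfolding yt power_mult_distrib binomial_ring[of t 2 i] by simp
        then show "e i * (y\<^sup>2 - 1) ^ i = (\<Sum>l\<le>i. a i l * t ^ (i + l))"
          by (simp add: a_def sum_distrib_left power_add mult_ac)
      qed simp
      also have "\<dots> = (\<Sum>(i, l)\<in>P. a i l * t ^ (i + l))"
        unfolding P_Sig by (simp add: sum.Sigma)
      also have "\<dots> = (\<Sum>(i, l)\<in>{p \<in> P. fst p + snd p < M}. a i l * t ^ (i + l)) + (\<Sum>(i, l)\<in>{p \<in> P. \<not> fst p + snd p < M}. a i l * t ^ (i + l))"
        by (subst sum.union_disjoint[symmetric]) (auto intro!: sum.cong simp: finP)
      also have "(\<Sum>(i, l)\<in>{p \<in> P. fst p + snd p < M}. a i l * t ^ (i + l)) = (\<Sum>j<M. \<rho> j * t ^ j)"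
      proof -
        have "(\<Sum>j<M. \<rho> j * t ^ j) = (\<Sum>j<M. \<Sum>i\<le>j. a i (j - i) * t ^ (i + (j - i)))"
          by (simp add: \<rho>_def sum_distrib_right)
        also have "\<dots> = (\<Sum>(j, i)\<in>Sigma {..<M} (\<lambda>j. {..j}). a i (j - i) * t ^ (i + (j - i)))"
          by (rule sum.Sigma) auto
        also have "\<dots> = (\<Sum>(i, l)\<in>{(i, l). i + l < M}. a i l * t ^ (i + l))"
          by (rule sum.reindex_bij_witness[of _ "\<lambda>(i, l). (i + l, i)" "\<lambda>(j, i). (i, j - i)"]) auto
        also have "\<dots> = (\<Sum>(i, l)\<in>{p \<in> P. fst p + snd p < M}. a i l * t ^ (i + l))"
        \<comment> \<open>Pairs with l > i lie outside \<open>P\<close>, but their binomial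
          coefficient is 0.\<close>
        proof (rule sum.mono_neutral_right)
          have "{(i, l). i + l < M} \<subseteq> {..<M} \<times> {..<M}" by auto
          then show "finite {(i, l). i + l < M}" by (rule finite_subset) auto
        qed (auto simp: P_def a_def)
        finally show ?thesis ..
      qed
      finally have eq: "(\<Sum>i<M. e i * (y\<^sup>2 - 1) ^ i) = (\<Sum>j<M. \<rho> j * t ^ j) + (\<Sum>(i, l)\<in>{p \<in> P. \<not> fst p + snd p < M}. a i l * t ^ (i + l))" .
      have "\<bar>\<Sum>(i, l)\<in>{p \<in> P. \<not> fst p + snd p < M}. a i l * t ^ (i + l)\<bar> \<le> (\<Sum>(i, l)\<in>{p \<in> P. \<not> fst p + snd p < M}. \<bar>a i l\<bar> * (t ^ M + t ^ (2 * M)))"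
      proof (rule order_trans[OF sum_abs], rule sum_mono)
        fix p assume p: "p \<in> {p \<in> P. \<not> fst p + snd p < M}"
        obtain i l where il: "p = (i, l)" by (cases p)
        have "t ^ (i + l) \<le> t ^ M + t ^ (2 * M)"
          using pw[OF t, of "i + l - M" M] p by (auto simp: il P_def)
        then show "\<bar>case p of (i, l) \<Rightarrow> a i l * t ^ (i + l)\<bar> \<le> (case p of (i, l) \<Rightarrow> \<bar>a i l\<bar> * (t ^ M + t ^ (2 * M)))"
          using t by (auto simp: il abs_mult intro!: mult_left_mono)
      qed
      also have "\<dots> \<le> (\<Sum>(i, l)\<in>P. \<bar>a i l\<bar> * (t ^ M + t ^ (2 * M)))"
        using t by (intro sum_mono2 finP) auto
      also have "\<dots> = C2 * (t ^ M + t ^ (2 * M))"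
        by (simp add: C2_def sum_distrib_right case_prod_unfold)
      finally have r: "\<bar>\<Sum>(i, l)\<in>{p \<in> P. \<not> fst p + snd p < M}. a i l * t ^ (i + l)\<bar> \<le> C2 * (t ^ M + t ^ (2 * M))" .
      have "(y\<^sup>2 - 1) ^ M \<le> 3 ^ M * (t ^ M + t ^ (2 * M))"
      proof (cases "t \<le> 1")
        case True
        have "t * (t + 2) \<le> t * 3" using True t by (intro mult_left_mono) auto
        then have "(y\<^sup>2 - 1) ^ M \<le> (3 * t) ^ M" unfolding yt using t by (intro power_mono) auto
        also have "\<dots> = 3 ^ M * t ^ M" by (simp add: power_mult_distrib)
        also have "\<dots> \<le> 3 ^ M * (t ^ M + t ^ (2 * M))" using t by (intro mult_left_mono) auto
        finally show ?thesis .
      next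
        case False
        have "t * (t + 2) \<le> 3 * (t * t)"
        proof -
          have "t * (t + 2) \<le> t * (3 * t)" using False t by (intro mult_left_mono) auto
          then show ?thesis by simp
        qed
        then have "(y\<^sup>2 - 1) ^ M \<le> (3 * (t * t)) ^ M" unfolding yt using t by (intro power_mono) auto
        also have "\<dots> = 3 ^ M * t ^ (2 * M)" by (simp add: power_mult_distrib power_mult power2_eq_square)
        also have "\<dots> \<le> 3 ^ M * (t ^ M + t ^ (2 * M))" using t by (intro mult_left_mono) auto
        finally show ?thesis .
      qed
      then have "C * (y\<^sup>2 - 1) ^ M \<le> C * (3 ^ M * (t ^ M + t ^ (2 * M)))" using C(1) by (intro mult_left_mono)
      then have "\<bar>agm_inv y - (\<Sum>j<M. \<rho> j * t ^ j)\<bar> \<le> C * (3 ^ M * (t ^ M + t ^ (2 * M))) + C2 * (t ^ M + t ^ (2 * M))"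
        using C(2)[OF y] r unfolding eq by linarith
      then show ?thesis unfolding t_def by (simp add: algebra_simps)
    qed
    show "\<exists>C\<ge>0. \<forall>y\<ge>1. \<bar>agm_inv y - (\<Sum>j<M. \<rho> j * (y - 1) ^ j)\<bar> \<le> C * ((y - 1) ^ M + (y - 1) ^ (2 * M))"
      using bound C(1) C2 by (intro exI[of _ "C * 3 ^ M + C2"]) auto
  qed
qed

section \<open>Mellin moments and the inverse factorial series\<close>

text \<open>Putting p = 1/y gives a Beta integral with parameters 2s - j and j + 1. The factor
  (-1)^j compensates the sign of (1 - 2s)_j, all of whose factors are negative. Thus the inverse
  factorials are, up to constants and 1/(2s), the moments of (y - 1)^j, which is what ties the
  series for c to the Taylor series of \<open>agm_inv\<close>.\<close>

lemma shifted_power_moment: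
  fixes s :: real
  assumes "2 * s > real j"
  shows "has_bochner_integral lborel (\<lambda>y. indicator {1<..} y * ((y - 1) ^ j * y powr (- 2 * s - 1)))
           ((- 1) ^ j * fact j / (2 * s * pochhammer (1 - 2 * s) j))"
proof -
  have s: "s > 0" using assms by linarith
  let ?f = "\<lambda>y. (y - 1) ^ j * y powr (- 2 * s - 1)"
  have im: "(\<lambda>p. 1 / p) ` {0<..<1} = {1::real<..}"
  proof (intro set_eqI iffI)
    fix u :: real assume "u \<in> {1<..}"
    then show "u \<in> (\<lambda>v. 1 / v) ` {0<..<1}" by (intro image_eqI[of _ _ "1 / u"]) auto
  qed auto
  have "(\<integral>\<^sup>+p\<in>{0<..<1}. ennreal (\<bar>- (1 / p\<^sup>2)\<bar> * ?f (1 / p)) \<partial>lborel) = (\<integral>\<^sup>+y\<in>(\<lambda>p. 1 / p) ` {0<..<1}. ennreal (?f y) \<partial>lborel)"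
  proof (rule nn_integral_substitution_inj[where f="?f" and g="\<lambda>p. 1 / p" and g'="\<lambda>p. - (1 / p\<^sup>2)"])
    show "(\<lambda>p::real. 1 / p) ` {0<..<1} \<in> sets borel" unfolding im by simp
    show "?f u \<ge> 0" if "u \<in> (\<lambda>v. 1 / v) ` {0<..<1}" for u using that unfolding im by simp
    show "((\<lambda>v. 1 / v) has_field_derivative - (1 / y\<^sup>2)) (at y)" if "y \<in> {0<..<1}" for y :: real
      using that by (auto intro!: derivative_eq_intros simp: power2_eq_square)
    show "continuous_on {0<..<1::real} (\<lambda>v. - (1 / v\<^sup>2))" by (intro continuous_intros) auto
  qed (auto intro!: inj_onI)
  moreover have "\<bar>- (1 / p\<^sup>2)\<bar> * ?f (1 / p) = p powr (2 * s - real j - 1) * (1 - p) powr (real (Suc j) - 1)" if "0 < p" "p < 1" for p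
  proof -
    have 1: "(1 / p - 1) ^ j = (1 - p) ^ j * p powr (- real j)"
    proof -
      have "1 / p - 1 = (1 - p) / p" using that by (simp add: field_simps)
      then show ?thesis using that by (simp add: power_divide powr_minus powr_realpow divide_inverse power_mult_distrib power_inverse)
    qed
    have 2: "1 / p\<^sup>2 = p powr (- 2)" using that by (simp add: powr_minus_divide powr_numeral)
    have "(1 / p) powr (- 2 * s - 1) = (p powr (- 1)) powr (- 2 * s - 1)" using that by (simp add: powr_minus_divide)
    also have "\<dots> = p powr (- 1 * (- 2 * s - 1))" by (simp only: powr_powr)
    also have "- 1 * (- 2 * s - 1) = 2 * s + 1" by simp
    finally have 3: "(1 / p) powr (- 2 * s - 1) = p powr (2 * s + 1)" .
    have "\<bar>- (1 / p\<^sup>2)\<bar> * ?f (1 / p) = p powr (- 2) * ((1 - p) ^ j * p powr (- real j) * p powr (2 * s + 1))"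
      unfolding 1 3 abs_minus_cancel 2 by simp
    also have "\<dots> = (1 - p) ^ j * p powr (- 2 + - real j + (2 * s + 1))" by (simp only: powr_add mult_ac)
    also have "- 2 + - real j + (2 * s + 1) = 2 * s - real j - 1" by simp
    also have "(1 - p) ^ j = (1 - p) powr (real (Suc j) - 1)" using that by (simp add: powr_realpow)
    finally show ?thesis by simp
  qed
  then have "(\<integral>\<^sup>+p\<in>{0<..<1}. ennreal (\<bar>- (1 / p\<^sup>2)\<bar> * ?f (1 / p)) \<partial>lborel) = (\<integral>\<^sup>+p\<in>{0<..<1}. ennreal (p powr ((2 * s - real j) - 1) * (1 - p) powr (real (Suc j) - 1)) \<partial>lborel)"
    by (intro nn_integral_cong) (auto simp: indicator_def)
  moreover have "\<dots> = ennreal (Beta (2 * s - real j) (real (Suc j)))"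
    using assms by (intro nn_integral_Beta) auto
  ultimately have I: "(\<integral>\<^sup>+y\<in>{1<..}. ennreal (?f y) \<partial>lborel) = ennreal (Beta (2 * s - real j) (real (Suc j)))"
    unfolding im by simp
  have np: "2 * s - real j \<notin> \<int>\<^sub>\<le>\<^sub>0" using assms nonpos_Ints_nonpos[of "2 * s - real j"] by auto
  have ph: "pochhammer (1 - 2 * s) j = (- 1) ^ j * pochhammer (2 * s - real j) j"
    using pochhammer_minus[of "2 * s - 1" j] by simp
  have pp: "pochhammer (2 * s - real j) j > 0" using assms by (intro pochhammer_pos) auto
  have B: "Beta (2 * s - real j) (real (Suc j)) = (- 1) ^ j * fact j / (2 * s * pochhammer (1 - 2 * s) j)"
  proof -
    have g: "Gamma (2 * s - real j) > 0" using assms by (intro Gamma_real_pos) auto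
    have "pochhammer (2 * s - real j) j = Gamma (2 * s) / Gamma (2 * s - real j)"
      using pochhammer_Gamma[OF np, of j] by simp
    then have G2: "Gamma (2 * s) = pochhammer (2 * s - real j) j * Gamma (2 * s - real j)" using g by simp
    have "Gamma (2 * s + 1) = 2 * s * Gamma (2 * s)" using s by (intro Gamma_plus1) (auto dest: nonpos_Ints_nonpos)
    moreover have "Gamma (real (Suc j)) = fact j" using Gamma_fact[of j, where 'a=real] by (simp add: add.commute)
    moreover have "2 * s - real j + real (Suc j) = 2 * s + 1" by simp
    ultimately have "Beta (2 * s - real j) (real (Suc j)) = Gamma (2 * s - real j) * fact j / (2 * s * Gamma (2 * s))"
      unfolding Beta_def by (simp only:)
    also have "\<dots> = fact j / (2 * s * pochhammer (2 * s - real j) j)"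
      unfolding G2 using g by simp
    finally have "Beta (2 * s - real j) (real (Suc j)) = fact j / (2 * s * pochhammer (2 * s - real j) j)" .
    also have "\<dots> = (- 1) ^ j * fact j / (2 * s * pochhammer (1 - 2 * s) j)"
      unfolding ph by (cases "even j") auto
    finally show ?thesis .
  qed
  have nn: "(- 1) ^ j * fact j / (2 * s * pochhammer (1 - 2 * s) j) \<ge> 0"
    unfolding ph using pp s by (cases "even j") auto
  show "has_bochner_integral lborel (\<lambda>y. indicator {1<..} y * ((y - 1) ^ j * y powr (- 2 * s - 1)))
           ((- 1) ^ j * fact j / (2 * s * pochhammer (1 - 2 * s) j))"
  proof (rule has_bochner_integral_nn_integral)
    have "(\<integral>\<^sup>+y. ennreal (indicator {1<..} y * ?f y) \<partial>lborel) = (\<integral>\<^sup>+y\<in>{1<..}. ennreal (?f y) \<partial>lborel)"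
      by (intro nn_integral_cong) (auto simp: indicator_def)
    then show "(\<integral>\<^sup>+y. ennreal (indicator {1<..} y * ?f y) \<partial>lborel) = ennreal ((- 1) ^ j * fact j / (2 * s * pochhammer (1 - 2 * s) j))"
      unfolding I B .
    show "AE y in lborel. 0 \<le> indicator {1<..} y * ?f y" by (intro AE_I2) (auto simp: indicator_def)
  qed (use nn in auto)
qed

lemma bigo_cmult:
  fixes c :: real
  assumes "f \<in> O[F](g)"
  shows "(\<lambda>x. c * f x) \<in> O[F](g)"
  using assms by (cases "c = 0") auto

lemma inverse_pochhammer_bigtheta:
  "(\<lambda>s::real. 1 / pochhammer (1 - 2 * s) j) \<in> \<Theta>[at_top](\<lambda>s. 1 / s ^ j)"
proof (induction j)
  case (Suc j)
  have "(\<lambda>s::real. 1 / (1 - 2 * s + real j)) \<in> \<Theta>[at_top](\<lambda>s. 1 / s)" by real_asymp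
  from landau_theta.mult[OF Suc this] show ?case by (simp add: pochhammer_Suc mult.commute)
qed simp

lemma inverse_factorial_scale:
  shows "(\<lambda>s::real. 1 / pochhammer (1 - 2 * s) (Suc n)) \<in> o[at_top](\<lambda>s. 1 / pochhammer (1 - 2 * s) n)"
    and "eventually (\<lambda>s::real. 1 / pochhammer (1 - 2 * s) n \<noteq> 0) at_top"
proof -
  have "(\<lambda>s::real. 1 / s ^ Suc n) \<in> o[at_top](\<lambda>s. 1 / s ^ n)"
  proof -
    have "(\<lambda>s::real. 1 / s * (1 / s ^ n)) \<in> o[at_top](\<lambda>s. 1 * (1 / s ^ n))"
      by (rule landau_o.small_big_mult) (real_asymp, simp)
    then show ?thesis by simp
  qed
  then show "(\<lambda>s::real. 1 / pochhammer (1 - 2 * s) (Suc n)) \<in> o[at_top](\<lambda>s. 1 / pochhammer (1 - 2 * s) n)"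
    by (simp only: landau_o.small.cong_bigtheta[OF inverse_pochhammer_bigtheta] landau_o.small.in_cong_bigtheta[OF inverse_pochhammer_bigtheta])
  have "eventually (\<lambda>s::real. 2 * s > real n + 1) at_top" by real_asymp
  then show "eventually (\<lambda>s::real. 1 / pochhammer (1 - 2 * s) n \<noteq> 0) at_top"
  proof eventually_elim
    case (elim s)
    then have "pochhammer (1 - 2 * s) n \<noteq> 0" by (auto simp: pochhammer_eq_0_iff)
    then show ?case by simp
  qed
qed

lemma inverse_factorial_coeffs_unique:
  assumes "inverse_factorial_coeffs a" "inverse_factorial_coeffs b"
  shows "a = b"
proof (rule asymptotic_coeffs_unique[where F=at_top and \<phi>="\<lambda>n s. 1 / pochhammer (1 - 2 * s) n"
    and f="\<lambda>s::real. 1 / s * (Gamma (s + 1/2) / Gamma s)\<^sup>2"])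
qed (use assms inverse_factorial_scale in \<open>simp_all add: inverse_factorial_coeffs_def\<close>)

text \<open>\<open>agm_inv_moment\<close> rewritten by Gamma (s + 1) = s Gamma s, which exposes the
  function expanded in \<open>inverse_factorial_coeffs\<close> with the prefactor 1/(2s).\<close>

lemma agm_moment_bochner:
  fixes s :: real
  assumes "s > 0"
  shows "has_bochner_integral lborel (\<lambda>y. indicator {1<..} y * (agm_inv y * y powr (- 2 * s - 1)))
           (1 / (2 * s) * (1 / s * (Gamma (s + 1/2) / Gamma s)\<^sup>2))"
proof (rule has_bochner_integral_nn_integral)
  have "Gamma (s + 1) = s * Gamma s" using assms by (intro Gamma_plus1) (auto dest: nonpos_Ints_nonpos)
  then have "(Gamma (s + 1/2) / Gamma (s + 1))\<^sup>2 / 2 = 1 / (2 * s) * (1 / s * (Gamma (s + 1/2) / Gamma s)\<^sup>2)"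
    by (simp add: power_divide power_mult_distrib power2_eq_square)
  moreover have "(\<integral>\<^sup>+y. ennreal (indicator {1<..} y * (agm_inv y * y powr (- 2 * s - 1))) \<partial>lborel)
      = (\<integral>\<^sup>+y\<in>{1<..}. ennreal (agm_inv y * y powr (- 2 * s - 1)) \<partial>lborel)"
    by (intro nn_integral_cong) (auto simp: indicator_def)
  ultimately show "(\<integral>\<^sup>+y. ennreal (indicator {1<..} y * (agm_inv y * y powr (- 2 * s - 1))) \<partial>lborel) = ennreal (1 / (2 * s) * (1 / s * (Gamma (s + 1/2) / Gamma s)\<^sup>2))"
    using agm_inv_moment[of s] assms by simp
  show "AE y in lborel. 0 \<le> indicator {1<..} y * (agm_inv y * y powr (- 2 * s - 1))"
    by (intro AE_I2) (auto simp: indicator_def agm_inv_nonneg)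
qed (use assms in auto)

text \<open>Watson's lemma for moments: the Taylor bound is integrated against y^(-2s-1) and
  multiplied by 2s. Each Taylor term becomes a multiple of one inverse factorial, and of the two
  error moments the one of order 2M is the smaller. Uniqueness then evaluates the definite
  description.\<close>

lemma agm_expansion_coeffs:
  assumes \<rho>: "\<And>M. \<exists>C\<ge>0. \<forall>y\<ge>1. \<bar>agm_inv y - (\<Sum>j<M. \<rho> j * (y - 1) ^ j)\<bar> \<le> C * ((y - 1) ^ M + (y - 1) ^ (2 * M))"
  shows "c_coeff = (\<lambda>j. (- 1) ^ j * fact j * \<rho> j)"
proof -
  have "inverse_factorial_coeffs (\<lambda>j. (- 1) ^ j * fact j * \<rho> j)"
    unfolding inverse_factorial_coeffs_def
  proof (intro allI impI)
    fix M :: nat assume "M \<ge> 1"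
    obtain C where C: "C \<ge> 0" "\<And>y. y \<ge> 1 \<Longrightarrow> \<bar>agm_inv y - (\<Sum>j<M. \<rho> j * (y - 1) ^ j)\<bar> \<le> C * ((y - 1) ^ M + (y - 1) ^ (2 * M))"
      using \<rho>[of M] by blast
    define b where "b = (\<lambda>j s. (- 1) ^ j * fact j / (2 * s * pochhammer (1 - 2 * s) j) :: real)"
    define L where "L = (\<lambda>s::real. 1 / s * (Gamma (s + 1/2) / Gamma s)\<^sup>2)"
    \<comment> \<open>The condition 2s > 2M makes the moments of (y - 1)^M and of (y - 1)^(2M) both
      finite.\<close>
    have bnd: "\<bar>L s - (\<Sum>j<M. (- 1) ^ j * fact j * \<rho> j / pochhammer (1 - 2 * s) j)\<bar> \<le> 2 * s * (C * (b M s + b (2 * M) s))"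
      if s: "2 * s > real (2 * M)" for s
    proof -
      have s0: "s > 0" using s by (smt (verit) of_nat_0_le_iff)
      have I1: "has_bochner_integral lborel (\<lambda>y. indicator {1<..} y * (agm_inv y * y powr (- 2 * s - 1)) - (\<Sum>j<M. \<rho> j * (indicator {1<..} y * ((y - 1) ^ j * y powr (- 2 * s - 1)))))
         (1 / (2 * s) * L s - (\<Sum>j<M. \<rho> j * b j s))"
        unfolding L_def b_def using s
        by (intro has_bochner_integral_diff has_bochner_integral_sum has_bochner_integral_mult_right agm_moment_bochner[OF s0] shifted_power_moment) auto
      have I2: "has_bochner_integral lborel (\<lambda>y. C * (indicator {1<..} y * ((y - 1) ^ M * y powr (- 2 * s - 1)) + indicator {1<..} y * ((y - 1) ^ (2 * M) * y powr (- 2 * s - 1))))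
         (C * (b M s + b (2 * M) s))"
        unfolding b_def using s
        by (intro has_bochner_integral_add has_bochner_integral_mult_right shifted_power_moment) auto
      have "\<bar>1 / (2 * s) * L s - (\<Sum>j<M. \<rho> j * b j s)\<bar> \<le> C * (b M s + b (2 * M) s)"
        unfolding has_bochner_integral_integral_eq[OF I1, symmetric] has_bochner_integral_integral_eq[OF I2, symmetric] real_norm_def[symmetric]
      proof (rule order_trans[OF integral_norm_bound Bochner_Integration.integral_mono])
        fix y :: real
        show "norm (indicator {1<..} y * (agm_inv y * y powr (- 2 * s - 1)) - (\<Sum>j<M. \<rho> j * (indicator {1<..} y * ((y - 1) ^ j * y powr (- 2 * s - 1)))))
           \<le> C * (indicator {1<..} y * ((y - 1) ^ M * y powr (- 2 * s - 1)) + indicator {1<..} y * ((y - 1) ^ (2 * M) * y powr (- 2 * s - 1)))"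
        proof (cases "y > 1")
          case True
          have "agm_inv y * y powr (- 2 * s - 1) - (\<Sum>j<M. \<rho> j * ((y - 1) ^ j * y powr (- 2 * s - 1))) = (agm_inv y - (\<Sum>j<M. \<rho> j * (y - 1) ^ j)) * y powr (- 2 * s - 1)"
            by (simp add: left_diff_distrib sum_distrib_right mult.assoc)
          also have "\<bar>\<dots>\<bar> \<le> (C * ((y - 1) ^ M + (y - 1) ^ (2 * M))) * y powr (- 2 * s - 1)"
            unfolding abs_mult using C(2)[of y] True by (intro mult_mono) auto
          finally show ?thesis using True by (simp add: algebra_simps)
        qed simp
      qed (use I1 I2 in \<open>auto simp: has_bochner_integral_iff\<close>)
      then have "2 * s * \<bar>1 / (2 * s) * L s - (\<Sum>j<M. \<rho> j * b j s)\<bar> \<le> 2 * s * (C * (b M s + b (2 * M) s))"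
        using s0 by (intro mult_left_mono) auto
      moreover have "2 * s * \<bar>1 / (2 * s) * L s - (\<Sum>j<M. \<rho> j * b j s)\<bar> = \<bar>2 * s * (1 / (2 * s) * L s - (\<Sum>j<M. \<rho> j * b j s))\<bar>"
        using s0 by (simp add: abs_mult)
      moreover have "2 * s * (1 / (2 * s) * L s - (\<Sum>j<M. \<rho> j * b j s)) = L s - (\<Sum>j<M. (- 1) ^ j * fact j * \<rho> j / pochhammer (1 - 2 * s) j)"
        using s0 by (simp add: b_def right_diff_distrib sum_distrib_left mult_ac)
      ultimately show ?thesis by simp
    qed
    have "(\<lambda>s. L s - (\<Sum>j<M. (- 1) ^ j * fact j * \<rho> j / pochhammer (1 - 2 * s) j)) \<in> O[at_top](\<lambda>s. 2 * s * (C * (b M s + b (2 * M) s)))"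
    proof (rule bigoI[where c=1])
      have "eventually (\<lambda>s::real. 2 * s > real (2 * M)) at_top" by real_asymp
      then show "\<forall>\<^sub>F s in at_top. norm (L s - (\<Sum>j<M. (- 1) ^ j * fact j * \<rho> j / pochhammer (1 - 2 * s) j)) \<le> 1 * norm (2 * s * (C * (b M s + b (2 * M) s)))"
        by eventually_elim (use bnd in \<open>auto intro: order_trans[OF _ abs_ge_self]\<close>)
    qed
    also have "(\<lambda>s. 2 * s * (C * (b M s + b (2 * M) s))) \<in> O[at_top](\<lambda>s. 1 / pochhammer (1 - 2 * s) M)"
    proof -
      have e: "eventually (\<lambda>s. C * ((- 1) ^ M * fact M) * (1 / pochhammer (1 - 2 * s) M) + C * ((- 1) ^ (2 * M) * fact (2 * M)) * (1 / pochhammer (1 - 2 * s) (2 * M)) = 2 * s * (C * (b M s + b (2 * M) s))) at_top"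
        using eventually_gt_at_top[of "0::real"] by eventually_elim (simp add: b_def algebra_simps)
      have "(\<lambda>s::real. 1 / s ^ (2 * M)) \<in> O[at_top](\<lambda>s. 1 / s ^ M)"
      proof (rule bigoI[where c=1])
        show "\<forall>\<^sub>F s::real in at_top. norm (1 / s ^ (2 * M)) \<le> 1 * norm (1 / s ^ M)"
          using eventually_ge_at_top[of "1::real"]
          by eventually_elim (auto simp: power_abs intro!: divide_left_mono power_increasing)
      qed
      then have "(\<lambda>s::real. 1 / pochhammer (1 - 2 * s) (2 * M)) \<in> O[at_top](\<lambda>s. 1 / pochhammer (1 - 2 * s) M)"
        by (simp only: landau_o.big.cong_bigtheta[OF inverse_pochhammer_bigtheta] landau_o.big.in_cong_bigtheta[OF inverse_pochhammer_bigtheta])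
      then have "(\<lambda>s. C * ((- 1) ^ M * fact M) * (1 / pochhammer (1 - 2 * s) M) + C * ((- 1) ^ (2 * M) * fact (2 * M)) * (1 / pochhammer (1 - 2 * s) (2 * M))) \<in> O[at_top](\<lambda>s::real. 1 / pochhammer (1 - 2 * s) M)"
        by (intro sum_in_bigo bigo_cmult) auto
      then show ?thesis using landau_o.big.in_cong[OF e] by blast
    qed
    finally show "(\<lambda>s::real. 1 / s * (Gamma (s + 1/2) / Gamma s)\<^sup>2 - (\<Sum>j<M. (- 1) ^ j * fact j * \<rho> j / pochhammer (1 - 2 * s) j)) \<in> O[at_top](\<lambda>s. 1 / pochhammer (1 - 2 * s) M)"
      by (simp only: L_def)
  qed
  then show ?thesis unfolding c_coeff_def
    by (intro the_equality) (auto intro: inverse_factorial_coeffs_unique)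
qed

section \<open>The branch \<open>\<tau>(w)\<close>\<close>

text \<open>The exponent at the saddle point: e^(-Yv) v^Y = e^(-Y) e^(-Y phase v). It has its
  minimum 0 at v = 1 and equals w^2 / 2 on the branch.\<close>

definition phase :: "real \<Rightarrow> real" where "phase \<tau> = \<tau> - ln \<tau> - 1"

lemma phase_nonneg: "\<tau> > 0 \<Longrightarrow> phase \<tau> \<ge> 0"
  using ln_le_minus_one[of \<tau>] by (simp add: phase_def)

lemma phase_pos: "\<tau> > 0 \<Longrightarrow> \<tau> \<noteq> 1 \<Longrightarrow> phase \<tau> > 0"
  using ln_le_minus_one[of \<tau>] ln_eq_minus_one[of \<tau>] by (force simp: phase_def)

lemma phase_deriv: "\<tau> > 0 \<Longrightarrow> (phase has_field_derivative (1 - 1 / \<tau>)) (at \<tau>)"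
  unfolding phase_def by (auto intro!: derivative_eq_intros simp: divide_inverse)

lemma phase_strict_mono: "1 \<le> a \<Longrightarrow> a < b \<Longrightarrow> phase a < phase b"
proof (rule DERIV_pos_imp_increasing_open[of a b phase])
  assume "1 \<le> a" "a < b"
  show "continuous_on {a..b} phase"
    unfolding phase_def using \<open>1 \<le> a\<close> by (intro continuous_intros) auto
  show "\<exists>y. (phase has_real_derivative y) (at x) \<and> 0 < y" if "a < x" "x < b" for x
    using phase_deriv[of x] that \<open>1 \<le> a\<close> by (intro exI[of _ "1 - 1 / x"]) auto
qed

lemma phase_strict_antimono: "0 < a \<Longrightarrow> a < b \<Longrightarrow> b \<le> 1 \<Longrightarrow> phase b < phase a"
proof (rule DERIV_neg_imp_decreasing_open[of a b phase])
  assume "0 < a" "a < b" "b \<le> 1"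
  show "continuous_on {a..b} phase"
    unfolding phase_def using \<open>0 < a\<close> by (intro continuous_intros) auto
  show "\<exists>y. (phase has_real_derivative y) (at x) \<and> y < 0" if "a < x" "x < b" for x
    using phase_deriv[of x] that \<open>0 < a\<close> \<open>b \<le> 1\<close> by (intro exI[of _ "1 - 1 / x"]) (auto simp: field_simps)
qed

lemma w_branch_phase: "w_branch \<tau> = sgn (\<tau> - 1) * sqrt (2 * phase \<tau>)"
  by (simp add: w_branch_def phase_def)

lemma w_branch_square: "\<tau> > 0 \<Longrightarrow> (w_branch \<tau>)\<^sup>2 = 2 * phase \<tau>"
  using phase_nonneg[of \<tau>] by (cases "\<tau> = 1") (auto simp: w_branch_phase power_mult_distrib sgn_if phase_def)

lemma w_branch_1 [simp]: "w_branch 1 = 0" by (simp add: w_branch_def)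

lemma w_branch_strict_mono:
  assumes "0 < a" "a < b"
  shows "w_branch a < w_branch b"
proof -
  consider "b \<le> 1" | "1 \<le> a" | "a < 1" "1 < b" by linarith
  then show ?thesis
  proof cases
    case 1
    then have "sqrt (2 * phase b) < sqrt (2 * phase a)" using phase_strict_antimono[OF assms 1] by simp
    moreover have "sqrt (2 * phase b) \<ge> 0" using phase_nonneg assms by simp
    ultimately show ?thesis using 1 assms by (cases "b = 1") (auto simp: w_branch_phase)
  next
    case 2
    then have "sqrt (2 * phase a) < sqrt (2 * phase b)" using phase_strict_mono[OF 2 assms(2)] by simp
    moreover have "sqrt (2 * phase a) \<ge> 0" using phase_nonneg[of a] assms by simp
    ultimately show ?thesis using 2 assms by (cases "a = 1") (auto simp: w_branch_phase)
  next
    case 3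
    then have "w_branch a < 0" "w_branch b > 0" using phase_pos[of a] phase_pos[of b] assms by (auto simp: w_branch_phase)
    then show ?thesis by simp
  qed
qed

lemma w_branch_inj: "inj_on w_branch {0<..}"
  by (intro inj_onI) (metis greaterThan_iff linorder_neqE_linordered_idom order_less_irrefl w_branch_strict_mono)

lemma w_branch_surj: "\<exists>\<tau>>0. w_branch \<tau> = w"
proof -
  consider "w = 0" | "w > 0" | "w < 0" by linarith
  then show ?thesis
  proof cases
    case 1 then show ?thesis by (intro exI[of _ 1]) auto
  next
    case 2
    \<comment> \<open>Large enough for the intermediate value theorem: ln T \<le> 2 (w + 1) gives
      phase T \<ge> (w + 1)^2 \<ge> w^2 / 2.\<close>
    define T where "T = (w + 2)\<^sup>2"
    have T: "T \<ge> 1" using 2 by (simp add: T_def)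
    have "ln T = 2 * ln (w + 2)" using 2 by (simp add: T_def ln_realpow)
    also have "\<dots> \<le> 2 * (w + 1)" using ln_le_minus_one[of "w + 2"] 2 by simp
    finally have "T - 2 * (w + 1) - 1 \<le> phase T" by (simp add: phase_def)
    moreover have "T - 2 * (w + 1) - 1 = w\<^sup>2 + 2 * w + 1" by (simp add: T_def power2_eq_square algebra_simps)
    ultimately have "w\<^sup>2 + 2 * w + 1 \<le> phase T" by simp
    moreover have "w\<^sup>2 / 2 \<le> w\<^sup>2 + 2 * w + 1" using 2 by simp
    ultimately have "w\<^sup>2 / 2 \<le> phase T" by linarith
    moreover have "phase 1 \<le> w\<^sup>2 / 2" by (simp add: phase_def)
    moreover have "continuous_on {1..T} phase" unfolding phase_def by (intro continuous_intros) auto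
    ultimately obtain t where t: "1 \<le> t" "phase t = w\<^sup>2 / 2" using IVT'[of phase 1 "w\<^sup>2 / 2" T] T by auto
    then have "sqrt (2 * phase t) = w" using 2 by (intro real_sqrt_unique) auto
    moreover have "t \<noteq> 1" using t(2) 2 by (auto simp: phase_def)
    ultimately show ?thesis using t(1) by (intro exI[of _ t]) (auto simp: w_branch_phase)
  next
    case 3
    \<comment> \<open>Here - ln T - 1 = w^2 / 2, so phase T exceeds w^2 / 2 by T.\<close>
    define T where "T = exp (- (w\<^sup>2 / 2 + 1))"
    have T: "0 < T" "T \<le> 1" using zero_le_power2[of w] unfolding T_def exp_le_one_iff by (simp, linarith)
    have "w\<^sup>2 / 2 \<le> phase T" by (simp add: phase_def T_def)
    moreover have "phase 1 \<le> w\<^sup>2 / 2" by (simp add: phase_def)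
    moreover have "continuous_on {T..1} phase" unfolding phase_def using T by (intro continuous_intros) auto
    ultimately obtain t where t: "T \<le> t" "t \<le> 1" "phase t = w\<^sup>2 / 2" using IVT2'[of phase 1 "w\<^sup>2 / 2" T] T by auto
    then have "sqrt (2 * phase t) = - w" using 3 by (intro real_sqrt_unique) auto
    moreover have "t \<noteq> 1" using t(3) 3 by (auto simp: phase_def)
    ultimately show ?thesis using t(1,2) T by (intro exI[of _ t]) (auto simp: w_branch_phase)
  qed
qed

lemma tau_of_w_branch: "\<tau> > 0 \<Longrightarrow> tau_of (w_branch \<tau>) = \<tau>"
  unfolding tau_of_def by (rule the_inv_into_f_f[OF w_branch_inj]) simp

lemma tau_of_pos: "tau_of w > 0" and w_branch_tau_of: "w_branch (tau_of w) = w"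
  using w_branch_surj[of w] tau_of_w_branch by auto

lemma tau_of_less_iff: "tau_of a < tau_of b \<longleftrightarrow> a < b"
  by (metis linorder_less_linear order_less_asym tau_of_pos w_branch_strict_mono w_branch_tau_of)

lemma tau_of_0 [simp]: "tau_of 0 = 1"
  using tau_of_w_branch[of 1] by simp

lemma tau_of_gt_1_iff: "tau_of w > 1 \<longleftrightarrow> w > 0" and tau_of_lt_1_iff: "tau_of w < 1 \<longleftrightarrow> w < 0"
  and tau_of_eq_1_iff: "tau_of w = 1 \<longleftrightarrow> w = 0"
  using tau_of_less_iff[of 0 w] tau_of_less_iff[of w 0] by (auto simp: not_less_iff_gr_or_eq)

lemma tau_of_phase: "phase (tau_of w) = w\<^sup>2 / 2"
  using w_branch_square[OF tau_of_pos, of w] by (simp add: w_branch_tau_of)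

lemma tau_of_mono: "mono tau_of"
  by (intro monoI) (metis linorder_not_less tau_of_less_iff)

lemma tau_of_measurable [measurable]: "tau_of \<in> borel_measurable borel"
  by (rule borel_measurable_mono[OF tau_of_mono])

lemma w_branch_deriv:
  assumes "\<tau> > 0" "\<tau> \<noteq> 1"
  shows "(w_branch has_field_derivative ((1 - 1 / \<tau>) / w_branch \<tau>)) (at \<tau>)"
proof -
  define s where "s = sgn (\<tau> - 1)"
  have s: "s * s = 1" using assms by (simp add: s_def sgn_if)
  have p: "phase \<tau> > 0" using phase_pos assms by simp
  have "((\<lambda>\<tau>. s * sqrt (2 * phase \<tau>)) has_field_derivative s * ((1 - 1 / \<tau>) / sqrt (2 * phase \<tau>))) (at \<tau>)"
    using p assms by (auto intro!: derivative_eq_intros phase_deriv[OF assms(1)] simp: divide_simps)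
  also have "s * ((1 - 1 / \<tau>) / sqrt (2 * phase \<tau>)) = (1 - 1 / \<tau>) / w_branch \<tau>"
    using p assms by (simp add: w_branch_phase s_def[symmetric] divide_simps) (use s in \<open>simp add: s_def sgn_if split: if_splits\<close>)
  finally show ?thesis
  \<comment> \<open>On each side of 1 the sign in \<open>w_branch\<close> is constant, so the
    derivative may be taken with the sign frozen at \<open>s\<close>.\<close>
  proof (rule has_field_derivative_transform_within_open[where S="{x. sgn (x - 1) = s}"])
    have "{x. sgn (x - 1) = s} = (if \<tau> > 1 then {1<..} else {..<1})"
      using assms by (auto simp: s_def sgn_if)
    then show "open {x. sgn (x - 1) = s}" by auto
  qed (auto simp: s_def w_branch_phase)
qed

text \<open>Differentiating phase \<tau> = w^2 / 2 gives (1 - 1/\<tau>) d\<tau>/dw = w. At w = 0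
  this is 0 = 0, so that point is excluded here and treated through the holomorphic inverse.\<close>

lemma tau_of_deriv:
  assumes "w \<noteq> 0"
  shows "(tau_of has_field_derivative (w * tau_of w / (tau_of w - 1))) (at w)"
proof -
  define t where "t = tau_of w"
  have t: "t > 0" "t \<noteq> 1" "w_branch t = w" using assms tau_of_pos tau_of_eq_1_iff w_branch_tau_of by (auto simp: t_def)
  \<comment> \<open>Half of the smaller of the distances of t from 0 and from 1, so that the
    neighbourhood avoids both.\<close>
  define d where "d = min t \<bar>t - 1\<bar> / 2"
  have d: "d > 0" using t by (simp add: d_def)
  have d2: "d \<le> t / 2" "d \<le> \<bar>t - 1\<bar> / 2" by (auto simp: d_def)
  have near: "z > 0 \<and> z \<noteq> 1" if "\<bar>z - t\<bar> \<le> d" for z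
  proof
    show "z > 0" using that d2(1) t(1) by linarith
    have "z = 1 \<Longrightarrow> \<bar>t - 1\<bar> \<le> \<bar>t - 1\<bar> / 2" using that d2(2) by linarith
    then show "z \<noteq> 1" using t(2) by auto
  qed
  have cont: "isCont tau_of (w_branch t)"
  proof (rule isCont_inverse_function[where f=w_branch and x=t, OF d])
    show "tau_of (w_branch z) = z" if "\<bar>z - t\<bar> \<le> d" for z using near[OF that] tau_of_w_branch by simp
    show "isCont w_branch z" if "\<bar>z - t\<bar> \<le> d" for z
      using near[OF that] w_branch_deriv DERIV_isCont by blast
  qed
  have "(tau_of has_field_derivative inverse ((1 - 1 / t) / w_branch t)) (at w)"
  proof (rule DERIV_inverse_function[where f=w_branch and a="w - 1" and b="w + 1"])
    show "(w_branch has_field_derivative (1 - 1 / t) / w_branch t) (at (tau_of w))"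
      unfolding t_def[symmetric] by (rule w_branch_deriv[OF t(1,2)])
    show "isCont tau_of w" using cont t by simp
  qed (use t assms w_branch_tau_of in auto)
  also have "inverse ((1 - 1 / t) / w_branch t) = w * t / (t - 1)" using t by (simp add: field_simps)
  finally show ?thesis by (simp add: t_def)
qed

lemma w_branch_less_iff: "t > 0 \<Longrightarrow> w_branch t < a \<longleftrightarrow> t < tau_of a"
  using tau_of_less_iff[of "w_branch t" a] by (simp add: tau_of_w_branch)

lemma less_w_branch_iff: "t > 0 \<Longrightarrow> a < w_branch t \<longleftrightarrow> tau_of a < t"
  using tau_of_less_iff[of a "w_branch t"] by (simp add: tau_of_w_branch)

lemma tau_of_image_lessThan: "tau_of ` {..<a} = {0<..<tau_of a}"
proof (intro set_eqI iffI)
  fix t assume "t \<in> {0<..<tau_of a}"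
  then show "t \<in> tau_of ` {..<a}"
    by (intro image_eqI[of _ _ "w_branch t"]) (auto simp: tau_of_w_branch w_branch_less_iff)
qed (auto simp: tau_of_pos tau_of_less_iff)

lemma tau_of_image_greaterThan: "tau_of ` {a<..} = {tau_of a<..}"
proof (intro set_eqI iffI)
  fix t assume "t \<in> {tau_of a<..}"
  moreover from this have "t > 0" using tau_of_pos[of a] by simp
  ultimately show "t \<in> tau_of ` {a<..}"
    by (intro image_eqI[of _ _ "w_branch t"]) (auto simp: tau_of_w_branch less_w_branch_iff)
qed (auto simp: tau_of_less_iff)

lemma tau_of_inj: "inj tau_of"
  by (metis injI w_branch_tau_of)

text \<open>Near \<open>w = 0\<close> the branch \<open>\<tau>(w)\<close> is the restriction to the real line of the local inverse of
  the holomorphic function \<open>W(z) = (z - 1) \<surd>H(z)\<close>, where \<open>2 (z - Ln z - 1) = (z - 1)\<^sup>2 H(z)\<close>.\<close>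

lemma holomorphic_tau:
  obtains H S T :: "complex \<Rightarrow> complex" and \<epsilon> :: real where
    "\<epsilon> > 0" "T holomorphic_on ball 0 \<epsilon>" "(\<lambda>z. H (T z)) holomorphic_on ball 0 \<epsilon>" "(\<lambda>z. S (T z)) holomorphic_on ball 0 \<epsilon>"
    "T 0 = 1" "H 1 = 1"
    "\<And>z. z \<in> ball 0 \<epsilon> \<Longrightarrow> Re (T z) > 0"
    "\<And>w. \<bar>w\<bar> < \<epsilon> \<Longrightarrow> T (of_real w) = of_real (tau_of w)"
    "\<And>w. \<bar>w\<bar> < \<epsilon> \<Longrightarrow> w \<noteq> 0 \<Longrightarrow> S (T (of_real w)) = of_real (w / (tau_of w - 1))"
    "\<And>w. \<bar>w\<bar> < \<epsilon> \<Longrightarrow> w \<noteq> 0 \<Longrightarrow> H (T (of_real w)) = of_real ((w / (tau_of w - 1))\<^sup>2)"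
proof -
  define F where "F = (\<lambda>z. 2 * (z - Ln z - 1) / (z - 1)\<^sup>2 :: complex)"
  define B where "B = ball (1::complex) 1"
  have Bre: "Re z > 0" if "z \<in> B" for z
  proof -
    have "\<bar>Re (1 - z)\<bar> \<le> cmod (1 - z)" by (rule abs_Re_le_cmod)
    then show ?thesis using that by (auto simp: B_def dist_norm)
  qed
  have Bnp: "z \<notin> \<real>\<^sub>\<le>\<^sub>0" if "z \<in> B" for z using Bre[OF that] by (auto simp: complex_nonpos_Reals_iff)
  have "F holomorphic_on B - {1}"
    unfolding F_def using Bnp by (intro holomorphic_intros) auto
  \<comment> \<open>The singularity of \<open>F\<close> at 1 is removable: z - Ln z - 1 has
    derivative 0 there, so already (z - 1) F(z) tends to 0.\<close>
  moreover have "((\<lambda>z. (z - 1) * F z) \<longlongrightarrow> 0) (at 1)"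
  proof -
    have "((\<lambda>z. 2 * (z - Ln z - 1)) has_field_derivative 2 * (1 - inverse 1)) (at 1)"
      by (auto intro!: derivative_eq_intros)
    then have "((\<lambda>z. (2 * (z - Ln z - 1) - 2 * (1 - Ln 1 - 1)) / (z - 1)) \<longlongrightarrow> 0) (at 1)"
      unfolding has_field_derivative_iff by simp
    then show ?thesis
    proof (rule Lim_transform_eventually)
      show "\<forall>\<^sub>F z in at 1. (2 * (z - Ln z - 1) - 2 * (1 - Ln 1 - 1)) / (z - 1) = (z - 1) * F z"
        using eventually_neq_at_within[of 1 1] by eventually_elim (simp add: F_def power2_eq_square)
    qed
  qed
  moreover have "1 \<in> interior B" by (simp add: B_def)
  ultimately have "\<exists>g. g holomorphic_on B \<and> (\<forall>z \<in> B - {1}. g z = F z)"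
    by (simp only: holomorphic_on_extend_lim)
  then obtain H where H: "H holomorphic_on B" "\<And>z. z \<in> B - {1} \<Longrightarrow> H z = F z"
    by blast
  have Hreal: "H (of_real t) = of_real (2 * phase t / (t - 1)\<^sup>2)" if "of_real t \<in> B" "t \<noteq> 1" for t
  proof -
    have "t > 0" using Bre[OF that(1)] by simp
    then show ?thesis using that by (simp add: H(2) F_def phase_def Ln_of_real algebra_simps)
  qed
  \<comment> \<open>The value at the removable singularity is found as a limit along the real axis
    from the right.\<close>
  have H1: "H 1 = 1"
  proof -
    have "isCont H 1" using H(1) by (auto simp: B_def intro!: continuous_on_interior[OF holomorphic_on_imp_continuous_on])
    then have "((\<lambda>t::real. H (of_real t)) \<longlongrightarrow> H (of_real 1)) (at_right 1)"
      by (intro isCont_tendsto_compose[of _ H] tendsto_intros) (auto intro!: tendsto_of_real)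
    moreover have "((\<lambda>t::real. of_real (2 * phase t / (t - 1)\<^sup>2) :: complex) \<longlongrightarrow> of_real 1) (at_right 1)"
      unfolding phase_def by (intro tendsto_of_real) real_asymp
    then have "((\<lambda>t::real. H (of_real t)) \<longlongrightarrow> of_real 1) (at_right 1)"
    proof (rule Lim_transform_eventually)
      have "eventually (\<lambda>t::real. t \<in> {1<..<2}) (at_right 1)" by (rule eventually_at_right_real) simp
      then show "\<forall>\<^sub>F t in at_right 1. of_real (2 * phase t / (t - 1)\<^sup>2) = H (of_real t)"
      proof eventually_elim
        case (elim t)
        have "cmod (1 - of_real t) = cmod (of_real (1 - t))" by simp
        then have "cmod (1 - of_real t) < 1" using elim by (simp only: norm_of_real) auto
        then show ?case using elim by (subst Hreal) (auto simp: B_def dist_norm)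
      qed
    qed
    ultimately show ?thesis using tendsto_unique[of "at_right (1::real)"] by (metis of_real_1 trivial_limit_at_right_real)
  qed
  \<comment> \<open>Where Re H > 0 the principal square root of \<open>H\<close> is holomorphic; 1
    belongs to this open set because H(1) = 1.\<close>
  define U where "U = B \<inter> (\<lambda>z. Re (H z)) -` {0<..}"
  have "open U"
    unfolding U_def by (intro continuous_open_preimage continuous_intros holomorphic_on_imp_continuous_on H(1)) (auto simp: B_def)
  moreover have "1 \<in> U" using H1 by (simp add: U_def B_def)
  ultimately obtain d where d: "d > 0" "ball 1 d \<subseteq> U" by (meson open_contains_ball)
  define S where "S = (\<lambda>z. csqrt (H z))"
  have S: "S holomorphic_on ball 1 d"
    unfolding S_def
  proof (rule holomorphic_on_csqrt')
    show "H holomorphic_on ball 1 d" using H(1) d(2) by (auto simp: U_def intro: holomorphic_on_subset)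
    show "H z \<notin> \<real>\<^sub>\<le>\<^sub>0" if "z \<in> ball 1 d" for z
      using that d(2) by (force simp: U_def complex_nonpos_Reals_iff)
  qed
  have S1: "S 1 = 1" by (simp add: S_def H1)
  define W where "W = (\<lambda>z. (z - 1) * S z)"
  have W: "W holomorphic_on ball 1 d" unfolding W_def by (intro holomorphic_intros S)
  \<comment> \<open>The nonzero derivative makes \<open>W\<close> injective near 1 and so gives the
    holomorphic inverse \<open>T\<close>.\<close>
  have "deriv W 1 = 1"
  proof (rule DERIV_imp_deriv)
    have "(S has_field_derivative deriv S 1) (at 1)" using S d(1) by (intro holomorphic_derivI) auto
    then show "(W has_field_derivative 1) (at 1)"
      unfolding W_def by (auto intro!: derivative_eq_intros simp: S1)
  qed
  then have nz: "deriv W 1 \<noteq> 0" by simp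
  have one: "1 \<in> ball (1::complex) d" using d(1) by simp
  obtain r where r: "r > 0" "ball (1::complex) r \<subseteq> ball 1 d" "inj_on W (ball 1 r)"
    by (rule has_complex_derivative_locally_injective[OF W one open_ball nz]) (rule that)
  have Wr: "W holomorphic_on ball 1 r" using W r(2) holomorphic_on_subset by blast
  obtain T where T: "T holomorphic_on (W ` ball 1 r)" "\<And>z. z \<in> ball 1 r \<Longrightarrow> T (W z) = z"
    by (rule holomorphic_has_inverse[OF Wr open_ball r(3)]) blast
  have "open (W ` ball 1 r)" using open_mapping_thm3[OF Wr _ r(3)] by simp
  moreover have "0 \<in> W ` ball 1 r" using r(1) by (intro image_eqI[of _ _ 1]) (auto simp: W_def)
  ultimately obtain e where e: "e > 0" "ball 0 e \<subseteq> W ` ball 1 r" by (meson open_contains_ball)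
  have Tin: "T z \<in> ball 1 r" if "z \<in> ball 0 e" for z
    using that e(2) T(2) by force
  have WT: "W (T z) = z" if "z \<in> ball 0 e" for z
    using that e(2) T(2) by force
  have Sreal: "S (of_real t) = of_real (w_branch t / (t - 1))" if "of_real t \<in> B" "t \<noteq> 1" for t
  proof -
    have t0: "t > 0" using Bre[OF that(1)] by simp
    have "S (of_real t) = of_real (sqrt (2 * phase t / (t - 1)\<^sup>2))"
      unfolding S_def Hreal[OF that] using phase_nonneg[OF t0] by (subst csqrt_of_real_nonneg) auto
    also have "sqrt (2 * phase t / (t - 1)\<^sup>2) = sqrt (2 * phase t) / \<bar>t - 1\<bar>"
      by (simp add: real_sqrt_divide)
    also have "\<dots> = w_branch t / (t - 1)"
      using that(2) by (cases "t > 1") (auto simp: w_branch_phase divide_simps algebra_simps)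
    finally show ?thesis .
  qed
  \<comment> \<open>A real interval (a, b) around 1 inside the disc on which \<open>W\<close> is
    injective. By monotonicity of \<open>tau_of\<close>, every |w| < \<epsilon> is sent into it, so
    there \<open>T\<close> agrees with \<open>tau_of\<close>.\<close>
  define a where "a = 1 - min r 1 / 2"
  define b where "b = 1 + min r 1 / 2"
  have ab: "0 < a" "a < 1" "1 < b" using r(1) by (auto simp: a_def b_def)
  define \<epsilon> where "\<epsilon> = min e (min (- w_branch a) (w_branch b))"
  have \<epsilon>: "\<epsilon> > 0" "\<epsilon> \<le> e" "\<epsilon> \<le> - w_branch a" "\<epsilon> \<le> w_branch b"
    using e(1) w_branch_strict_mono[of a 1] w_branch_strict_mono[of 1 b] ab by (auto simp: \<epsilon>_def)
  have near: "of_real (tau_of w) \<in> ball (1::complex) r" if "\<bar>w\<bar> < \<epsilon>" for w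
  proof -
    have "w_branch a < w" "w < w_branch b" using that \<epsilon> by linarith+
    then have "a < tau_of w" "tau_of w < b" using w_branch_less_iff[of a w] less_w_branch_iff[of b w] ab by auto
    then have "\<bar>1 - tau_of w\<bar> < r" using r(1) by (auto simp: a_def b_def min_def abs_if split: if_splits)
    moreover have "cmod (1 - of_real (tau_of w)) = cmod (of_real (1 - tau_of w))" by simp
    ultimately show ?thesis by (simp only: mem_ball dist_norm norm_of_real)
  qed
  have inB: "z \<in> B" if "z \<in> ball 1 r" for z :: complex using that r(2) d(2) unfolding U_def by blast
  have Treal: "T (of_real w) = of_real (tau_of w)" if w: "\<bar>w\<bar> < \<epsilon>" for w
  proof -
    have "W (of_real (tau_of w)) = of_real w"
    proof (cases "w = 0")
      case False
      then have n: "tau_of w \<noteq> 1" by (simp add: tau_of_eq_1_iff)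
      have "W (of_real (tau_of w)) = (of_real (tau_of w) - 1) * of_real (w / (tau_of w - 1))"
        unfolding W_def Sreal[OF inB[OF near[OF w]] n] by (simp add: w_branch_tau_of)
      also have "\<dots> = of_real w"
      proof -
        have "(of_real (tau_of w) - 1) * of_real (w / (tau_of w - 1)) = (of_real ((tau_of w - 1) * (w / (tau_of w - 1))) :: complex)" by simp
        then show ?thesis using n by simp
      qed
      finally show ?thesis .
    qed (simp add: W_def)
    then show ?thesis using T(2)[OF near[OF w]] by simp
  qed
  show ?thesis
  proof (rule that[of \<epsilon> T H S])
    have sub: "ball 0 \<epsilon> \<subseteq> ball 0 e" using \<epsilon> by auto
    show "T holomorphic_on ball 0 \<epsilon>" using T(1) e(2) sub by (meson holomorphic_on_subset order_trans)
    moreover have "T ` ball 0 \<epsilon> \<subseteq> ball 1 r" using Tin sub by blast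
    then have "T ` ball 0 \<epsilon> \<subseteq> B" "T ` ball 0 \<epsilon> \<subseteq> ball 1 d" using inB r(2) by blast+
    ultimately show "(\<lambda>z. H (T z)) holomorphic_on ball 0 \<epsilon>" "(\<lambda>z. S (T z)) holomorphic_on ball 0 \<epsilon>"
      using holomorphic_on_compose_gen[of T "ball 0 \<epsilon>" H B] holomorphic_on_compose_gen[of T "ball 0 \<epsilon>" S "ball 1 d"] H(1) S
      by (simp_all only: o_def)
    show "T 0 = 1" using Treal[of 0] \<epsilon> by simp
    show "Re (T z) > 0" if "z \<in> ball 0 \<epsilon>" for z using Bre inB Tin that sub by blast
    fix w :: real assume w: "\<bar>w\<bar> < \<epsilon>" "w \<noteq> 0"
    then have n: "tau_of w \<noteq> 1" by (simp add: tau_of_eq_1_iff)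
    show "S (T (of_real w)) = of_real (w / (tau_of w - 1))"
      unfolding Treal[OF w(1)] Sreal[OF inB[OF near[OF w(1)]] n] by (simp add: w_branch_tau_of)
    have "2 * phase (tau_of w) / (tau_of w - 1)\<^sup>2 = (w / (tau_of w - 1))\<^sup>2"
      by (simp add: tau_of_phase power_divide)
    then show "H (T (of_real w)) = of_real ((w / (tau_of w - 1))\<^sup>2)"
      unfolding Treal[OF w(1)] Hreal[OF inB[OF near[OF w(1)]] n] by simp
  qed (use \<epsilon> H1 Treal in auto)
qed

section \<open>Gaussian integrals\<close>

text \<open>The point w = 0 is left out because the real functions to which this applies have only a
  junk value there; the coefficients come from the complex function.\<close>

lemma real_power_series:
  assumes P: "P holomorphic_on ball 0 \<epsilon>" and real: "\<And>w. 0 < \<bar>w\<bar> \<Longrightarrow> \<bar>w\<bar> < \<epsilon> \<Longrightarrow> P (of_real w) = of_real (\<phi> w)"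
  obtains g :: "nat \<Rightarrow> real" where "g 0 = Re (P 0)" "\<And>w. 0 < \<bar>w\<bar> \<Longrightarrow> \<bar>w\<bar> < \<epsilon> \<Longrightarrow> (\<lambda>k. g k * w ^ k) sums \<phi> w"
proof (rule that[of "\<lambda>k. Re ((deriv ^^ k) P 0 / fact k)"])
  show "Re ((deriv ^^ 0) P 0 / fact 0) = Re (P 0)" by simp
  fix w :: real assume w: "0 < \<bar>w\<bar>" "\<bar>w\<bar> < \<epsilon>"
  then have "of_real w \<in> ball (0::complex) \<epsilon>" by simp
  from sums_Re[OF holomorphic_power_series[OF P this]]
  have "(\<lambda>k. Re ((deriv ^^ k) P 0 / fact k * of_real (w ^ k))) sums \<phi> w"
    using real[OF w] by simp
  moreover have "Re (z * of_real x) = Re z * x" for z x by simp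
  ultimately show "(\<lambda>k. Re ((deriv ^^ k) P 0 / fact k) * w ^ k) sums \<phi> w"
    by (simp only:)
qed

lemma power_series_remainder:
  fixes g :: "nat \<Rightarrow> real"
  assumes "r > 0" and s: "\<And>w. 0 < \<bar>w\<bar> \<Longrightarrow> \<bar>w\<bar> < r \<Longrightarrow> (\<lambda>k. g k * w ^ k) sums \<phi> w"
  obtains C where "C \<ge> 0" "\<And>w. 0 < \<bar>w\<bar> \<Longrightarrow> \<bar>w\<bar> \<le> r / 2 \<Longrightarrow> \<bar>\<phi> w - (\<Sum>k<K. g k * w ^ k)\<bar> \<le> C * \<bar>w\<bar> ^ K"
proof -
  \<comment> \<open>The point 3r/4 lies strictly between r/2 and r: convergence there gives absolute
    convergence at r/2.\<close>
  have "summable (\<lambda>k. g k * (3 * r / 4) ^ k)" using s[of "3 * r / 4"] assms(1) by (auto simp: sums_iff)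
  from powser_insidea[OF this, of "r / 2"] assms(1)
  have "summable (\<lambda>k. norm (g k * (r / 2) ^ k))" by simp
  then have "summable (\<lambda>k. norm (g (k + K) * (r / 2) ^ (k + K)))" by (subst summable_iff_shift)
  from summable_mult[OF this, of "1 / (r / 2) ^ K"]
  have sm: "summable (\<lambda>k. \<bar>g (k + K)\<bar> * (r / 2) ^ k)"
    using assms(1) by (simp add: abs_mult power_add mult_ac)
  define C where "C = (\<Sum>k. \<bar>g (k + K)\<bar> * (r / 2) ^ k)"
  show ?thesis
  proof (rule that[of C])
    show "C \<ge> 0" unfolding C_def using assms(1) by (intro suminf_nonneg sm) auto
    fix w :: real assume w: "0 < \<bar>w\<bar>" "\<bar>w\<bar> \<le> r / 2"
    have "(\<lambda>k. g (k + K) * w ^ (k + K)) sums (\<phi> w - (\<Sum>k<K. g k * w ^ k))"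
      using sums_split_initial_segment[OF s[of w], of K] w assms(1) by auto
    then have *: "(\<lambda>k. g (k + K) * w ^ (k + K)) sums (\<phi> w - (\<Sum>k<K. g k * w ^ k))" .
    have le: "norm (g (k + K) * w ^ (k + K)) \<le> (\<bar>g (k + K)\<bar> * (r / 2) ^ k) * \<bar>w\<bar> ^ K" for k
    proof -
      have "\<bar>w\<bar> ^ k \<le> (r / 2) ^ k" using w by (intro power_mono) auto
      then have "\<bar>g (k + K)\<bar> * \<bar>w\<bar> ^ k * \<bar>w\<bar> ^ K \<le> \<bar>g (k + K)\<bar> * (r / 2) ^ k * \<bar>w\<bar> ^ K"
        by (intro mult_left_mono mult_right_mono) auto
      then show ?thesis by (simp add: abs_mult power_add power_abs mult.assoc)
    qed
    have "norm (\<Sum>k. g (k + K) * w ^ (k + K)) \<le> (\<Sum>k. (\<bar>g (k + K)\<bar> * (r / 2) ^ k) * \<bar>w\<bar> ^ K)"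
      by (rule norm_suminf_le[OF le summable_mult2[OF sm]])
    also have "\<dots> = C * \<bar>w\<bar> ^ K" unfolding C_def by (rule suminf_mult2[OF sm, symmetric])
    finally show "\<bar>\<phi> w - (\<Sum>k<K. g k * w ^ k)\<bar> \<le> C * \<bar>w\<bar> ^ K"
      using * by (simp add: sums_iff)
  qed
qed

text \<open>Both series represent the same function only off 0, so the coefficients are compared
  asymptotically as w tends to 0.\<close>

lemma power_series_unique:
  fixes g h :: "nat \<Rightarrow> real"
  assumes "r > 0" "\<And>w. 0 < \<bar>w\<bar> \<Longrightarrow> \<bar>w\<bar> < r \<Longrightarrow> (\<lambda>k. g k * w ^ k) sums \<phi> w"
    and "r' > 0" "\<And>w. 0 < \<bar>w\<bar> \<Longrightarrow> \<bar>w\<bar> < r' \<Longrightarrow> (\<lambda>k. h k * w ^ k) sums \<phi> w"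
  shows "g = h"
proof (rule asymptotic_coeffs_unique[where F="at (0::real)" and \<phi>="\<lambda>n w. w ^ n" and f=\<phi>])
  have big: "(\<lambda>w. \<phi> w - (\<Sum>j<M. g j * w ^ j)) \<in> O[at 0](\<lambda>w. w ^ M)"
    if r: "r > 0" "\<And>w. 0 < \<bar>w\<bar> \<Longrightarrow> \<bar>w\<bar> < r \<Longrightarrow> (\<lambda>k. g k * w ^ k) sums \<phi> w" for r M and g :: "nat \<Rightarrow> real"
  proof -
    obtain C where C: "\<And>w. 0 < \<bar>w\<bar> \<Longrightarrow> \<bar>w\<bar> \<le> r / 2 \<Longrightarrow> \<bar>\<phi> w - (\<Sum>k<M. g k * w ^ k)\<bar> \<le> C * \<bar>w\<bar> ^ M"
      using power_series_remainder[OF r, of M] by blast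
    have "eventually (\<lambda>w. w \<in> ball 0 (r / 2) - {0}) (at (0::real))"
      using r(1) by (intro eventually_at_in_open) auto
    then have "eventually (\<lambda>w. norm (\<phi> w - (\<Sum>j<M. g j * w ^ j)) \<le> C * norm (w ^ M)) (at 0)"
      by eventually_elim (use C in \<open>auto simp: power_abs\<close>)
    then show ?thesis by (rule bigoI)
  qed
  show "(\<lambda>w. \<phi> w - (\<Sum>j<M. g j * w ^ j)) \<in> O[at 0](\<lambda>w. w ^ M)" "(\<lambda>w. \<phi> w - (\<Sum>j<M. h j * w ^ j)) \<in> O[at 0](\<lambda>w. w ^ M)" for M
    using big assms by blast+
  show "(\<lambda>w::real. w ^ Suc n) \<in> o[at 0](\<lambda>w. w ^ n)" for n
  proof -
    have "(\<lambda>w::real. w * w ^ n) \<in> o[at 0](\<lambda>w. 1 * w ^ n)"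
      by (rule landau_o.small_big_mult) (real_asymp, simp)
    then show ?thesis by simp
  qed
  show "eventually (\<lambda>w::real. w ^ n \<noteq> 0) (at 0)" for n
    using eventually_neq_at_within[of 0 0] by eventually_elim simp
qed simp

text \<open>The moment of order 2k of e^(-y w^2 / 2). The factor 2^k (1/2)_k is the double factorial
  (2k-1)!!, written in the form that occurs in \<open>D_coeff\<close>.\<close>

definition gauss_moment :: "real \<Rightarrow> nat \<Rightarrow> real" where
  "gauss_moment y k = sqrt (2 * pi / y) * (2 ^ k * pochhammer (1/2) k / y ^ k)"

lemma gauss_even:
  assumes "y > 0"
  shows "has_bochner_integral lborel (\<lambda>w. exp (- y * w\<^sup>2 / 2) * w ^ (2 * k)) (gauss_moment y k)"
proof -
  define \<sigma> where "\<sigma> = 1 / sqrt y"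
  have \<sigma>: "\<sigma> > 0" "\<sigma>\<^sup>2 = 1 / y" using assms by (auto simp: \<sigma>_def power_divide)
  have nd: "sqrt (2 * pi / y) * normal_density 0 \<sigma> w = exp (- y * w\<^sup>2 / 2)" for w
    using assms by (simp add: normal_density_def \<sigma>(2) mult.commute)
  have f: "(fact (2 * k) :: real) / ((2 / \<sigma>\<^sup>2) ^ k * fact k) = 2 ^ k * pochhammer (1/2) k / y ^ k"
    using assms fact_double[of k, where 'a=real]
    by (simp add: \<sigma>(2) power_mult_distrib power_mult field_simps flip: power2_eq_square)
  show ?thesis
    using has_bochner_integral_mult_right[OF normal_moment_even[OF \<sigma>(1), of 0 k], of "sqrt (2 * pi / y)"]
    unfolding f gauss_moment_def by (simp only: mult.assoc[symmetric] nd diff_0_right)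
qed

lemma gauss_odd:
  fixes y :: real
  assumes "y > 0"
  shows "has_bochner_integral lborel (\<lambda>w. exp (- y * w\<^sup>2 / 2) * w ^ (2 * k + 1)) 0"
proof -
  define \<sigma> where "\<sigma> = 1 / sqrt y"
  have \<sigma>: "\<sigma> > 0" "\<sigma>\<^sup>2 = 1 / y" using assms by (auto simp: \<sigma>_def power_divide)
  have nd: "sqrt (2 * pi / y) * normal_density 0 \<sigma> w = exp (- y * w\<^sup>2 / 2)" for w
    using assms by (simp add: normal_density_def \<sigma>(2) mult.commute)
  show ?thesis
    using has_bochner_integral_mult_right[OF normal_moment_odd[OF \<sigma>(1), of 0 k], of "sqrt (2 * pi / y)"]
    by (simp only: mult.assoc[symmetric] nd diff_0_right mult_zero_right)
qed

lemma sum_lessThan_double: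
  fixes f :: "nat \<Rightarrow> real"
  shows "(\<Sum>k<2 * K. f k) = (\<Sum>k<K. f (2 * k) + f (2 * k + 1))"
  by (induction K) auto

lemma gauss_poly:
  assumes "y > 0"
  shows "has_bochner_integral lborel (\<lambda>w. exp (- y * w\<^sup>2 / 2) * (\<Sum>k<2 * K. g k * w ^ k)) (\<Sum>k<K. g (2 * k) * gauss_moment y k)"
proof -
  have "has_bochner_integral lborel (\<lambda>w. \<Sum>k<K. g (2 * k) * (exp (- y * w\<^sup>2 / 2) * w ^ (2 * k)) + g (2 * k + 1) * (exp (- y * w\<^sup>2 / 2) * w ^ (2 * k + 1)))
     (\<Sum>k<K. g (2 * k) * gauss_moment y k + g (2 * k + 1) * 0)"
    by (intro has_bochner_integral_sum has_bochner_integral_add has_bochner_integral_mult_right gauss_even gauss_odd assms)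
  moreover have "exp (- y * w\<^sup>2 / 2) * (\<Sum>k<2 * K. g k * w ^ k) = (\<Sum>k<K. g (2 * k) * (exp (- y * w\<^sup>2 / 2) * w ^ (2 * k)) + g (2 * k + 1) * (exp (- y * w\<^sup>2 / 2) * w ^ (2 * k + 1)))" for w
    unfolding sum_lessThan_double sum_distrib_left distrib_left by (intro sum.cong refl) (simp only: mult_ac)
  ultimately show ?thesis by simp
qed

text \<open>Laplace's method on the whole line. The partial sum is taken up to degree 2K; its odd
  terms integrate to 0. Near 0 the remainder is controlled by the power series, and away from 0 by
  growth of order e^(b w^2), which half of the Gaussian exponent absorbs once y > 4b.\<close>

lemma gauss_kernel_expansion:
  fixes \<psi> :: "real \<Rightarrow> real" and g :: "nat \<Rightarrow> real"
  assumes [measurable]: "\<psi> \<in> borel_measurable borel"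
    and r: "r > 0" and s: "\<And>w. 0 < \<bar>w\<bar> \<Longrightarrow> \<bar>w\<bar> < r \<Longrightarrow> (\<lambda>k. g k * w ^ k) sums \<psi> w"
    and b: "b \<ge> 0" and growth: "\<exists>C. \<forall>w. \<bar>w\<bar> \<ge> r / 2 \<longrightarrow> \<bar>\<psi> w\<bar> \<le> C * exp (b * w\<^sup>2)"
  shows "\<And>y. y > 4 * b \<Longrightarrow> integrable lborel (\<lambda>w. exp (- y * w\<^sup>2 / 2) * \<psi> w)"
    and "\<And>K. (\<lambda>y. (LBINT w. exp (- y * w\<^sup>2 / 2) * \<psi> w) - (\<Sum>k<K. g (2 * k) * gauss_moment y k)) \<in> O[at_top](\<lambda>y. 1 / (sqrt y * y ^ K))"
proof -
  have bound: "\<exists>C\<ge>0. \<forall>w. w \<noteq> 0 \<longrightarrow> \<bar>\<psi> w - (\<Sum>k<2 * K. g k * w ^ k)\<bar> \<le> C * w ^ (2 * K) * exp (b * w\<^sup>2)" for K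
  proof -
    obtain C1 where C1: "C1 \<ge> 0" "\<And>w. 0 < \<bar>w\<bar> \<Longrightarrow> \<bar>w\<bar> \<le> r / 2 \<Longrightarrow> \<bar>\<psi> w - (\<Sum>k<2 * K. g k * w ^ k)\<bar> \<le> C1 * \<bar>w\<bar> ^ (2 * K)"
      using power_series_remainder[OF r s, of "2 * K"] by blast
    obtain C2 where C2: "\<And>w. \<bar>w\<bar> \<ge> r / 2 \<Longrightarrow> \<bar>\<psi> w\<bar> \<le> C2 * exp (b * w\<^sup>2)" using growth by blast
    \<comment> \<open>For |w| \<ge> r/2 each lower power of |w| can be raised to w^(2K) at the cost
      of a power of r/2.\<close>
    define C3 where "C3 = \<bar>C2\<bar> / (r / 2) ^ (2 * K) + (\<Sum>k<2 * K. \<bar>g k\<bar> / (r / 2) ^ (2 * K - k))"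
    have C3: "C3 \<ge> 0" unfolding C3_def using r by (intro add_nonneg_nonneg sum_nonneg divide_nonneg_nonneg) auto
    have e1: "exp (b * w\<^sup>2) \<ge> 1" for w using b by simp
    have even: "\<bar>w\<bar> ^ (2 * K) = w ^ (2 * K)" for w :: real by (simp add: power_mult)
    have "\<bar>\<psi> w - (\<Sum>k<2 * K. g k * w ^ k)\<bar> \<le> (C1 + C3) * w ^ (2 * K) * exp (b * w\<^sup>2)" if "w \<noteq> 0" for w
    proof (cases "\<bar>w\<bar> \<le> r / 2")
      case True
      have "\<bar>\<psi> w - (\<Sum>k<2 * K. g k * w ^ k)\<bar> \<le> C1 * w ^ (2 * K) * 1" using C1(2)[of w] True that by (simp add: even)
      also have "\<dots> \<le> (C1 + C3) * w ^ (2 * K) * exp (b * w\<^sup>2)"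
        using C1 C3 e1[of w] by (intro mult_mono mult_nonneg_nonneg) (auto simp: power_mult)
      finally show ?thesis .
    next
      case False
      then have w: "\<bar>w\<bar> \<ge> r / 2" by simp
      have pw: "1 \<le> \<bar>w\<bar> ^ m / (r / 2) ^ m" for m
      proof -
        have "(r / 2) ^ m \<le> \<bar>w\<bar> ^ m" using w r by (intro power_mono) auto
        then show ?thesis using r by simp
      qed
      have "\<bar>\<psi> w - (\<Sum>k<2 * K. g k * w ^ k)\<bar> \<le> \<bar>\<psi> w\<bar> + (\<Sum>k<2 * K. \<bar>g k * w ^ k\<bar>)"
        using sum_abs[of "\<lambda>k. g k * w ^ k" "{..<2 * K}"] by linarith
      also have "\<bar>\<psi> w\<bar> \<le> \<bar>C2\<bar> / (r / 2) ^ (2 * K) * w ^ (2 * K) * exp (b * w\<^sup>2)"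
      proof -
        have "\<bar>\<psi> w\<bar> \<le> C2 * exp (b * w\<^sup>2)" by (rule C2[OF w])
        also have "\<dots> \<le> \<bar>C2\<bar> * exp (b * w\<^sup>2)" by (intro mult_right_mono) auto
        also have "\<dots> \<le> (\<bar>C2\<bar> * (\<bar>w\<bar> ^ (2 * K) / (r / 2) ^ (2 * K))) * exp (b * w\<^sup>2)"
          using mult_left_mono[OF pw[of "2 * K"], of "\<bar>C2\<bar>"] by (intro mult_right_mono) auto
        finally show ?thesis by (simp add: even)
      qed
      also have "(\<Sum>k<2 * K. \<bar>g k * w ^ k\<bar>) \<le> (\<Sum>k<2 * K. \<bar>g k\<bar> / (r / 2) ^ (2 * K - k)) * w ^ (2 * K) * exp (b * w\<^sup>2)"
      proof -
        have "(\<Sum>k<2 * K. \<bar>g k * w ^ k\<bar>) \<le> (\<Sum>k<2 * K. \<bar>g k\<bar> / (r / 2) ^ (2 * K - k) * w ^ (2 * K))"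
        proof (rule sum_mono)
          fix k assume k: "k \<in> {..<2 * K}"
          have "\<bar>g k * w ^ k\<bar> = \<bar>g k\<bar> * \<bar>w\<bar> ^ k * 1" by (simp add: abs_mult power_abs)
          also have "\<dots> \<le> \<bar>g k\<bar> * \<bar>w\<bar> ^ k * (\<bar>w\<bar> ^ (2 * K - k) / (r / 2) ^ (2 * K - k))"
            by (intro mult_left_mono pw) auto
          also have "\<dots> = \<bar>g k\<bar> / (r / 2) ^ (2 * K - k) * (\<bar>w\<bar> ^ k * \<bar>w\<bar> ^ (2 * K - k))" by simp
          also have "\<bar>w\<bar> ^ k * \<bar>w\<bar> ^ (2 * K - k) = w ^ (2 * K)" using k by (simp add: even flip: power_add)
          finally show "\<bar>g k * w ^ k\<bar> \<le> \<bar>g k\<bar> / (r / 2) ^ (2 * K - k) * w ^ (2 * K)" .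
        qed
        also have "\<dots> = (\<Sum>k<2 * K. \<bar>g k\<bar> / (r / 2) ^ (2 * K - k)) * w ^ (2 * K) * 1" by (simp add: sum_distrib_right)
        also have "\<dots> \<le> (\<Sum>k<2 * K. \<bar>g k\<bar> / (r / 2) ^ (2 * K - k)) * w ^ (2 * K) * exp (b * w\<^sup>2)"
          using r e1[of w] by (intro mult_left_mono mult_nonneg_nonneg sum_nonneg divide_nonneg_nonneg) (auto simp: power_mult)
        finally show ?thesis .
      qed
      finally have "\<bar>\<psi> w - (\<Sum>k<2 * K. g k * w ^ k)\<bar> \<le> C3 * w ^ (2 * K) * exp (b * w\<^sup>2)"
        by (simp add: C3_def distrib_right)
      also have "\<dots> \<le> (C1 + C3) * w ^ (2 * K) * exp (b * w\<^sup>2)"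
        using C1(1) by (intro mult_right_mono) (auto simp: power_mult)
      finally show ?thesis .
    qed
    then show ?thesis using C1(1) C3 by (intro exI[of _ "C1 + C3"]) auto
  qed
  have main: "integrable lborel (\<lambda>w. exp (- y * w\<^sup>2 / 2) * \<psi> w) \<and>
      \<bar>(LBINT w. exp (- y * w\<^sup>2 / 2) * \<psi> w) - (\<Sum>k<K. g (2 * k) * gauss_moment y k)\<bar> \<le> C * gauss_moment (y / 2) K"
    if y: "y > 4 * b" and C: "C \<ge> 0" "\<And>w. w \<noteq> 0 \<Longrightarrow> \<bar>\<psi> w - (\<Sum>k<2 * K. g k * w ^ k)\<bar> \<le> C * w ^ (2 * K) * exp (b * w\<^sup>2)" for y K C
  proof -
    have y0: "y > 0" "y / 2 > 0" using y b by auto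
    define d where "d = (\<lambda>w. exp (- y * w\<^sup>2 / 2) * (\<psi> w - (\<Sum>k<2 * K. g k * w ^ k)))"
    have [measurable]: "d \<in> borel_measurable borel" unfolding d_def by measurable
    have G: "has_bochner_integral lborel (\<lambda>w. C * (exp (- (y / 2) * w\<^sup>2 / 2) * w ^ (2 * K))) (C * gauss_moment (y / 2) K)"
      by (intro has_bochner_integral_mult_right gauss_even y0)
    have le: "norm (d w) \<le> C * (exp (- (y / 2) * w\<^sup>2 / 2) * w ^ (2 * K))" if "w \<noteq> 0" for w
    proof -
      have "norm (d w) \<le> exp (- y * w\<^sup>2 / 2) * (C * w ^ (2 * K) * exp (b * w\<^sup>2))"
        unfolding d_def norm_mult using C(2)[OF that] by (intro mult_mono) auto
      also have "\<dots> = C * w ^ (2 * K) * exp ((b - y / 2) * w\<^sup>2)" by (simp add: algebra_simps flip: exp_add)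
      also have "\<dots> \<le> C * w ^ (2 * K) * exp (- (y / 2) * w\<^sup>2 / 2)"
      proof (intro mult_left_mono)
        \<comment> \<open>Since b < y/4, the Gaussian with y/2 in place of y remains as a
          majorant.\<close>
        have "(b - y / 2) * w\<^sup>2 \<le> (- (y / 4)) * w\<^sup>2" using y by (intro mult_right_mono) auto
        then show "exp ((b - y / 2) * w\<^sup>2) \<le> exp (- (y / 2) * w\<^sup>2 / 2)" by simp
      qed (use C in \<open>auto simp: power_mult\<close>)
      finally show ?thesis by (simp add: mult_ac)
    qed
    have ae: "AE w in lborel. norm (d w) \<le> C * (exp (- (y / 2) * w\<^sup>2 / 2) * w ^ (2 * K))"
      by (rule AE_mp[OF AE_lborel_singleton[of 0]], rule AE_I2) (use le in blast)
    have id: "integrable lborel d"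
    proof (rule Bochner_Integration.integrable_bound)
      show "integrable lborel (\<lambda>w. C * (exp (- (y / 2) * w\<^sup>2 / 2) * w ^ (2 * K)))" using G by (simp only: has_bochner_integral_iff)
      show "AE w in lborel. norm (d w) \<le> norm (C * (exp (- (y / 2) * w\<^sup>2 / 2) * w ^ (2 * K)))"
        using ae by eventually_elim (auto intro: order_trans[OF _ abs_ge_self])
    qed measurable
    have eq: "exp (- y * w\<^sup>2 / 2) * \<psi> w = d w + exp (- y * w\<^sup>2 / 2) * (\<Sum>k<2 * K. g k * w ^ k)" for w
      by (simp add: d_def algebra_simps)
    note P = gauss_poly[OF y0(1), where K=K and g=g]
    have "has_bochner_integral lborel (\<lambda>w. exp (- y * w\<^sup>2 / 2) * \<psi> w) (integral\<^sup>L lborel d + (\<Sum>k<K. g (2 * k) * gauss_moment y k))"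
      unfolding eq by (intro has_bochner_integral_add has_bochner_integral_integrable id P)
    moreover have "\<bar>integral\<^sup>L lborel d\<bar> \<le> C * gauss_moment (y / 2) K"
    proof -
      have "\<bar>integral\<^sup>L lborel d\<bar> \<le> (LBINT w. norm (d w))" using integral_norm_bound[of lborel d] by simp
      also have "\<dots> \<le> (LBINT w. C * (exp (- (y / 2) * w\<^sup>2 / 2) * w ^ (2 * K)))"
        using G ae id by (intro integral_mono_AE) (auto simp: has_bochner_integral_iff)
      finally show ?thesis using G by (simp only: has_bochner_integral_iff)
    qed
    ultimately show ?thesis by (auto simp: has_bochner_integral_iff)
  qed
  show "integrable lborel (\<lambda>w. exp (- y * w\<^sup>2 / 2) * \<psi> w)" if "y > 4 * b" for y
    using bound[of 0] main[OF that, of _ 0] by blast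
  show "(\<lambda>y. (LBINT w. exp (- y * w\<^sup>2 / 2) * \<psi> w) - (\<Sum>k<K. g (2 * k) * gauss_moment y k)) \<in> O[at_top](\<lambda>y. 1 / (sqrt y * y ^ K))" for K
  proof -
    obtain C where C: "C \<ge> 0" "\<And>w. w \<noteq> 0 \<Longrightarrow> \<bar>\<psi> w - (\<Sum>k<2 * K. g k * w ^ k)\<bar> \<le> C * w ^ (2 * K) * exp (b * w\<^sup>2)"
      using bound[of K] by blast
    define c where "c = sqrt (4 * pi) * (2 ^ K * pochhammer (1/2) K * 2 ^ K)"
    have gm: "gauss_moment (y / 2) K = c * (1 / (sqrt y * y ^ K))" if "y > 0" for y
      using that by (simp add: gauss_moment_def c_def real_sqrt_divide power_divide)
    show ?thesis
    proof (rule bigoI[where c="C * c"])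
      show "\<forall>\<^sub>F y in at_top. norm ((LBINT w. exp (- y * w\<^sup>2 / 2) * \<psi> w) - (\<Sum>k<K. g (2 * k) * gauss_moment y k)) \<le> C * c * norm (1 / (sqrt y * y ^ K))"
        using eventually_gt_at_top[of "4 * b"] eventually_gt_at_top[of "0::real"]
      proof eventually_elim
        case (elim y)
        then show ?case using main[OF elim(1) C] gm[OF elim(2)] by (simp add: mult.assoc)
      qed
    qed
  qed
qed

section \<open>The saddle point\<close>

text \<open>The expansion of \<open>psiG j\<close> at \<open>0\<close> has the coefficients \<open>G\<^sub>k\<^sub>,\<^sub>j\<close>, while \<open>psiA j\<close> is the integrand of the
  terminant after the substitution \<open>v = \<tau>(w)\<close>. Both take the junk value \<open>0\<close> at \<open>w = 0\<close>.\<close>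

definition psiG :: "nat \<Rightarrow> real \<Rightarrow> real" where
  "psiG j w = 1 / w - w * tau_of w powr (- real j) / (tau_of w - 1)\<^sup>2"

definition psiA :: "nat \<Rightarrow> real \<Rightarrow> real" where
  "psiA j w = w * tau_of w powr (- real j) / ((tau_of w - 1) * (tau_of w + 1))"

lemma psi_measurable [measurable]: "psiG j \<in> borel_measurable borel" "psiA j \<in> borel_measurable borel"
  unfolding psiG_def psiA_def by measurable

text \<open>Inserts d\<tau>/dw = w \<tau> / (\<tau> - 1) into the function that defines the G
  coefficients at \<gamma> = -j.\<close>

lemma branch_expression:
  assumes "w \<noteq> 0"
  shows "tau_of w powr (- real j - 1) / (1 - tau_of w) * deriv tau_of w + 1 / w = psiG j w"
proof -
  define t where "t = tau_of w"
  have t: "t > 0" "t \<noteq> 1" using tau_of_pos tau_of_eq_1_iff assms by (auto simp: t_def)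
  have d: "deriv tau_of w = w * t / (t - 1)" using DERIV_imp_deriv[OF tau_of_deriv[OF assms]] by (simp add: t_def)
  have p: "t powr (- real j - 1) * t = t powr (- real j)"
    using t powr_add[of t "- real j - 1" 1] by simp
  have "t powr (- real j - 1) / (1 - t) * (w * t / (t - 1)) = (t powr (- real j - 1) * t) * (w / ((1 - t) * (t - 1)))"
    by simp
  also have "(1 - t) * (t - 1) = - (t - 1)\<^sup>2" by (simp add: power2_eq_square algebra_simps)
  finally show ?thesis unfolding d t_def[symmetric] p psiG_def by simp
qed

lemma psi_power_series:
  obtains r g a where "r > (0::real)" "\<And>w. 0 < \<bar>w\<bar> \<Longrightarrow> \<bar>w\<bar> < r \<Longrightarrow> (\<lambda>k. g k * w ^ k) sums psiG j w"
    "\<And>w. 0 < \<bar>w\<bar> \<Longrightarrow> \<bar>w\<bar> < r \<Longrightarrow> (\<lambda>k. a k * w ^ k) sums psiA j w"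
proof -
  obtain H S T :: "complex \<Rightarrow> complex" and \<epsilon> :: real where
    eps: "\<epsilon> > 0" and hol: "T holomorphic_on ball 0 \<epsilon>" "(\<lambda>z. H (T z)) holomorphic_on ball 0 \<epsilon>" "(\<lambda>z. S (T z)) holomorphic_on ball 0 \<epsilon>"
    and T0: "T 0 = 1" "H 1 = 1"
    and Tre: "\<And>z. z \<in> ball 0 \<epsilon> \<Longrightarrow> Re (T z) > 0"
    and Treal: "\<And>w. \<bar>w\<bar> < \<epsilon> \<Longrightarrow> T (of_real w) = of_real (tau_of w)"
    and Sreal: "\<And>w. \<bar>w\<bar> < \<epsilon> \<Longrightarrow> w \<noteq> 0 \<Longrightarrow> S (T (of_real w)) = of_real (w / (tau_of w - 1))"
    and Hreal: "\<And>w. \<bar>w\<bar> < \<epsilon> \<Longrightarrow> w \<noteq> 0 \<Longrightarrow> H (T (of_real w)) = of_real ((w / (tau_of w - 1))\<^sup>2)"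
    using holomorphic_tau by metis
  have Tnz: "T z \<noteq> 0" "T z + 1 \<noteq> 0" if "z \<in> ball 0 \<epsilon>" for z
  proof -
    show "T z \<noteq> 0" using Tre[OF that] by auto
    have "Re (T z + 1) > 0" using Tre[OF that] by simp
    then show "T z + 1 \<noteq> 0" by (metis less_irrefl zero_complex.sel(1))
  qed
  have pw: "tau_of w powr (- real j) = inverse (tau_of w ^ j)" for w
    using tau_of_pos[of w] by (simp add: powr_minus powr_realpow)
  \<comment> \<open>This extends 1 - w psiG(w) = \<tau>^(-j) (w / (\<tau> - 1))^2 holomorphically to
    0.\<close>
  define P where "P = (\<lambda>z. inverse (T z ^ j) * H (T z))"
  have "P holomorphic_on ball 0 \<epsilon>" unfolding P_def using Tnz by (intro holomorphic_intros hol) auto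
  moreover have "P (of_real w) = of_real (1 - w * psiG j w)" if w: "0 < \<bar>w\<bar>" "\<bar>w\<bar> < \<epsilon>" for w
  proof -
    have "P (of_real w) = of_real (inverse (tau_of w ^ j) * (w / (tau_of w - 1))\<^sup>2)"
      unfolding P_def using Treal[of w] Hreal[of w] w by simp
    also have "inverse (tau_of w ^ j) * (w / (tau_of w - 1))\<^sup>2 = 1 - w * psiG j w"
      using w unfolding psiG_def pw by (simp add: right_diff_distrib power_divide power2_eq_square)
    finally show ?thesis .
  qed
  ultimately obtain p where p0: "p 0 = Re (P 0)" and p: "\<And>w. 0 < \<bar>w\<bar> \<Longrightarrow> \<bar>w\<bar> < \<epsilon> \<Longrightarrow> (\<lambda>k. p k * w ^ k) sums (1 - w * psiG j w)"
    using real_power_series[of P \<epsilon> "\<lambda>w. 1 - w * psiG j w"] by metis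
  \<comment> \<open>The constant term 1 cancels the pole 1/w in \<open>psiG\<close>, so dividing by
    w leaves a power series.\<close>
  have p1: "p 0 = 1" unfolding p0 P_def using T0 by simp
  have g: "(\<lambda>k. - p (Suc k) * w ^ k) sums psiG j w" if w: "0 < \<bar>w\<bar>" "\<bar>w\<bar> < \<epsilon>" for w
  proof -
    have "(\<lambda>k. p (Suc k) * w ^ Suc k) sums (- (w * psiG j w))"
      using sums_Suc_iff[of "\<lambda>k. p k * w ^ k" "- (w * psiG j w)"] p[OF w] p1 by simp
    from sums_mult[OF this, of "- 1 / w"] show ?thesis using w by (simp add: field_simps)
  qed
  define A where "A = (\<lambda>z. inverse (T z ^ j) * S (T z) / (T z + 1))"
  have "A holomorphic_on ball 0 \<epsilon>" unfolding A_def using Tnz by (intro holomorphic_intros hol) auto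
  moreover have "A (of_real w) = of_real (psiA j w)" if w: "0 < \<bar>w\<bar>" "\<bar>w\<bar> < \<epsilon>" for w
  proof -
    have "A (of_real w) = of_real (inverse (tau_of w ^ j) * (w / (tau_of w - 1)) / (tau_of w + 1))"
      unfolding A_def using Treal[of w] Sreal[of w] w by simp
    also have "inverse (tau_of w ^ j) * (w / (tau_of w - 1)) / (tau_of w + 1) = psiA j w"
      unfolding psiA_def pw by simp
    finally show ?thesis .
  qed
  ultimately obtain a where a: "\<And>w. 0 < \<bar>w\<bar> \<Longrightarrow> \<bar>w\<bar> < \<epsilon> \<Longrightarrow> (\<lambda>k. a k * w ^ k) sums psiA j w"
    using real_power_series[of A \<epsilon> "psiA j"] by metis
  show ?thesis by (rule that[OF eps g a])
qed

text \<open>The danger is w -> -\<infinity>, where \<open>tau_of w\<close> tends to 0. The branch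
  equation gives - ln \<tau> = 1 + w^2 / 2 - \<tau>, so the growth is at most that of a Gaussian
  exponent proportional to j.\<close>

lemma tau_of_powr_bound: "tau_of w powr (- real j) \<le> exp (real j) * exp (real j / 2 * w\<^sup>2)"
proof -
  have "ln (tau_of w) = tau_of w - 1 - w\<^sup>2 / 2" using tau_of_phase[of w] by (simp add: phase_def)
  then have "- ln (tau_of w) \<le> 1 + w\<^sup>2 / 2" using tau_of_pos[of w] by linarith
  then have "real j * (- ln (tau_of w)) \<le> real j * (1 + w\<^sup>2 / 2)" by (intro mult_left_mono) auto
  then have "exp (real j * (- ln (tau_of w))) \<le> exp (real j * (1 + w\<^sup>2 / 2))" by simp
  moreover have "tau_of w powr (- real j) = exp (real j * (- ln (tau_of w)))" using tau_of_pos[of w] by (simp add: powr_def)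
  ultimately show ?thesis by (simp add: algebra_simps flip: exp_add)
qed

text \<open>Away from 0 the denominators are bounded below. The exponent is j/2 from
  \<open>tau_of_powr_bound\<close> plus 1/2, which pays for the factor |w|.\<close>

lemma psi_growth:
  assumes r: "r > 0"
  shows "\<exists>C. \<forall>w. \<bar>w\<bar> \<ge> r \<longrightarrow> \<bar>psiG j w\<bar> \<le> C * exp ((real j + 1) / 2 * w\<^sup>2)"
    and "\<exists>C. \<forall>w. \<bar>w\<bar> \<ge> r \<longrightarrow> \<bar>psiA j w\<bar> \<le> C * exp ((real j + 1) / 2 * w\<^sup>2)"
proof -
  \<comment> \<open>Since \<open>tau_of\<close> is increasing, its distance from 1 outside (-r, r)
    is at least the smaller of the distances at the two endpoints.\<close>
  define d where "d = min (tau_of r - 1) (1 - tau_of (- r))"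
  have d: "d > 0" using r tau_of_gt_1_iff[of r] tau_of_lt_1_iff[of "- r"] by (simp add: d_def)
  have dist: "d \<le> \<bar>tau_of w - 1\<bar>" if "\<bar>w\<bar> \<ge> r" for w
  proof -
    have "w \<ge> r \<or> w \<le> - r" using that by linarith
    then have "tau_of w \<ge> tau_of r \<or> tau_of w \<le> tau_of (- r)" using monoD[OF tau_of_mono] by blast
    then show ?thesis by (auto simp: d_def min_def)
  qed
  have num: "\<bar>w\<bar> * tau_of w powr (- real j) \<le> exp (real j) * exp ((real j + 1) / 2 * w\<^sup>2)" for w
  proof -
    have "0 \<le> (\<bar>w\<bar> - 1)\<^sup>2" by simp
    then have "2 * \<bar>w\<bar> \<le> 1 + w\<^sup>2" by (simp add: power2_eq_square algebra_simps)
    then have "\<bar>w\<bar> \<le> 1 + w\<^sup>2 / 2" by simp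
    also have "\<dots> \<le> exp (w\<^sup>2 / 2)" by (rule exp_ge_add_one_self)
    finally have "\<bar>w\<bar> * tau_of w powr (- real j) \<le> exp (w\<^sup>2 / 2) * (exp (real j) * exp (real j / 2 * w\<^sup>2))"
      using tau_of_powr_bound[of w j] by (intro mult_mono) auto
    also have "\<dots> = exp (real j) * exp ((real j + 1) / 2 * w\<^sup>2)" by (simp add: algebra_simps add_divide_distrib flip: exp_add)
    finally show ?thesis .
  qed
  have e1: "1 \<le> exp ((real j + 1) / 2 * w\<^sup>2)" for w by simp
  show "\<exists>C. \<forall>w. \<bar>w\<bar> \<ge> r \<longrightarrow> \<bar>psiG j w\<bar> \<le> C * exp ((real j + 1) / 2 * w\<^sup>2)"
  proof (intro exI allI impI)
    fix w assume w: "\<bar>w\<bar> \<ge> r"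
    have "\<bar>psiG j w\<bar> \<le> \<bar>1 / w\<bar> + \<bar>w * tau_of w powr (- real j) / (tau_of w - 1)\<^sup>2\<bar>"
      unfolding psiG_def by (rule abs_triangle_ineq4)
    also have "\<bar>1 / w\<bar> \<le> 1 / r * exp ((real j + 1) / 2 * w\<^sup>2)"
    proof -
      have "\<bar>1 / w\<bar> \<le> 1 / r * 1" using w r by (simp add: frac_le)
      also have "\<dots> \<le> 1 / r * exp ((real j + 1) / 2 * w\<^sup>2)" using r e1 by (intro mult_left_mono) auto
      finally show ?thesis .
    qed
    also have "\<bar>w * tau_of w powr (- real j) / (tau_of w - 1)\<^sup>2\<bar> \<le> (exp (real j) * exp ((real j + 1) / 2 * w\<^sup>2)) / d\<^sup>2"
    proof -
      have "d\<^sup>2 \<le> \<bar>tau_of w - 1\<bar>\<^sup>2" using dist[OF w] d by (intro power_mono) auto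
      then have "(\<bar>w\<bar> * tau_of w powr (- real j)) / (tau_of w - 1)\<^sup>2 \<le> (exp (real j) * exp ((real j + 1) / 2 * w\<^sup>2)) / d\<^sup>2"
        using num[of w] d by (intro frac_le) auto
      then show ?thesis by (simp add: abs_mult)
    qed
    finally show "\<bar>psiG j w\<bar> \<le> (1 / r + exp (real j) / d\<^sup>2) * exp ((real j + 1) / 2 * w\<^sup>2)"
      by (simp add: algebra_simps)
  qed
  show "\<exists>C. \<forall>w. \<bar>w\<bar> \<ge> r \<longrightarrow> \<bar>psiA j w\<bar> \<le> C * exp ((real j + 1) / 2 * w\<^sup>2)"
  proof (intro exI allI impI)
    fix w assume w: "\<bar>w\<bar> \<ge> r"
    have "d * 1 \<le> \<bar>tau_of w - 1\<bar> * (tau_of w + 1)" using dist[OF w] d tau_of_pos[of w] by (intro mult_mono) auto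
    then have "(\<bar>w\<bar> * tau_of w powr (- real j)) / (\<bar>tau_of w - 1\<bar> * (tau_of w + 1)) \<le> (exp (real j) * exp ((real j + 1) / 2 * w\<^sup>2)) / d"
      using num[of w] d by (intro frac_le) auto
    then show "\<bar>psiA j w\<bar> \<le> exp (real j) / d * exp ((real j + 1) / 2 * w\<^sup>2)"
      using tau_of_pos[of w] by (simp add: psiA_def abs_mult)
  qed
qed

lemma tau_of_deriv_cont: "continuous_on (- {0}) (\<lambda>w. w * tau_of w / (tau_of w - 1))"
proof -
  have "continuous_on (- {0}) tau_of"
    using tau_of_deriv DERIV_isCont by (intro continuous_at_imp_continuous_on) auto
  then show ?thesis by (intro continuous_intros) (auto simp: tau_of_eq_1_iff)
qed

text \<open>The factor in front is d\<tau>/dw; its positivity removes the absolute value from the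
  substitution rule. The branch equation turns e^(-Y\<tau>) \<tau>^Y into e^(-Y) times a Gaussian,
  and the factor \<tau> of the Jacobian raises the remaining power from -1-j to -j.\<close>

lemma tau_of_weight:
  assumes "w \<noteq> 0"
  shows "w * tau_of w / (tau_of w - 1) > 0"
    and "w * tau_of w / (tau_of w - 1) * (exp (- Y * tau_of w) * tau_of w powr (Y - 1 - real j)) = exp (- Y) * (exp (- Y * w\<^sup>2 / 2) * (w * tau_of w powr (- real j) / (tau_of w - 1)))"
proof -
  define t where "t = tau_of w"
  have t: "t > 0" "t \<noteq> 1" using tau_of_pos tau_of_eq_1_iff assms by (auto simp: t_def)
  show "w * tau_of w / (tau_of w - 1) > 0"
    using assms t tau_of_gt_1_iff[of w] tau_of_lt_1_iff[of w] unfolding t_def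
    by (cases "w > 0") (auto simp: zero_less_divide_iff mult_less_0_iff zero_less_mult_iff)
  have "w\<^sup>2 / 2 = t - ln t - 1" using tau_of_phase[of w] by (simp add: phase_def t_def)
  then have lt: "ln t = t - 1 - w\<^sup>2 / 2" by linarith
  have e: "- Y * t + Y * ln t = - Y + - Y * w\<^sup>2 / 2" unfolding lt by (simp add: algebra_simps)
  have "exp (- Y * t) * t powr (Y - 1 - real j) * t = exp (- Y * t) * (t powr (Y - 1 - real j) * t powr 1)" using t by simp
  also have "t powr (Y - 1 - real j) * t powr 1 = t powr (Y + - real j)"
  proof -
    have "Y - 1 - real j + 1 = Y + - real j" by simp
    then show ?thesis by (simp only: powr_add[symmetric])
  qed
  also have "\<dots> = exp (Y * ln t) * t powr (- real j)" unfolding powr_add using t by (simp add: powr_def)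
  also have "exp (- Y * t) * (exp (Y * ln t) * t powr (- real j)) = exp (- Y * t + Y * ln t) * t powr (- real j)" by (simp only: exp_add mult.assoc)
  also have "\<dots> = exp (- Y) * exp (- Y * w\<^sup>2 / 2) * t powr (- real j)" unfolding e by (simp only: exp_add)
  finally have k: "exp (- Y * t) * t powr (Y - 1 - real j) * t = exp (- Y) * exp (- Y * w\<^sup>2 / 2) * t powr (- real j)" .
  have "w * t / (t - 1) * (exp (- Y * t) * t powr (Y - 1 - real j)) = w / (t - 1) * (exp (- Y * t) * t powr (Y - 1 - real j) * t)" by simp
  also have "\<dots> = exp (- Y) * (exp (- Y * w\<^sup>2 / 2) * (w * t powr (- real j) / (t - 1)))" unfolding k by simp
  finally show "w * tau_of w / (tau_of w - 1) * (exp (- Y * tau_of w) * tau_of w powr (Y - 1 - real j)) = exp (- Y) * (exp (- Y * w\<^sup>2 / 2) * (w * tau_of w powr (- real j) / (tau_of w - 1)))"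
    unfolding t_def .
qed

lemma psiA_nonneg: "psiA j w \<ge> 0"
proof (cases "w = 0")
  case False
  then have "w / (tau_of w - 1) \<ge> 0" using tau_of_gt_1_iff[of w] tau_of_lt_1_iff[of w] by (cases "w > 0") (auto simp: zero_le_divide_iff)
  moreover have "tau_of w powr (- real j) / (tau_of w + 1) \<ge> 0" using tau_of_pos[of w] by simp
  ultimately have "w / (tau_of w - 1) * (tau_of w powr (- real j) / (tau_of w + 1)) \<ge> 0" by (rule mult_nonneg_nonneg)
  then show ?thesis by (simp add: psiA_def)
qed (simp add: psiA_def)

lemma tau_of_image_nonzero: "tau_of ` (- {0}) = {0<..} - {1}"
proof -
  have "- {0::real} = {..<0} \<union> {0<..}" by auto
  then have "tau_of ` (- {0}) = {0<..<1} \<union> {1<..}" by (simp add: image_Un tau_of_image_lessThan tau_of_image_greaterThan)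
  also have "\<dots> = {0<..} - {1::real}" by auto
  finally show ?thesis .
qed

section \<open>The terminant integral\<close>

lemma terminant_laplace:
  "(\<integral>\<^sup>+v\<in>{0<..}. ennreal (exp (- Y * v) * v powr (Y - 1 - real j) / (1 + v)) \<partial>lborel)
     = (\<integral>\<^sup>+w. ennreal (exp (- Y) * (exp (- Y * w\<^sup>2 / 2) * psiA j w)) \<partial>lborel)"
proof -
  let ?f = "\<lambda>v. exp (- Y * v) * v powr (Y - 1 - real j) / (1 + v)"
  have "(\<integral>\<^sup>+v\<in>{0<..}. ennreal (?f v) \<partial>lborel) = (\<integral>\<^sup>+v\<in>{0<..} - {1}. ennreal (?f v) \<partial>lborel)"
    by (rule nn_integral_cong_except[of 1]) (auto simp: indicator_def)
  also have "\<dots> = (\<integral>\<^sup>+w\<in>- {0}. ennreal (\<bar>w * tau_of w / (tau_of w - 1)\<bar> * ?f (tau_of w)) \<partial>lborel)"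
    unfolding tau_of_image_nonzero[symmetric]
  proof (rule nn_integral_substitution_inj[symmetric, where f="?f" and g=tau_of and g'="\<lambda>w. w * tau_of w / (tau_of w - 1)"])
    show "tau_of ` (- {0}) \<in> sets borel" unfolding tau_of_image_nonzero by simp
    show "(tau_of has_field_derivative w * tau_of w / (tau_of w - 1)) (at w)" if "w \<in> - {0}" for w
      using that by (intro tau_of_deriv) auto
    show "inj_on tau_of (- {0})" using tau_of_inj by (rule inj_on_subset) auto
    show "?f u \<ge> 0" if "u \<in> tau_of ` (- {0})" for u using that unfolding tau_of_image_nonzero by simp
  qed (auto intro: tau_of_deriv_cont)
  also have "\<dots> = (\<integral>\<^sup>+w. ennreal (exp (- Y) * (exp (- Y * w\<^sup>2 / 2) * psiA j w)) \<partial>lborel)"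
  proof (rule nn_integral_cong_except[of 0])
    fix w :: real assume w: "w \<noteq> 0"
    have "\<bar>w * tau_of w / (tau_of w - 1)\<bar> * ?f (tau_of w) = w * tau_of w / (tau_of w - 1) * (exp (- Y * tau_of w) * tau_of w powr (Y - 1 - real j)) / (1 + tau_of w)"
      unfolding abs_of_pos[OF tau_of_weight(1)[OF w]] by simp
    also have "\<dots> = exp (- Y) * (exp (- Y * w\<^sup>2 / 2) * psiA j w)"
      unfolding tau_of_weight(2)[OF w] by (simp add: psiA_def add.commute)
    finally show "ennreal (\<bar>w * tau_of w / (tau_of w - 1)\<bar> * ?f (tau_of w)) * indicator (- {0}) w = ennreal (exp (- Y) * (exp (- Y * w\<^sup>2 / 2) * psiA j w))"
      using w by simp
  qed
  finally show ?thesis .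
qed

text \<open>Writing Gamma(\<nu>) t^(-\<nu>) as the integral of q^(\<nu>-1) e^(-tq) over q > 0 and
  exchanging it with the incomplete Gamma integral over t > Y leaves e^(-(1+q)Y) / (1 + q).\<close>

lemma terminant_nn_integral:
  assumes "Y > 0" "\<nu> > 0"
  shows "ennreal (2 * pi * exp Y * terminant \<nu> Y) = (\<integral>\<^sup>+v\<in>{0<..}. ennreal (exp (- Y * v) * v powr (\<nu> - 1) / (1 + v)) \<partial>lborel)"
    and "terminant \<nu> Y \<ge> 0"
proof -
  define G where "G = (\<lambda>t. t powr (- \<nu>) * exp (- t))"
  have intG: "G integrable_on {Y..}"
  proof (rule measurable_bounded_by_integrable_imp_integrable_real)
    show "(\<lambda>t. Y powr (- \<nu>) * exp (- 1 * t)) integrable_on {Y..}"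
      using integrable_on_exp_minus_to_infinity[of 1 Y] by (intro integrable_on_mult_right) auto
    show "\<bar>G t\<bar> \<le> Y powr (- \<nu>) * exp (- 1 * t)" if "t \<in> {Y..}" for t
    proof -
      have "t powr (- \<nu>) \<le> Y powr (- \<nu>)" using that assms by (intro powr_mono2') auto
      then show ?thesis by (simp add: G_def)
    qed
    show "G \<in> borel_measurable (lebesgue_on {Y..})"
      unfolding G_def by (intro measurable_restrict_space1 measurable_completion) measurable
  qed auto
  have uG: "(G has_integral upper_Gamma (1 - \<nu>) Y) {Y..}"
    using integrable_integral[OF intG] by (simp add: upper_Gamma_def G_def)
  have u0: "upper_Gamma (1 - \<nu>) Y \<ge> 0" by (rule has_integral_nonneg[OF uG]) (simp add: G_def)
  have g0: "Gamma \<nu> > 0" using assms by (intro Gamma_real_pos)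
  show "terminant \<nu> Y \<ge> 0" using u0 g0 by (simp add: terminant_def)
  have U: "(\<integral>\<^sup>+t\<in>{Y<..}. ennreal (G t) \<partial>lborel) = ennreal (upper_Gamma (1 - \<nu>) Y)"
  proof -
    have "(\<integral>\<^sup>+t\<in>{Y<..}. ennreal (G t) \<partial>lborel) = (\<integral>\<^sup>+t\<in>{Y..}. ennreal (G t) \<partial>lborel)"
    proof (rule nn_integral_cong_except[of Y])
      fix t :: real assume "t \<noteq> Y"
      then show "ennreal (G t) * indicator {Y<..} t = ennreal (G t) * indicator {Y..} t"
        by (cases "t > Y") (simp_all add: indicator_def)
    qed
    also have "\<dots> = ennreal (upper_Gamma (1 - \<nu>) Y)"
      by (rule nn_integral_has_integral_on) (use uG in \<open>auto simp: G_def\<close>)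
    finally show ?thesis .
  qed
  define h where "h = (\<lambda>s::real. s powr (\<nu> - 1) * exp (- s))"
  have Gam: "(\<integral>\<^sup>+s\<in>{0<..}. ennreal (h s) \<partial>lborel) = ennreal (Gamma \<nu>)"
  proof -
    have "(\<integral>\<^sup>+s\<in>{0<..}. ennreal (h s) \<partial>lborel) = (\<integral>\<^sup>+s\<in>{0..}. ennreal (h s) \<partial>lborel)"
    proof (rule nn_integral_cong_except[of 0])
      fix t :: real assume "t \<noteq> 0"
      then show "ennreal (h t) * indicator {0<..} t = ennreal (h t) * indicator {0..} t"
        by (cases "t > 0") (simp_all add: indicator_def)
    qed
    also have "\<dots> = ennreal (Gamma \<nu>)"
      using Gamma_integral_real[OF assms(2)] by (intro nn_integral_has_integral_on) (auto simp: h_def exp_minus divide_inverse)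
    finally show ?thesis .
  qed
  define D where "D = (\<lambda>t q::real. indicator {Y<..} t * indicator {0<..} q * ennreal (q powr (\<nu> - 1) * exp (- (1 + q) * t)))"
  have [measurable]: "case_prod D \<in> borel_measurable (borel \<Otimes>\<^sub>M borel)"
    unfolding D_def indicator_def greaterThan_iff by measurable
  have "ennreal (Gamma \<nu> * upper_Gamma (1 - \<nu>) Y) = (\<integral>\<^sup>+t\<in>{Y<..}. ennreal (G t) \<partial>lborel) * ennreal (Gamma \<nu>)"
    unfolding U using u0 g0 by (simp add: ennreal_mult mult.commute)
  also have "\<dots> = (\<integral>\<^sup>+t. ennreal (G t) * indicator {Y<..} t * ennreal (Gamma \<nu>) \<partial>lborel)"
    by (rule nn_integral_multc[symmetric]) (auto simp: G_def)
  also have "\<dots> = (\<integral>\<^sup>+t. (\<integral>\<^sup>+q. D t q \<partial>lborel) \<partial>lborel)"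
  proof (rule nn_integral_cong)
    fix t :: real
    show "ennreal (G t) * indicator {Y<..} t * ennreal (Gamma \<nu>) = (\<integral>\<^sup>+q. D t q \<partial>lborel)"
    proof (cases "t > Y")
      case True
      then have t: "t > 0" using assms by simp
      have im: "(\<lambda>q. t * q) ` {0<..} = {0<..}"
      proof (intro set_eqI iffI)
        fix u :: real assume "u \<in> {0<..}"
        then show "u \<in> (\<lambda>q. t * q) ` {0<..}" using t by (intro image_eqI[of _ _ "u / t"]) auto
      qed (use t in auto)
      have "(\<integral>\<^sup>+q\<in>{0<..}. ennreal (\<bar>t\<bar> * h (t * q)) \<partial>lborel) = (\<integral>\<^sup>+s\<in>(\<lambda>q. t * q) ` {0<..}. ennreal (h s) \<partial>lborel)"
      proof (rule nn_integral_substitution_inj[where f=h and g="\<lambda>q. t * q" and g'="\<lambda>_. t"])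
        show "(\<lambda>q. t * q) ` {0<..} \<in> sets borel" unfolding im by simp
        show "((\<lambda>q. t * q) has_field_derivative t) (at q)" for q by (auto intro!: derivative_eq_intros)
      qed (use t in \<open>auto simp: h_def intro!: inj_onI\<close>)
      then have "ennreal (Gamma \<nu>) = (\<integral>\<^sup>+q\<in>{0<..}. ennreal (\<bar>t\<bar> * h (t * q)) \<partial>lborel)" unfolding im Gam ..
      then have "ennreal (G t) * ennreal (Gamma \<nu>) = (\<integral>\<^sup>+q\<in>{0<..}. ennreal (G t * (\<bar>t\<bar> * h (t * q))) \<partial>lborel)"
        by (simp only:) (rule nn_set_integral_cmult[symmetric], auto simp: G_def h_def)
      also have "\<dots> = (\<integral>\<^sup>+q. D t q \<partial>lborel)"
      proof (rule nn_integral_cong)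
        fix q :: real
        have "G t * (\<bar>t\<bar> * h (t * q)) = q powr (\<nu> - 1) * exp (- (1 + q) * t)" if "q > 0"
        proof -
          have "t powr (- \<nu>) * t * t powr (\<nu> - 1) = 1"
          proof -
            have "t powr (- \<nu>) * t powr 1 * t powr (\<nu> - 1) = t powr (- \<nu> + 1 + (\<nu> - 1))" by (simp only: powr_add)
            then show ?thesis using t by simp
          qed
          moreover have "G t * (\<bar>t\<bar> * h (t * q)) = (t powr (- \<nu>) * t * t powr (\<nu> - 1)) * (q powr (\<nu> - 1) * (exp (- t) * exp (- (t * q))))"
            using t that by (simp add: G_def h_def powr_mult)
          ultimately show ?thesis by (simp add: algebra_simps flip: exp_add)
        qed
        then show "ennreal (G t * (\<bar>t\<bar> * h (t * q))) * indicator {0<..} q = D t q"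
          using True by (cases "q > 0") (auto simp: D_def)
      qed
      finally show ?thesis using True by simp
    qed (simp add: D_def)
  qed
  also have "\<dots> = (\<integral>\<^sup>+q. (\<integral>\<^sup>+t. D t q \<partial>lborel) \<partial>lborel)"
    by (rule lborel_pair.Fubini') measurable
  also have "\<dots> = (\<integral>\<^sup>+q\<in>{0<..}. ennreal (exp (- Y) * (exp (- Y * q) * q powr (\<nu> - 1) / (1 + q))) \<partial>lborel)"
  proof (rule nn_integral_cong)
    fix q :: real
    show "(\<integral>\<^sup>+t. D t q \<partial>lborel) = ennreal (exp (- Y) * (exp (- Y * q) * q powr (\<nu> - 1) / (1 + q))) * indicator {0<..} q"
    proof (cases "q > 0")
      case True
      have "(\<integral>\<^sup>+t. D t q \<partial>lborel) = (\<integral>\<^sup>+t\<in>{Y<..}. ennreal (q powr (\<nu> - 1) * ((t - Y) ^ 0 * exp (- (1 + q) * t))) \<partial>lborel)"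
        using True by (intro nn_integral_cong) (auto simp: D_def indicator_def)
      also have "\<dots> = ennreal (q powr (\<nu> - 1)) * ennreal (fact 0 * exp (- (1 + q) * Y) / (1 + q) ^ Suc 0)"
        using nn_integral_power_exp[of "1 + q" Y 0] True by (subst nn_set_integral_cmult) auto
      also have "\<dots> = ennreal (q powr (\<nu> - 1) * (fact 0 * exp (- (1 + q) * Y) / (1 + q) ^ Suc 0))"
        by (rule ennreal_mult'[symmetric]) simp
      also have "q powr (\<nu> - 1) * (fact 0 * exp (- (1 + q) * Y) / (1 + q) ^ Suc 0) = exp (- Y) * (exp (- Y * q) * q powr (\<nu> - 1) / (1 + q))"
      proof -
        have "exp (- (1 + q) * Y) = exp (- Y) * exp (- Y * q)" by (simp add: algebra_simps flip: exp_add)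
        then show ?thesis by simp
      qed
      finally show ?thesis using True by simp
    qed (simp add: D_def)
  qed
  also have "\<dots> = ennreal (exp (- Y)) * (\<integral>\<^sup>+v\<in>{0<..}. ennreal (exp (- Y * v) * v powr (\<nu> - 1) / (1 + v)) \<partial>lborel)"
    by (rule nn_set_integral_cmult) auto
  finally have e: "ennreal (Gamma \<nu> * upper_Gamma (1 - \<nu>) Y) = ennreal (exp (- Y)) * (\<integral>\<^sup>+v\<in>{0<..}. ennreal (exp (- Y * v) * v powr (\<nu> - 1) / (1 + v)) \<partial>lborel)" .
  have "ennreal (2 * pi * exp Y * terminant \<nu> Y) = ennreal (exp Y * (Gamma \<nu> * upper_Gamma (1 - \<nu>) Y))"
    by (simp add: terminant_def)
  also have "\<dots> = ennreal (exp Y) * ennreal (Gamma \<nu> * upper_Gamma (1 - \<nu>) Y)" by (rule ennreal_mult') simp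
  also have "\<dots> = (ennreal (exp Y) * ennreal (exp (- Y))) * (\<integral>\<^sup>+v\<in>{0<..}. ennreal (exp (- Y * v) * v powr (\<nu> - 1) / (1 + v)) \<partial>lborel)"
    unfolding e by (simp only: mult.assoc)
  also have "ennreal (exp Y) * ennreal (exp (- Y)) = 1" by (simp add: ennreal_mult[symmetric] exp_minus)
  finally show "ennreal (2 * pi * exp Y * terminant \<nu> Y) = (\<integral>\<^sup>+v\<in>{0<..}. ennreal (exp (- Y * v) * v powr (\<nu> - 1) / (1 + v)) \<partial>lborel)" by simp
qed

section \<open>The principal value integral at the saddle point\<close>

definition gkern :: "real \<Rightarrow> nat \<Rightarrow> real \<Rightarrow> real" where
  "gkern Y j v = exp (- Y * v) * v powr (Y - 1 - real j)"

lemma gkern_measurable [measurable]: "gkern Y j \<in> borel_measurable borel"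
  unfolding gkern_def by measurable

lemma gkern_nonneg: "gkern Y j v \<ge> 0" by (simp add: gkern_def)

text \<open>The pole \<open>1/w\<close> contributes \<open>gtail\<close> on either side of the cut. The two contributions cancel in the limit,
  because \<open>w_branch c\<close> and \<open>w_branch (1 / c)\<close> are asymptotically opposite as \<open>c \<rightarrow> 1\<close>.\<close>

definition gtail :: "real \<Rightarrow> real \<Rightarrow> real" where
  "gtail Y p = (LBINT w. indicator {p<..} w * (exp (- Y * w\<^sup>2 / 2) / w))"

lemma gtail_integrable:
  fixes Y p :: real
  assumes "Y > 0" "p > 0"
  shows "integrable lborel (\<lambda>w. indicator {p<..} w * (exp (- Y * w\<^sup>2 / 2) / w))"
proof (rule Bochner_Integration.integrable_bound)
  have "integrable lborel (\<lambda>w. exp (- Y * w\<^sup>2 / 2) * w ^ (2 * 0))"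
    using gauss_even[OF assms(1), of 0] by (simp only: has_bochner_integral_iff)
  then show "integrable lborel (\<lambda>w. 1 / p * exp (- Y * w\<^sup>2 / 2))" by simp
  show "AE w in lborel. norm (indicator {p<..} w * (exp (- Y * w\<^sup>2 / 2) / w)) \<le> norm (1 / p * exp (- Y * w\<^sup>2 / 2))"
  proof (rule AE_I2)
    fix w :: real
    show "norm (indicator {p<..} w * (exp (- Y * w\<^sup>2 / 2) / w)) \<le> norm (1 / p * exp (- Y * w\<^sup>2 / 2))"
    proof (cases "w > p")
      case True
      then have "exp (- Y * w\<^sup>2 / 2) / w \<le> exp (- Y * w\<^sup>2 / 2) / p" using assms by (intro divide_left_mono) auto
      then show ?thesis using True assms by simp
    qed simp
  qed
qed measurable

text \<open>As the Gaussian is at most 1, the difference is bounded by the integral of 1/w from p to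
  q. Only the ratio q/p matters, which is why cut points of asymptotically equal size suffice
  although \<open>gtail\<close> itself diverges as p tends to 0.\<close>

lemma gtail_diff:
  assumes Y: "Y > 0" and pq: "0 < p" "p \<le> q"
  shows "\<bar>gtail Y p - gtail Y q\<bar> \<le> ln q - ln p"
proof -
  have F: "has_bochner_integral lborel (\<lambda>w. 1 / w * indicator {p..q} w) (ln q - ln p)"
  proof (rule has_bochner_integral_FTC_Icc_real[OF pq(2)])
    show "DERIV ln x :> 1 / x" if "p \<le> x" "x \<le> q" for x using that pq by (auto intro!: derivative_eq_intros)
    show "isCont (\<lambda>x. 1 / x) x" if "p \<le> x" "x \<le> q" for x using that pq by (intro continuous_intros) auto
  qed
  let ?m = "\<lambda>p w. indicator {p<..} w * (exp (- Y * w\<^sup>2 / 2) / w)"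
  have q0: "q > 0" using pq by simp
  note ip = gtail_integrable[OF Y pq(1)] and iq = gtail_integrable[OF Y q0]
  have eq: "gtail Y p - gtail Y q = (LBINT w. ?m p w - ?m q w)"
    unfolding gtail_def by (rule Bochner_Integration.integral_diff[symmetric, OF ip iq])
  have "norm (LBINT w. ?m p w - ?m q w) \<le> (LBINT w. norm (?m p w - ?m q w))"
    by (rule integral_norm_bound)
  also have "\<dots> \<le> (LBINT w. 1 / w * indicator {p..q} w)"
  proof (rule Bochner_Integration.integral_mono)
    show "integrable lborel (\<lambda>w. norm (?m p w - ?m q w))"
      using Bochner_Integration.integrable_diff[OF ip iq] by (rule integrable_norm)
    show "integrable lborel (\<lambda>w. 1 / w * indicator {p..q} w)" using F by (simp only: has_bochner_integral_iff)
    fix w :: real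
    have "exp (- Y * w\<^sup>2 / 2) \<le> 1" using Y by simp
    then have "exp (- Y * w\<^sup>2 / 2) / w \<le> 1 / w" if "w > 0" using that by (intro divide_right_mono) auto
    then show "norm (?m p w - ?m q w) \<le> 1 / w * indicator {p..q} w"
      using pq by (auto simp: indicator_def)
  qed
  also have "\<dots> = ln q - ln p" using F by (simp only: has_bochner_integral_iff)
  finally show ?thesis unfolding eq by (simp only: real_norm_def)
qed

lemma gtail_diff_abs:
  assumes "Y > 0" "p > 0" "q > 0"
  shows "\<bar>gtail Y p - gtail Y q\<bar> \<le> \<bar>ln (q / p)\<bar>"
  using gtail_diff[OF assms(1), of p q] gtail_diff[OF assms(1), of q p] assms
  by (cases "p \<le> q") (auto simp: ln_divide_pos abs_minus_commute)

text \<open>In the variable w the integrand is a Gaussian times psiG(w) - 1/w, on w <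
  \<open>w_branch c\<close> < 0. The regular part and the pole are each integrable there, and the
  pole yields a positive tail. The inequality is needed because \<open>ennreal\<close> does not see
  negative values.\<close>

lemma pv_left_cut:
  assumes Y: "Y > 2 * (real j + 1)" and c: "0 < c" "c < 1"
    and iN: "integrable lborel (\<lambda>w. exp (- Y * w\<^sup>2 / 2) * psiG j w)"
  shows "(\<integral>\<^sup>+v\<in>{0<..<c}. ennreal (gkern Y j v / (1 - v)) \<partial>lborel)
     = ennreal (exp (- Y) * ((LBINT w. indicator {..<w_branch c} w * (exp (- Y * w\<^sup>2 / 2) * psiG j w)) + gtail Y (- w_branch c)))"
    and "exp (- Y) * ((LBINT w. indicator {..<w_branch c} w * (exp (- Y * w\<^sup>2 / 2) * psiG j w)) + gtail Y (- w_branch c)) \<ge> 0"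
proof -
  define a where "a = w_branch c"
  have a: "a < 0" using w_branch_strict_mono[of c 1] c by (simp add: a_def)
  have ta: "tau_of a = c" using tau_of_w_branch c by (simp add: a_def)
  have Y0: "Y > 0" using Y by simp
  let ?e = "\<lambda>w. exp (- Y * w\<^sup>2 / 2)"
  let ?f = "\<lambda>v. gkern Y j v / (1 - v)"
  have im: "tau_of ` {..<a} = {0<..<c}" by (simp add: tau_of_image_lessThan ta)
  have phi: "\<bar>w * tau_of w / (tau_of w - 1)\<bar> * ?f (tau_of w) = exp (- Y) * (?e w * psiG j w - ?e w / w)" if w: "w < 0" for w
  proof -
    have "\<bar>w * tau_of w / (tau_of w - 1)\<bar> * ?f (tau_of w) = (w * tau_of w / (tau_of w - 1) * (exp (- Y * tau_of w) * tau_of w powr (Y - 1 - real j))) / (1 - tau_of w)"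
      using tau_of_weight(1)[of w] w by (simp only: abs_of_pos gkern_def) simp
    also have "\<dots> = exp (- Y) * (?e w * (w * tau_of w powr (- real j) / (tau_of w - 1) / (1 - tau_of w)))"
      using w by (subst tau_of_weight(2)) auto
    also have "w * tau_of w powr (- real j) / (tau_of w - 1) / (1 - tau_of w) = psiG j w - 1 / w"
    proof -
      have "(tau_of w - 1) * (1 - tau_of w) = - (tau_of w - 1)\<^sup>2" by (simp add: power2_eq_square algebra_simps)
      then show ?thesis unfolding psiG_def divide_divide_eq_left by simp
    qed
    finally show ?thesis by (simp add: right_diff_distrib)
  qed
  have fnn: "?f v \<ge> 0" if "0 < v" "v < 1" for v using that gkern_nonneg[of Y j v] by simp
  have iM: "integrable lborel (\<lambda>w. indicator {- a<..} w * (?e w / w))" using gtail_integrable[OF Y0, of "- a"] a by simp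
  \<comment> \<open>The reflection w -> -w maps the negative half to the tail \<open>gtail\<close>
    and changes the sign.\<close>
  have iM': "has_bochner_integral lborel (\<lambda>w. indicator {..<a} w * (?e w / w)) (- gtail Y (- a))"
  proof -
    have eq: "indicator {- a<..} (0 + - 1 * w) * (?e (0 + - 1 * w) / (0 + - 1 * w)) = - (indicator {..<a} w * (?e w / w))" for w
      by (auto simp: indicator_def)
    have 1: "integrable lborel (\<lambda>w. - (indicator {..<a} w * (?e w / w)))"
      using lborel_integrable_real_affine[OF iM, of "- 1" 0] unfolding eq by simp
    have 2: "gtail Y (- a) = (LBINT w. - (indicator {..<a} w * (?e w / w)))"
      unfolding gtail_def using lborel_integral_real_affine[of "- 1" "\<lambda>w. indicator {- a<..} w * (?e w / w)" 0] unfolding eq by simp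
    show ?thesis using 1 2 by (auto simp: has_bochner_integral_iff)
  qed
  have iNa: "integrable lborel (\<lambda>w. indicator {..<a} w * (?e w * psiG j w))"
    using integrable_mult_indicator[OF _ iN, of "{..<a}"] by simp
  have nonneg: "0 \<le> exp (- Y) * (indicator {..<a} w * (?e w * psiG j w) - indicator {..<a} w * (?e w / w))" for w
  proof (cases "w < a")
    case True
    then have "0 < tau_of w" "tau_of w < 1" using tau_of_pos tau_of_lt_1_iff a by auto
    from mult_nonneg_nonneg[OF abs_ge_zero fnn[OF this]]
    have "0 \<le> \<bar>w * tau_of w / (tau_of w - 1)\<bar> * ?f (tau_of w)" .
    then show ?thesis using phi[of w] True a by simp
  qed simp
  have val: "(LBINT w. exp (- Y) * (indicator {..<a} w * (?e w * psiG j w) - indicator {..<a} w * (?e w / w)))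
      = exp (- Y) * ((LBINT w. indicator {..<a} w * (?e w * psiG j w)) + gtail Y (- a))"
    using iNa iM' by (simp add: has_bochner_integral_iff)
  have "(\<integral>\<^sup>+v\<in>{0<..<c}. ennreal (?f v) \<partial>lborel) = (\<integral>\<^sup>+w\<in>{..<a}. ennreal (\<bar>w * tau_of w / (tau_of w - 1)\<bar> * ?f (tau_of w)) \<partial>lborel)"
    unfolding im[symmetric]
  proof (rule nn_integral_substitution_inj[symmetric, where f="?f" and g=tau_of and g'="\<lambda>w. w * tau_of w / (tau_of w - 1)"])
    show "tau_of ` {..<a} \<in> sets borel" unfolding im by simp
    show "(tau_of has_field_derivative w * tau_of w / (tau_of w - 1)) (at w)" if "w \<in> {..<a}" for w
      using that a by (intro tau_of_deriv) auto
    show "inj_on tau_of {..<a}" using tau_of_inj by (rule inj_on_subset) auto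
    show "?f u \<ge> 0" if "u \<in> tau_of ` {..<a}" for u using that fnn[of u] c unfolding im by simp
    show "continuous_on {..<a} (\<lambda>w. w * tau_of w / (tau_of w - 1))" using tau_of_deriv_cont by (rule continuous_on_subset) (use a in auto)
  qed auto
  also have "\<dots> = (\<integral>\<^sup>+w. ennreal (exp (- Y) * (indicator {..<a} w * (?e w * psiG j w) - indicator {..<a} w * (?e w / w))) \<partial>lborel)"
    using phi a by (intro nn_integral_cong) (auto simp: indicator_def)
  also have "\<dots> = ennreal (LBINT w. exp (- Y) * (indicator {..<a} w * (?e w * psiG j w) - indicator {..<a} w * (?e w / w)))"
  proof (rule nn_integral_eq_integral)
    show "integrable lborel (\<lambda>w. exp (- Y) * (indicator {..<a} w * (?e w * psiG j w) - indicator {..<a} w * (?e w / w)))"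
      using iNa iM' by (intro integrable_mult_right Bochner_Integration.integrable_diff) (auto simp: has_bochner_integral_iff)
    show "AE w in lborel. 0 \<le> exp (- Y) * (indicator {..<a} w * (?e w * psiG j w) - indicator {..<a} w * (?e w / w))" using nonneg by (intro AE_I2)
  qed
  finally show "(\<integral>\<^sup>+v\<in>{0<..<c}. ennreal (?f v) \<partial>lborel) = ennreal (exp (- Y) * ((LBINT w. indicator {..<w_branch c} w * (?e w * psiG j w)) + gtail Y (- w_branch c)))"
    unfolding val by (simp only: a_def)
  have "0 \<le> (LBINT w. exp (- Y) * (indicator {..<a} w * (?e w * psiG j w) - indicator {..<a} w * (?e w / w)))"
    using nonneg by (intro integral_nonneg_AE AE_I2)
  then show "0 \<le> exp (- Y) * ((LBINT w. indicator {..<w_branch c} w * (?e w * psiG j w)) + gtail Y (- w_branch c))"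
    unfolding val by (simp only: a_def)
qed

text \<open>The part beyond 1/c, already folded onto (0, c) and with its sign reversed. Hence the
  substitution v = 1 / \<tau>(w) with w > 0, and the opposite signs of the regular part and of the
  tail in comparison with \<open>pv_left_cut\<close>.\<close>

lemma pv_right_cut:
  assumes Y: "Y > 2 * (real j + 1)" and c: "0 < c" "c < 1"
    and iN: "integrable lborel (\<lambda>w. exp (- Y * w\<^sup>2 / 2) * psiG j w)"
  shows "(\<integral>\<^sup>+v\<in>{0<..<c}. ennreal (gkern Y j (1 / v) / (v * (1 - v))) \<partial>lborel)
     = ennreal (exp (- Y) * (gtail Y (w_branch (1 / c)) - (LBINT w. indicator {w_branch (1 / c)<..} w * (exp (- Y * w\<^sup>2 / 2) * psiG j w))))"
    and "exp (- Y) * (gtail Y (w_branch (1 / c)) - (LBINT w. indicator {w_branch (1 / c)<..} w * (exp (- Y * w\<^sup>2 / 2) * psiG j w))) \<ge> 0"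
proof -
  define b where "b = w_branch (1 / c)"
  have c1: "1 < 1 / c" using c by simp
  have b: "b > 0" using w_branch_strict_mono[of 1 "1 / c"] c1 by (simp add: b_def)
  have tb: "tau_of b = 1 / c" using tau_of_w_branch c by (simp add: b_def)
  have Y0: "Y > 0" using Y by simp
  let ?e = "\<lambda>w. exp (- Y * w\<^sup>2 / 2)"
  let ?f = "\<lambda>v. gkern Y j (1 / v) / (v * (1 - v))"
  let ?g = "\<lambda>w. 1 / tau_of w"
  let ?g' = "\<lambda>w. - (w * tau_of w / (tau_of w - 1) / (tau_of w)\<^sup>2)"
  have t1: "tau_of w > 1" if "w > 0" for w using that tau_of_gt_1_iff by simp
  have im: "?g ` {b<..} = {0<..<c}"
  proof -
    have "?g ` {b<..} = (\<lambda>t. 1 / t) ` {1 / c<..}" using tau_of_image_greaterThan[of b] unfolding tb by (metis (no_types, lifting) image_cong image_image)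
    also have "\<dots> = {0<..<c}"
    proof (intro set_eqI iffI)
      fix u assume "u \<in> {0<..<c}"
      then show "u \<in> (\<lambda>t. 1 / t) ` {1 / c<..}" using c by (intro image_eqI[of _ _ "1 / u"]) (auto simp: frac_less2)
    next
      fix u assume "u \<in> (\<lambda>t. 1 / t) ` {1 / c<..}"
      then obtain t where t: "u = 1 / t" "t > 1 / c" by auto
      then have "t > 0" using c1 by linarith
      moreover have "1 < c * t" using t(2) c by (simp add: pos_divide_less_eq mult.commute)
      ultimately show "u \<in> {0<..<c}" unfolding t(1) by (simp add: pos_divide_less_eq)
    qed
    finally show ?thesis .
  qed
  have phi: "\<bar>?g' w\<bar> * ?f (?g w) = exp (- Y) * (?e w / w - ?e w * psiG j w)" if w: "w > 0" for w
  proof -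
    define t where "t = tau_of w"
    have t: "t > 1" using t1[OF w] by (simp add: t_def)
    have W: "w * t / (t - 1) > 0" using w t by simp
    then have "w * t / (t - 1) / t\<^sup>2 > 0" by (rule divide_pos_pos) (use t in auto)
    then have g: "\<bar>?g' w\<bar> = w * t / (t - 1) / t\<^sup>2" by (simp only: abs_minus_cancel abs_of_pos t_def)
    have "\<bar>?g' w\<bar> * ?f (?g w) = (w * t / (t - 1) * gkern Y j t) / (t - 1)"
      unfolding g t_def[symmetric] using t w by (simp add: divide_simps power2_eq_square)
    also have "w * t / (t - 1) * gkern Y j t = exp (- Y) * (?e w * (w * t powr (- real j) / (t - 1)))"
      unfolding t_def gkern_def using w by (subst tau_of_weight(2)) auto
    also have "\<dots> / (t - 1) = exp (- Y) * (?e w * (w * t powr (- real j) / (t - 1)\<^sup>2))"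
      by (simp add: power2_eq_square)
    also have "w * t powr (- real j) / (t - 1)\<^sup>2 = 1 / w - psiG j w" by (simp add: psiG_def t_def)
    finally show ?thesis by (simp add: right_diff_distrib)
  qed
  have fnn: "?f v \<ge> 0" if "0 < v" "v < 1" for v using that gkern_nonneg[of Y j "1 / v"] by simp
  have iM: "integrable lborel (\<lambda>w. indicator {b<..} w * (?e w / w))" by (rule gtail_integrable[OF Y0 b])
  have iNb: "integrable lborel (\<lambda>w. indicator {b<..} w * (?e w * psiG j w))"
    using integrable_mult_indicator[OF _ iN, of "{b<..}"] by simp
  have nonneg: "0 \<le> exp (- Y) * (indicator {b<..} w * (?e w / w) - indicator {b<..} w * (?e w * psiG j w))" for w
  proof (cases "w > b")
    case True
    then have "?g w \<in> {0<..<c}" unfolding im[symmetric] by (intro imageI) simp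
    then have "0 < ?g w" "?g w < 1" using c unfolding greaterThanLessThan_iff by linarith+
    from mult_nonneg_nonneg[OF abs_ge_zero fnn[OF this]] have "0 \<le> \<bar>?g' w\<bar> * ?f (?g w)" .
    then show ?thesis using phi[of w] True b by simp
  qed simp
  have int: "integrable lborel (\<lambda>w. exp (- Y) * (indicator {b<..} w * (?e w / w) - indicator {b<..} w * (?e w * psiG j w)))"
    by (intro integrable_mult_right Bochner_Integration.integrable_diff iM iNb)
  have val: "(LBINT w. exp (- Y) * (indicator {b<..} w * (?e w / w) - indicator {b<..} w * (?e w * psiG j w)))
      = exp (- Y) * (gtail Y b - (LBINT w. indicator {b<..} w * (?e w * psiG j w)))"
    using iNb iM by (simp add: gtail_def)
  have "(\<integral>\<^sup>+v\<in>{0<..<c}. ennreal (?f v) \<partial>lborel) = (\<integral>\<^sup>+w\<in>{b<..}. ennreal (\<bar>?g' w\<bar> * ?f (?g w)) \<partial>lborel)"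
    unfolding im[symmetric]
  proof (rule nn_integral_substitution_inj[symmetric, where f="?f" and g="?g" and g'="?g'"])
    show "?g ` {b<..} \<in> sets borel" unfolding im by simp
    show "(?g has_field_derivative ?g' w) (at w)" if "w \<in> {b<..}" for w
    proof -
      have "w \<noteq> 0" "tau_of w \<noteq> 0" using that b tau_of_pos[of w] by auto
      then show ?thesis
        by (auto intro!: derivative_eq_intros tau_of_deriv simp: power2_eq_square)
    qed
    show "inj_on ?g {b<..}"
    proof (rule inj_onI)
      fix x y assume "1 / tau_of x = 1 / tau_of y"
      then have "tau_of x = tau_of y" by simp
      then show "x = y" using tau_of_inj by (simp add: inj_eq)
    qed
    show "?f u \<ge> 0" if "u \<in> ?g ` {b<..}" for u using that fnn[of u] c unfolding im by simp
    have "continuous_on {b<..} tau_of"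
      using b by (intro continuous_at_imp_continuous_on ballI, intro DERIV_isCont[OF tau_of_deriv]) auto
    then show "continuous_on {b<..} ?g'"
      using b tau_of_pos[THEN less_imp_neq, THEN not_sym] by (intro continuous_intros) (auto simp: tau_of_eq_1_iff)
  qed auto
  also have "\<dots> = (\<integral>\<^sup>+w. ennreal (exp (- Y) * (indicator {b<..} w * (?e w / w) - indicator {b<..} w * (?e w * psiG j w))) \<partial>lborel)"
    using phi b by (intro nn_integral_cong) (auto simp: indicator_def)
  also have "\<dots> = ennreal (LBINT w. exp (- Y) * (indicator {b<..} w * (?e w / w) - indicator {b<..} w * (?e w * psiG j w)))"
    by (rule nn_integral_eq_integral[OF int]) (use nonneg in simp)
  finally show "(\<integral>\<^sup>+v\<in>{0<..<c}. ennreal (?f v) \<partial>lborel) = ennreal (exp (- Y) * (gtail Y (w_branch (1 / c)) - (LBINT w. indicator {w_branch (1 / c)<..} w * (?e w * psiG j w))))"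
    unfolding val by (simp only: b_def)
  have "0 \<le> (LBINT w. exp (- Y) * (indicator {b<..} w * (?e w / w) - indicator {b<..} w * (?e w * psiG j w)))"
    using nonneg by (intro integral_nonneg_AE) simp
  then show "0 \<le> exp (- Y) * (gtail Y (w_branch (1 / c)) - (LBINT w. indicator {w_branch (1 / c)<..} w * (?e w * psiG j w)))"
    unfolding val by (simp only: b_def)
qed

text \<open>\<open>reflected_exp_powr_le\<close> with p = Y - j; lowering the exponent by one
  afterwards only enlarges a power of v < 1. It makes the folded integrand nonnegative.\<close>

lemma gkern_reflect_le:
  assumes "Y > 0" "0 < v" "v < 1"
  shows "gkern Y j (1 / v) / v \<le> gkern Y j v"
proof -
  have "gkern Y j (1 / v) / v = exp (- Y / v) * v powr (- (Y - real j))"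
  proof -
    have "(1 / v) powr (Y - 1 - real j) = v powr (- (Y - 1 - real j))" using assms by (simp add: powr_divide flip: powr_minus_divide)
    moreover have "1 / v = v powr (- 1)" using assms by (simp add: powr_minus_divide)
    ultimately have "(1 / v) powr (Y - 1 - real j) / v = v powr (- (Y - 1 - real j)) * v powr (- 1)" by simp
    also have "\<dots> = v powr (- (Y - 1 - real j) + - 1)" by (simp only: powr_add)
    also have "- (Y - 1 - real j) + - 1 = - (Y - real j)" by simp
    finally have e: "(1 / v) powr (Y - 1 - real j) / v = v powr (- (Y - real j))" .
    have "gkern Y j (1 / v) / v = exp (- Y / v) * ((1 / v) powr (Y - 1 - real j) / v)" by (simp add: gkern_def)
    then show ?thesis unfolding e .
  qed
  also have "\<dots> \<le> exp (- Y * v) * v powr (Y - real j)"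
    by (rule reflected_exp_powr_le) (use assms in auto)
  also have "\<dots> \<le> gkern Y j v"
    unfolding gkern_def using assms by (intro mult_left_mono powr_mono') auto
  finally show ?thesis .
qed

text \<open>The half-line is cut at c and 1/c and c is sent to 1. On the left the integral converges
  monotonically, on the right the regular parts converge dominatedly, and the two tails cancel. So
  the pole disappears and only \<open>psiG\<close> remains.\<close>

lemma pv_saddle_integral:
  assumes Y: "Y > 2 * (real j + 1)"
    and iN: "integrable lborel (\<lambda>w. exp (- Y * w\<^sup>2 / 2) * psiG j w)"
  shows "(\<integral>\<^sup>+v\<in>{0<..<1}. ennreal (gkern Y j v / (1 - v) - gkern Y j (1 / v) / (v * (1 - v))) \<partial>lborel)
     = ennreal (exp (- Y) * (LBINT w. exp (- Y * w\<^sup>2 / 2) * psiG j w))"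
    and "exp (- Y) * (LBINT w. exp (- Y * w\<^sup>2 / 2) * psiG j w) \<ge> 0"
proof -
  define q where "q = (\<lambda>v. gkern Y j v / (1 - v) - gkern Y j (1 / v) / (v * (1 - v)))"
  have Y0: "Y > 0" using Y by simp
  have le: "gkern Y j (1 / v) / (v * (1 - v)) \<le> gkern Y j v / (1 - v)" if "0 < v" "v < 1" for v
  proof -
    have "gkern Y j (1 / v) / v / (1 - v) \<le> gkern Y j v / (1 - v)"
      using gkern_reflect_le[OF Y0 that, of j] that by (intro divide_right_mono) auto
    then show ?thesis by simp
  qed
  have [measurable]: "q \<in> borel_measurable borel" unfolding q_def by measurable
  define N where "N = (\<lambda>w. exp (- Y * w\<^sup>2 / 2) * psiG j w)"
  have iN': "integrable lborel N" using iN by (simp only: N_def)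
  \<comment> \<open>A sequence in (0, 1) increasing to 1; the shift by 2 makes it start at 1/2
    rather than at 0.\<close>
  define c where "c = (\<lambda>n::nat. 1 - 1 / (real n + 2))"
  have c: "0 < c n" "c n < 1" for n by (auto simp: c_def)
  define a where "a = (\<lambda>n. - w_branch (c n))"
  define b where "b = (\<lambda>n. w_branch (1 / c n))"
  have c1: "1 < 1 / c n" for n using c[of n] by simp
  have a_eq: "a n = sqrt (2 * phase (c n))" for n using c[of n] by (simp add: a_def w_branch_phase)
  have b_eq: "b n = sqrt (2 * phase (1 / c n))" for n using c1[of n] by (simp only: b_def w_branch_phase) simp
  have pp: "phase (c n) > 0" "phase (1 / c n) > 0" for n
    using phase_pos[of "c n"] phase_pos[of "1 / c n"] c[of n] c1[of n] by auto
  have ab: "a n > 0" "b n > 0" for n using pp[of n] by (auto simp: a_eq b_eq)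
  define r where "r = (\<lambda>n. exp (- Y) * ((LBINT w. indicator {..<- a n} w * N w + indicator {b n<..} w * N w) + (gtail Y (a n) - gtail Y (b n))))"
  have X: "(\<integral>\<^sup>+v\<in>{0<..<c n}. ennreal (q v) \<partial>lborel) = ennreal (r n)" and r0: "r n \<ge> 0" for n
  proof -
    define A where "A = exp (- Y) * ((LBINT w. indicator {..<- a n} w * N w) + gtail Y (a n))"
    define B where "B = exp (- Y) * (gtail Y (b n) - (LBINT w. indicator {b n<..} w * N w))"
    have A: "(\<integral>\<^sup>+v\<in>{0<..<c n}. ennreal (gkern Y j v / (1 - v)) \<partial>lborel) = ennreal A" and A0: "A \<ge> 0"
      using pv_left_cut[OF Y c iN, of n] by (simp_all add: A_def N_def a_def)
    have B: "(\<integral>\<^sup>+v\<in>{0<..<c n}. ennreal (gkern Y j (1 / v) / (v * (1 - v))) \<partial>lborel) = ennreal B" "B \<ge> 0"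
      using pv_right_cut[OF Y c iN, of n] by (simp_all add: B_def N_def b_def)
    have "(\<integral>\<^sup>+v\<in>{0<..<c n}. ennreal (q v) \<partial>lborel) = (\<integral>\<^sup>+v. ennreal (gkern Y j v / (1 - v)) * indicator {0<..<c n} v - ennreal (gkern Y j (1 / v) / (v * (1 - v))) * indicator {0<..<c n} v \<partial>lborel)"
    proof (rule nn_integral_cong)
      fix v
      show "ennreal (q v) * indicator {0<..<c n} v = ennreal (gkern Y j v / (1 - v)) * indicator {0<..<c n} v - ennreal (gkern Y j (1 / v) / (v * (1 - v))) * indicator {0<..<c n} v"
      proof (cases "v \<in> {0<..<c n}")
        case True
        then have "0 \<le> gkern Y j (1 / v) / (v * (1 - v))" using c[of n] gkern_nonneg by (intro divide_nonneg_nonneg mult_nonneg_nonneg) auto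
        then show ?thesis using True by (simp add: q_def ennreal_minus)
      qed simp
    qed
    also have "\<dots> = ennreal A - ennreal B"
      unfolding A[symmetric] B(1)[symmetric]
    proof (rule nn_integral_diff)
      show "(\<integral>\<^sup>+v\<in>{0<..<c n}. ennreal (gkern Y j (1 / v) / (v * (1 - v))) \<partial>lborel) \<noteq> \<infinity>" unfolding B by simp
      show "AE v in lborel. ennreal (gkern Y j (1 / v) / (v * (1 - v))) * indicator {0<..<c n} v \<le> ennreal (gkern Y j v / (1 - v)) * indicator {0<..<c n} v"
      proof (rule AE_I2)
        fix v
        show "ennreal (gkern Y j (1 / v) / (v * (1 - v))) * indicator {0<..<c n} v \<le> ennreal (gkern Y j v / (1 - v)) * indicator {0<..<c n} v"
          using le[of v] c[of n] by (cases "v \<in> {0<..<c n}") (auto intro!: ennreal_leI)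
      qed
    qed measurable
    also have "\<dots> = ennreal (A - B)" using B(2) by (simp add: ennreal_minus)
    finally have 1: "(\<integral>\<^sup>+v\<in>{0<..<c n}. ennreal (q v) \<partial>lborel) = ennreal (A - B)" .
    have "ennreal B \<le> ennreal A"
      unfolding A[symmetric] B(1)[symmetric]
    proof (rule nn_integral_mono)
      fix v
      show "ennreal (gkern Y j (1 / v) / (v * (1 - v))) * indicator {0<..<c n} v \<le> ennreal (gkern Y j v / (1 - v)) * indicator {0<..<c n} v"
        using le[of v] c[of n] by (cases "v \<in> {0<..<c n}") (auto intro!: ennreal_leI)
    qed
    then have 2: "A - B \<ge> 0" using A0 by simp
    have "integrable lborel (\<lambda>w. indicator {..<- a n} w * N w)" "integrable lborel (\<lambda>w. indicator {b n<..} w * N w)"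
      using integrable_mult_indicator[OF _ iN', of "{..<- a n}"] integrable_mult_indicator[OF _ iN', of "{b n<..}"] by simp_all
    then have "r n = A - B" by (simp add: r_def A_def B_def algebra_simps)
    then show "(\<integral>\<^sup>+v\<in>{0<..<c n}. ennreal (q v) \<partial>lborel) = ennreal (r n)" "r n \<ge> 0" using 1 2 by auto
  qed
  have clim: "c \<longlonglongrightarrow> 1" unfolding c_def by real_asymp
  have alim: "a \<longlonglongrightarrow> 0" unfolding a_eq[abs_def] phase_def c_def by real_asymp
  have blim: "b \<longlonglongrightarrow> 0" unfolding b_eq[abs_def] phase_def c_def by real_asymp
  have lim1: "(\<lambda>n. LBINT w. indicator {..<- a n} w * N w + indicator {b n<..} w * N w) \<longlonglongrightarrow> (LBINT w. N w)"
  proof (rule integral_dominated_convergence[where w="\<lambda>w. norm (N w)"])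
    show "AE w in lborel. (\<lambda>n. indicator {..<- a n} w * N w + indicator {b n<..} w * N w) \<longlonglongrightarrow> N w"
    proof (rule AE_mp[OF AE_lborel_singleton[of 0]], rule AE_I2, rule impI)
      fix w :: real assume "w \<noteq> 0"
      then consider "w < 0" | "w > 0" by linarith
      then have "eventually (\<lambda>n. indicator {..<- a n} w * N w + indicator {b n<..} w * N w = N w) sequentially"
      proof cases
        case 1
        have "eventually (\<lambda>n. a n < - w) sequentially" using order_tendstoD(2)[OF alim, of "- w"] 1 by simp
        then show ?thesis
        proof eventually_elim
          case (elim n)
          then have "w < - a n" "\<not> b n < w" using ab(2)[of n] 1 by linarith+
          then show ?case by simp
        qed
      next
        case 2
        have "eventually (\<lambda>n. b n < w) sequentially" using order_tendstoD(2)[OF blim, of w] 2 by simp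
        then show ?thesis
        proof eventually_elim
          case (elim n)
          then have "\<not> w < - a n" "b n < w" using ab(1)[of n] 2 by linarith+
          then show ?case by simp
        qed
      qed
      then show "(\<lambda>n. indicator {..<- a n} w * N w + indicator {b n<..} w * N w) \<longlonglongrightarrow> N w"
        by (rule tendsto_eventually)
    qed
    show "AE w in lborel. norm (indicator {..<- a n} w * N w + indicator {b n<..} w * N w) \<le> norm (N w)" for n
    proof (rule AE_I2)
      fix w
      have "\<not> (w < - a n \<and> b n < w)" using ab[of n] by linarith
      then show "norm (indicator {..<- a n} w * N w + indicator {b n<..} w * N w) \<le> norm (N w)" by (auto simp: indicator_def)
    qed
    show "integrable lborel (\<lambda>w. norm (N w))" using iN' by (rule integrable_norm)
  qed (use iN' in auto)
  have lim2: "(\<lambda>n. gtail Y (a n) - gtail Y (b n)) \<longlonglongrightarrow> 0"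
  proof (rule Lim_null_comparison)
    show "\<forall>\<^sub>F n in sequentially. norm (gtail Y (a n) - gtail Y (b n)) \<le> \<bar>ln (phase (1 / c n) / phase (c n)) / 2\<bar>"
    proof (rule always_eventually, rule allI)
      fix n
      \<comment> \<open>\<open>phase\<close> has a quadratic zero at 1, so its values at the
        reciprocal points c and 1/c have ratio tending to 1.\<close>
      have "b n / a n = sqrt (phase (1 / c n) / phase (c n))" by (simp add: a_eq b_eq real_sqrt_divide[symmetric])
      moreover have "phase (1 / c n) / phase (c n) > 0" using pp[of n] by simp
      ultimately have "ln (b n / a n) = ln (phase (1 / c n) / phase (c n)) / 2" by (simp only: ln_sqrt)
      then show "norm (gtail Y (a n) - gtail Y (b n)) \<le> \<bar>ln (phase (1 / c n) / phase (c n)) / 2\<bar>"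
        using gtail_diff_abs[OF Y0 ab(1)[of n] ab(2)[of n]] by (simp only: real_norm_def)
    qed
    show "(\<lambda>n. \<bar>ln (phase (1 / c n) / phase (c n)) / 2\<bar>) \<longlonglongrightarrow> 0"
      unfolding phase_def c_def by real_asymp
  qed
  have rlim: "r \<longlonglongrightarrow> exp (- Y) * (LBINT w. N w)"
    unfolding r_def using tendsto_mult_left[OF tendsto_add[OF lim1 lim2], of "exp (- Y)"] by simp
  have nn: "exp (- Y) * (LBINT w. N w) \<ge> 0" using rlim r0 by (intro LIMSEQ_le_const[OF rlim]) auto
  have "(\<lambda>n. \<integral>\<^sup>+v\<in>{0<..<c n}. ennreal (q v) \<partial>lborel) \<longlonglongrightarrow> (\<integral>\<^sup>+v\<in>{0<..<1}. ennreal (q v) \<partial>lborel)"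
  proof (rule nn_integral_LIMSEQ)
    have "c m \<le> c n" if "m \<le> n" for m n using that by (simp add: c_def frac_le)
    then show "incseq (\<lambda>n v. ennreal (q v) * indicator {0<..<c n} v)"
      by (auto simp: incseq_def le_fun_def indicator_def intro: less_le_trans)
    fix v :: real
    show "(\<lambda>n. ennreal (q v) * indicator {0<..<c n} v) \<longlonglongrightarrow> ennreal (q v) * indicator {0<..<1} v"
    proof (cases "v < 1")
      case True
      then have "eventually (\<lambda>n. v < c n) sequentially" using order_tendstoD(1)[OF clim] by simp
      then have "eventually (\<lambda>n. ennreal (q v) * indicator {0<..<c n} v = ennreal (q v) * indicator {0<..<1} v) sequentially"
        by eventually_elim (use True in \<open>simp add: indicator_def\<close>)
      then show ?thesis by (rule tendsto_eventually)
    next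
      case False
      then have "v \<notin> {0<..<c n}" for n using c(2)[of n] by auto
      then show ?thesis using False by simp
    qed
  qed measurable
  then have "(\<lambda>n. ennreal (r n)) \<longlonglongrightarrow> (\<integral>\<^sup>+v\<in>{0<..<1}. ennreal (q v) \<partial>lborel)" unfolding X .
  moreover have "(\<lambda>n. ennreal (r n)) \<longlonglongrightarrow> ennreal (exp (- Y) * (LBINT w. N w))" by (rule tendsto_ennrealI[OF rlim])
  ultimately have "(\<integral>\<^sup>+v\<in>{0<..<1}. ennreal (q v) \<partial>lborel) = ennreal (exp (- Y) * (LBINT w. N w))"
    by (rule LIMSEQ_unique)
  then show "(\<integral>\<^sup>+v\<in>{0<..<1}. ennreal (gkern Y j v / (1 - v) - gkern Y j (1 / v) / (v * (1 - v))) \<partial>lborel)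
     = ennreal (exp (- Y) * (LBINT w. exp (- Y * w\<^sup>2 / 2) * psiG j w))"
    by (simp only: q_def N_def)
  show "exp (- Y) * (LBINT w. exp (- Y * w\<^sup>2 / 2) * psiG j w) \<ge> 0" using nn by (simp only: N_def)
qed

section \<open>Expansions of the two saddle point integrals\<close>

definition saddleA :: "nat \<Rightarrow> real \<Rightarrow> real" where
  "saddleA j Y = (LBINT w. exp (- Y * w\<^sup>2 / 2) * psiA j w)"

definition saddleG :: "nat \<Rightarrow> real \<Rightarrow> real" where
  "saddleG j Y = (LBINT w. exp (- Y * w\<^sup>2 / 2) * psiG j w)"

text \<open>The threshold 2 (j + 1) is 4b for the growth exponent b = (j + 1) / 2 of
  \<open>psi_growth\<close>.\<close>

lemma saddle_expansions:
  obtains r g a where "r > (0::real)"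
    "\<And>w. 0 < \<bar>w\<bar> \<Longrightarrow> \<bar>w\<bar> < r \<Longrightarrow> (\<lambda>k. g k * w ^ k) sums psiG j w"
    "\<And>Y. Y > 2 * (real j + 1) \<Longrightarrow> integrable lborel (\<lambda>w. exp (- Y * w\<^sup>2 / 2) * psiG j w)"
    "\<And>Y. Y > 2 * (real j + 1) \<Longrightarrow> integrable lborel (\<lambda>w. exp (- Y * w\<^sup>2 / 2) * psiA j w)"
    "\<And>K. (\<lambda>Y. saddleG j Y - (\<Sum>k<K. g (2 * k) * gauss_moment Y k)) \<in> O[at_top](\<lambda>Y. 1 / (sqrt Y * Y ^ K))"
    "\<And>K. (\<lambda>Y. saddleA j Y - (\<Sum>k<K. a (2 * k) * gauss_moment Y k)) \<in> O[at_top](\<lambda>Y. 1 / (sqrt Y * Y ^ K))"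
proof -
  obtain r g a where r: "r > (0::real)"
    and g: "\<And>w. 0 < \<bar>w\<bar> \<Longrightarrow> \<bar>w\<bar> < r \<Longrightarrow> (\<lambda>k. g k * w ^ k) sums psiG j w"
    and a: "\<And>w. 0 < \<bar>w\<bar> \<Longrightarrow> \<bar>w\<bar> < r \<Longrightarrow> (\<lambda>k. a k * w ^ k) sums psiA j w"
    by (rule psi_power_series[of j]) (rule that)
  have b: "(real j + 1) / 2 \<ge> 0" by simp
  have r2: "r / 2 > 0" using r by simp
  note G = gauss_kernel_expansion[OF psi_measurable(1) r g b psi_growth(1)[OF r2]]
  note A = gauss_kernel_expansion[OF psi_measurable(2) r a b psi_growth(2)[OF r2]]
  show ?thesis
  proof (rule that[OF r g])
    show "integrable lborel (\<lambda>w. exp (- Y * w\<^sup>2 / 2) * psiG j w)"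
      if "Y > 2 * (real j + 1)" for Y
    proof (rule G(1))
      have "4 * ((real j + 1) / 2) = 2 * (real j + 1)" by simp
      then show "4 * ((real j + 1) / 2) < Y" using \<open>Y > 2 * (real j + 1)\<close> by (simp only:)
    qed
    show "integrable lborel (\<lambda>w. exp (- Y * w\<^sup>2 / 2) * psiA j w)" if "Y > 2 * (real j + 1)" for Y
    proof (rule A(1))
      have "4 * ((real j + 1) / 2) = 2 * (real j + 1)" by simp
      then show "4 * ((real j + 1) / 2) < Y" using \<open>Y > 2 * (real j + 1)\<close> by (simp only:)
    qed
    show "(\<lambda>Y. saddleG j Y - (\<Sum>k<K. g (2 * k) * gauss_moment Y k)) \<in> O[at_top](\<lambda>Y. 1 / (sqrt Y * Y ^ K))" for K
      unfolding saddleG_def by (rule G(2))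
    show "(\<lambda>Y. saddleA j Y - (\<Sum>k<K. a (2 * k) * gauss_moment Y k)) \<in> O[at_top](\<lambda>Y. 1 / (sqrt Y * Y ^ K))" for K
      unfolding saddleA_def by (rule A(2))
  qed
qed

lemma saddle_integrable:
  assumes "Y > 2 * (real j + 1)"
  shows "integrable lborel (\<lambda>w. exp (- Y * w\<^sup>2 / 2) * psiG j w)"
    and "integrable lborel (\<lambda>w. exp (- Y * w\<^sup>2 / 2) * psiA j w)"
proof -
  show "integrable lborel (\<lambda>w. exp (- Y * w\<^sup>2 / 2) * psiG j w)"
    by (rule saddle_expansions[of j]) (use assms in blast)
  show "integrable lborel (\<lambda>w. exp (- Y * w\<^sup>2 / 2) * psiA j w)"
    by (rule saddle_expansions[of j]) (use assms in blast)
qed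

lemma saddleA_nn:
  assumes "Y > 2 * (real j + 1)"
  shows "(\<integral>\<^sup>+v\<in>{0<..}. ennreal (gkern Y j v / (1 + v)) \<partial>lborel) = ennreal (exp (- Y) * saddleA j Y)"
    and "saddleA j Y \<ge> 0"
proof -
  have "(\<integral>\<^sup>+w. ennreal (exp (- Y) * (exp (- Y * w\<^sup>2 / 2) * psiA j w)) \<partial>lborel) = ennreal (LBINT w. exp (- Y) * (exp (- Y * w\<^sup>2 / 2) * psiA j w))"
    by (rule nn_integral_eq_integral) (use saddle_integrable(2)[OF assms] psiA_nonneg in auto)
  then show "(\<integral>\<^sup>+v\<in>{0<..}. ennreal (gkern Y j v / (1 + v)) \<partial>lborel) = ennreal (exp (- Y) * saddleA j Y)"
    using terminant_laplace[of Y j] by (simp add: gkern_def saddleA_def)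
  show "saddleA j Y \<ge> 0" unfolding saddleA_def using psiA_nonneg by (intro integral_nonneg_AE) auto
qed

lemma saddle_combined:
  assumes Y: "Y > 2 * (real j + 1)"
  shows "(\<integral>\<^sup>+v\<in>{0<..<1}. ennreal ((gkern Y j v - gkern Y j (1 / v)) / (1 - v\<^sup>2)) \<partial>lborel)
     = ennreal (exp (- Y) / 2 * (saddleA j Y + saddleG j Y))"
    and "saddleG j Y \<ge> 0"
proof -
  define f where "f = (\<lambda>v. gkern Y j v / (1 + v))"
  define q where "q = (\<lambda>v. gkern Y j v / (1 - v) - gkern Y j (1 / v) / (v * (1 - v)))"
  have [measurable]: "f \<in> borel_measurable borel" "q \<in> borel_measurable borel" unfolding f_def q_def by measurable
  note S = pv_saddle_integral[OF Y saddle_integrable(1)[OF Y]]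
  have Y0: "Y > 0" using Y by simp
  have f0: "f v \<ge> 0" if "v > 0" for v using that gkern_nonneg by (simp add: f_def)
  have q0: "q v \<ge> 0" if "0 < v" "v < 1" for v
  proof -
    have "gkern Y j (1 / v) / v / (1 - v) \<le> gkern Y j v / (1 - v)"
      using gkern_reflect_le[OF Y0 that, of j] that by (intro divide_right_mono) auto
    then show ?thesis by (simp add: q_def)
  qed
  \<comment> \<open>The partial fraction decomposition in folded form. Folding sends f(v) = gkern(v)
    / (1 + v) to f(v) + f(1/v) / v^2 and the singular half to \<open>q\<close>. Both halves are
    nonnegative, so the extended integral splits.\<close>
  have alg: "(gkern Y j v - gkern Y j (1 / v)) / (1 - v\<^sup>2) = 1 / 2 * (f v + f (1 / v) / v\<^sup>2) + 1 / 2 * q v" if v: "0 < v" "v < 1" for v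
  proof -
    define A B where "A = gkern Y j v" and "B = gkern Y j (1 / v)"
    define m p where "m = 1 - v" and "p = 1 + v"
    have mp: "m > 0" "p > 0" "v = p - 1" "m = 2 - p" using v by (auto simp: m_def p_def)
    have s: "1 - v\<^sup>2 = m * p" by (simp add: m_def p_def power2_eq_square algebra_simps)
    have "1 + 1 / v = p / v" using v by (simp add: p_def field_simps)
    then have t: "B / (1 + 1 / v) / v\<^sup>2 = B / (v * p)" using v by (simp add: power2_eq_square)
    have 1: "A / p + A / m = 2 * A / (m * p)" using mp(1,2) by (simp add: divide_simps) (simp add: mp algebra_simps)
    have 2: "B / (v * m) - B / (v * p) = 2 * B / (m * p)"
    proof -
      have "B / (v * m) - B / (v * p) = B * (p - m) / (v * (m * p))" using mp(1,2) v by (simp add: divide_simps) (simp add: algebra_simps)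
      also have "p - m = 2 * v" by (simp add: m_def p_def)
      finally show ?thesis using v by simp
    qed
    have "(A - B) / (m * p) = 1 / 2 * (2 * A / (m * p)) - 1 / 2 * (2 * B / (m * p))" by (simp add: diff_divide_distrib)
    then have "(A - B) / (m * p) = 1 / 2 * (A / p + B / (v * p)) + 1 / 2 * (A / m - B / (v * m))"
      unfolding 1[symmetric] 2[symmetric] by (simp add: algebra_simps)
    then have "(A - B) / (1 - v\<^sup>2) = 1 / 2 * (A / (1 + v) + B / (1 + 1 / v) / v\<^sup>2) + 1 / 2 * (A / (1 - v) - B / (v * (1 - v)))"
      unfolding s t by (simp only: m_def p_def)
    then show ?thesis unfolding A_def B_def f_def q_def .
  qed
  show g0: "saddleG j Y \<ge> 0" using S(2) by (simp add: saddleG_def zero_le_mult_iff)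
  have "(\<integral>\<^sup>+v\<in>{0<..<1}. ennreal ((gkern Y j v - gkern Y j (1 / v)) / (1 - v\<^sup>2)) \<partial>lborel)
    = (\<integral>\<^sup>+v. ennreal (1 / 2 * (f v + f (1 / v) / v\<^sup>2)) * indicator {0<..<1} v + ennreal (1 / 2 * q v) * indicator {0<..<1} v \<partial>lborel)"
  proof (rule nn_integral_cong)
    fix v :: real
    show "ennreal ((gkern Y j v - gkern Y j (1 / v)) / (1 - v\<^sup>2)) * indicator {0<..<1} v = ennreal (1 / 2 * (f v + f (1 / v) / v\<^sup>2)) * indicator {0<..<1} v + ennreal (1 / 2 * q v) * indicator {0<..<1} v"
    proof (cases "v \<in> {0<..<1}")
      case True
      then have v: "0 < v" "v < 1" by auto
      have "0 \<le> 1 / 2 * (f v + f (1 / v) / v\<^sup>2)" "0 \<le> 1 / 2 * q v" using f0[of v] f0[of "1 / v"] q0[OF v] v by auto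
      then show ?thesis using True by (simp only: alg[OF v] ennreal_plus indicator_def simp_thms of_bool_eq mult_1_right)
    qed simp
  qed
  also have "\<dots> = (\<integral>\<^sup>+v\<in>{0<..<1}. ennreal (1 / 2 * (f v + f (1 / v) / v\<^sup>2)) \<partial>lborel) + (\<integral>\<^sup>+v\<in>{0<..<1}. ennreal (1 / 2 * q v) \<partial>lborel)"
    by (rule nn_integral_add) measurable
  also have "(\<integral>\<^sup>+v\<in>{0<..<1}. ennreal (1 / 2 * (f v + f (1 / v) / v\<^sup>2)) \<partial>lborel) = ennreal (1 / 2) * (\<integral>\<^sup>+v\<in>{0<..<1}. ennreal (f v + f (1 / v) / v\<^sup>2) \<partial>lborel)"
    by (rule nn_set_integral_cmult) auto
  also have "(\<integral>\<^sup>+v\<in>{0<..<1}. ennreal (f v + f (1 / v) / v\<^sup>2) \<partial>lborel) = ennreal (exp (- Y) * saddleA j Y)"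
    using nn_integral_fold_at_1[of f] f0 saddleA_nn(1)[OF Y] by (simp add: f_def)
  also have "(\<integral>\<^sup>+v\<in>{0<..<1}. ennreal (1 / 2 * q v) \<partial>lborel) = ennreal (1 / 2) * (\<integral>\<^sup>+v\<in>{0<..<1}. ennreal (q v) \<partial>lborel)"
    by (rule nn_set_integral_cmult) auto
  also have "(\<integral>\<^sup>+v\<in>{0<..<1}. ennreal (q v) \<partial>lborel) = ennreal (exp (- Y) * saddleG j Y)"
    using S(1) by (simp only: q_def saddleG_def)
  also have "ennreal (1 / 2) * ennreal (exp (- Y) * saddleA j Y) = ennreal (1 / 2 * (exp (- Y) * saddleA j Y))" by (rule ennreal_mult'[symmetric]) simp
  also have "ennreal (1 / 2) * ennreal (exp (- Y) * saddleG j Y) = ennreal (1 / 2 * (exp (- Y) * saddleG j Y))" by (rule ennreal_mult'[symmetric]) simp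
  also have "ennreal (1 / 2 * (exp (- Y) * saddleA j Y)) + ennreal (1 / 2 * (exp (- Y) * saddleG j Y)) = ennreal (1 / 2 * (exp (- Y) * saddleA j Y) + 1 / 2 * (exp (- Y) * saddleG j Y))"
    using saddleA_nn(2)[OF Y] g0 by (intro ennreal_plus[symmetric]) auto
  also have "1 / 2 * (exp (- Y) * saddleA j Y) + 1 / 2 * (exp (- Y) * saddleG j Y) = exp (- Y) / 2 * (saddleA j Y + saddleG j Y)" by (simp add: algebra_simps)
  finally show "(\<integral>\<^sup>+v\<in>{0<..<1}. ennreal ((gkern Y j v - gkern Y j (1 / v)) / (1 - v\<^sup>2)) \<partial>lborel) = ennreal (exp (- Y) / 2 * (saddleA j Y + saddleG j Y))" .
qed

lemma terminant_saddle:
  assumes Y: "Y > 2 * (real j + 1)"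
  shows "terminant (Y + - real j) Y = exp (- 2 * Y) / (2 * pi) * saddleA j Y"
proof -
  have nu: "Y + - real j > 0" "Y > 0" using Y by auto
  have "ennreal (2 * pi * exp Y * terminant (Y + - real j) Y) = ennreal (exp (- Y) * saddleA j Y)"
    unfolding terminant_nn_integral(1)[OF nu(2,1)] saddleA_nn(1)[OF Y, symmetric]
    by (simp add: gkern_def algebra_simps)
  then have "2 * pi * exp Y * terminant (Y + - real j) Y = exp (- Y) * saddleA j Y"
    using terminant_nn_integral(2)[OF nu(2,1)] saddleA_nn(2)[OF Y] by (subst (asm) ennreal_inj) auto
  then have "terminant (Y + - real j) Y = exp (- Y) / exp Y / (2 * pi) * saddleA j Y" by (simp add: field_simps)
  moreover have "exp (- 2 * Y) = exp (- Y) / exp Y" by (simp flip: exp_diff)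
  ultimately show ?thesis by simp
qed

lemma inverse_power_scale:
  "(\<lambda>y::real. 1 / y ^ Suc n) \<in> o[at_top](\<lambda>y. 1 / y ^ n)"
  "eventually (\<lambda>y::real. 1 / y ^ n \<noteq> 0) at_top"
proof -
  have "(\<lambda>s::real. 1 / s * (1 / s ^ n)) \<in> o[at_top](\<lambda>s. 1 * (1 / s ^ n))"
    by (rule landau_o.small_big_mult) (real_asymp, simp)
  then show "(\<lambda>y::real. 1 / y ^ Suc n) \<in> o[at_top](\<lambda>y. 1 / y ^ n)" by simp
  show "eventually (\<lambda>y::real. 1 / y ^ n \<noteq> 0) at_top"
    using eventually_gt_at_top[of "0::real"] by eventually_elim simp
qed

text \<open>The error function in the definition is existentially bound; dividing by the positive
  prefactor recovers it eventually, which gives the form required by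
  \<open>asymptotic_coeffs_unique\<close>.\<close>

lemma terminant_coeffs_unique:
  assumes "terminant_coeffs \<gamma> a" "terminant_coeffs \<gamma> b"
  shows "a = b"
proof -
  define p where "p = (\<lambda>y::real. exp (- 2 * y) / (2 * sqrt (2 * pi * y)))"
  have *: "(\<lambda>y. terminant (y + \<gamma>) y / p y - (\<Sum>j<K. a j * (1 / y ^ j))) \<in> O[at_top](\<lambda>y. 1 / y ^ K)"
    if a: "terminant_coeffs \<gamma> a" and K: "K \<ge> 1" for a K
  proof -
    obtain E where E: "E \<in> O[at_top](\<lambda>y. 1 / y ^ K)"
      "\<forall>\<^sub>F y in at_top. terminant (y + \<gamma>) y = p y * ((\<Sum>k<K. a k / y ^ k) + E y)"
      using a K unfolding terminant_coeffs_def p_def by blast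
    have "\<forall>\<^sub>F y in at_top. E y = terminant (y + \<gamma>) y / p y - (\<Sum>j<K. a j * (1 / y ^ j))"
      using E(2) eventually_gt_at_top[of 0]
    proof eventually_elim
      case (elim y)
      then have "p y > 0" by (simp add: p_def)
      then show ?case using elim(1) by simp
    qed
    then have "E \<in> O[at_top](\<lambda>y. 1 / y ^ K) \<longleftrightarrow> (\<lambda>y. terminant (y + \<gamma>) y / p y - (\<Sum>j<K. a j * (1 / y ^ j))) \<in> O[at_top](\<lambda>y. 1 / y ^ K)"
      by (rule landau_o.big.in_cong)
    then show ?thesis using E(1) by simp
  qed
  show ?thesis
    by (rule asymptotic_coeffs_unique[where F=at_top and \<phi>="\<lambda>n y. 1 / y ^ n" and f="\<lambda>y. terminant (y + \<gamma>) y / p y"])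
      (use * assms inverse_power_scale in simp_all)
qed

text \<open>The factor sqrt (2Y/pi) turns the sqrt (2 pi/Y) of the Gaussian moments into 2. This is
  where 2^(k+1) (1/2)_k comes from. The same factor normalises the terminant, so the expansion of
  \<open>saddleA\<close> supplies the A coefficients already scaled.\<close>

lemma saddle_D_expansion:
  "(\<lambda>Y. sqrt (2 * Y / pi) * (saddleA j Y + saddleG j Y) - (\<Sum>k<K. D_coeff k j / Y ^ k)) \<in> O[at_top](\<lambda>Y. 1 / Y ^ K)"
proof -
  obtain r g a where r: "r > (0::real)"
    and g: "\<And>w. 0 < \<bar>w\<bar> \<Longrightarrow> \<bar>w\<bar> < r \<Longrightarrow> (\<lambda>k. g k * w ^ k) sums psiG j w"
    and GE: "\<And>K. (\<lambda>Y. saddleG j Y - (\<Sum>k<K. g (2 * k) * gauss_moment Y k)) \<in> O[at_top](\<lambda>Y. 1 / (sqrt Y * Y ^ K))"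
    and AE: "\<And>K. (\<lambda>Y. saddleA j Y - (\<Sum>k<K. a (2 * k) * gauss_moment Y k)) \<in> O[at_top](\<lambda>Y. 1 / (sqrt Y * Y ^ K))"
    by (rule saddle_expansions[of j]) (rule that)
  have Gc: "G_coeff (- real j) = g"
    unfolding G_coeff_def
  proof (rule the_equality)
    show "branch_coeffs (- real j) g"
      unfolding branch_coeffs_def
    proof (intro exI conjI allI impI)
      show "r > 0" by (rule r)
      fix w :: real assume "0 < \<bar>w\<bar> \<and> \<bar>w\<bar> < r"
      then show "(\<lambda>k. g k * w ^ k) sums (tau_of w powr (- real j - 1) / (1 - tau_of w) * deriv tau_of w + 1 / w)"
        using g[of w] branch_expression[of w j] by simp
    qed
    fix h assume "branch_coeffs (- real j) h"
    then obtain r' where r': "r' > 0" "\<And>w. 0 < \<bar>w\<bar> \<Longrightarrow> \<bar>w\<bar> < r' \<Longrightarrow> (\<lambda>k. h k * w ^ k) sums (tau_of w powr (- real j - 1) / (1 - tau_of w) * deriv tau_of w + 1 / w)"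
      unfolding branch_coeffs_def by blast
    have "(\<lambda>k. h k * w ^ k) sums psiG j w" if "0 < \<bar>w\<bar>" "\<bar>w\<bar> < r'" for w
      using r'(2)[OF that] branch_expression[of w j] that by simp
    then show "h = g" using power_series_unique[OF r'(1) _ r g] by blast
  qed
  \<comment> \<open>The even Taylor coefficients of \<open>psiA\<close> times their Gaussian
    moments; shown below to be the terminant coefficients.\<close>
  define A where "A = (\<lambda>k. 2 ^ (k + 1) * pochhammer (1/2) k * a (2 * k))"
  have s1: "(\<lambda>Y. sqrt (2 * Y / pi) * (1 / (sqrt Y * Y ^ K))) \<in> O[at_top](\<lambda>Y. 1 / Y ^ K)" for K
  proof -
    have "eventually (\<lambda>Y. sqrt (2 / pi) * (1 / Y ^ K) = sqrt (2 * Y / pi) * (1 / (sqrt Y * Y ^ K))) at_top"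
      using eventually_gt_at_top[of 0] by eventually_elim (simp add: real_sqrt_mult real_sqrt_divide)
    then have "(\<lambda>Y. sqrt (2 / pi) * (1 / Y ^ K)) \<in> O[at_top](\<lambda>Y. 1 / Y ^ K) \<longleftrightarrow> (\<lambda>Y. sqrt (2 * Y / pi) * (1 / (sqrt Y * Y ^ K))) \<in> O[at_top](\<lambda>Y. 1 / Y ^ K)"
      by (rule landau_o.big.in_cong)
    moreover have "(\<lambda>Y. sqrt (2 / pi) * (1 / Y ^ K)) \<in> O[at_top](\<lambda>Y. 1 / Y ^ K)" by (rule bigo_cmult) simp
    ultimately show ?thesis by iprover
  qed
  have gm: "sqrt (2 * Y / pi) * (b * gauss_moment Y k) = 2 ^ (k + 1) * pochhammer (1/2) k * b / Y ^ k" if "Y > 0" for Y b k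
  proof -
    have "sqrt (2 * Y / pi) * sqrt (2 * pi / Y) = sqrt (2\<^sup>2)" using that by (subst real_sqrt_mult[symmetric]) (simp add: field_simps)
    then have "sqrt (2 * Y / pi) * sqrt (2 * pi / Y) = 2" by simp
    moreover have "sqrt (2 * Y / pi) * (b * (sqrt (2 * pi / Y) * c)) = (sqrt (2 * Y / pi) * sqrt (2 * pi / Y)) * (b * c)" for c by (simp only: mult_ac)
    ultimately show ?thesis by (simp add: gauss_moment_def)
  qed
  have scaled: "(\<lambda>Y. sqrt (2 * Y / pi) * S Y - (\<Sum>k<K. 2 ^ (k + 1) * pochhammer (1/2) k * b (2 * k) / Y ^ k)) \<in> O[at_top](\<lambda>Y. 1 / Y ^ K)"
    if S: "(\<lambda>Y. S Y - (\<Sum>k<K. b (2 * k) * gauss_moment Y k)) \<in> O[at_top](\<lambda>Y. 1 / (sqrt Y * Y ^ K))" for S b K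
  proof -
    have "(\<lambda>Y. sqrt (2 * Y / pi) * (S Y - (\<Sum>k<K. b (2 * k) * gauss_moment Y k))) \<in> O[at_top](\<lambda>Y. sqrt (2 * Y / pi) * (1 / (sqrt Y * Y ^ K)))"
      by (rule landau_o.big.mult_left[OF S])
    also note s1
    finally have o: "(\<lambda>Y. sqrt (2 * Y / pi) * (S Y - (\<Sum>k<K. b (2 * k) * gauss_moment Y k))) \<in> O[at_top](\<lambda>Y. 1 / Y ^ K)" .
    have "eventually (\<lambda>Y. sqrt (2 * Y / pi) * (S Y - (\<Sum>k<K. b (2 * k) * gauss_moment Y k)) = sqrt (2 * Y / pi) * S Y - (\<Sum>k<K. 2 ^ (k + 1) * pochhammer (1/2) k * b (2 * k) / Y ^ k)) at_top"
      using eventually_gt_at_top[of 0] by eventually_elim (simp only: right_diff_distrib sum_distrib_left gm)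
    then have "(\<lambda>Y. sqrt (2 * Y / pi) * (S Y - (\<Sum>k<K. b (2 * k) * gauss_moment Y k))) \<in> O[at_top](\<lambda>Y. 1 / Y ^ K)
      \<longleftrightarrow> (\<lambda>Y. sqrt (2 * Y / pi) * S Y - (\<Sum>k<K. 2 ^ (k + 1) * pochhammer (1/2) k * b (2 * k) / Y ^ k)) \<in> O[at_top](\<lambda>Y. 1 / Y ^ K)"
      by (rule landau_o.big.in_cong)
    then show ?thesis using o by iprover
  qed
  have Ac: "A_coeff (- real j) = A"
    unfolding A_coeff_def
  proof (rule the_equality)
    show "terminant_coeffs (- real j) A"
      unfolding terminant_coeffs_def
    proof (intro allI impI)
      fix K :: nat
      define E where "E = (\<lambda>Y. sqrt (2 * Y / pi) * saddleA j Y - (\<Sum>k<K. A k / Y ^ k))"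
      have "E \<in> O[at_top](\<lambda>y. 1 / y ^ K)" unfolding E_def A_def by (rule scaled[OF AE])
      moreover have "\<forall>\<^sub>F y in at_top. terminant (y + - real j) y = exp (- 2 * y) / (2 * sqrt (2 * pi * y)) * ((\<Sum>k<K. A k / y ^ k) + E y)"
        using eventually_gt_at_top[of "2 * (real j + 1)"]
      proof eventually_elim
        case (elim y)
        then have y: "y > 0" by simp
        \<comment> \<open>The prefactor in the definition of the A coefficients, times the scaling,
          is the constant in \<open>terminant_saddle\<close>.\<close>
        have "sqrt (2 * y / pi) / (2 * sqrt (2 * pi * y)) = 1 / (2 * pi)"
        proof -
          have "sqrt (2 * y / pi) = sqrt (2 * pi * y) / pi"
          proof -
            have "2 * y / pi = (2 * pi * y) / pi\<^sup>2" by (simp add: power2_eq_square)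
            then have "sqrt (2 * y / pi) = sqrt (2 * pi * y) / sqrt (pi\<^sup>2)" by (simp only: real_sqrt_divide)
            then show ?thesis by simp
          qed
          then show ?thesis using y by simp
        qed
        note h = this
        have "exp (- 2 * y) / (2 * sqrt (2 * pi * y)) * (sqrt (2 * y / pi) * saddleA j y) = exp (- 2 * y) * (sqrt (2 * y / pi) / (2 * sqrt (2 * pi * y))) * saddleA j y" by simp
        then have "exp (- 2 * y) / (2 * sqrt (2 * pi * y)) * (sqrt (2 * y / pi) * saddleA j y) = exp (- 2 * y) / (2 * pi) * saddleA j y"
          unfolding h by simp
        then show ?case unfolding terminant_saddle[OF elim] E_def by simp
      qed
      ultimately show "\<exists>E\<in>O[at_top](\<lambda>y. 1 / y ^ K). \<forall>\<^sub>F y in at_top. terminant (y + - real j) y = exp (- 2 * y) / (2 * sqrt (2 * pi * y)) * ((\<Sum>k<K. A k / y ^ k) + E y)"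
        by blast
    qed
    then show "h = A" if "terminant_coeffs (- real j) h" for h using that terminant_coeffs_unique by blast
  qed
  have D: "D_coeff k j = 2 ^ (k + 1) * pochhammer (1/2) k * (a (2 * k) + g (2 * k))" for k
    unfolding D_coeff_def Ac Gc A_def by (simp add: algebra_simps)
  have "(\<lambda>Y. (sqrt (2 * Y / pi) * saddleA j Y - (\<Sum>k<K. 2 ^ (k + 1) * pochhammer (1/2) k * a (2 * k) / Y ^ k)) + (sqrt (2 * Y / pi) * saddleG j Y - (\<Sum>k<K. 2 ^ (k + 1) * pochhammer (1/2) k * g (2 * k) / Y ^ k))) \<in> O[at_top](\<lambda>Y. 1 / Y ^ K)"
    by (intro sum_in_bigo scaled AE GE)
  then show ?thesis
    by (simp add: D distrib_left add_divide_distrib sum.distrib algebra_simps)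
qed

section \<open>The asymptotic expansion\<close>

lemma shifted_exp_bochner:
  fixes a :: real
  assumes "a > 0"
  shows "has_bochner_integral lborel (\<lambda>y. indicator {1<..} y * ((y - 1) ^ j * exp (- a * y))) (fact j * exp (- a) / a ^ Suc j)"
proof (rule has_bochner_integral_nn_integral)
  have "(\<integral>\<^sup>+y. ennreal (indicator {1<..} y * ((y - 1) ^ j * exp (- a * y))) \<partial>lborel) = (\<integral>\<^sup>+y\<in>{1<..}. ennreal ((y - 1) ^ j * exp (- a * y)) \<partial>lborel)"
    by (intro nn_integral_cong) (auto simp: indicator_def)
  then show "(\<integral>\<^sup>+y. ennreal (indicator {1<..} y * ((y - 1) ^ j * exp (- a * y))) \<partial>lborel) = ennreal (fact j * exp (- a) / a ^ Suc j)"
    using nn_integral_power_exp[OF assms, of 1 j] by simp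
  show "AE y in lborel. 0 \<le> indicator {1<..} y * ((y - 1) ^ j * exp (- a * y))" by (intro AE_I2) (auto simp: indicator_def)
qed (use assms in auto)

text \<open>For fixed v, integrating over y produces j! e^(-Yv) / (Yv)^(j+1) and the same with 1/v.
  Since N = x, the factor v^(2N) is v^Y, and the two results are the kernel at v and at 1/v.\<close>

lemma pv_moment:
  fixes n j :: nat
  defines "x \<equiv> real n" and "Y \<equiv> 2 * real n"
  assumes n: "n \<ge> 1" and Y: "Y > 2 * (real j + 1)"
  shows "(\<integral>\<^sup>+y\<in>{1<..}. ennreal ((y - 1) ^ j) * (\<integral>\<^sup>+v\<in>{0<..<1}. ennreal (pv_integrand n (x * y) v) \<partial>lborel) \<partial>lborel)
     = ennreal (fact j / Y ^ Suc j * (exp (- Y) / 2 * (saddleA j Y + saddleG j Y)))"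
proof -
  have x: "x > 0" and Y0: "Y > 0" and Yx: "Y = 2 * x" using n by (auto simp: x_def Y_def)
  define T where "T = (\<lambda>y v. indicator {1<..} y * indicator {0<..<1} v * ennreal ((y - 1) ^ j * pv_integrand n (x * y) v))"
  have [measurable]: "case_prod T \<in> borel_measurable (borel \<Otimes>\<^sub>M borel)"
    unfolding T_def indicator_def greaterThan_iff greaterThanLessThan_iff by measurable
  have "(\<integral>\<^sup>+y\<in>{1<..}. ennreal ((y - 1) ^ j) * (\<integral>\<^sup>+v\<in>{0<..<1}. ennreal (pv_integrand n (x * y) v) \<partial>lborel) \<partial>lborel)
     = (\<integral>\<^sup>+y. (\<integral>\<^sup>+v. T y v \<partial>lborel) \<partial>lborel)"
  proof (rule nn_integral_cong)
    fix y :: real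
    show "ennreal ((y - 1) ^ j) * (\<integral>\<^sup>+v\<in>{0<..<1}. ennreal (pv_integrand n (x * y) v) \<partial>lborel) * indicator {1<..} y = (\<integral>\<^sup>+v. T y v \<partial>lborel)"
    proof (cases "y > 1")
      case True
      have "(\<integral>\<^sup>+v. T y v \<partial>lborel) = (\<integral>\<^sup>+v\<in>{0<..<1}. ennreal ((y - 1) ^ j * pv_integrand n (x * y) v) \<partial>lborel)"
        using True by (intro nn_integral_cong) (simp add: T_def mult.commute)
      also have "\<dots> = ennreal ((y - 1) ^ j) * (\<integral>\<^sup>+v\<in>{0<..<1}. ennreal (pv_integrand n (x * y) v) \<partial>lborel)"
        using True by (intro nn_set_integral_cmult) auto
      finally show ?thesis using True by simp
    qed (simp add: T_def)
  qed
  also have "\<dots> = (\<integral>\<^sup>+v. (\<integral>\<^sup>+y. T y v \<partial>lborel) \<partial>lborel)"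
    by (rule lborel_pair.Fubini') measurable
  also have "\<dots> = (\<integral>\<^sup>+v\<in>{0<..<1}. ennreal (fact j / Y ^ Suc j * ((gkern Y j v - gkern Y j (1 / v)) / (1 - v\<^sup>2))) \<partial>lborel)"
  proof (rule nn_integral_cong)
    fix v :: real
    show "(\<integral>\<^sup>+y. T y v \<partial>lborel) = ennreal (fact j / Y ^ Suc j * ((gkern Y j v - gkern Y j (1 / v)) / (1 - v\<^sup>2))) * indicator {0<..<1} v"
    proof (cases "v \<in> {0<..<1}")
      case True
      then have v: "0 < v" "v < 1" by auto
      define V where "V = v ^ (2 * n)"
      have V: "V > 0" using v by (simp add: V_def)
      have Yv: "Y * v > 0" "Y / v > 0" using Y0 v by auto
      let ?h = "\<lambda>y. (V * (indicator {1<..} y * ((y - 1) ^ j * exp (- (Y * v) * y))) - 1 / V * (indicator {1<..} y * ((y - 1) ^ j * exp (- (Y / v) * y)))) / (1 - v\<^sup>2)"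
      have I: "has_bochner_integral lborel ?h ((V * (fact j * exp (- (Y * v)) / (Y * v) ^ Suc j) - 1 / V * (fact j * exp (- (Y / v)) / (Y / v) ^ Suc j)) / (1 - v\<^sup>2))"
        by (intro has_bochner_integral_divide_zero has_bochner_integral_diff has_bochner_integral_mult_right shifted_exp_bochner Yv)
      have h: "?h y = indicator {1<..} y * ((y - 1) ^ j * pv_integrand n (x * y) v)" for y
      proof (cases "y > 1")
        case True
        define E1 E2 P where "E1 = exp (- 2 * (x * y) * v)" and "E2 = exp (- 2 * (x * y) / v)" and "P = (y - 1) ^ j"
        have "exp (- (Y * v) * y) = E1" "exp (- (Y / v) * y) = E2" by (simp_all add: Yx E1_def E2_def mult_ac)
        moreover have "pv_integrand n (x * y) v = (V * E1 - 1 / V * E2) / (1 - v\<^sup>2)" by (simp add: pv_integrand_def V_def E1_def E2_def mult.commute)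
        moreover have "(V * (1 * (P * E1)) - 1 / V * (1 * (P * E2))) / (1 - v\<^sup>2) = 1 * (P * ((V * E1 - 1 / V * E2) / (1 - v\<^sup>2)))"
          by (simp add: right_diff_distrib mult_ac)
        moreover have "indicator {1<..} y = (1::real)" using True by simp
        ultimately show ?thesis by (simp only: P_def)
      qed simp
      have h0: "?h y \<ge> 0" for y
      proof (cases "y > 1")
        case True
        then have "x * 1 \<le> x * y" using x by (intro mult_left_mono) auto
        then have "real n \<le> x * y" by (simp add: x_def)
        then have "pv_integrand n (x * y) v \<ge> 0" using v by (intro pv_integrand_nonneg)
        then show ?thesis unfolding h using True by simp
      qed simp
      have "(\<integral>\<^sup>+y. T y v \<partial>lborel) = (\<integral>\<^sup>+y. ennreal (?h y) \<partial>lborel)"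
        unfolding h using True by (intro nn_integral_cong) (auto simp: T_def indicator_def)
      also have "\<dots> = ennreal ((V * (fact j * exp (- (Y * v)) / (Y * v) ^ Suc j) - 1 / V * (fact j * exp (- (Y / v)) / (Y / v) ^ Suc j)) / (1 - v\<^sup>2))"
        using I h0 by (subst nn_integral_eq_integral) (auto simp only: has_bochner_integral_iff intro!: AE_I2)
      also have "(V * (fact j * exp (- (Y * v)) / (Y * v) ^ Suc j) - 1 / V * (fact j * exp (- (Y / v)) / (Y / v) ^ Suc j)) / (1 - v\<^sup>2)
          = fact j / Y ^ Suc j * ((gkern Y j v - gkern Y j (1 / v)) / (1 - v\<^sup>2))"
      proof -
        define W where "W = v ^ Suc j"
        have W: "W > 0" using v by (simp add: W_def)
        \<comment> \<open>As Y = 2n, the exponent is a difference of natural numbers and the real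
          powers become quotients of \<open>V\<close> and \<open>W\<close>.\<close>
        have e: "Y - 1 - real j = real (2 * n) - real (Suc j)" by (simp add: Y_def)
        have p1: "v powr (Y - 1 - real j) = V / W" using v unfolding e V_def W_def by (simp only: powr_diff powr_realpow)
        have p2: "(1 / v) powr (Y - 1 - real j) = W / V"
          using v p1 by (simp add: powr_divide)
        have g1: "gkern Y j v = exp (- (Y * v)) * (V / W)" unfolding gkern_def p1 by simp
        have g2: "gkern Y j (1 / v) = exp (- (Y / v)) * (W / V)" unfolding gkern_def p2 by simp
        have "(Y * v) ^ Suc j = Y ^ Suc j * W" "(Y / v) ^ Suc j = Y ^ Suc j / W" unfolding W_def by (simp_all only: power_mult_distrib power_divide)
        moreover have "(V * (f * e1 / (Z * W)) - 1 / V * (f * e2 / (Z / W))) / d = f / Z * ((e1 * (V / W) - e2 * (W / V)) / d)" for f e1 e2 Z d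
        proof -
          have "V * (f * e1 / (Z * W)) = f / Z * (e1 * (V / W))" "1 / V * (f * e2 / (Z / W)) = f / Z * (e2 * (W / V))" by (simp_all add: mult_ac)
          then have "V * (f * e1 / (Z * W)) - 1 / V * (f * e2 / (Z / W)) = f / Z * (e1 * (V / W) - e2 * (W / V))" by (simp only: right_diff_distrib)
          then show ?thesis by (simp only: times_divide_eq_right)
        qed
        ultimately show ?thesis unfolding g1 g2 by (simp only:)
      qed
      finally show ?thesis using True by simp
    qed (simp add: T_def)
  qed
  also have "\<dots> = ennreal (fact j / Y ^ Suc j) * (\<integral>\<^sup>+v\<in>{0<..<1}. ennreal ((gkern Y j v - gkern Y j (1 / v)) / (1 - v\<^sup>2)) \<partial>lborel)"
    using Y0 by (intro nn_set_integral_cmult) auto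
  also have "\<dots> = ennreal (fact j / Y ^ Suc j) * ennreal (exp (- Y) / 2 * (saddleA j Y + saddleG j Y))"
    by (simp only: saddle_combined(1)[OF Y])
  also have "\<dots> = ennreal (fact j / Y ^ Suc j * (exp (- Y) / 2 * (saddleA j Y + saddleG j Y)))"
    using Y0 by (intro ennreal_mult'[symmetric]) auto
  finally show ?thesis .
qed

definition pv_moment_value :: "nat \<Rightarrow> real \<Rightarrow> real" where
  "pv_moment_value j Y = fact j / Y ^ Suc j * (exp (- Y) / 2 * (saddleA j Y + saddleG j Y))"

text \<open>The weight in y is nonnegative, so the pointwise bound on the Taylor remainder
  integrates directly. The condition on Y makes all moments up to order 2M available.\<close>

lemma remainder_IK_bound:
  fixes n M :: nat and \<rho> :: "nat \<Rightarrow> real" and C :: real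
  defines "Y \<equiv> 2 * real n"
  assumes n: "n \<ge> 1" and Y: "Y > 2 * (real (2 * M) + 1)"
    and C: "C \<ge> 0" "\<And>y. y \<ge> 1 \<Longrightarrow> \<bar>agm_inv y - (\<Sum>j<M. \<rho> j * (y - 1) ^ j)\<bar> \<le> C * ((y - 1) ^ M + (y - 1) ^ (2 * M))"
  shows "\<bar>pi / 2 * remainder_IK n (real n) - (\<Sum>j<M. \<rho> j * pv_moment_value j Y)\<bar>
    \<le> C * (pv_moment_value M Y + pv_moment_value (2 * M) Y)"
proof -
  define V where "V = (\<lambda>y. \<integral>\<^sup>+v\<in>{0<..<1}. ennreal (pv_integrand n (real n * y) v) \<partial>lborel)"
  have [measurable]: "V \<in> borel_measurable borel" unfolding V_def by measurable
  define Vr where "Vr = (\<lambda>y. enn2real (V y))"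
  have [measurable]: "Vr \<in> borel_measurable borel" unfolding Vr_def by measurable
  have Vr0: "Vr y \<ge> 0" for y by (simp add: Vr_def)
  have mom: "(\<integral>\<^sup>+y\<in>{1<..}. ennreal ((y - 1) ^ j) * V y \<partial>lborel) = ennreal (pv_moment_value j Y)"
    and mom0: "pv_moment_value j Y \<ge> 0" if "j \<le> 2 * M" for j
  proof -
    have Yj: "Y > 2 * (real j + 1)"
    proof -
      have "2 * (real j + 1) \<le> 2 * (real (2 * M) + 1)" using that by (simp only: of_nat_le_iff mult_le_cancel_left_pos add_le_cancel_right zero_less_numeral)
      also note Y
      finally show ?thesis .
    qed
    show "(\<integral>\<^sup>+y\<in>{1<..}. ennreal ((y - 1) ^ j) * V y \<partial>lborel) = ennreal (pv_moment_value j Y)"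
      unfolding V_def pv_moment_value_def using pv_moment[OF n] Yj by (simp only: Y_def)
    have "Y > 0" "saddleA j Y \<ge> 0" "saddleG j Y \<ge> 0" using Yj saddleA_nn(2)[OF Yj] saddle_combined(2)[OF Yj] by auto
    then show "pv_moment_value j Y \<ge> 0" by (simp add: pv_moment_value_def)
  qed
  \<comment> \<open>\<open>V\<close> is an extended integral and could be infinite on a null set;
    finiteness of its moment of order 0 allows the passage to the real version
    \<open>Vr\<close>.\<close>
  have "AE y in lborel. V y * indicator {1<..} y \<noteq> \<infinity>"
    using mom[of 0] by (intro nn_integral_PInf_AE) simp_all
  then have fin: "AE y in lborel. y > 1 \<longrightarrow> V y = ennreal (Vr y)"
    by eventually_elim (auto simp: Vr_def top.not_eq_extremum)
  have hb: "has_bochner_integral lborel (\<lambda>y. indicator {1<..} y * (g y * Vr y)) r"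
    if [measurable]: "g \<in> borel_measurable borel" and g: "\<And>y. y > 1 \<Longrightarrow> g y \<ge> 0" and r: "r \<ge> 0"
      and e: "(\<integral>\<^sup>+y\<in>{1<..}. ennreal (g y) * V y \<partial>lborel) = ennreal r" for g r
  proof (rule has_bochner_integral_nn_integral)
    show "AE y in lborel. 0 \<le> indicator {1<..} y * (g y * Vr y)"
      using g Vr0 by (intro AE_I2) (auto simp: indicator_def)
    have "(\<integral>\<^sup>+y. ennreal (indicator {1<..} y * (g y * Vr y)) \<partial>lborel) = (\<integral>\<^sup>+y\<in>{1<..}. ennreal (g y) * V y \<partial>lborel)"
    proof (rule nn_integral_cong_AE, use fin in eventually_elim)
      case (elim y)
      then show ?case using g[of y] Vr0[of y] by (cases "y > 1") (simp_all add: ennreal_mult)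
    qed
    then show "(\<integral>\<^sup>+y. ennreal (indicator {1<..} y * (g y * Vr y)) \<partial>lborel) = ennreal r" using e by simp
  qed (use r in measurable)
  have m: "has_bochner_integral lborel (\<lambda>y. indicator {1<..} y * ((y - 1) ^ j * Vr y)) (pv_moment_value j Y)" if "j \<le> 2 * M" for j
    by (rule hb) (use mom[OF that] mom0[OF that] in simp_all)
  have r: "has_bochner_integral lborel (\<lambda>y. indicator {1<..} y * (agm_inv y * Vr y)) (pi / 2 * remainder_IK n (real n))"
    using remainder_IK_nn_integral[of "real n" n] n by (intro hb) (simp_all add: agm_inv_nonneg V_def)
  have d: "has_bochner_integral lborel
      (\<lambda>y. indicator {1<..} y * (agm_inv y * Vr y) - (\<Sum>j<M. \<rho> j * (indicator {1<..} y * ((y - 1) ^ j * Vr y))))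
      (pi / 2 * remainder_IK n (real n) - (\<Sum>j<M. \<rho> j * pv_moment_value j Y))"
    by (intro has_bochner_integral_diff r has_bochner_integral_sum has_bochner_integral_mult_right m) auto
  have b: "has_bochner_integral lborel
      (\<lambda>y. C * (indicator {1<..} y * ((y - 1) ^ M * Vr y) + indicator {1<..} y * ((y - 1) ^ (2 * M) * Vr y)))
      (C * (pv_moment_value M Y + pv_moment_value (2 * M) Y))"
    by (intro has_bochner_integral_mult_right has_bochner_integral_add m) auto
  have le: "\<bar>indicator {1<..} y * (agm_inv y * Vr y) - (\<Sum>j<M. \<rho> j * (indicator {1<..} y * ((y - 1) ^ j * Vr y)))\<bar>
    \<le> C * (indicator {1<..} y * ((y - 1) ^ M * Vr y) + indicator {1<..} y * ((y - 1) ^ (2 * M) * Vr y))" for y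
  proof (cases "y > 1")
    case True
    have "agm_inv y * Vr y - (\<Sum>j<M. \<rho> j * ((y - 1) ^ j * Vr y)) = (agm_inv y - (\<Sum>j<M. \<rho> j * (y - 1) ^ j)) * Vr y"
      by (simp add: left_diff_distrib sum_distrib_right mult.assoc)
    then have "\<bar>agm_inv y * Vr y - (\<Sum>j<M. \<rho> j * ((y - 1) ^ j * Vr y))\<bar> = \<bar>agm_inv y - (\<Sum>j<M. \<rho> j * (y - 1) ^ j)\<bar> * Vr y"
      using Vr0[of y] by (simp add: abs_mult)
    moreover have "\<bar>agm_inv y - (\<Sum>j<M. \<rho> j * (y - 1) ^ j)\<bar> * Vr y \<le> C * ((y - 1) ^ M + (y - 1) ^ (2 * M)) * Vr y"
      using True Vr0[of y] by (intro mult_right_mono C(2)) auto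
    moreover have "C * ((y - 1) ^ M + (y - 1) ^ (2 * M)) * Vr y = C * ((y - 1) ^ M * Vr y + (y - 1) ^ (2 * M) * Vr y)"
      by (simp only: distrib_right mult.assoc)
    ultimately show ?thesis using True by simp
  qed simp
  have di: "integrable lborel (\<lambda>y. indicator {1<..} y * (agm_inv y * Vr y) - (\<Sum>j<M. \<rho> j * (indicator {1<..} y * ((y - 1) ^ j * Vr y))))"
    using d by (rule integrable.intros)
  have "\<bar>LBINT y. indicator {1<..} y * (agm_inv y * Vr y) - (\<Sum>j<M. \<rho> j * (indicator {1<..} y * ((y - 1) ^ j * Vr y)))\<bar>
    \<le> (LBINT y. C * (indicator {1<..} y * ((y - 1) ^ M * Vr y) + indicator {1<..} y * ((y - 1) ^ (2 * M) * Vr y)))"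
    by (rule order_trans[OF integral_abs_bound integral_mono[OF integrable_abs[OF di] integrable.intros[OF b] le]])
  then show ?thesis unfolding has_bochner_integral_integral_eq[OF d] has_bochner_integral_integral_eq[OF b] .
qed

definition saddle_scaled :: "nat \<Rightarrow> real \<Rightarrow> real" where
  "saddle_scaled j Y = sqrt (2 * Y / pi) * (saddleA j Y + saddleG j Y)"

text \<open>Origin of the prefactor of the theorem: with Y = 2x it is e^(-Y) / (pi Y) divided by the
  scaling sqrt (2Y/pi).\<close>

lemma pv_moment_value_scaled:
  assumes x: "x > 0"
  shows "2 / pi * pv_moment_value j (2 * x)
    = exp (- 2 * x) / (4 * sqrt pi * x powr (3/2)) * (fact j / (2 * x) ^ j * saddle_scaled j (2 * x))"
proof -
  define Y e S where "Y = 2 * x" and "e = exp (- Y)" and "S = saddleA j Y + saddleG j Y"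
  define P where "P = Y ^ j"
  have P: "P > 0" using x by (simp add: P_def Y_def)
  have "x powr (3/2) = x powr (1 + 1/2)" by simp
  also have "\<dots> = x * sqrt x" using x by (subst powr_add) (simp add: powr_half_sqrt)
  finally have p: "x powr (3/2) = x * sqrt x" .
  have "sqrt (2 * Y / pi) = 2 * sqrt x / sqrt pi"
  proof -
    have "2 * Y / pi = 2\<^sup>2 * x / pi" by (simp add: Y_def)
    then show ?thesis by (simp only: real_sqrt_divide real_sqrt_mult real_sqrt_power) simp
  qed
  then have "e / (4 * sqrt pi * (x * sqrt x)) * (fact j / P * (sqrt (2 * Y / pi) * S)) = e / (4 * sqrt pi * (x * sqrt x)) * (fact j / P * (2 * sqrt x / sqrt pi * S))"
    by simp
  also have "\<dots> = e * fact j * S * 2 * sqrt x / (4 * (sqrt pi * sqrt pi) * x * sqrt x * P)" by simp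
  also have "\<dots> = e * fact j * S / (2 * pi * x * P)" using x by (simp add: mult_ac)
  also have "\<dots> = 2 / pi * (fact j / (Y * P) * (e / 2 * S))" by (simp add: Y_def mult_ac)
  finally show ?thesis
    unfolding p pv_moment_value_def saddle_scaled_def by (simp add: Y_def e_def S_def P_def)
qed

lemma saddle_scaled_bounded: "saddle_scaled j \<in> O[at_top](\<lambda>_. 1)"
  using saddle_D_expansion[of j 0] by (simp add: saddle_scaled_def[abs_def])

text \<open>The double sum over j and k is rearranged by n = j + k, which is how
  \<open>B_coeff\<close> arises.\<close>

lemma saddle_sum_expansion:
  "(\<lambda>Y. (\<Sum>j<M. (- 1) ^ j * c_coeff j / Y ^ j * saddle_scaled j Y) - (\<Sum>j<M. B_coeff j / Y ^ j)) \<in> O[at_top](\<lambda>Y. 1 / Y ^ M)"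
proof -
  have B: "(\<Sum>j<M. B_coeff j / Y ^ j) = (\<Sum>j<M. (- 1) ^ j * c_coeff j / Y ^ j * (\<Sum>k<M - j. D_coeff k j / Y ^ k))" if "Y > 0" for Y :: real
  proof -
    define t where "t = (\<lambda>j k. (- 1) ^ j * c_coeff j / Y ^ j * (D_coeff k j / Y ^ k))"
    have "(\<Sum>n<M. B_coeff n / Y ^ n) = (\<Sum>n<M. \<Sum>j\<le>n. t j (n - j))"
    proof (rule sum.cong[OF refl])
      fix n
      have "t j (n - j) = (- 1) ^ j * c_coeff j * D_coeff (n - j) j / Y ^ n" if "j \<le> n" for j
        using that power_add[of Y j "n - j"] by (simp add: t_def)
      then show "B_coeff n / Y ^ n = (\<Sum>j\<le>n. t j (n - j))" by (simp add: B_coeff_def sum_divide_distrib)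
    qed
    also have "\<dots> = (\<Sum>(j,k)\<in>{(j,k). j + k < M}. t j k)" by (rule sum.triangle_reindex[symmetric])
    also have "{(j,k). j + k < M} = Sigma {..<M} (\<lambda>j. {..<M - j})" by auto
    also have "(\<Sum>(j,k)\<in>Sigma {..<M} (\<lambda>j. {..<M - j}). t j k) = (\<Sum>j<M. \<Sum>k<M - j. t j k)" by (rule sum.Sigma[symmetric]) auto
    finally show ?thesis by (simp only: t_def sum_distrib_left)
  qed
  \<comment> \<open>The factor Y^(-j) already supplies j orders, so the j-th expansion is truncated
    after M - j terms.\<close>
  have s: "(\<lambda>Y. (- 1) ^ j * c_coeff j * (1 / Y ^ j * (saddle_scaled j Y - (\<Sum>k<M - j. D_coeff k j / Y ^ k)))) \<in> O[at_top](\<lambda>Y. 1 / Y ^ M)"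
    if "j < M" for j
  proof (rule bigo_cmult)
    have "(\<lambda>Y. 1 / Y ^ j * (saddle_scaled j Y - (\<Sum>k<M - j. D_coeff k j / Y ^ k))) \<in> O[at_top](\<lambda>Y. 1 / Y ^ j * (1 / Y ^ (M - j)))"
      unfolding saddle_scaled_def by (rule landau_o.big.mult_left[OF saddle_D_expansion])
    moreover have "1 / Y ^ j * (1 / Y ^ (M - j)) = 1 / Y ^ M" for Y :: real
      using that power_add[of Y j "M - j"] by simp
    ultimately show "(\<lambda>Y. 1 / Y ^ j * (saddle_scaled j Y - (\<Sum>k<M - j. D_coeff k j / Y ^ k))) \<in> O[at_top](\<lambda>Y. 1 / Y ^ M)" by (simp only:)
  qed
  have "(\<lambda>Y. \<Sum>j<M. (- 1) ^ j * c_coeff j * (1 / Y ^ j * (saddle_scaled j Y - (\<Sum>k<M - j. D_coeff k j / Y ^ k)))) \<in> O[at_top](\<lambda>Y. 1 / Y ^ M)"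
    by (rule big_sum_in_bigo) (use s in simp)
  moreover have "\<forall>\<^sub>F Y in at_top. (\<Sum>j<M. (- 1) ^ j * c_coeff j * (1 / Y ^ j * (saddle_scaled j Y - (\<Sum>k<M - j. D_coeff k j / Y ^ k))))
     = (\<Sum>j<M. (- 1) ^ j * c_coeff j / Y ^ j * saddle_scaled j Y) - (\<Sum>j<M. B_coeff j / Y ^ j)"
    using eventually_gt_at_top[of "0::real"]
  proof eventually_elim
    case (elim Y)
    have "a * (1 / p * (u - v)) = a / p * u - a / p * v" for a p u v :: real by (simp add: right_diff_distrib diff_divide_distrib)
    then show ?case by (simp only: B[OF elim] sum_subtractf)
  qed
  then have "(\<lambda>Y. \<Sum>j<M. (- 1) ^ j * c_coeff j * (1 / Y ^ j * (saddle_scaled j Y - (\<Sum>k<M - j. D_coeff k j / Y ^ k)))) \<in> O[at_top](\<lambda>Y. 1 / Y ^ M)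
    \<longleftrightarrow> (\<lambda>Y. (\<Sum>j<M. (- 1) ^ j * c_coeff j / Y ^ j * saddle_scaled j Y) - (\<Sum>j<M. B_coeff j / Y ^ j)) \<in> O[at_top](\<lambda>Y. 1 / Y ^ M)"
    by (rule landau_o.big.in_cong)
  ultimately show ?thesis by iprover
qed

theorem theorem1:
  fixes M :: nat
  assumes "M \<ge> 1"
  shows "\<exists>E \<in> O[sequentially](\<lambda>x::nat. real x powr (- real M + 1/2)). \<forall>x\<ge>1.
           remainder_IK x (real x)
             = exp (- 2 * real x) / (4 * sqrt pi * real x powr (3/2))
               * ((\<Sum>j<M. B_coeff j / (2 * real x) ^ j) + E x)"
proof -
  obtain \<rho> where \<rho>: "\<And>M. \<exists>C\<ge>0. \<forall>y\<ge>1. \<bar>agm_inv y - (\<Sum>j<M. \<rho> j * (y - 1) ^ j)\<bar> \<le> C * ((y - 1) ^ M + (y - 1) ^ (2 * M))"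
    by (rule agm_inv_expansion) (rule that)
  have c: "c_coeff j = (- 1) ^ j * fact j * \<rho> j" for j by (rule fun_cong[OF agm_expansion_coeffs[OF \<rho>]])
  obtain C where C: "C \<ge> 0" "\<And>y. y \<ge> 1 \<Longrightarrow> \<bar>agm_inv y - (\<Sum>j<M. \<rho> j * (y - 1) ^ j)\<bar> \<le> C * ((y - 1) ^ M + (y - 1) ^ (2 * M))"
    using \<rho>[of M] by blast
  define pref where "pref = (\<lambda>x. exp (- 2 * x) / (4 * sqrt pi * x powr (3/2)))"
  define F where "F = (\<lambda>Y. \<Sum>j<M. (- 1) ^ j * c_coeff j / Y ^ j * saddle_scaled j Y)"
  define S where "S = (\<lambda>Y. \<Sum>j<M. B_coeff j / Y ^ j)"
  \<comment> \<open>The scaled moments of (y - 1)^M and (y - 1)^(2M), which bound the Taylor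
    remainder.\<close>
  define H where "H = (\<lambda>Y. C * (fact M / Y ^ M * saddle_scaled M Y + fact (2 * M) / Y ^ (2 * M) * saddle_scaled (2 * M) Y))"
  have pref: "pref (real n) > 0" if "n \<ge> 1" for n :: nat using that by (simp add: pref_def)
  \<comment> \<open>Solving the claimed identity for the error makes it hold exactly at every
    positive integer; only the order of \<open>E\<close> is asymptotic.\<close>
  define E where "E = (\<lambda>n::nat. remainder_IK n (real n) / pref (real n) - S (2 * real n))"
  have lim: "filterlim (\<lambda>n::nat. 2 * real n) at_top sequentially" by real_asymp
  \<comment> \<open>The estimates give order x^(-M), which is weakened by a factor sqrt x to the
    stated order.\<close>
  have scale: "(\<lambda>n::nat. 1 / (2 * real n) ^ M) \<in> O(\<lambda>n. real n powr (- real M + 1/2))"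
  proof (rule bigoI[where c = 1], use eventually_ge_at_top[of "1::nat"] in eventually_elim)
    case (elim n)
    then have n: "real n \<ge> 1" by simp
    have "1 / (2 * real n) ^ M \<le> 1 / real n ^ M" using n by (intro divide_left_mono power_mono) auto
    also have "\<dots> = real n powr (- real M)" using n by (simp add: powr_minus powr_realpow divide_inverse)
    also have "\<dots> \<le> real n powr (- real M + 1/2)" using n by (intro powr_mono) auto
    finally show ?case using n by simp
  qed
  have Hb: "H \<in> O[at_top](\<lambda>Y. 1 / Y ^ M)"
  proof -
    have t: "(\<lambda>Y. fact m * (1 / Y ^ m * saddle_scaled m Y)) \<in> O[at_top](\<lambda>Y. 1 / Y ^ M)" if "M \<le> m" for m
    proof (rule bigo_cmult)
      have "(\<lambda>Y. 1 / Y ^ m * saddle_scaled m Y) \<in> O[at_top](\<lambda>Y. 1 / Y ^ M * 1)"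
      proof (rule landau_o.big.mult[OF _ saddle_scaled_bounded])
        show "(\<lambda>Y. 1 / Y ^ m) \<in> O[at_top](\<lambda>Y::real. 1 / Y ^ M)"
        proof (rule bigoI[where c = 1], use eventually_ge_at_top[of "1::real"] in eventually_elim)
          case (elim Y)
          then have "Y ^ M \<le> Y ^ m" using that by (intro power_increasing)
          then have "1 / Y ^ m \<le> 1 / Y ^ M" using elim by (intro divide_left_mono) auto
          then show ?case using elim by simp
        qed
      qed
      then show "(\<lambda>Y. 1 / Y ^ m * saddle_scaled m Y) \<in> O[at_top](\<lambda>Y. 1 / Y ^ M)" by simp
    qed
    have "(\<lambda>Y. C * (fact M * (1 / Y ^ M * saddle_scaled M Y) + fact (2 * M) * (1 / Y ^ (2 * M) * saddle_scaled (2 * M) Y))) \<in> O[at_top](\<lambda>Y. 1 / Y ^ M)"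
      by (intro bigo_cmult sum_in_bigo t) auto
    then show ?thesis by (simp add: H_def)
  qed
  have bound: "\<bar>remainder_IK n (real n) / pref (real n) - F (2 * real n)\<bar> \<le> H (2 * real n)"
    if n: "n \<ge> 1" and Y: "2 * real n > 2 * (real (2 * M) + 1)" for n
  proof -
    let ?Y = "2 * real n"
    have q: "2 / pi * pv_moment_value j ?Y = pref (real n) * (fact j / ?Y ^ j * saddle_scaled j ?Y)" for j
      using pv_moment_value_scaled[of "real n" j] n by (simp add: pref_def)
    have "\<rho> j * (2 / pi * pv_moment_value j ?Y) = pref (real n) * ((- 1) ^ j * c_coeff j / ?Y ^ j * saddle_scaled j ?Y)" for j
    proof -
      \<comment> \<open>The sign in the identification of c cancels the sign in the sum, leaving the
        plain Taylor coefficient.\<close>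
      have "(- 1) ^ j * c_coeff j = fact j * \<rho> j" by (simp add: c power_mult_distrib[symmetric] flip: mult.assoc)
      then show ?thesis unfolding q by simp
    qed
    then have 1: "2 / pi * (\<Sum>j<M. \<rho> j * pv_moment_value j ?Y) = pref (real n) * F ?Y"
      unfolding F_def sum_distrib_left by (intro sum.cong) (simp_all add: mult.left_commute)
    have 2: "2 / pi * (C * (pv_moment_value M ?Y + pv_moment_value (2 * M) ?Y)) = pref (real n) * H ?Y"
    proof -
      have "2 / pi * (C * (pv_moment_value M ?Y + pv_moment_value (2 * M) ?Y)) = C * (2 / pi * pv_moment_value M ?Y + 2 / pi * pv_moment_value (2 * M) ?Y)"
        by (simp only: distrib_left mult.left_commute)
      then show ?thesis unfolding q H_def by (simp only: distrib_left mult.left_commute)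
    qed
    have "2 / pi * \<bar>pi / 2 * remainder_IK n (real n) - (\<Sum>j<M. \<rho> j * pv_moment_value j ?Y)\<bar>
        \<le> 2 / pi * (C * (pv_moment_value M ?Y + pv_moment_value (2 * M) ?Y))"
      by (intro mult_left_mono remainder_IK_bound n Y C) auto
    also have "2 / pi * \<bar>pi / 2 * remainder_IK n (real n) - (\<Sum>j<M. \<rho> j * pv_moment_value j ?Y)\<bar>
        = \<bar>2 / pi * (pi / 2 * remainder_IK n (real n) - (\<Sum>j<M. \<rho> j * pv_moment_value j ?Y))\<bar>"
      by (simp only: abs_mult) simp
    also have "2 / pi * (pi / 2 * remainder_IK n (real n) - (\<Sum>j<M. \<rho> j * pv_moment_value j ?Y))
        = remainder_IK n (real n) - pref (real n) * F ?Y"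
      unfolding right_diff_distrib 1 by simp
    finally have "\<bar>remainder_IK n (real n) - pref (real n) * F ?Y\<bar> \<le> pref (real n) * H ?Y" unfolding 2 .
    moreover have "remainder_IK n (real n) - pref (real n) * F ?Y = pref (real n) * (remainder_IK n (real n) / pref (real n) - F ?Y)"
      using pref[OF n] by (simp add: right_diff_distrib)
    ultimately show ?thesis using pref[OF n] by (simp add: abs_mult)
  qed
  have "(\<lambda>n. remainder_IK n (real n) / pref (real n) - F (2 * real n)) \<in> O(\<lambda>n. H (2 * real n))"
  proof (rule bigoI[where c = 1], use eventually_gt_at_top[of "2 * M + 1"] in eventually_elim)
    case (elim n)
    have "\<bar>remainder_IK n (real n) / pref (real n) - F (2 * real n)\<bar> \<le> H (2 * real n)"
      by (rule bound) (use elim in auto)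
    then show ?case by simp
  qed
  then have "(\<lambda>n. remainder_IK n (real n) / pref (real n) - F (2 * real n)) \<in> O(\<lambda>n. real n powr (- real M + 1/2))"
    by (rule landau_o.big.trans[OF _ landau_o.big.trans[OF landau_o.big.compose[OF Hb lim] scale]])
  moreover have "(\<lambda>Y. F Y - S Y) \<in> O[at_top](\<lambda>Y. 1 / Y ^ M)" unfolding F_def S_def by (rule saddle_sum_expansion)
  then have "(\<lambda>n. F (2 * real n) - S (2 * real n)) \<in> O(\<lambda>n. real n powr (- real M + 1/2))"
    by (rule landau_o.big.trans[OF landau_o.big.compose[OF _ lim] scale])
  ultimately have "(\<lambda>n. (remainder_IK n (real n) / pref (real n) - F (2 * real n)) + (F (2 * real n) - S (2 * real n))) \<in> O(\<lambda>n. real n powr (- real M + 1/2))"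
    by (rule sum_in_bigo)
  then have EO: "E \<in> O(\<lambda>n. real n powr (- real M + 1/2))" by (simp add: E_def)
  show ?thesis
  proof (rule bexI[OF _ EO], intro allI impI)
    fix n :: nat assume "n \<ge> 1"
    show "remainder_IK n (real n) = exp (- 2 * real n) / (4 * sqrt pi * real n powr (3/2)) * ((\<Sum>j<M. B_coeff j / (2 * real n) ^ j) + E n)"
    proof -
      have "pref (real n) > 0" by (rule pref) fact
      then have "remainder_IK n (real n) = pref (real n) * (S (2 * real n) + E n)" by (simp add: E_def)
      then show ?thesis by (simp only: pref_def S_def)
    qed
  qed
qed

end
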